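(* Let $K$ be a field, $A=KQ/I$ a finite-dimensional $K$-algebra given by a finite quiver $Q$ and an admissible ideal $I$, and let $k$ be a vertex of $Q$ without loops. Assume that $\operatorname{pd}_A\tau^{-1}S_k\leq 2$. If $T^-_k$ is a tilting complex, then the BB-tilting module is defined at $k$ and $T^-_k\simeq T^{\mathrm{BB}}_k$ in $\mathcal{D}^b(A)$.
   Context: For an arrow $\alpha$ of $Q$, $s(\alpha)$ and $t(\alpha)$ denote its start and end vertices; paths compose left to right, i.e. $\alpha\beta$ is defined if $t(\alpha)=s(\beta)$. Modules are finite-dimensional right $A$-modules, and $\mathcal{D}^b(A)$ is the bounded derived category of $\operatorname{mod} A$. For a vertex $i$, $S_i$ is the simple module at $i$ and $P_i$ its projective cover, spanned by the (non-zero) paths starting at $i$. An arrow $\alpha$ induces a map $P_{t(\alpha)}\xrightarrow{\alpha}P_{s(\alpha)}$ (left multiplication by $\alpha$). $\tau$ is the Auslander-Reiten translation in $\operatorname{mod}A$, and $\operatorname{pd}$ denotes projective dimension. $L_k$ is the two-term complex $P_k\xrightarrow{f}\bigoplus_{\alpha:\,t(\alpha)=k}P_{s(\alpha)}$ with $P_k$ in degree $-1$, where $f$ is induced by all arrows $\alpha$ ending at $k$; and $T^-_k=L_k\oplus\bigoplus_{i\neq k}P_i$. The BB-tilting module is said to be defined at $k$ if $T^{\mathrm{BB}}_k=\tau^{-1}S_k\oplus\bigoplus_{i\neq k}P_i$ is a tilting module of projective dimension at most $1$. A tilting complex is a bounded complex $T$ of finitely generated projective modules with $\operatorname{Hom}_{\mathcal{D}^b(A)}(T,T[r])=0$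 for all $r\neq 0$ whose direct summands generate the category $\operatorname{per}A$ of perfect complexes as a triangulated category.
   Formalization: Adds the assumption that some arrow starts or ends at k; for an isolated vertex k the claim is false (e.g. A=K: T^-_k=P_k[1] is a tilting complex and τ^{-1}S_k=0, but T^BB_k=0 is not a tilting module). *)

theory Defs
  imports
    "Graph_Theory.Arc_Walk"
    "HOL-Algebra.Module"
    "HOL-Algebra.QuotRing"
    "HOL-Algebra.Ideal_Product"
begin

section \<open>Algebras and right modules\<close>

text \<open>
  The structure map \<open>scal\<close> sends a scalar \<open>c\<close> to \<open>c\<close> times the identity of the algebra.
\<close>

record ('k, 'e) kalg = "'e ring" +
  scal :: "'k \<Rightarrow> 'e"

text \<open>
  Right modules are carried by the library's module records: \<open>a \<odot> x\<close> denotes the right action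
  \<open>x \<cdot> a\<close>.  The ring operations \<open>mult\<close> and \<open>one\<close> of such a record carry no meaning.
\<close>

locale right_module = A?: ring A + M?: abelian_group M
  for A :: "('e, 'r) ring_scheme" (structure) and M :: "('e, 'm) module" (structure) +
  assumes act_closed:
      "\<lbrakk>a \<in> carrier A; x \<in> carrier M\<rbrakk> \<Longrightarrow> a \<odot>\<^bsub>M\<^esub> x \<in> carrier M"
    and act_add_left:
      "\<lbrakk>a \<in> carrier A; b \<in> carrier A; x \<in> carrier M\<rbrakk> \<Longrightarrow>
        (a \<oplus>\<^bsub>A\<^esub> b) \<odot>\<^bsub>M\<^esub> x = a \<odot>\<^bsub>M\<^esub> x \<oplus>\<^bsub>M\<^esub> b \<odot>\<^bsub>M\<^esub> x"
    and act_add_right: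
      "\<lbrakk>a \<in> carrier A; x \<in> carrier M; y \<in> carrier M\<rbrakk> \<Longrightarrow>
        a \<odot>\<^bsub>M\<^esub> (x \<oplus>\<^bsub>M\<^esub> y) = a \<odot>\<^bsub>M\<^esub> x \<oplus>\<^bsub>M\<^esub> a \<odot>\<^bsub>M\<^esub> y"
    and act_mult:
      "\<lbrakk>a \<in> carrier A; b \<in> carrier A; x \<in> carrier M\<rbrakk> \<Longrightarrow>
        (a \<otimes>\<^bsub>A\<^esub> b) \<odot>\<^bsub>M\<^esub> x = b \<odot>\<^bsub>M\<^esub> (a \<odot>\<^bsub>M\<^esub> x)"
    and act_one: "x \<in> carrier M \<Longrightarrow> \<one>\<^bsub>A\<^esub> \<odot>\<^bsub>M\<^esub> x = x"

definition fd_module :: "('k, 'e) kalg \<Rightarrow> ('e, 'm) module \<Rightarrow> bool" where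
  "fd_module A M \<longleftrightarrow> right_module A M \<and>
    (\<exists>B. finite B \<and> B \<subseteq> carrier M \<and>
      (\<forall>x\<in>carrier M. \<exists>c. x = (\<Oplus>\<^bsub>M\<^esub>b\<in>B. scal A (c b) \<odot>\<^bsub>M\<^esub> b)))"

text \<open>
  Every finite-dimensional module is isomorphic to one whose elements are vectors in this type.
  Quantification over all finite-dimensional modules (or complexes of such) is quantification
  over those living on it; particular modules may live on any type.
\<close>

type_synonym 'k vec = "nat \<Rightarrow> 'k"

definition mod_hom ::
    "('k, 'e) kalg \<Rightarrow> ('e, 'm) module \<Rightarrow> ('e, 'n) module \<Rightarrow> ('m \<Rightarrow> 'n) set" where
  "mod_hom A M N = {f \<in> carrier M \<rightarrow> carrier N.
     (\<forall>x\<in>carrier M. \<forall>y\<in>carrier M. f (x \<oplus>\<^bsub>M\<^esub> y) = f x \<oplus>\<^bsub>N\<^esub> f y) \<and>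
     (\<forall>a\<in>carrier A. \<forall>x\<in>carrier M. f (a \<odot>\<^bsub>M\<^esub> x) = a \<odot>\<^bsub>N\<^esub> f x)}"

definition mod_iso :: "('k, 'e) kalg \<Rightarrow> ('e, 'm) module \<Rightarrow> ('e, 'n) module \<Rightarrow> bool" where
  "mod_iso A M N \<longleftrightarrow> (\<exists>f\<in>mod_hom A M N. bij_betw f (carrier M) (carrier N))"

definition submod :: "('e, 'm) module \<Rightarrow> 'm set \<Rightarrow> ('e, 'm) module" where
  "submod M H = M\<lparr>carrier := H\<rparr>"

definition zero_mod :: "('e, 'm) module \<Rightarrow> ('e, 'm) module" where
  "zero_mod M = submod M {\<zero>\<^bsub>M\<^esub>}"

definition quot_mod :: "('e, 'm) module \<Rightarrow> 'm set \<Rightarrow> ('e, 'm set) module" where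
  "quot_mod M N = \<lparr>carrier = a_rcosets\<^bsub>M\<^esub> N, mult = undefined, one = undefined,
     zero = N, add = set_add M, smult = (\<lambda>a C. \<Union>x\<in>C. N +>\<^bsub>M\<^esub> (a \<odot>\<^bsub>M\<^esub> x))\<rparr>"

definition dprod :: "('e, 'm) module \<Rightarrow> ('e, 'n) module \<Rightarrow> ('e, 'm \<times> 'n) module" where
  "dprod M N = \<lparr>carrier = carrier M \<times> carrier N, mult = undefined, one = undefined,
     zero = (\<zero>\<^bsub>M\<^esub>, \<zero>\<^bsub>N\<^esub>),
     add = (\<lambda>(x, y) (x', y'). (x \<oplus>\<^bsub>M\<^esub> x', y \<oplus>\<^bsub>N\<^esub> y')),
     smult = (\<lambda>a (x, y). (a \<odot>\<^bsub>M\<^esub> x, a \<odot>\<^bsub>N\<^esub> y))\<rparr>"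

text \<open>Used for finite index sets only, where the product is the direct sum.\<close>

definition dsum :: "'j set \<Rightarrow> ('j \<Rightarrow> ('e, 'm) module) \<Rightarrow> ('e, 'j \<Rightarrow> 'm) module" where
  "dsum J M = \<lparr>carrier = (\<Pi>\<^sub>E j\<in>J. carrier (M j)), mult = undefined, one = undefined,
     zero = (\<lambda>j\<in>J. \<zero>\<^bsub>M j\<^esub>),
     add = (\<lambda>x y. \<lambda>j\<in>J. x j \<oplus>\<^bsub>M j\<^esub> y j),
     smult = (\<lambda>a x. \<lambda>j\<in>J. a \<odot>\<^bsub>M j\<^esub> x j)\<rparr>"

definition regular_mod :: "('k, 'e) kalg \<Rightarrow> ('e, 'e) module" where
  "regular_mod A = \<lparr>carrier = carrier A, mult = undefined, one = undefined,
     zero = \<zero>\<^bsub>A\<^esub>, add = add A, smult = (\<lambda>a x. x \<otimes>\<^bsub>A\<^esub> a)\<rparr>"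

definition projective :: "('k, 'e) kalg \<Rightarrow> ('e, 'm) module \<Rightarrow> bool" where
  "projective A P \<longleftrightarrow> fd_module A P \<and>
    (\<forall>(M :: ('e, 'k vec) module) (N :: ('e, 'k vec) module) g h.
      fd_module A M \<longrightarrow> fd_module A N \<longrightarrow> g \<in> mod_hom A M N \<longrightarrow> g ` carrier M = carrier N \<longrightarrow>
      h \<in> mod_hom A P N \<longrightarrow>
      (\<exists>h'\<in>mod_hom A P M. \<forall>x\<in>carrier P. g (h' x) = h x))"

definition exact_at ::
    "('e, 'l) module \<Rightarrow> ('e, 'm) module \<Rightarrow> ('e, 'n) module \<Rightarrow> ('l \<Rightarrow> 'm) \<Rightarrow> ('m \<Rightarrow> 'n) \<Rightarrow> bool" where
  "exact_at L M N f g \<longleftrightarrow> f ` carrier L = a_kernel M N g"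

definition pd_le :: "('k, 'e) kalg \<Rightarrow> nat \<Rightarrow> ('e, 'm) module \<Rightarrow> bool" where
  "pd_le A n M \<longleftrightarrow>
    (\<exists>(P :: nat \<Rightarrow> ('e, 'k vec) module) d \<epsilon>.
      (\<forall>i. projective A (P i)) \<and> (\<forall>i>n. carrier (P i) = {\<zero>\<^bsub>P i\<^esub>}) \<and>
      (\<forall>i. d i \<in> mod_hom A (P (Suc i)) (P i)) \<and>
      \<epsilon> \<in> mod_hom A (P 0) M \<and> \<epsilon> ` carrier (P 0) = carrier M \<and>
      exact_at (P 1) (P 0) M (d 0) \<epsilon> \<and>
      (\<forall>i. exact_at (P (Suc (Suc i))) (P (Suc i)) (P i) (d (Suc i)) (d i)))"


section \<open>The inverse Auslander--Reiten translation\<close>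

text \<open>Left modules over an algebra are right modules over the opposite algebra.\<close>

definition opp :: "('k, 'e) kalg \<Rightarrow> ('k, 'e) kalg" where
  "opp A = A\<lparr>mult := \<lambda>a b. b \<otimes>\<^bsub>A\<^esub> a\<rparr>"

text \<open>The left module of linear forms on a right module, with \<open>(a \<phi>) x = \<phi> (x a)\<close>.\<close>

definition dual :: "('k::field, 'e) kalg \<Rightarrow> ('e, 'm) module \<Rightarrow> ('e, 'm \<Rightarrow> 'k) module" where
  "dual A M = \<lparr>carrier = {\<phi> \<in> extensional (carrier M).
       (\<forall>x\<in>carrier M. \<forall>y\<in>carrier M. \<phi> (x \<oplus>\<^bsub>M\<^esub> y) = \<phi> x + \<phi> y) \<and>
       (\<forall>c. \<forall>x\<in>carrier M. \<phi> (scal A c \<odot>\<^bsub>M\<^esub> x) = c * \<phi> x)},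
     mult = undefined, one = undefined,
     zero = (\<lambda>x\<in>carrier M. 0),
     add = (\<lambda>\<phi> \<psi>. \<lambda>x\<in>carrier M. \<phi> x + \<psi> x),
     smult = (\<lambda>a \<phi>. \<lambda>x\<in>carrier M. \<phi> (a \<odot>\<^bsub>M\<^esub> x))\<rparr>"

definition superfluous :: "('k, 'e) kalg \<Rightarrow> ('e, 'm) module \<Rightarrow> 'm set \<Rightarrow> bool" where
  "superfluous A M N \<longleftrightarrow>
    (\<forall>H. submodule H A M \<longrightarrow> N <+>\<^bsub>M\<^esub> H = carrier M \<longrightarrow> H = carrier M)"

definition projective_cover ::
    "('k, 'e) kalg \<Rightarrow> ('e, 'm) module \<Rightarrow> ('e, 'n) module \<Rightarrow> ('m \<Rightarrow> 'n) \<Rightarrow> bool" where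
  "projective_cover A P M p \<longleftrightarrow> projective A P \<and> p \<in> mod_hom A P M \<and>
     p ` carrier P = carrier M \<and> superfluous A P (a_kernel P M p)"

definition minimal_presentation ::
    "('k, 'e) kalg \<Rightarrow> ('e, 'l) module \<Rightarrow> ('e, 'm) module \<Rightarrow> ('e, 'n) module \<Rightarrow>
     ('l \<Rightarrow> 'm) \<Rightarrow> ('m \<Rightarrow> 'n) \<Rightarrow> bool" where
  "minimal_presentation A P1 P0 M p1 p0 \<longleftrightarrow>
     projective_cover A P0 M p0 \<and>
     projective_cover A P1 (submod P0 (a_kernel P0 M p0)) p1"

text \<open>The left module of homomorphisms into the regular module, with \<open>(a \<phi>) x = a (\<phi> x)\<close>.\<close>

definition hom_regular :: "('k, 'e) kalg \<Rightarrow> ('e, 'm) module \<Rightarrow> ('e, 'm \<Rightarrow> 'e) module" where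
  "hom_regular A P = \<lparr>carrier = mod_hom A P (regular_mod A) \<inter> extensional (carrier P),
     mult = undefined, one = undefined,
     zero = (\<lambda>x\<in>carrier P. \<zero>\<^bsub>A\<^esub>),
     add = (\<lambda>\<phi> \<psi>. \<lambda>x\<in>carrier P. \<phi> x \<oplus>\<^bsub>A\<^esub> \<psi> x),
     smult = (\<lambda>a \<phi>. \<lambda>x\<in>carrier P. a \<otimes>\<^bsub>A\<^esub> \<phi> x)\<rparr>"

text \<open>
  \<open>X\<close> is (a representative of) the Auslander--Bridger transpose of \<open>M\<close>, a module over the
  opposite algebra.
\<close>

definition is_transpose ::
    "('k, 'e) kalg \<Rightarrow> ('e, 'm) module \<Rightarrow> ('e, 'n) module \<Rightarrow> bool" where
  "is_transpose A M X \<longleftrightarrow> fd_module (opp A) X \<and>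
    (\<exists>(P1 :: ('e, 'k vec) module) (P0 :: ('e, 'k vec) module) p1 p0.
      minimal_presentation A P1 P0 M p1 p0 \<and>
      mod_iso (opp A) X
        (quot_mod (hom_regular A P1)
          ((\<lambda>\<phi>. \<lambda>x\<in>carrier P1. \<phi> (p1 x)) ` carrier (hom_regular A P0))))"

text \<open>\<open>X\<close> represents \<open>\<tau>\<^sup>-\<^sup>1 M = Tr (D M)\<close>.\<close>

definition is_tau_inv ::
    "('k::field, 'e) kalg \<Rightarrow> ('e, 'm) module \<Rightarrow> ('e, 'n) module \<Rightarrow> bool" where
  "is_tau_inv A M X \<longleftrightarrow> is_transpose (opp A) (dual A M) X"


section \<open>The bounded derived category\<close>

record ('e, 'm) cplx =
  cobj :: "int \<Rightarrow> ('e, 'm) module"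
  cdiff :: "int \<Rightarrow> 'm \<Rightarrow> 'm"

definition bounded_cplx :: "('k, 'e) kalg \<Rightarrow> ('e, 'm) cplx \<Rightarrow> bool" where
  "bounded_cplx A X \<longleftrightarrow>
     (\<forall>n. fd_module A (cobj X n)) \<and>
     (\<forall>n. cdiff X n \<in> mod_hom A (cobj X n) (cobj X (n + 1))) \<and>
     (\<forall>n. \<forall>x\<in>carrier (cobj X n). cdiff X (n + 1) (cdiff X n x) = \<zero>\<^bsub>cobj X (n + 2)\<^esub>) \<and>
     (\<exists>b. \<forall>n. \<bar>n\<bar> > b \<longrightarrow> carrier (cobj X n) = {\<zero>\<^bsub>cobj X n\<^esub>})"

definition chain_map ::
    "('k, 'e) kalg \<Rightarrow> ('e, 'm) cplx \<Rightarrow> ('e, 'n) cplx \<Rightarrow> (int \<Rightarrow> 'm \<Rightarrow> 'n) \<Rightarrow> bool" where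
  "chain_map A X Y f \<longleftrightarrow>
     (\<forall>n. f n \<in> mod_hom A (cobj X n) (cobj Y n)) \<and>
     (\<forall>n. \<forall>x\<in>carrier (cobj X n). f (n + 1) (cdiff X n x) = cdiff Y n (f n x))"

definition ccomp :: "(int \<Rightarrow> 'n \<Rightarrow> 'l) \<Rightarrow> (int \<Rightarrow> 'm \<Rightarrow> 'n) \<Rightarrow> int \<Rightarrow> 'm \<Rightarrow> 'l" where
  "ccomp g f = (\<lambda>n. g n \<circ> f n)"

definition homotopic ::
    "('k, 'e) kalg \<Rightarrow> ('e, 'm) cplx \<Rightarrow> ('e, 'n) cplx \<Rightarrow>
     (int \<Rightarrow> 'm \<Rightarrow> 'n) \<Rightarrow> (int \<Rightarrow> 'm \<Rightarrow> 'n) \<Rightarrow> bool" where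
  "homotopic A X Y f g \<longleftrightarrow>
     (\<exists>h. (\<forall>n. h n \<in> mod_hom A (cobj X n) (cobj Y (n - 1))) \<and>
       (\<forall>n. \<forall>x\<in>carrier (cobj X n).
         f n x = g n x \<oplus>\<^bsub>cobj Y n\<^esub>
           (cdiff Y (n - 1) (h n x) \<oplus>\<^bsub>cobj Y n\<^esub> h (n + 1) (cdiff X n x))))"

definition cocycles :: "('e, 'm) cplx \<Rightarrow> int \<Rightarrow> 'm set" where
  "cocycles X n = a_kernel (cobj X n) (cobj X (n + 1)) (cdiff X n)"

definition coboundaries :: "('e, 'm) cplx \<Rightarrow> int \<Rightarrow> 'm set" where
  "coboundaries X n = cdiff X (n - 1) ` carrier (cobj X (n - 1))"

definition cohomology :: "('e, 'm) cplx \<Rightarrow> int \<Rightarrow> ('e, 'm set) module" where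
  "cohomology X n = quot_mod (submod (cobj X n) (cocycles X n)) (coboundaries X n)"

definition coh_map :: "('e, 'n) cplx \<Rightarrow> (int \<Rightarrow> 'm \<Rightarrow> 'n) \<Rightarrow> int \<Rightarrow> 'm set \<Rightarrow> 'n set" where
  "coh_map Y f n C = (\<Union>x\<in>C. coboundaries Y n +>\<^bsub>cobj Y n\<^esub> f n x)"

definition quasi_iso ::
    "('k, 'e) kalg \<Rightarrow> ('e, 'm) cplx \<Rightarrow> ('e, 'n) cplx \<Rightarrow> (int \<Rightarrow> 'm \<Rightarrow> 'n) \<Rightarrow> bool" where
  "quasi_iso A X Y f \<longleftrightarrow> chain_map A X Y f \<and>
     (\<forall>n. bij_betw (coh_map Y f n) (carrier (cohomology X n)) (carrier (cohomology Y n)))"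

text \<open>
  Morphisms \<open>X \<rightarrow> Y\<close> of the bounded derived category are classes, modulo \<open>roof_equiv\<close>, of roofs
  \<open>(Z, s, f)\<close>, standing for \<open>f s\<^sup>-\<^sup>1\<close>, with \<open>s: Z \<rightarrow> X\<close> a quasi-isomorphism and \<open>f: Z \<rightarrow> Y\<close>
  a chain map.
\<close>

type_synonym ('k, 'e, 'm, 'n) roof =
  "('e, 'k vec) cplx \<times> (int \<Rightarrow> 'k vec \<Rightarrow> 'm) \<times> (int \<Rightarrow> 'k vec \<Rightarrow> 'n)"

fun is_roof ::
    "('k, 'e) kalg \<Rightarrow> ('e, 'm) cplx \<Rightarrow> ('e, 'n) cplx \<Rightarrow> ('k, 'e, 'm, 'n) roof \<Rightarrow> bool" where
  "is_roof A X Y (Z, s, f) \<longleftrightarrow> bounded_cplx A Z \<and> quasi_iso A Z X s \<and> chain_map A Z Y f"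

fun roof_equiv ::
    "('k, 'e) kalg \<Rightarrow> ('e, 'm) cplx \<Rightarrow> ('e, 'n) cplx \<Rightarrow>
     ('k, 'e, 'm, 'n) roof \<Rightarrow> ('k, 'e, 'm, 'n) roof \<Rightarrow> bool" where
  "roof_equiv A X Y (Z, s, f) (Z', s', f') \<longleftrightarrow>
     (\<exists>(W :: ('e, 'k vec) cplx) u v.
       bounded_cplx A W \<and> chain_map A W Z u \<and> chain_map A W Z' v \<and>
       quasi_iso A W X (ccomp s u) \<and>
       homotopic A W X (ccomp s u) (ccomp s' v) \<and>
       homotopic A W Y (ccomp f u) (ccomp f' v))"

text \<open>
  The roofs representing the composite of \<open>(V, s, f): X \<rightarrow> Y\<close> and \<open>(W, t, g): Y \<rightarrow> Z\<close>.
\<close>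

fun roof_comps ::
    "('k, 'e) kalg \<Rightarrow> ('e, 'm) cplx \<Rightarrow> ('k, 'e, 'l, 'm) roof \<Rightarrow> ('k, 'e, 'm, 'n) roof \<Rightarrow>
     ('k, 'e, 'l, 'n) roof set" where
  "roof_comps A Y (V, s, f) (W, t, g) =
     {(U, ccomp s u, ccomp g v) | U u v.
       bounded_cplx A U \<and> quasi_iso A U V u \<and> chain_map A U W v \<and>
       homotopic A U Y (ccomp f u) (ccomp t v)}"

fun represents_id ::
    "('k, 'e) kalg \<Rightarrow> ('e, 'm) cplx \<Rightarrow> ('k, 'e, 'm, 'm) roof \<Rightarrow> bool" where
  "represents_id A X (Z, s, f) \<longleftrightarrow> roof_equiv A X X (Z, s, f) (Z, s, s)"

fun represents_zero ::
    "('k, 'e) kalg \<Rightarrow> ('e, 'm) cplx \<Rightarrow> ('e, 'n) cplx \<Rightarrow> ('k, 'e, 'm, 'n) roof \<Rightarrow> bool" where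
  "represents_zero A X Y (Z, s, f) \<longleftrightarrow>
     roof_equiv A X Y (Z, s, f) (Z, s, \<lambda>n _. \<zero>\<^bsub>cobj Y n\<^esub>)"

definition D_Hom_zero :: "('k, 'e) kalg \<Rightarrow> ('e, 'm) cplx \<Rightarrow> ('e, 'n) cplx \<Rightarrow> bool" where
  "D_Hom_zero A X Y \<longleftrightarrow> (\<forall>r. is_roof A X Y r \<longrightarrow> represents_zero A X Y r)"

definition D_iso :: "('k, 'e) kalg \<Rightarrow> ('e, 'm) cplx \<Rightarrow> ('e, 'n) cplx \<Rightarrow> bool" where
  "D_iso A X Y \<longleftrightarrow>
     (\<exists>r r'. is_roof A X Y r \<and> is_roof A Y X r' \<and>
       (\<exists>q\<in>roof_comps A Y r r'. represents_id A X q) \<and>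
       (\<exists>q\<in>roof_comps A X r' r. represents_id A Y q))"

definition shift :: "('e, 'm) cplx \<Rightarrow> int \<Rightarrow> ('e, 'm) cplx" where
  "shift X r = \<lparr>cobj = (\<lambda>n. cobj X (n + r)),
     cdiff = (\<lambda>n x. if even r then cdiff X (n + r) x
                    else \<ominus>\<^bsub>cobj X (n + r + 1)\<^esub> cdiff X (n + r) x)\<rparr>"

definition cone ::
    "('e, 'm) cplx \<Rightarrow> ('e, 'n) cplx \<Rightarrow> (int \<Rightarrow> 'm \<Rightarrow> 'n) \<Rightarrow> ('e, 'm \<times> 'n) cplx" where
  "cone X Y f = \<lparr>cobj = (\<lambda>n. dprod (cobj X (n + 1)) (cobj Y n)),
     cdiff = (\<lambda>n (x, y). (\<ominus>\<^bsub>cobj X (n + 2)\<^esub> cdiff X (n + 1) x,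
                          f (n + 1) x \<oplus>\<^bsub>cobj Y (n + 1)\<^esub> cdiff Y n y))\<rparr>"

definition cplx_dsum :: "('e, 'm) cplx \<Rightarrow> ('e, 'n) cplx \<Rightarrow> ('e, 'm \<times> 'n) cplx" where
  "cplx_dsum X Y = \<lparr>cobj = (\<lambda>n. dprod (cobj X n) (cobj Y n)),
     cdiff = (\<lambda>n (x, y). (cdiff X n x, cdiff Y n y))\<rparr>"

text \<open>A module as a complex concentrated in degree 0.\<close>

definition stalk :: "('e, 'm) module \<Rightarrow> ('e, 'm) cplx" where
  "stalk M = \<lparr>cobj = (\<lambda>n. if n = 0 then M else zero_mod M), cdiff = (\<lambda>n x. \<zero>\<^bsub>M\<^esub>)\<rparr>"

text \<open>
  The complex \<open>f: M \<rightarrow> N\<close> with \<open>M\<close> in degree \<open>-1\<close> and \<open>N\<close> in degree \<open>0\<close>.  Since all terms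
  of a complex live on the same type, \<open>M\<close> appears as \<open>M \<times> 0\<close> and \<open>N\<close> as \<open>0 \<times> N\<close>.
\<close>

definition two_term ::
    "('e, 'm) module \<Rightarrow> ('e, 'n) module \<Rightarrow> ('m \<Rightarrow> 'n) \<Rightarrow> ('e, 'm \<times> 'n) cplx" where
  "two_term M N f = \<lparr>
     cobj = (\<lambda>n. dprod (if n = -1 then M else zero_mod M) (if n = 0 then N else zero_mod N)),
     cdiff = (\<lambda>n (x, y). (\<zero>\<^bsub>M\<^esub>, if n = -1 then f x else \<zero>\<^bsub>N\<^esub>))\<rparr>"


section \<open>Tilting complexes and tilting modules\<close>

definition projective_cplx :: "('k, 'e) kalg \<Rightarrow> ('e, 'm) cplx \<Rightarrow> bool" where
  "projective_cplx A X \<longleftrightarrow> bounded_cplx A X \<and> (\<forall>n. projective A (cobj X n))"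

text \<open>
  The objects of the smallest full triangulated subcategory, closed under isomorphism, that
  contains all direct summands of \<open>T\<close>.  Up to isomorphism, every morphism of the derived category
  is a chain map, so that \<open>tri_cone\<close> covers all distinguished triangles.
\<close>

inductive tri_gen ::
    "('k, 'e) kalg \<Rightarrow> ('e, 'm) cplx \<Rightarrow> ('e, 'k vec) cplx \<Rightarrow> bool"
  for A :: "('k, 'e) kalg" and T :: "('e, 'm) cplx" where
  tri_summand: "\<lbrakk>bounded_cplx A Y; bounded_cplx A (Y' :: ('e, 'k vec) cplx);
      D_iso A T (cplx_dsum Y Y')\<rbrakk> \<Longrightarrow> tri_gen A T Y"
| tri_iso: "\<lbrakk>tri_gen A T X; bounded_cplx A Y; D_iso A X Y\<rbrakk> \<Longrightarrow> tri_gen A T Y"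
| tri_shift: "tri_gen A T X \<Longrightarrow> tri_gen A T (shift X r)"
| tri_cone: "\<lbrakk>tri_gen A T X; tri_gen A T Y; chain_map A X Y f;
      bounded_cplx A Z; D_iso A (cone X Y f) Z\<rbrakk> \<Longrightarrow> tri_gen A T Z"

definition tilting_complex :: "('k, 'e) kalg \<Rightarrow> ('e, 'm) cplx \<Rightarrow> bool" where
  "tilting_complex A T \<longleftrightarrow> projective_cplx A T \<and>
     (\<forall>r. r \<noteq> 0 \<longrightarrow> D_Hom_zero A T (shift T r)) \<and>
     (\<forall>X. projective_cplx A X \<longrightarrow> tri_gen A T X)"

text \<open>Direct summands of finite direct sums of copies of \<open>T\<close>.\<close>

definition in_add :: "('k, 'e) kalg \<Rightarrow> ('e, 'm) module \<Rightarrow> ('e, 'n) module \<Rightarrow> bool" where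
  "in_add A T M \<longleftrightarrow> fd_module A M \<and>
     (\<exists>(N :: ('e, 'k vec) module) n. fd_module A N \<and>
       mod_iso A (dprod M N) (dsum {..<n::nat} (\<lambda>_. T)))"

text \<open>
  Tilting modules of projective dimension at most 1, with \<open>Ext\<^sup>1(T, T)\<close> read as
  \<open>Hom(T, T[1])\<close> in the derived category.
\<close>

definition tilting_module_pd1 :: "('k, 'e) kalg \<Rightarrow> ('e, 'm) module \<Rightarrow> bool" where
  "tilting_module_pd1 A T \<longleftrightarrow> fd_module A T \<and> pd_le A 1 T \<and>
     D_Hom_zero A (stalk T) (shift (stalk T) 1) \<and>
     (\<exists>(T0 :: ('e, 'k vec) module) (T1 :: ('e, 'k vec) module) f g.
       in_add A T T0 \<and> in_add A T T1 \<and>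
       f \<in> mod_hom A (regular_mod A) T0 \<and> g \<in> mod_hom A T0 T1 \<and>
       inj_on f (carrier A) \<and> exact_at (regular_mod A) T0 T1 f g \<and>
       g ` carrier T0 = carrier T1)"


section \<open>Quivers with relations\<close>

text \<open>
  Finite quivers are the finite directed multigraphs \<open>fin_digraph\<close>, an arrow \<open>\<alpha>\<close> running from
  \<open>tail Q \<alpha>\<close> to \<open>head Q \<alpha>\<close>.  A path is given by its start vertex and its list of arrows,
  in the order in which they are traversed.
\<close>

type_synonym ('v, 'a) qpath = "'v \<times> 'a list"

definition qpaths :: "('v, 'a) pre_digraph \<Rightarrow> ('v, 'a) qpath set" where
  "qpaths Q = {(u, p) | u p. \<exists>v. pre_digraph.awalk Q u p v}"

definition path_elem :: "('v, 'a) qpath \<Rightarrow> ('v, 'a) qpath \<Rightarrow> 'k::field" where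
  "path_elem x = (\<lambda>y. if y = x then 1 else 0)"

text \<open>
  Elements are coefficient functions.  In a product, the coefficient of a path is summed over all
  ways to cut the path into two.
\<close>

definition path_algebra :: "('v, 'a) pre_digraph \<Rightarrow> (('v, 'a) qpath \<Rightarrow> 'k::field) ring" where
  "path_algebra Q = \<lparr>
     carrier = {f. finite {x. f x \<noteq> 0} \<and> {x. f x \<noteq> 0} \<subseteq> qpaths Q},
     mult = (\<lambda>f g (u, p). \<Sum>i\<le>length p.
       f (u, take i p) * g (pre_digraph.awlast Q u (take i p), drop i p)),
     one = (\<lambda>(u, p). if u \<in> verts Q \<and> p = [] then 1 else 0),
     zero = (\<lambda>_. 0),
     add = (\<lambda>f g x. f x + g x)\<rparr>"

definition arrow_ideal :: "('v, 'a) pre_digraph \<Rightarrow> (('v, 'a) qpath \<Rightarrow> 'k::field) set" where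
  "arrow_ideal Q =
     genideal (path_algebra Q) {path_elem (tail Q \<alpha>, [\<alpha>]) | \<alpha>. \<alpha> \<in> arcs Q}"

definition admissible ::
    "('v, 'a) pre_digraph \<Rightarrow> (('v, 'a) qpath \<Rightarrow> 'k::field) set \<Rightarrow> bool" where
  "admissible Q I \<longleftrightarrow> ideal I (path_algebra Q) \<and>
     (\<exists>m::nat. m \<ge> 2 \<and> arrow_ideal Q [^]\<^bsub>ideals_set (path_algebra Q)\<^esub> m \<subseteq> I) \<and>
     I \<subseteq> arrow_ideal Q [^]\<^bsub>ideals_set (path_algebra Q)\<^esub> (2::nat)"

text \<open>The algebra \<open>KQ/I\<close>.\<close>

definition quiver_algebra ::
    "('v, 'a) pre_digraph \<Rightarrow> (('v, 'a) qpath \<Rightarrow> 'k::field) set \<Rightarrow>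
     ('k, (('v, 'a) qpath \<Rightarrow> 'k) set) kalg" where
  "quiver_algebra Q I = ring.extend (path_algebra Q Quot I)
     (kalg.fields (\<lambda>c. I +>\<^bsub>path_algebra Q\<^esub> (\<lambda>x. c * \<one>\<^bsub>path_algebra Q\<^esub> x)))"

definition path_class ::
    "('v, 'a) pre_digraph \<Rightarrow> (('v, 'a) qpath \<Rightarrow> 'k::field) set \<Rightarrow> ('v, 'a) qpath \<Rightarrow>
     (('v, 'a) qpath \<Rightarrow> 'k) set" where
  "path_class Q I x = I +>\<^bsub>path_algebra Q\<^esub> path_elem x"

definition vertex_proj ::
    "('v, 'a) pre_digraph \<Rightarrow> (('v, 'a) qpath \<Rightarrow> 'k::field) set \<Rightarrow> 'v \<Rightarrow>
     ((('v, 'a) qpath \<Rightarrow> 'k) set, (('v, 'a) qpath \<Rightarrow> 'k) set) module" where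
  "vertex_proj Q I i = submod (regular_mod (quiver_algebra Q I))
     {path_class Q I (i, []) \<otimes>\<^bsub>quiver_algebra Q I\<^esub> a | a. a \<in> carrier (quiver_algebra Q I)}"

text \<open>
  The one-dimensional module on which a path acts as \<open>1\<close> if it is the trivial path at \<open>i\<close>
  and as \<open>0\<close> otherwise.  As \<open>I\<close> is admissible, the coefficient of a trivial path is the
  same on all representatives \<open>p\<close> of a class.
\<close>

definition vertex_simple ::
    "'v \<Rightarrow> ((('v, 'a) qpath \<Rightarrow> 'k::field) set, 'k) module" where
  "vertex_simple i = \<lparr>carrier = UNIV, mult = undefined, one = undefined, zero = 0, add = (+),
     smult = (\<lambda>a x. x * (THE c. \<forall>p\<in>a. p (i, []) = c))\<rparr>"

definition other_projs ::
    "('v, 'a) pre_digraph \<Rightarrow> (('v, 'a) qpath \<Rightarrow> 'k::field) set \<Rightarrow> 'v \<Rightarrow>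
     ((('v, 'a) qpath \<Rightarrow> 'k) set, 'v \<Rightarrow> (('v, 'a) qpath \<Rightarrow> 'k) set) module" where
  "other_projs Q I k = dsum (verts Q - {k}) (vertex_proj Q I)"

definition arrows_into :: "('v, 'a) pre_digraph \<Rightarrow> 'v \<Rightarrow> 'a set" where
  "arrows_into Q k = {\<alpha> \<in> arcs Q. head Q \<alpha> = k}"

definition L_cplx ::
    "('v, 'a) pre_digraph \<Rightarrow> (('v, 'a) qpath \<Rightarrow> 'k::field) set \<Rightarrow> 'v \<Rightarrow>
     ((('v, 'a) qpath \<Rightarrow> 'k) set,
      (('v, 'a) qpath \<Rightarrow> 'k) set \<times> ('a \<Rightarrow> (('v, 'a) qpath \<Rightarrow> 'k) set)) cplx" where
  "L_cplx Q I k = two_term (vertex_proj Q I k)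
     (dsum (arrows_into Q k) (\<lambda>\<alpha>. vertex_proj Q I (tail Q \<alpha>)))
     (\<lambda>x. \<lambda>\<alpha>\<in>arrows_into Q k. path_class Q I (tail Q \<alpha>, [\<alpha>]) \<otimes>\<^bsub>quiver_algebra Q I\<^esub> x)"

definition T_minus where
  "T_minus Q I k = cplx_dsum (L_cplx Q I k) (stalk (other_projs Q I k))"

text \<open>\<open>X\<close> stands for \<open>\<tau>\<^sup>-\<^sup>1 S\<^sub>k\<close>.\<close>

definition T_BB where
  "T_BB Q I k X = dprod X (other_projs Q I k)"

end

theory Submission
  imports Defs
begin

text \<open>
  Let \<open>N\<close> be the kernel of the map \<open>P\<^sub>k \<rightarrow> R = \<Oplus>P\<^bsub>s(\<alpha>)\<^esub>\<close> induced by the arrows ending at \<open>k\<close>; its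
  cokernel is \<open>X = \<tau>\<^sup>-\<^sup>1S\<^sub>k\<close>.  Since \<open>pd X \<le> 2\<close>, the second syzygy \<open>N\<close> is projective.  As
  \<open>Hom(P\<^sub>i, L\<^sub>k[-1]) = 0\<close> for \<open>i \<noteq> k\<close>, it is a sum of copies of the simple module at \<open>k\<close>.
  If \<open>N \<noteq> 0\<close>, that simple module would be projective and \<open>k\<close> would be a sink; but then some arrow
  ends at \<open>k\<close>, and the map does not vanish on \<open>P\<^sub>k = S\<^sub>k\<close>.  So \<open>N = 0\<close>, and \<open>T\<^sup>-\<^sub>k\<close> is a projective resolution of
  \<open>X \<oplus> \<Oplus>P\<^sub>i\<close> of length 1.  The coresolution of \<open>A\<close> that a tilting module needs is
  \<open>0 \<rightarrow> A \<rightarrow> R \<oplus> \<Oplus>P\<^sub>i \<rightarrow> X \<rightarrow> 0\<close>, with \<open>i \<noteq> k\<close> in both sums of \<open>P\<^sub>i\<close>.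
\<close>

section \<open>Algebras, modules and homomorphisms\<close>

text \<open>A morphism of the derived category that is zero comes with a homotopy only on some
  complex W above its roof, and the terms of W are known merely to be finite-dimensional. For the
  shift by -1 it suffices to look at cohomology, because the target has only the zero coboundary in
  degree 0. For the shift by 1 the homotopy has to be pulled back to T, which can be lifted along
  quasi-isomorphisms as a bounded complex of projectives.

  The module X is tied to an arbitrary minimal presentation over the opposite algebra, so its
  description as a cokernel rests on uniqueness of projective covers. Admissibility enters through
  both of its bounds: long paths lie in I, which gives Nakayama's lemma, and elements of I have no
  coefficients at paths of length at most one, which makes the explicit presentation minimal.

  At an isolated vertex k the sum R would be empty and \<open>L_k\<close> just a shift of
  \<open>P_k\<close>, with zero cokernel; hence the assumption that some arrow meets k. A loop at k
  would put \<open>P_k\<close> among the summands of R; without loops, every summand of R is also a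
  summand of the other projectives.\<close>

locale kalgebra = ring A for A :: "('k::field, 'e) kalg" (structure) +
  assumes scal_closed [simp, intro]: "scal A c \<in> carrier A"
    and scal_add: "scal A (c + d) = scal A c \<oplus> scal A d"
    and scal_mult: "scal A (c * d) = scal A c \<otimes> scal A d"
    and scal_one: "scal A 1 = \<one>"
    and scal_commute: "a \<in> carrier A \<Longrightarrow> scal A c \<otimes> a = a \<otimes> scal A c"

lemma opp_simps [simp]:
  "carrier (opp A) = carrier A" "zero (opp A) = zero A" "one (opp A) = one A"
  "add (opp A) = add A" "scal (opp A) = scal A" "a \<otimes>\<^bsub>opp A\<^esub> b = b \<otimes>\<^bsub>A\<^esub> a"
  by (simp_all add: opp_def)

lemma opp_opp [simp]: "opp (opp A) = A"
  by (simp add: opp_def)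

text \<open>The inverse translate is formed over the opposite algebra, so every result of this
  locale is needed on both sides. Reversing products keeps the structure map multiplicative because
  scalars are central.\<close>

lemma (in kalgebra) kalgebra_opp: "kalgebra (opp A)"
proof -
  have "ring (opp A)"
  proof (rule ringI)
    show "abelian_group (opp A)"
      by (rule abelian_groupI) (auto simp: a_ac intro: l_neg)
    show "monoid (opp A)"
      by (rule monoidI) (auto simp: m_assoc)
  qed (auto simp: l_distr r_distr)
  then show ?thesis
  proof (intro kalgebra.intro kalgebra_axioms.intro)
    fix c d
    show "scal (opp A) (c * d) = scal (opp A) c \<otimes>\<^bsub>opp A\<^esub> scal (opp A) d"
      using scal_mult[of c d] scal_commute[OF scal_closed, of c d] by simp
    fix a assume "a \<in> carrier (opp A)"
    then show "scal (opp A) c \<otimes>\<^bsub>opp A\<^esub> a = a \<otimes>\<^bsub>opp A\<^esub> scal (opp A) c"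
      using scal_commute[of a c] by simp
  qed (simp_all add: scal_add scal_one)
qed

context right_module
begin

lemma act_zero_left [simp]: "x \<in> carrier M \<Longrightarrow> \<zero>\<^bsub>A\<^esub> \<odot>\<^bsub>M\<^esub> x = \<zero>\<^bsub>M\<^esub>"
  by (metis A.add.l_cancel_one' A.zero_closed A.l_zero M.add.r_cancel_one' act_add_left act_closed)

lemma act_zero_right [simp]: "a \<in> carrier A \<Longrightarrow> a \<odot>\<^bsub>M\<^esub> \<zero>\<^bsub>M\<^esub> = \<zero>\<^bsub>M\<^esub>"
  by (metis M.zero_closed M.l_zero M.add.r_cancel_one' act_add_right act_closed)

lemma minus_zero [simp]: "\<ominus>\<^bsub>M\<^esub> \<zero>\<^bsub>M\<^esub> = \<zero>\<^bsub>M\<^esub>"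
  by (rule M.minus_equality) simp_all

lemma act_minus_right:
  "\<lbrakk>a \<in> carrier A; x \<in> carrier M\<rbrakk> \<Longrightarrow> a \<odot>\<^bsub>M\<^esub> (\<ominus>\<^bsub>M\<^esub> x) = \<ominus>\<^bsub>M\<^esub> (a \<odot>\<^bsub>M\<^esub> x)"
  by (metis M.a_inv_closed M.minus_equality act_add_right act_closed act_zero_right M.l_neg)

lemma act_minus_left:
  "\<lbrakk>a \<in> carrier A; x \<in> carrier M\<rbrakk> \<Longrightarrow> (\<ominus>\<^bsub>A\<^esub> a) \<odot>\<^bsub>M\<^esub> x = \<ominus>\<^bsub>M\<^esub> (a \<odot>\<^bsub>M\<^esub> x)"
  by (metis A.a_inv_closed M.minus_equality act_add_left act_closed act_zero_left A.l_neg)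

lemma act_finsum_right:
  "\<lbrakk>finite S; a \<in> carrier A; f \<in> S \<rightarrow> carrier M\<rbrakk> \<Longrightarrow>
    a \<odot>\<^bsub>M\<^esub> (\<Oplus>\<^bsub>M\<^esub>i\<in>S. f i) = (\<Oplus>\<^bsub>M\<^esub>i\<in>S. a \<odot>\<^bsub>M\<^esub> f i)"
  by (induct set: finite) (simp_all add: Pi_def act_add_right act_closed)

lemma act_finsum_left:
  "\<lbrakk>finite S; x \<in> carrier M; f \<in> S \<rightarrow> carrier A\<rbrakk> \<Longrightarrow>
    (\<Oplus>\<^bsub>A\<^esub>i\<in>S. f i) \<odot>\<^bsub>M\<^esub> x = (\<Oplus>\<^bsub>M\<^esub>i\<in>S. f i \<odot>\<^bsub>M\<^esub> x)"
  by (induct set: finite) (simp_all add: Pi_def act_add_left act_closed)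

text \<open>Negation needs no closure condition of its own: \<open>\<ominus> x\<close> is the action
  of minus one on x.\<close>

lemma submoduleI':
  assumes "H \<subseteq> carrier M" "\<zero>\<^bsub>M\<^esub> \<in> H"
    and "\<And>x y. \<lbrakk>x \<in> H; y \<in> H\<rbrakk> \<Longrightarrow> x \<oplus>\<^bsub>M\<^esub> y \<in> H"
    and act: "\<And>a x. \<lbrakk>a \<in> carrier A; x \<in> H\<rbrakk> \<Longrightarrow> a \<odot>\<^bsub>M\<^esub> x \<in> H"
  shows "submodule H A M"
proof -
  have "\<ominus>\<^bsub>M\<^esub> x \<in> H" if "x \<in> H" for x
    using act[of "\<ominus>\<^bsub>A\<^esub> \<one>\<^bsub>A\<^esub>" x] that assms(1) by (simp add: act_minus_left act_one subset_eq)
  then show ?thesis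
    using assms
    by (intro submodule.intro subgroup.intro) (simp_all add: submodule_axioms_def a_inv_def)
qed

lemma submodule_closed:
  assumes "submodule H A M"
  shows "H \<subseteq> carrier M" "\<zero>\<^bsub>M\<^esub> \<in> H"
    "\<And>x y. \<lbrakk>x \<in> H; y \<in> H\<rbrakk> \<Longrightarrow> x \<oplus>\<^bsub>M\<^esub> y \<in> H"
    "\<And>x. x \<in> H \<Longrightarrow> \<ominus>\<^bsub>M\<^esub> x \<in> H"
    "\<And>a x. \<lbrakk>a \<in> carrier A; x \<in> H\<rbrakk> \<Longrightarrow> a \<odot>\<^bsub>M\<^esub> x \<in> H"
proof -
  interpret H: submodule H A M by fact
  show "H \<subseteq> carrier M" "\<zero>\<^bsub>M\<^esub> \<in> H" "\<And>x y. \<lbrakk>x \<in> H; y \<in> H\<rbrakk> \<Longrightarrow> x \<oplus>\<^bsub>M\<^esub> y \<in> H"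
    "\<And>x. x \<in> H \<Longrightarrow> \<ominus>\<^bsub>M\<^esub> x \<in> H"
    "\<And>a x. \<lbrakk>a \<in> carrier A; x \<in> H\<rbrakk> \<Longrightarrow> a \<odot>\<^bsub>M\<^esub> x \<in> H"
    using H.subset H.one_closed H.m_closed H.m_inv_closed by (auto simp: a_inv_def)
qed

end

lemma right_moduleI:
  assumes "ring A"
    and "\<And>x y. \<lbrakk>x \<in> carrier M; y \<in> carrier M\<rbrakk> \<Longrightarrow> x \<oplus>\<^bsub>M\<^esub> y \<in> carrier M"
    and "\<zero>\<^bsub>M\<^esub> \<in> carrier M"
    and "\<And>x y z. \<lbrakk>x \<in> carrier M; y \<in> carrier M; z \<in> carrier M\<rbrakk> \<Longrightarrow>
      (x \<oplus>\<^bsub>M\<^esub> y) \<oplus>\<^bsub>M\<^esub> z = x \<oplus>\<^bsub>M\<^esub> (y \<oplus>\<^bsub>M\<^esub> z)"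
    and "\<And>x y. \<lbrakk>x \<in> carrier M; y \<in> carrier M\<rbrakk> \<Longrightarrow> x \<oplus>\<^bsub>M\<^esub> y = y \<oplus>\<^bsub>M\<^esub> x"
    and "\<And>x. x \<in> carrier M \<Longrightarrow> \<zero>\<^bsub>M\<^esub> \<oplus>\<^bsub>M\<^esub> x = x"
    and "\<And>x. x \<in> carrier M \<Longrightarrow> \<exists>y\<in>carrier M. y \<oplus>\<^bsub>M\<^esub> x = \<zero>\<^bsub>M\<^esub>"
    and "\<And>a x. \<lbrakk>a \<in> carrier A; x \<in> carrier M\<rbrakk> \<Longrightarrow> a \<odot>\<^bsub>M\<^esub> x \<in> carrier M"
    and "\<And>a b x. \<lbrakk>a \<in> carrier A; b \<in> carrier A; x \<in> carrier M\<rbrakk> \<Longrightarrow>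
      (a \<oplus>\<^bsub>A\<^esub> b) \<odot>\<^bsub>M\<^esub> x = a \<odot>\<^bsub>M\<^esub> x \<oplus>\<^bsub>M\<^esub> b \<odot>\<^bsub>M\<^esub> x"
    and "\<And>a x y. \<lbrakk>a \<in> carrier A; x \<in> carrier M; y \<in> carrier M\<rbrakk> \<Longrightarrow>
      a \<odot>\<^bsub>M\<^esub> (x \<oplus>\<^bsub>M\<^esub> y) = a \<odot>\<^bsub>M\<^esub> x \<oplus>\<^bsub>M\<^esub> a \<odot>\<^bsub>M\<^esub> y"
    and "\<And>a b x. \<lbrakk>a \<in> carrier A; b \<in> carrier A; x \<in> carrier M\<rbrakk> \<Longrightarrow>
      (a \<otimes>\<^bsub>A\<^esub> b) \<odot>\<^bsub>M\<^esub> x = b \<odot>\<^bsub>M\<^esub> (a \<odot>\<^bsub>M\<^esub> x)"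
    and "\<And>x. x \<in> carrier M \<Longrightarrow> \<one>\<^bsub>A\<^esub> \<odot>\<^bsub>M\<^esub> x = x"
  shows "right_module A M"
  by (intro right_module.intro abelian_groupI right_module_axioms.intro)
    (fact assms | rule assms(1) | erule (2) assms(4) | erule (1) assms(5))+

lemma right_module_regular:
  assumes "ring (A :: ('k, 'e) kalg)"
  shows "right_module A (regular_mod A)"
proof -
  interpret ring A by fact
  show ?thesis
    by (rule right_moduleI)
      (auto simp: regular_mod_def ring_axioms l_distr r_distr m_assoc a_ac intro: l_neg)
qed

lemma submod_simps [simp]:
  "carrier (submod M H) = H" "zero (submod M H) = zero M" "add (submod M H) = add M"
  "smult (submod M H) = smult M"
  by (simp_all add: submod_def)

lemma zero_mod_simps [simp]:
  "carrier (zero_mod M) = {\<zero>\<^bsub>M\<^esub>}" "zero (zero_mod M) = zero M" "add (zero_mod M) = add M"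
  "smult (zero_mod M) = smult M"
  by (simp_all add: zero_mod_def)

lemma dprod_simps [simp]:
  "carrier (dprod M N) = carrier M \<times> carrier N" "zero (dprod M N) = (\<zero>\<^bsub>M\<^esub>, \<zero>\<^bsub>N\<^esub>)"
  "(x, y) \<oplus>\<^bsub>dprod M N\<^esub> (x', y') = (x \<oplus>\<^bsub>M\<^esub> x', y \<oplus>\<^bsub>N\<^esub> y')"
  "a \<odot>\<^bsub>dprod M N\<^esub> (x, y) = (a \<odot>\<^bsub>M\<^esub> x, a \<odot>\<^bsub>N\<^esub> y)"
  by (simp_all add: dprod_def)

lemma dsum_simps [simp]:
  "carrier (dsum J M) = (\<Pi>\<^sub>E j\<in>J. carrier (M j))" "zero (dsum J M) = (\<lambda>j\<in>J. \<zero>\<^bsub>M j\<^esub>)"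
  "x \<oplus>\<^bsub>dsum J M\<^esub> y = (\<lambda>j\<in>J. x j \<oplus>\<^bsub>M j\<^esub> y j)" "a \<odot>\<^bsub>dsum J M\<^esub> x = (\<lambda>j\<in>J. a \<odot>\<^bsub>M j\<^esub> x j)"
  by (simp_all add: dsum_def)

lemma regular_mod_simps [simp]:
  "carrier (regular_mod A) = carrier A" "zero (regular_mod A) = zero A"
  "add (regular_mod A) = add A" "a \<odot>\<^bsub>regular_mod A\<^esub> x = x \<otimes>\<^bsub>A\<^esub> a"
  by (simp_all add: regular_mod_def)

lemma right_module_submod:
  assumes "right_module A M" "submodule H A M"
  shows "right_module A (submod M H)"
proof -
  interpret right_module A M by fact
  note H = submodule_closed[OF assms(2)]
  have "\<exists>y\<in>H. y \<oplus>\<^bsub>M\<^esub> x = \<zero>\<^bsub>M\<^esub>" if "x \<in> H" for x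
    using H(1) H(4)[OF that] that by (intro bexI[of _ "\<ominus>\<^bsub>M\<^esub> x"]) (auto simp: M.l_neg)
  then show ?thesis
    using H
    by (intro right_moduleI)
      (auto simp: A.ring_axioms M.a_ac subset_eq act_add_left act_add_right act_mult act_one)
qed

lemma (in right_module) submodule_zero: "submodule {\<zero>\<^bsub>M\<^esub>} A M"
  by (rule submoduleI') auto

lemma right_module_zero_mod: "right_module A M \<Longrightarrow> right_module A (zero_mod M)"
  unfolding zero_mod_def by (intro right_module_submod right_module.submodule_zero)

lemma right_module_dprod:
  assumes "right_module A M" "right_module A N"
  shows "right_module A (dprod M N)"
proof -
  interpret M: right_module A M by fact
  interpret N: right_module A N by fact
  have "\<exists>y\<in>carrier (dprod M N). y \<oplus>\<^bsub>dprod M N\<^esub> x = \<zero>\<^bsub>dprod M N\<^esub>"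
    if "x \<in> carrier (dprod M N)" for x
    using that
    by (intro bexI[of _ "(\<ominus>\<^bsub>M\<^esub> fst x, \<ominus>\<^bsub>N\<^esub> snd x)"]) (auto simp: M.l_neg N.l_neg)
  then show ?thesis
    by (intro right_moduleI)
      (auto simp: M.A.ring_axioms M.a_ac N.a_ac M.act_add_left M.act_add_right M.act_mult M.act_one
        N.act_add_left N.act_add_right N.act_mult N.act_one M.act_closed N.act_closed)
qed

lemma right_module_dsum:
  assumes "ring A" "\<And>j. j \<in> J \<Longrightarrow> right_module A (M j)"
  shows "right_module A (dsum J M)"
proof -
  have ag: "abelian_group (M j)" and ax: "right_module_axioms A (M j)" if "j \<in> J" for j
    using assms(2)[OF that] by (auto simp: right_module_def)
  note ag' = abelian_group.axioms(1)[OF ag]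
  note am = abelian_monoid.a_closed[OF ag'] abelian_monoid.zero_closed[OF ag']
    abelian_monoid.a_assoc[OF ag'] abelian_monoid.a_comm[OF ag'] abelian_monoid.l_zero[OF ag']
  note ac = right_module.act_closed[OF assms(2)] right_module.act_add_left[OF assms(2)]
    right_module.act_add_right[OF assms(2)] right_module.act_mult[OF assms(2)]
    right_module.act_one[OF assms(2)]
  show ?thesis
  proof (rule right_moduleI)
    fix x assume x: "x \<in> carrier (dsum J M)"
    show "\<exists>y\<in>carrier (dsum J M). y \<oplus>\<^bsub>dsum J M\<^esub> x = \<zero>\<^bsub>dsum J M\<^esub>"
      using x
      by (intro bexI[of _ "\<lambda>j\<in>J. \<ominus>\<^bsub>M j\<^esub> x j"])
        (auto simp: PiE_iff abelian_group.l_neg[OF ag] abelian_group.a_inv_closed[OF ag]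
          intro!: restrict_ext)
  next
    fix x assume x: "x \<in> carrier (dsum J M)"
    show "\<zero>\<^bsub>dsum J M\<^esub> \<oplus>\<^bsub>dsum J M\<^esub> x = x"
      by (rule ext) (use x in \<open>auto simp: PiE_iff am(2,5) extensional_def\<close>)
    show "\<one>\<^bsub>A\<^esub> \<odot>\<^bsub>dsum J M\<^esub> x = x"
      by (rule ext) (use x in \<open>auto simp: PiE_iff ac extensional_def\<close>)
  next
    fix x y assume "x \<in> carrier (dsum J M)" "y \<in> carrier (dsum J M)"
    then show "x \<oplus>\<^bsub>dsum J M\<^esub> y = y \<oplus>\<^bsub>dsum J M\<^esub> x"
      by (auto simp: PiE_iff am(4) intro!: restrict_ext)
  qed (auto simp: assms(1) PiE_iff am(1,2,3) ac intro!: restrict_ext)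
qed

section \<open>Homomorphisms, kernels and images\<close>

lemma mod_homI:
  assumes "\<And>x. x \<in> carrier M \<Longrightarrow> f x \<in> carrier N"
    and "\<And>x y. \<lbrakk>x \<in> carrier M; y \<in> carrier M\<rbrakk> \<Longrightarrow> f (x \<oplus>\<^bsub>M\<^esub> y) = f x \<oplus>\<^bsub>N\<^esub> f y"
    and "\<And>a x. \<lbrakk>a \<in> carrier A; x \<in> carrier M\<rbrakk> \<Longrightarrow> f (a \<odot>\<^bsub>M\<^esub> x) = a \<odot>\<^bsub>N\<^esub> f x"
  shows "f \<in> mod_hom A M N"
  using assms by (simp add: mod_hom_def)

lemma mod_homD:
  assumes "f \<in> mod_hom A M N"
  shows "\<And>x. x \<in> carrier M \<Longrightarrow> f x \<in> carrier N"
    and "\<And>x y. \<lbrakk>x \<in> carrier M; y \<in> carrier M\<rbrakk> \<Longrightarrow> f (x \<oplus>\<^bsub>M\<^esub> y) = f x \<oplus>\<^bsub>N\<^esub> f y"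
    and "\<And>a x. \<lbrakk>a \<in> carrier A; x \<in> carrier M\<rbrakk> \<Longrightarrow> f (a \<odot>\<^bsub>M\<^esub> x) = a \<odot>\<^bsub>N\<^esub> f x"
  using assms by (auto simp add: mod_hom_def)

lemma mod_hom_zero:
  assumes "right_module A M" "right_module A N" "f \<in> mod_hom A M N"
  shows "f \<zero>\<^bsub>M\<^esub> = \<zero>\<^bsub>N\<^esub>"
proof -
  interpret M: right_module A M by fact
  interpret N: right_module A N by fact
  show ?thesis
    using mod_homD(2)[OF assms(3) M.zero_closed M.zero_closed] mod_homD(1)[OF assms(3) M.zero_closed]
    by (metis M.l_zero M.zero_closed N.add.r_cancel_one')
qed

lemma mod_hom_minus:
  assumes "right_module A M" "right_module A N" "f \<in> mod_hom A M N" "x \<in> carrier M"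
  shows "f (\<ominus>\<^bsub>M\<^esub> x) = \<ominus>\<^bsub>N\<^esub> f x"
proof -
  interpret M: right_module A M by fact
  interpret N: right_module A N by fact
  show ?thesis
    using mod_homD(1,2)[OF assms(3)] assms(4) mod_hom_zero[OF assms(1-3)]
    by (metis M.a_inv_closed M.l_neg N.minus_equality)
qed

lemma mod_hom_diff:
  assumes "right_module A M" "right_module A N" "f \<in> mod_hom A M N" "x \<in> carrier M" "y \<in> carrier M"
  shows "f (x \<ominus>\<^bsub>M\<^esub> y) = f x \<ominus>\<^bsub>N\<^esub> f y"
proof -
  interpret M: right_module A M by fact
  show ?thesis
    using assms by (simp add: a_minus_def mod_homD(2) mod_hom_minus)
qed

lemma mod_hom_finsum:
  assumes "right_module A M" "right_module A N" "f \<in> mod_hom A M N"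
    "finite S" "x \<in> S \<rightarrow> carrier M"
  shows "f (\<Oplus>\<^bsub>M\<^esub>i\<in>S. x i) = (\<Oplus>\<^bsub>N\<^esub>i\<in>S. f (x i))"
proof -
  interpret M: right_module A M by fact
  interpret N: right_module A N by fact
  show ?thesis
    using assms(4,5)
    by (induct set: finite)
      (simp_all add: Pi_def mod_hom_zero[OF assms(1-3)] mod_homD(1,2)[OF assms(3)])
qed

lemma mod_hom_id [simp]: "id \<in> mod_hom A M M" "(\<lambda>x. x) \<in> mod_hom A M M"
  by (simp_all add: mod_hom_def)

lemma mod_hom_comp:
  "\<lbrakk>f \<in> mod_hom A L M; g \<in> mod_hom A M N\<rbrakk> \<Longrightarrow> (\<lambda>x. g (f x)) \<in> mod_hom A L N"
  by (auto simp: mod_hom_def Pi_iff)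

lemma mod_hom_const_zero:
  assumes "right_module A N" shows "(\<lambda>x. \<zero>\<^bsub>N\<^esub>) \<in> mod_hom A M N"
proof -
  interpret N: right_module A N by fact
  show ?thesis by (rule mod_homI) auto
qed

lemma mod_hom_plus:
  assumes "right_module A N" "f \<in> mod_hom A M N" "g \<in> mod_hom A M N"
  shows "(\<lambda>x. f x \<oplus>\<^bsub>N\<^esub> g x) \<in> mod_hom A M N"
proof -
  interpret N: right_module A N by fact
  note fg = mod_homD[OF assms(2)] mod_homD[OF assms(3)]
  show ?thesis
    by (rule mod_homI) (simp_all add: fg N.a_ac N.act_add_right)
qed

lemma mod_hom_neg:
  assumes "right_module A N" "f \<in> mod_hom A M N"
  shows "(\<lambda>x. \<ominus>\<^bsub>N\<^esub> f x) \<in> mod_hom A M N"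
proof -
  interpret N: right_module A N by fact
  note f = mod_homD[OF assms(2)]
  show ?thesis
    by (rule mod_homI) (simp_all add: f N.minus_add N.a_ac N.act_minus_right)
qed

lemma mod_hom_minus_fun:
  assumes "right_module A N" "f \<in> mod_hom A M N" "g \<in> mod_hom A M N"
  shows "(\<lambda>x. f x \<ominus>\<^bsub>N\<^esub> g x) \<in> mod_hom A M N"
  unfolding a_minus_def by (intro mod_hom_plus mod_hom_neg assms)

lemma mod_hom_submod_codomain:
  "\<lbrakk>f \<in> mod_hom A M N; \<And>x. x \<in> carrier M \<Longrightarrow> f x \<in> H\<rbrakk> \<Longrightarrow> f \<in> mod_hom A M (submod N H)"
  by (auto simp: mod_hom_def)

lemma mod_hom_submod_domain:
  "\<lbrakk>f \<in> mod_hom A M N; H \<subseteq> carrier M\<rbrakk> \<Longrightarrow> f \<in> mod_hom A (submod M H) N"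
  by (auto simp: mod_hom_def subset_eq)

lemma mod_hom_from_submod:
  "\<lbrakk>f \<in> mod_hom A M (submod N H); H \<subseteq> carrier N\<rbrakk> \<Longrightarrow> f \<in> mod_hom A M N"
  by (auto simp: mod_hom_def)

lemma a_kernel_iff [simp]: "x \<in> a_kernel M N f \<longleftrightarrow> x \<in> carrier M \<and> f x = \<zero>\<^bsub>N\<^esub>"
  by (simp add: a_kernel_def')

lemma submodule_a_kernel:
  assumes "right_module A M" "right_module A N" "f \<in> mod_hom A M N"
  shows "submodule (a_kernel M N f) A M"
proof -
  interpret M: right_module A M by fact
  interpret N: right_module A N by fact
  show ?thesis
    by (rule M.submoduleI')
      (auto simp: mod_homD[OF assms(3)] mod_hom_zero[OF assms] M.act_closed)
qed

lemma submodule_image: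
  assumes "right_module A M" "right_module A N" "f \<in> mod_hom A M N"
  shows "submodule (f ` carrier M) A N"
proof -
  interpret M: right_module A M by fact
  interpret N: right_module A N by fact
  note f = mod_homD[OF assms(3)]
  show ?thesis
  proof (rule N.submoduleI')
    show "\<zero>\<^bsub>N\<^esub> \<in> f ` carrier M" using mod_hom_zero[OF assms] by (metis M.zero_closed imageI)
    show "x \<oplus>\<^bsub>N\<^esub> y \<in> f ` carrier M" if "x \<in> f ` carrier M" "y \<in> f ` carrier M" for x y
      using that f(2) by (auto simp: image_iff) (metis M.a_closed)
    show "a \<odot>\<^bsub>N\<^esub> x \<in> f ` carrier M" if "a \<in> carrier A" "x \<in> f ` carrier M" for a x
      using that f(3) by (auto simp: image_iff) (metis M.act_closed)
  qed (use f in auto)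
qed

lemma mod_hom_inj_on:
  assumes "right_module A M" "right_module A N" "f \<in> mod_hom A M N"
    and "\<And>x. \<lbrakk>x \<in> carrier M; f x = \<zero>\<^bsub>N\<^esub>\<rbrakk> \<Longrightarrow> x = \<zero>\<^bsub>M\<^esub>"
  shows "inj_on f (carrier M)"
proof (rule inj_onI)
  interpret M: right_module A M by fact
  interpret N: right_module A N by fact
  fix x y assume xy: "x \<in> carrier M" "y \<in> carrier M" "f x = f y"
  have "f (x \<ominus>\<^bsub>M\<^esub> y) = \<zero>\<^bsub>N\<^esub>"
    using mod_hom_diff[OF assms(1-3) xy(1,2)] xy mod_homD(1)[OF assms(3) xy(2)]
    by (simp add: a_minus_def N.r_neg)
  then show "x = y"
    using assms(4)[of "x \<ominus>\<^bsub>M\<^esub> y"] xy M.minus_equality[of x "\<ominus>\<^bsub>M\<^esub> y"]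
    by (simp add: a_minus_def)
qed

lemma mod_hom_inv_into:
  assumes "right_module A M" "f \<in> mod_hom A M N" "bij_betw f (carrier M) (carrier N)"
  shows "inv_into (carrier M) f \<in> mod_hom A N M"
proof -
  interpret M: right_module A M by fact
  let ?g = "inv_into (carrier M) f"
  note f = mod_homD[OF assms(2)]
  have g: "?g y \<in> carrier M" "f (?g y) = y" if "y \<in> carrier N" for y
    using that assms(3) by (auto simp: bij_betw_def inv_into_into f_inv_into_f)
  have gf: "?g (f x) = x" if "x \<in> carrier M" for x
    using that assms(3) by (simp add: bij_betw_def)
  show ?thesis
  proof (rule mod_homI)
    fix x y assume xy: "x \<in> carrier N" "y \<in> carrier N"
    have "x \<oplus>\<^bsub>N\<^esub> y = f (?g x \<oplus>\<^bsub>M\<^esub> ?g y)" using xy f g by simp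
    then show "?g (x \<oplus>\<^bsub>N\<^esub> y) = ?g x \<oplus>\<^bsub>M\<^esub> ?g y" using gf g xy by simp
  next
    fix a x assume ax: "a \<in> carrier A" "x \<in> carrier N"
    have "a \<odot>\<^bsub>N\<^esub> x = f (a \<odot>\<^bsub>M\<^esub> ?g x)" using ax f g by simp
    then show "?g (a \<odot>\<^bsub>N\<^esub> x) = a \<odot>\<^bsub>M\<^esub> ?g x" using gf g ax M.act_closed by simp
  qed (use g in simp)
qed

lemma mod_isoE:
  assumes "mod_iso A M N" "right_module A M"
  obtains f g where "f \<in> mod_hom A M N" "g \<in> mod_hom A N M"
    "\<And>x. x \<in> carrier M \<Longrightarrow> g (f x) = x" "\<And>y. y \<in> carrier N \<Longrightarrow> f (g y) = y"
proof -
  obtain f where f: "f \<in> mod_hom A M N" "bij_betw f (carrier M) (carrier N)"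
    using assms(1) by (auto simp: mod_iso_def)
  show ?thesis
    using that[OF f(1) mod_hom_inv_into[OF assms(2) f]] f(2)
    by (simp add: bij_betw_def f_inv_into_f)
qed

lemma mod_isoI:
  assumes "f \<in> mod_hom A M N" "g \<in> mod_hom A N M"
    and "\<And>x. x \<in> carrier M \<Longrightarrow> g (f x) = x" "\<And>y. y \<in> carrier N \<Longrightarrow> f (g y) = y"
  shows "mod_iso A M N"
proof -
  have "bij_betw f (carrier M) (carrier N)"
    by (rule bij_betwI[where g = g]) (use assms mod_homD(1) in \<open>auto simp: Pi_iff\<close>)
  then show ?thesis using assms(1) by (auto simp: mod_iso_def)
qed

section \<open>Finite-dimensional modules\<close>

text \<open>Linear combinations built up one term at a time, with repetitions allowed. This replaces
  the sums with chosen coefficients in \<open>fd_module\<close> by something that supports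
  induction; \<open>fd_module_iff\<close> compares the two.\<close>

inductive_set kspan :: "('k, 'e) kalg \<Rightarrow> ('e, 'm) module \<Rightarrow> 'm set \<Rightarrow> 'm set"
  for A M B where
  zero: "\<zero>\<^bsub>M\<^esub> \<in> kspan A M B"
| step: "\<lbrakk>b \<in> B; x \<in> kspan A M B\<rbrakk> \<Longrightarrow> scal A c \<odot>\<^bsub>M\<^esub> b \<oplus>\<^bsub>M\<^esub> x \<in> kspan A M B"

lemma kspan_mono: "x \<in> kspan A M B \<Longrightarrow> B \<subseteq> C \<Longrightarrow> x \<in> kspan A M C"
  by (induct rule: kspan.induct) (auto intro: kspan.intros)

context kalgebra
begin

lemma scal_zero [simp]: "scal A 0 = \<zero>"
  using scal_add[of 0 0] by (metis add.r_cancel_one' scal_closed add_0)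

lemma kspan_closed:
  assumes "right_module A M" "B \<subseteq> carrier M" "x \<in> kspan A M B"
  shows "x \<in> carrier M"
proof -
  interpret M: right_module A M by fact
  show ?thesis using assms(3) by induct (use assms(2) M.act_closed in auto)
qed

lemma kspan_add:
  assumes "right_module A M" "B \<subseteq> carrier M" "x \<in> kspan A M B" "y \<in> kspan A M B"
  shows "x \<oplus>\<^bsub>M\<^esub> y \<in> kspan A M B"
proof -
  interpret M: right_module A M by fact
  note cl = kspan_closed[OF assms(1,2)]
  show ?thesis using assms(3)
  proof induct
    case zero
    then show ?case using assms(4) cl by simp
  next
    case (step b x c)
    then show ?case
      using assms(2) cl assms(4) M.act_closed kspan.step[OF step(1) step(3), of c]
      by (subst M.a_assoc) auto
  qed
qed

lemma kspan_scal:
  assumes "right_module A M" "B \<subseteq> carrier M" "x \<in> kspan A M B"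
  shows "scal A c \<odot>\<^bsub>M\<^esub> x \<in> kspan A M B"
proof -
  interpret M: right_module A M by fact
  note cl = kspan_closed[OF assms(1,2)]
  show ?thesis using assms(3)
  proof induct
    case zero
    then show ?case by (simp add: kspan.zero)
  next
    case (step b x d)
    have "scal A c \<odot>\<^bsub>M\<^esub> (scal A d \<odot>\<^bsub>M\<^esub> b \<oplus>\<^bsub>M\<^esub> x) = scal A (d * c) \<odot>\<^bsub>M\<^esub> b \<oplus>\<^bsub>M\<^esub> scal A c \<odot>\<^bsub>M\<^esub> x"
      using step assms(2) cl M.act_closed
      by (simp add: M.act_add_right scal_mult M.act_mult subset_eq)
    then show ?case using step kspan.step[OF step(1,3)] by simp
  qed
qed

lemma kspan_base:
  assumes "right_module A M" "B \<subseteq> carrier M" "b \<in> B"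
  shows "b \<in> kspan A M B"
proof -
  interpret M: right_module A M by fact
  show ?thesis
    using kspan.step[where A = A and M = M and B = B and c = 1, OF assms(3) kspan.zero] assms(2,3)
    by (simp add: scal_one M.act_one subset_eq)
qed

lemma kspan_finsum:
  assumes "right_module A M" "B \<subseteq> carrier M" "finite S" "\<And>i. i \<in> S \<Longrightarrow> f i \<in> kspan A M B"
  shows "(\<Oplus>\<^bsub>M\<^esub>i\<in>S. f i) \<in> kspan A M B"
proof -
  interpret M: right_module A M by fact
  show ?thesis
    using assms(3,4)
  proof (induct set: finite)
    case empty
    then show ?case by (simp add: kspan.zero)
  next
    case (insert i S)
    then have "f \<in> S \<rightarrow> carrier M" "f i \<in> carrier M"
      using kspan_closed[OF assms(1,2)] by auto
    then show ?case using insert by (simp add: kspan_add[OF assms(1,2)])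
  qed
qed

lemma kspan_imp_finsum:
  assumes "right_module A M" "B \<subseteq> carrier M" "finite B" "x \<in> kspan A M B"
  shows "\<exists>c. x = (\<Oplus>\<^bsub>M\<^esub>b\<in>B. scal A (c b) \<odot>\<^bsub>M\<^esub> b)"
proof -
  interpret M: right_module A M by fact
  have act: "(\<lambda>b. scal A (c b) \<odot>\<^bsub>M\<^esub> b) \<in> B \<rightarrow> carrier M" for c
    using assms(2) M.act_closed by auto
  show ?thesis
    using assms(4)
  proof induct
    case zero
    have "(\<Oplus>\<^bsub>M\<^esub>b\<in>B. scal A 0 \<odot>\<^bsub>M\<^esub> b) = (\<Oplus>\<^bsub>M\<^esub>b\<in>B. \<zero>\<^bsub>M\<^esub>)"
      using assms(2) by (intro M.finsum_cong') (auto simp: scal_zero)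
    then show ?case by (intro exI[of _ "\<lambda>_. 0"]) simp
  next
    case (step b x d)
    then obtain c where c: "x = (\<Oplus>\<^bsub>M\<^esub>b\<in>B. scal A (c b) \<odot>\<^bsub>M\<^esub> b)" by blast
    \<comment> \<open>The vector b may already occur in x, so the new term is absorbed into its
      coefficient.\<close>
    let ?c = "c(b := d + c b)"
    have B: "B = insert b (B - {b})" using step by auto
    have b: "b \<in> carrier M" using step assms(2) by auto
    have split: "(\<Oplus>\<^bsub>M\<^esub>b\<in>B. scal A (c b) \<odot>\<^bsub>M\<^esub> b) =
        scal A (c b) \<odot>\<^bsub>M\<^esub> b \<oplus>\<^bsub>M\<^esub> (\<Oplus>\<^bsub>M\<^esub>b\<in>B - {b}. scal A (c b) \<odot>\<^bsub>M\<^esub> b)" for c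
      by (subst B, subst M.finsum_insert)
        (use assms(2,3) step(1) M.act_closed in \<open>auto\<close>)
    have rest: "(\<Oplus>\<^bsub>M\<^esub>b\<in>B - {b}. scal A (c b) \<odot>\<^bsub>M\<^esub> b) = (\<Oplus>\<^bsub>M\<^esub>b\<in>B - {b}. scal A (?c b) \<odot>\<^bsub>M\<^esub> b)"
      by (rule M.finsum_cong') (use assms(2) M.act_closed in auto)
    have cl: "(\<Oplus>\<^bsub>M\<^esub>b\<in>B - {b}. scal A (?c b) \<odot>\<^bsub>M\<^esub> b) \<in> carrier M"
      by (rule M.finsum_closed) (use assms(2) M.act_closed in auto)
    show ?case
      unfolding c
      by (rule exI[of _ ?c])
        (use b cl in \<open>simp only: split rest fun_upd_same, simp add: scal_add M.act_add_left M.act_closed M.a_assoc\<close>)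
  qed
qed

lemma fd_module_iff:
  "fd_module A M \<longleftrightarrow>
    right_module A M \<and> (\<exists>B. finite B \<and> B \<subseteq> carrier M \<and> carrier M \<subseteq> kspan A M B)"
proof (cases "right_module A M")
  case True
  interpret M: right_module A M by fact
  have "(\<forall>x\<in>carrier M. \<exists>c. x = (\<Oplus>\<^bsub>M\<^esub>b\<in>B. scal A (c b) \<odot>\<^bsub>M\<^esub> b)) \<longleftrightarrow> carrier M \<subseteq> kspan A M B"
    if B: "finite B" "B \<subseteq> carrier M" for B
  proof
    assume *: "\<forall>x\<in>carrier M. \<exists>c. x = (\<Oplus>\<^bsub>M\<^esub>b\<in>B. scal A (c b) \<odot>\<^bsub>M\<^esub> b)"
    show "carrier M \<subseteq> kspan A M B"
    proof
      fix x assume "x \<in> carrier M"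
      then obtain c where x: "x = (\<Oplus>\<^bsub>M\<^esub>b\<in>B. scal A (c b) \<odot>\<^bsub>M\<^esub> b)" using * by blast
      show "x \<in> kspan A M B"
        unfolding x using B
        by (intro kspan_finsum[OF True]) (auto intro: kspan_scal[OF True] kspan_base[OF True])
    qed
  next
    assume "carrier M \<subseteq> kspan A M B"
    then show "\<forall>x\<in>carrier M. \<exists>c. x = (\<Oplus>\<^bsub>M\<^esub>b\<in>B. scal A (c b) \<odot>\<^bsub>M\<^esub> b)"
      using kspan_imp_finsum[OF True B(2,1)] by blast
  qed
  then show ?thesis unfolding fd_module_def using True by blast
next
  case False
  then show ?thesis by (simp add: fd_module_def)
qed

lemma fd_right_module: "fd_module A M \<Longrightarrow> right_module A M"
  by (simp add: fd_module_def)

lemma fd_moduleE: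
  assumes "fd_module A M"
  obtains B where "finite B" "B \<subseteq> carrier M" "carrier M \<subseteq> kspan A M B"
  using assms unfolding fd_module_iff by blast

lemma fd_moduleI:
  "\<lbrakk>right_module A M; finite B; B \<subseteq> carrier M; carrier M \<subseteq> kspan A M B\<rbrakk> \<Longrightarrow> fd_module A M"
  unfolding fd_module_iff by blast

lemma kspan_image:
  assumes "right_module A M" "right_module A N" "f \<in> mod_hom A M N" "B \<subseteq> carrier M" "x \<in> kspan A M B"
  shows "f x \<in> kspan A N (f ` B)"
  using assms(5)
proof induct
  case zero
  then show ?case by (simp add: mod_hom_zero[OF assms(1-3)] kspan.zero)
next
  case (step b x c)
  interpret M: right_module A M by fact
  have "f (scal A c \<odot>\<^bsub>M\<^esub> b \<oplus>\<^bsub>M\<^esub> x) = scal A c \<odot>\<^bsub>N\<^esub> f b \<oplus>\<^bsub>N\<^esub> f x"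
    using step assms(4) kspan_closed[OF assms(1,4)]
    by (simp add: mod_homD(2,3)[OF assms(3)] M.act_closed subset_eq)
  then show ?case using step by (simp add: kspan.step)
qed

lemma fd_module_image:
  assumes "fd_module A M" "right_module A N" "f \<in> mod_hom A M N" "f ` carrier M = carrier N"
  shows "fd_module A N"
proof -
  obtain B where B: "finite B" "B \<subseteq> carrier M" "carrier M \<subseteq> kspan A M B"
    using assms(1) by (rule fd_moduleE)
  have "carrier N \<subseteq> kspan A N (f ` B)"
  proof
    fix y assume "y \<in> carrier N"
    then obtain x where x: "x \<in> carrier M" "y = f x" using assms(4) by (metis imageE)
    then have "x \<in> kspan A M B" using B(3) by auto
    then show "y \<in> kspan A N (f ` B)"
      unfolding x(2) by (rule kspan_image[OF fd_right_module[OF assms(1)] assms(2,3) B(2)])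
  qed
  moreover have "f ` B \<subseteq> carrier N" using image_mono[OF B(2), of f] assms(4) by simp
  ultimately show ?thesis using B(1) assms(2) by (intro fd_moduleI[of N "f ` B"]) auto
qed

lemma fd_module_iso: "\<lbrakk>fd_module A M; right_module A N; mod_iso A M N\<rbrakk> \<Longrightarrow> fd_module A N"
  by (auto simp: mod_iso_def bij_betw_def intro: fd_module_image)

text \<open>Gaussian elimination, by induction on the spanning set. If some h in H involves the new
  vector b, multiples of h clear the b-coefficient of every other element of H; what remains lies in
  the span of the smaller set, where the induction hypothesis applies. This makes submodules of
  finite-dimensional modules finite-dimensional.\<close>

lemma finite_kspan_subspace:
  assumes "right_module A M" "finite B" "B \<subseteq> carrier M"
  shows "\<And>H. \<lbrakk>\<zero>\<^bsub>M\<^esub> \<in> H; H \<subseteq> kspan A M B;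
      \<And>x y. \<lbrakk>x \<in> H; y \<in> H\<rbrakk> \<Longrightarrow> x \<oplus>\<^bsub>M\<^esub> y \<in> H; \<And>c x. x \<in> H \<Longrightarrow> scal A c \<odot>\<^bsub>M\<^esub> x \<in> H\<rbrakk> \<Longrightarrow>
    \<exists>C. finite C \<and> C \<subseteq> H \<and> H \<subseteq> kspan A M C"
  using assms(2,3)
proof (induct set: finite)
  case empty
  have "x = \<zero>\<^bsub>M\<^esub>" if "x \<in> kspan A M {}" for x
    using that by induct auto
  then show ?case using empty by (intro exI[of _ "{}"]) (auto intro: kspan.zero)
next
  case (insert b B)
  interpret M: right_module A M by fact
  have b: "b \<in> carrier M" and B: "B \<subseteq> carrier M" using insert by auto
  note B_ops = kspan_closed[OF assms(1) B] kspan_add[OF assms(1) B] kspan_scal[OF assms(1) B]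
  \<comment> \<open>Splits off the coefficient of the new vector b.\<close>
  have dec: "\<exists>c. \<exists>y\<in>kspan A M B. x = scal A c \<odot>\<^bsub>M\<^esub> b \<oplus>\<^bsub>M\<^esub> y" if "x \<in> kspan A M (insert b B)" for x
    using that
  proof induct
    case zero
    then show ?case using b scal_zero by (intro exI[of _ 0] bexI[of _ "\<zero>\<^bsub>M\<^esub>"]) (auto intro: kspan.zero)
  next
    case (step b' x d)
    then obtain c y where x: "y \<in> kspan A M B" "x = scal A c \<odot>\<^bsub>M\<^esub> b \<oplus>\<^bsub>M\<^esub> y" by blast
    show ?case
    proof (cases "b' = b")
      case True
      show ?thesis
        by (rule exI[of _ "d + c"], rule bexI[of _ y])
          (use x b B_ops True in \<open>auto simp: scal_add M.act_add_left M.act_closed M.a_assoc\<close>)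
    next
      case False
      then have "b' \<in> B" using step by auto
      then show ?thesis
        by (intro exI[of _ c] bexI[of _ "scal A d \<odot>\<^bsub>M\<^esub> b' \<oplus>\<^bsub>M\<^esub> y"])
          (use x b B B_ops in \<open>auto simp: M.act_closed M.a_lcomm subset_eq intro: kspan.step\<close>)
    qed
  qed
  let ?H = "H \<inter> kspan A M B"
  have "\<exists>C. finite C \<and> C \<subseteq> ?H \<and> ?H \<subseteq> kspan A M C"
    by (rule insert(3)) (use insert B_ops in \<open>auto intro: kspan.zero\<close>)
  then obtain C where C: "finite C" "C \<subseteq> ?H" "?H \<subseteq> kspan A M C" by blast
  show ?case
  proof (cases "H \<subseteq> kspan A M B")
    case True
    then show ?thesis using C by (intro exI[of _ C]) auto
  next
    case False
    then obtain h where h: "h \<in> H" "h \<notin> kspan A M B" by blast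
    then obtain c y where cy: "y \<in> kspan A M B" "h = scal A c \<odot>\<^bsub>M\<^esub> b \<oplus>\<^bsub>M\<^esub> y"
      using dec insert(5) by blast
    note s0 = scal_zero
    have "c \<noteq> 0" using cy h b B_ops s0 by auto
    have Hc: "H \<subseteq> carrier M"
      using insert(5) kspan_closed[OF assms(1) insert(8)] by blast
    then have hc: "h \<in> carrier M" using h by blast
    have hh: "scal A u \<odot>\<^bsub>M\<^esub> h \<oplus>\<^bsub>M\<^esub> scal A v \<odot>\<^bsub>M\<^esub> h = scal A (u + v) \<odot>\<^bsub>M\<^esub> h" for u v
      using hc by (simp add: scal_add M.act_add_left)
    have "H \<subseteq> kspan A M (insert h C)"
    proof
      fix x assume x: "x \<in> H"
      then obtain d z where dz: "z \<in> kspan A M B" "x = scal A d \<odot>\<^bsub>M\<^esub> b \<oplus>\<^bsub>M\<^esub> z"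
        using dec insert(5) by blast
      \<comment> \<open>Chosen so that the b-coefficients \<open>c * ?e\<close> and d cancel; c is
        non-zero because h does not lie in the span of B.\<close>
      let ?e = "- (d / c)"
      let ?x' = "scal A ?e \<odot>\<^bsub>M\<^esub> h \<oplus>\<^bsub>M\<^esub> x"
      have zc: "z \<in> carrier M" "y \<in> carrier M" using dz cy B_ops by auto
      have bb: "scal A u \<odot>\<^bsub>M\<^esub> b \<oplus>\<^bsub>M\<^esub> scal A v \<odot>\<^bsub>M\<^esub> b = scal A (u + v) \<odot>\<^bsub>M\<^esub> b" for u v
        using b by (simp add: scal_add M.act_add_left)
      have "scal A ?e \<odot>\<^bsub>M\<^esub> h = scal A (c * ?e) \<odot>\<^bsub>M\<^esub> b \<oplus>\<^bsub>M\<^esub> scal A ?e \<odot>\<^bsub>M\<^esub> y"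
        using cy b zc by (simp add: M.act_add_right M.act_closed scal_mult M.act_mult del: mult_minus_right times_divide_eq_right)
      then have "?x' = (scal A (c * ?e) \<odot>\<^bsub>M\<^esub> b \<oplus>\<^bsub>M\<^esub> scal A d \<odot>\<^bsub>M\<^esub> b) \<oplus>\<^bsub>M\<^esub> (scal A ?e \<odot>\<^bsub>M\<^esub> y \<oplus>\<^bsub>M\<^esub> z)"
        using dz zc b by (simp add: M.act_closed M.a_ac del: mult_minus_right times_divide_eq_right)
      also have "\<dots> = scal A ?e \<odot>\<^bsub>M\<^esub> y \<oplus>\<^bsub>M\<^esub> z"
        using \<open>c \<noteq> 0\<close> b zc s0 by (simp add: bb M.act_closed)
      finally have "?x' \<in> kspan A M B" using B_ops cy dz by simp
      moreover have "?x' \<in> H" using insert(6,7) x h by simp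
      ultimately have "?x' \<in> kspan A M (insert h C)" using C(3) kspan_mono[of ?x' A M C] by blast
      from kspan.step[OF insertI1 this, of "d / c"]
      have "scal A (d / c) \<odot>\<^bsub>M\<^esub> h \<oplus>\<^bsub>M\<^esub> ?x' \<in> kspan A M (insert h C)" .
      moreover have "scal A (d / c) \<odot>\<^bsub>M\<^esub> h \<oplus>\<^bsub>M\<^esub> ?x' = x"
      proof -
        have "scal A (d / c) \<odot>\<^bsub>M\<^esub> h \<oplus>\<^bsub>M\<^esub> ?x' = (scal A (d / c) \<odot>\<^bsub>M\<^esub> h \<oplus>\<^bsub>M\<^esub> scal A ?e \<odot>\<^bsub>M\<^esub> h) \<oplus>\<^bsub>M\<^esub> x"
          using h x Hc by (simp add: M.a_assoc M.act_closed subset_eq)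
        also have "scal A (d / c) \<odot>\<^bsub>M\<^esub> h \<oplus>\<^bsub>M\<^esub> scal A ?e \<odot>\<^bsub>M\<^esub> h = \<zero>\<^bsub>M\<^esub>"
          using hh[of "d / c" ?e] hc by simp
        also have "\<zero>\<^bsub>M\<^esub> \<oplus>\<^bsub>M\<^esub> x = x" using x Hc by auto
        finally show ?thesis .
      qed
      ultimately show "x \<in> kspan A M (insert h C)" by simp
    qed
    then show ?thesis using C h by (intro exI[of _ "insert h C"]) auto
  qed
qed

lemma kspan_submod: "kspan A (submod M H) B = kspan A M B"
proof
  show "kspan A (submod M H) B \<subseteq> kspan A M B"
  proof
    fix x assume "x \<in> kspan A (submod M H) B"
    then show "x \<in> kspan A M B"
      by induct (auto intro: kspan.zero kspan.step)
  qed
  show "kspan A M B \<subseteq> kspan A (submod M H) B"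
  proof
    fix x assume "x \<in> kspan A M B"
    then show "x \<in> kspan A (submod M H) B"
    proof induct
      case zero
      show ?case using kspan.zero[where A = A and M = "submod M H" and B = B] by simp
    next
      case (step b x c)
      then show ?case using kspan.step[where A = A and M = "submod M H" and B = B and b = b and x = x and c = c] by simp
    qed
  qed
qed

lemma fd_module_submod:
  assumes "fd_module A M" "submodule H A M"
  shows "fd_module A (submod M H)"
proof -
  interpret M: right_module A M using assms(1) by (rule fd_right_module)
  obtain B where B: "finite B" "B \<subseteq> carrier M" "carrier M \<subseteq> kspan A M B"
    using assms(1) by (rule fd_moduleE)
  note H = M.submodule_closed[OF assms(2)]
  have "\<exists>C. finite C \<and> C \<subseteq> H \<and> H \<subseteq> kspan A M C"
    by (rule finite_kspan_subspace[OF M.right_module_axioms B(1,2)]) (use H B in auto)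
  then obtain C where "finite C" "C \<subseteq> H" "H \<subseteq> kspan A M C" by blast
  then show ?thesis
    using right_module_submod[OF M.right_module_axioms assms(2)]
    by (intro fd_moduleI[of _ C]) (auto simp: kspan_submod)
qed

lemma fd_module_zero_mod: "fd_module A M \<Longrightarrow> fd_module A (zero_mod M)"
  unfolding zero_mod_def
  by (intro fd_module_submod right_module.submodule_zero fd_right_module)

lemma mod_hom_fst: "fst \<in> mod_hom A (dprod M N) M"
  and mod_hom_snd: "snd \<in> mod_hom A (dprod M N) N"
  by (auto intro!: mod_homI)

lemma mod_hom_Pair:
  "\<lbrakk>f \<in> mod_hom A L M; g \<in> mod_hom A L N\<rbrakk> \<Longrightarrow> (\<lambda>x. (f x, g x)) \<in> mod_hom A L (dprod M N)"
  by (auto simp: mod_hom_def Pi_iff)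

lemma mod_hom_inl:
  assumes "right_module A N" shows "(\<lambda>x. (x, \<zero>\<^bsub>N\<^esub>)) \<in> mod_hom A M (dprod M N)"
  by (intro mod_hom_Pair mod_hom_const_zero assms) simp

lemma mod_hom_inr:
  assumes "right_module A M" shows "(\<lambda>y. (\<zero>\<^bsub>M\<^esub>, y)) \<in> mod_hom A N (dprod M N)"
  by (intro mod_hom_Pair mod_hom_const_zero assms) simp

lemma fd_module_dprod:
  assumes "fd_module A M" "fd_module A N"
  shows "fd_module A (dprod M N)"
proof -
  interpret M: right_module A M using assms(1) by (rule fd_right_module)
  interpret N: right_module A N using assms(2) by (rule fd_right_module)
  note rm = M.right_module_axioms N.right_module_axioms
  note rp = right_module_dprod[OF rm]
  obtain B C where B: "finite B" "B \<subseteq> carrier M" "carrier M \<subseteq> kspan A M B"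
    and C: "finite C" "C \<subseteq> carrier N" "carrier N \<subseteq> kspan A N C"
    using assms by (metis fd_moduleE)
  let ?i = "\<lambda>x. (x, \<zero>\<^bsub>N\<^esub>)" and ?j = "\<lambda>y. (\<zero>\<^bsub>M\<^esub>, y)"
  let ?D = "?i ` B \<union> ?j ` C"
  have D: "?D \<subseteq> carrier (dprod M N)" using B C by auto
  have "(x, y) \<in> kspan A (dprod M N) ?D" if xy: "x \<in> carrier M" "y \<in> carrier N" for x y
  proof -
    have "?i x \<in> kspan A (dprod M N) ?D"
      using kspan_image[OF rm(1) rp mod_hom_inl[OF rm(2)] B(2), of x] B(3) xy
      by (auto intro: kspan_mono)
    moreover have "?j y \<in> kspan A (dprod M N) ?D"
      using kspan_image[OF rm(2) rp mod_hom_inr[OF rm(1)] C(2), of y] C(3) xy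
      by (auto intro: kspan_mono)
    ultimately show ?thesis
      using kspan_add[OF rp D, of "?i x" "?j y"] xy by simp
  qed
  then show ?thesis using B C D by (intro fd_moduleI[OF rp _ D]) auto
qed

end

section \<open>Finite direct sums and their inclusions and projections\<close>

definition dinj :: "'j set \<Rightarrow> ('j \<Rightarrow> ('e, 'm) module) \<Rightarrow> 'j \<Rightarrow> 'm \<Rightarrow> 'j \<Rightarrow> 'm" where
  "dinj J M j x = (\<lambda>i\<in>J. if i = j then x else \<zero>\<^bsub>M i\<^esub>)"

lemma mod_hom_proj: "j \<in> J \<Longrightarrow> (\<lambda>x. x j) \<in> mod_hom A (dsum J M) (M j)"
  by (auto intro!: mod_homI)

lemma mod_hom_dinj:
  assumes "\<And>j. j \<in> J \<Longrightarrow> right_module A (M j)" "j \<in> J"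
  shows "dinj J M j \<in> mod_hom A (M j) (dsum J M)"
proof -
  have z: "\<zero>\<^bsub>M i\<^esub> \<in> carrier (M i)" "\<zero>\<^bsub>M i\<^esub> \<oplus>\<^bsub>M i\<^esub> \<zero>\<^bsub>M i\<^esub> = \<zero>\<^bsub>M i\<^esub>"
    "\<And>a. a \<in> carrier A \<Longrightarrow> a \<odot>\<^bsub>M i\<^esub> \<zero>\<^bsub>M i\<^esub> = \<zero>\<^bsub>M i\<^esub>" if "i \<in> J" for i
  proof -
    interpret right_module A "M i" using assms(1) that by blast
    show "\<zero>\<^bsub>M i\<^esub> \<in> carrier (M i)" "\<zero>\<^bsub>M i\<^esub> \<oplus>\<^bsub>M i\<^esub> \<zero>\<^bsub>M i\<^esub> = \<zero>\<^bsub>M i\<^esub>"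
      "\<And>a. a \<in> carrier A \<Longrightarrow> a \<odot>\<^bsub>M i\<^esub> \<zero>\<^bsub>M i\<^esub> = \<zero>\<^bsub>M i\<^esub>" by auto
  qed
  show ?thesis
    by (rule mod_homI) (use assms(2) in \<open>auto simp: dinj_def z intro!: restrict_ext\<close>)
qed

lemma mod_hom_tuple:
  "(\<And>j. j \<in> J \<Longrightarrow> f j \<in> mod_hom A M (N j)) \<Longrightarrow> (\<lambda>x. \<lambda>j\<in>J. f j x) \<in> mod_hom A M (dsum J N)"
  by (auto simp: mod_hom_def Pi_iff intro!: restrict_ext)

lemma mod_hom_finsum_fun:
  assumes "right_module A N" "finite J" "\<And>j. j \<in> J \<Longrightarrow> f j \<in> mod_hom A M N"
  shows "(\<lambda>x. \<Oplus>\<^bsub>N\<^esub>j\<in>J. f j x) \<in> mod_hom A M N"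
proof -
  interpret N: right_module A N by fact
  have cl: "(\<lambda>j. f j x) \<in> J \<rightarrow> carrier N" if "x \<in> carrier M" for x
    using mod_homD(1)[OF assms(3)] that by auto
  show ?thesis
  proof (rule mod_homI)
    fix x y assume xy: "x \<in> carrier M" "y \<in> carrier M"
    show "(\<Oplus>\<^bsub>N\<^esub>j\<in>J. f j (x \<oplus>\<^bsub>M\<^esub> y)) = (\<Oplus>\<^bsub>N\<^esub>j\<in>J. f j x) \<oplus>\<^bsub>N\<^esub> (\<Oplus>\<^bsub>N\<^esub>j\<in>J. f j y)"
      unfolding N.finsum_addf[OF cl[OF xy(1)] cl[OF xy(2)], symmetric]
      by (rule N.finsum_cong') (use cl xy mod_homD(2)[OF assms(3) xy] in auto)
  next
    fix a x assume ax: "a \<in> carrier A" "x \<in> carrier M"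
    show "(\<Oplus>\<^bsub>N\<^esub>j\<in>J. f j (a \<odot>\<^bsub>M\<^esub> x)) = a \<odot>\<^bsub>N\<^esub> (\<Oplus>\<^bsub>N\<^esub>j\<in>J. f j x)"
      using cl[OF ax(2)] mod_homD(3)[OF assms(3) ax] ax N.act_closed
      by (subst N.act_finsum_right[OF assms(2)]) (auto intro!: N.finsum_cong')
  qed (use N.finsum_closed cl in auto)
qed

lemma dsum_decomp:
  fixes A :: "('k, 'e) kalg"
  assumes "ring A" "\<And>j. j \<in> J \<Longrightarrow> right_module A (M j)" "finite J" "x \<in> carrier (dsum J M)"
  shows "x = (\<Oplus>\<^bsub>dsum J M\<^esub>j\<in>J. dinj J M j (x j))"
proof -
  interpret D: right_module A "dsum J M" by (rule right_module_dsum) (use assms in auto)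
  note inj = mod_homD(1)[OF mod_hom_dinj[where J = J and M = M and A = A, OF assms(2)]]
  have cl: "(\<lambda>j. dinj J M j (x j)) \<in> J \<rightarrow> carrier (dsum J M)"
    using assms(4) inj by (auto simp: PiE_iff)
  have "(\<Oplus>\<^bsub>dsum J M\<^esub>j\<in>J. dinj J M j (x j)) i = x i" if i: "i \<in> J" for i
  proof -
    interpret Mi: right_module A "M i" by (rule assms(2)[OF i])
    have "(\<Oplus>\<^bsub>dsum J M\<^esub>j\<in>J. dinj J M j (x j)) i = (\<Oplus>\<^bsub>M i\<^esub>j\<in>J. dinj J M j (x j) i)"
      by (rule mod_hom_finsum[OF D.right_module_axioms Mi.right_module_axioms mod_hom_proj[OF i] assms(3) cl])
    also have "\<dots> = (\<Oplus>\<^bsub>M i\<^esub>j\<in>J. if i = j then x j else \<zero>\<^bsub>M i\<^esub>)"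
      by (rule Mi.finsum_cong') (use i assms(4) in \<open>auto simp: dinj_def PiE_iff\<close>)
    also have "\<dots> = (\<Oplus>\<^bsub>M i\<^esub>j\<in>J. if i = j then x i else \<zero>\<^bsub>M i\<^esub>)"
      by (rule Mi.finsum_cong') (use i assms(4) in \<open>auto simp: PiE_iff\<close>)
    also have "\<dots> = x i"
      by (rule Mi.finsum_singleton[where f = "\<lambda>_. x i"]) (use i assms(3,4) in \<open>auto simp: PiE_iff\<close>)
    finally show ?thesis .
  qed
  moreover have "(\<Oplus>\<^bsub>dsum J M\<^esub>j\<in>J. dinj J M j (x j)) \<in> carrier (dsum J M)"
    by (rule D.finsum_closed[OF cl])
  ultimately show ?thesis using assms(4) by (intro PiE_ext[where k = J]) auto
qed

context kalgebra
begin

lemma fd_module_dsum: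
  assumes "finite J" "\<And>j. j \<in> J \<Longrightarrow> fd_module A (M j)"
  shows "fd_module A (dsum J M)"
proof -
  have rm: "right_module A (M j)" if "j \<in> J" for j
    using assms(2) that by (simp add: fd_right_module)
  have rD: "right_module A (dsum J M)" by (rule right_module_dsum) (auto simp: rm ring_axioms)
  have "\<forall>j\<in>J. \<exists>B. finite B \<and> B \<subseteq> carrier (M j) \<and> carrier (M j) \<subseteq> kspan A (M j) B"
    using assms(2) unfolding fd_module_iff by blast
  then obtain B where B: "\<And>j. j \<in> J \<Longrightarrow> finite (B j)" "\<And>j. j \<in> J \<Longrightarrow> B j \<subseteq> carrier (M j)"
    "\<And>j. j \<in> J \<Longrightarrow> carrier (M j) \<subseteq> kspan A (M j) (B j)"
    by metis
  note inj = mod_hom_dinj[where J = J and M = M and A = A, OF rm]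
  let ?B = "\<Union>j\<in>J. dinj J M j ` B j"
  have Bc: "?B \<subseteq> carrier (dsum J M)"
    using mod_homD(1)[OF inj] B(2) by blast
  have "x \<in> kspan A (dsum J M) ?B" if x: "x \<in> carrier (dsum J M)" for x
  proof -
    have "dinj J M j (x j) \<in> kspan A (dsum J M) ?B" if j: "j \<in> J" for j
    proof -
      have "x j \<in> kspan A (M j) (B j)" using B(3)[OF j] x j by (auto simp: PiE_iff)
      then have "dinj J M j (x j) \<in> kspan A (dsum J M) (dinj J M j ` B j)"
        using kspan_image[OF rm[OF j] rD inj[OF _ j] B(2)[OF j]] j by simp
      then show ?thesis by (rule kspan_mono) (use j in auto)
    qed
    then have "(\<Oplus>\<^bsub>dsum J M\<^esub>j\<in>J. dinj J M j (x j)) \<in> kspan A (dsum J M) ?B"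
      by (intro kspan_finsum[OF rD Bc assms(1)])
    then show ?thesis
      using dsum_decomp[OF ring_axioms rm assms(1) x] by simp
  qed
  then show ?thesis
    using assms(1) B(1) by (intro fd_moduleI[OF rD _ Bc]) auto
qed

end

text \<open>Meant for f injective on the carrier. It moves a module to the type
  \<open>'k vec\<close>, over which the definitions of projectivity, resolutions and roofs
  quantify.\<close>

definition transport :: "('m \<Rightarrow> 'n) \<Rightarrow> ('e, 'm) module \<Rightarrow> ('e, 'n) module" where
  "transport f M = (let g = inv_into (carrier M) f in
    \<lparr>carrier = f ` carrier M, mult = undefined, one = undefined, zero = f \<zero>\<^bsub>M\<^esub>,
     add = (\<lambda>x y. f (g x \<oplus>\<^bsub>M\<^esub> g y)), smult = (\<lambda>a x. f (a \<odot>\<^bsub>M\<^esub> g x))\<rparr>)"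

lemma transport_simps:
  assumes "inj_on f (carrier M)"
  shows "carrier (transport f M) = f ` carrier M" "zero (transport f M) = f \<zero>\<^bsub>M\<^esub>"
    "\<lbrakk>x \<in> carrier M; y \<in> carrier M\<rbrakk> \<Longrightarrow> f x \<oplus>\<^bsub>transport f M\<^esub> f y = f (x \<oplus>\<^bsub>M\<^esub> y)"
    "x \<in> carrier M \<Longrightarrow> a \<odot>\<^bsub>transport f M\<^esub> f x = f (a \<odot>\<^bsub>M\<^esub> x)"
  using assms by (simp_all add: transport_def Let_def)

lemma right_module_transport:
  assumes "right_module A M" "inj_on f (carrier M)"
  shows "right_module A (transport f M)" "f \<in> mod_hom A M (transport f M)"
    "bij_betw f (carrier M) (carrier (transport f M))"
proof -
  interpret M: right_module A M by fact
  note t = transport_simps[OF assms(2)]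
  show "f \<in> mod_hom A M (transport f M)" by (rule mod_homI) (simp_all add: t)
  show "bij_betw f (carrier M) (carrier (transport f M))"
    using assms(2) by (simp add: bij_betw_def t(1))
  let ?N = "transport f M"
  have ex: "\<exists>x'\<in>carrier M. x = f x'" if "x \<in> carrier ?N" for x
    using that by (auto simp: t(1))
  have cl: "f x \<in> carrier ?N" if "x \<in> carrier M" for x
    using that by (simp add: t(1))
  show "right_module A ?N"
  proof (rule right_moduleI)
    fix x y z assume "x \<in> carrier ?N" "y \<in> carrier ?N" "z \<in> carrier ?N"
    then obtain x' y' z' where "x' \<in> carrier M" "x = f x'" "y' \<in> carrier M" "y = f y'"
      "z' \<in> carrier M" "z = f z'"
      using ex by meson
    then show "(x \<oplus>\<^bsub>?N\<^esub> y) \<oplus>\<^bsub>?N\<^esub> z = x \<oplus>\<^bsub>?N\<^esub> (y \<oplus>\<^bsub>?N\<^esub> z)"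
      by (simp add: t(3) M.a_assoc)
  next
    fix x y assume "x \<in> carrier ?N" "y \<in> carrier ?N"
    then obtain x' y' where xy: "x' \<in> carrier M" "x = f x'" "y' \<in> carrier M" "y = f y'"
      using ex by meson
    then show "x \<oplus>\<^bsub>?N\<^esub> y \<in> carrier ?N" by (simp add: t(3) cl)
    show "x \<oplus>\<^bsub>?N\<^esub> y = y \<oplus>\<^bsub>?N\<^esub> x" using xy by (simp add: t(3) M.a_comm)
    fix a assume "a \<in> carrier A"
    then show "a \<odot>\<^bsub>?N\<^esub> (x \<oplus>\<^bsub>?N\<^esub> y) = a \<odot>\<^bsub>?N\<^esub> x \<oplus>\<^bsub>?N\<^esub> a \<odot>\<^bsub>?N\<^esub> y"
      using xy by (simp add: t(3,4) M.act_closed M.act_add_right)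
  next
    fix x assume "x \<in> carrier ?N"
    then obtain x' where x: "x' \<in> carrier M" "x = f x'"
      using ex by meson
    then show "\<zero>\<^bsub>?N\<^esub> \<oplus>\<^bsub>?N\<^esub> x = x" by (simp add: t(2,3))
    show "\<exists>y\<in>carrier ?N. y \<oplus>\<^bsub>?N\<^esub> x = \<zero>\<^bsub>?N\<^esub>"
      using x by (intro bexI[of _ "f (\<ominus>\<^bsub>M\<^esub> x')"]) (simp_all add: t(2,3) cl M.l_neg)
    show "\<one>\<^bsub>A\<^esub> \<odot>\<^bsub>?N\<^esub> x = x" using x by (simp add: t(4) M.act_one)
    fix a assume a: "a \<in> carrier A"
    show "a \<odot>\<^bsub>?N\<^esub> x \<in> carrier ?N" using a x by (simp add: t(4) cl M.act_closed)
    fix b assume "b \<in> carrier A"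
    then show "(a \<oplus>\<^bsub>A\<^esub> b) \<odot>\<^bsub>?N\<^esub> x = a \<odot>\<^bsub>?N\<^esub> x \<oplus>\<^bsub>?N\<^esub> b \<odot>\<^bsub>?N\<^esub> x"
      "(a \<otimes>\<^bsub>A\<^esub> b) \<odot>\<^bsub>?N\<^esub> x = b \<odot>\<^bsub>?N\<^esub> (a \<odot>\<^bsub>?N\<^esub> x)"
      using a x by (simp_all add: t(3,4) M.act_closed M.act_add_left M.act_mult)
  qed (simp_all add: t(2) cl M.A.ring_axioms)
qed

context kalgebra
begin

text \<open>The coefficients of an element with respect to a finite spanning set determine it. They
  are merely chosen, so the injection need not be linear; \<open>transport\<close> carries the
  structure along.\<close>

lemma ex_vec_inj:
  assumes "fd_module A M"
  shows "\<exists>f :: 'm \<Rightarrow> 'k vec. inj_on f (carrier (M :: ('e, 'm) module))"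
proof -
  interpret M: right_module A M using assms by (rule fd_right_module)
  obtain B where B: "finite B" "B \<subseteq> carrier M"
    "\<forall>x\<in>carrier M. \<exists>c. x = (\<Oplus>\<^bsub>M\<^esub>b\<in>B. scal A (c b) \<odot>\<^bsub>M\<^esub> b)"
    using assms by (auto simp: fd_module_def)
  obtain c where c: "\<And>x. x \<in> carrier M \<Longrightarrow> x = (\<Oplus>\<^bsub>M\<^esub>b\<in>B. scal A (c x b) \<odot>\<^bsub>M\<^esub> b)"
    using B(3) by metis
  \<comment> \<open>Numbers the spanning set, since vectors are indexed by natural numbers.\<close>
  obtain e :: "'m \<Rightarrow> nat" where e: "inj_on e B"
    using B(1) finite_imp_inj_to_nat_seg by metis
  define f where "f x = (\<lambda>n. c x (inv_into B e n))" for x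
  have "inj_on f (carrier M)"
  proof (rule inj_onI)
    fix x y assume xy: "x \<in> carrier M" "y \<in> carrier M" "f x = f y"
    have "c x b = c y b" if "b \<in> B" for b
      using fun_cong[OF xy(3), of "e b"] that e by (simp add: f_def)
    then have "(\<Oplus>\<^bsub>M\<^esub>b\<in>B. scal A (c x b) \<odot>\<^bsub>M\<^esub> b) = (\<Oplus>\<^bsub>M\<^esub>b\<in>B. scal A (c y b) \<odot>\<^bsub>M\<^esub> b)"
      using B(2) by (intro M.finsum_cong') (auto intro!: M.act_closed)
    then show "x = y" using c[OF xy(1)] c[OF xy(2)] by simp
  qed
  then show ?thesis by blast
qed

lemma ex_vec_copy:
  assumes "fd_module A (M :: ('e, 'm) module)"
  obtains M' :: "('e, 'k vec) module" and f g
  where "fd_module A M'" "f \<in> mod_hom A M M'" "g \<in> mod_hom A M' M"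
    "\<And>x. x \<in> carrier M \<Longrightarrow> g (f x) = x" "\<And>y. y \<in> carrier M' \<Longrightarrow> f (g y) = y"
proof -
  obtain f :: "'m \<Rightarrow> 'k vec" where f: "inj_on f (carrier M)"
    using ex_vec_inj[OF assms] by blast
  note t = right_module_transport[OF fd_right_module[OF assms] f]
  have iso: "mod_iso A M (transport f M)" using t by (auto simp: mod_iso_def)
  have fd: "fd_module A (transport f M)" using fd_module_iso[OF assms t(1) iso] .
  from iso fd_right_module[OF assms] show ?thesis
    by (rule mod_isoE) (rule that[OF fd])
qed

section \<open>Projective modules\<close>

lemma projective_fd: "projective A P \<Longrightarrow> fd_module A P"
  by (simp add: projective_def)

text \<open>The lifting property is postulated only for modules on \<open>'k vec\<close>. Copying
  both M and N there gives it for modules on arbitrary types.\<close>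

lemma projective_lift:
  assumes P: "projective A P" and M: "fd_module A (M :: ('e, 'm) module)"
    and N: "fd_module A (N :: ('e, 'n) module)"
    and g: "g \<in> mod_hom A M N" "g ` carrier M = carrier N" and h: "h \<in> mod_hom A P N"
  obtains h' where "h' \<in> mod_hom A P M" "\<And>x. x \<in> carrier P \<Longrightarrow> g (h' x) = h x"
proof -
  obtain M' :: "('e, 'k vec) module" and fM gM where M': "fd_module A M'" "fM \<in> mod_hom A M M'"
    "gM \<in> mod_hom A M' M" "\<And>x. x \<in> carrier M \<Longrightarrow> gM (fM x) = x" "\<And>y. y \<in> carrier M' \<Longrightarrow> fM (gM y) = y"
    by (rule ex_vec_copy[OF M]) (rule that)
  obtain N' :: "('e, 'k vec) module" and fN gN where N': "fd_module A N'" "fN \<in> mod_hom A N N'"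
    "gN \<in> mod_hom A N' N" "\<And>x. x \<in> carrier N \<Longrightarrow> gN (fN x) = x" "\<And>y. y \<in> carrier N' \<Longrightarrow> fN (gN y) = y"
    by (rule ex_vec_copy[OF N]) (rule that)
  let ?g = "\<lambda>x. fN (g (gM x))"
  have g': "?g \<in> mod_hom A M' N'"
    by (intro mod_hom_comp[OF _ N'(2)] mod_hom_comp[OF M'(3) g(1)])
  have "carrier N' \<subseteq> ?g ` carrier M'"
  proof
    fix y assume y: "y \<in> carrier N'"
    then obtain x where x: "x \<in> carrier M" "gN y = g x"
      using mod_homD(1)[OF N'(3) y] g(2) by (metis imageE)
    have "y = ?g (fM x)" using x M'(4) N'(5)[OF y] by simp
    then show "y \<in> ?g ` carrier M'" using mod_homD(1)[OF M'(2) x(1)] by blast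
  qed
  then have sg: "?g ` carrier M' = carrier N'" using mod_homD(1)[OF g'] by blast
  obtain h' where h': "h' \<in> mod_hom A P M'" "\<And>x. x \<in> carrier P \<Longrightarrow> ?g (h' x) = fN (h x)"
    using P M'(1) N'(1) g' sg mod_hom_comp[OF h N'(2)] unfolding projective_def by meson
  show ?thesis
  proof (rule that)
    show "(\<lambda>x. gM (h' x)) \<in> mod_hom A P M" by (rule mod_hom_comp[OF h'(1) M'(3)])
    fix x assume x: "x \<in> carrier P"
    have "gM (h' x) \<in> carrier M" using mod_homD(1)[OF M'(3)] mod_homD(1)[OF h'(1)] x by blast
    then have "g (gM (h' x)) \<in> carrier N" using g(2) by blast
    then show "g (gM (h' x)) = h x"
      using N'(4) h'(2)[OF x] N'(4)[OF mod_homD(1)[OF h x]] by metis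
  qed
qed

lemma projective_retract:
  assumes "projective A P" "fd_module A M"
    and i: "i \<in> mod_hom A M P" and p: "p \<in> mod_hom A P M" "\<And>x. x \<in> carrier M \<Longrightarrow> p (i x) = x"
  shows "projective A M"
  unfolding projective_def
proof (intro conjI allI impI)
  fix L :: "('e, 'k vec) module" and N :: "('e, 'k vec) module" and g h
  assume fd: "fd_module A L" "fd_module A N" and g: "g \<in> mod_hom A L N" "g ` carrier L = carrier N"
    and h: "h \<in> mod_hom A M N"
  obtain h' where h': "h' \<in> mod_hom A P L" "\<And>x. x \<in> carrier P \<Longrightarrow> g (h' x) = h (p x)"
    by (rule projective_lift[OF assms(1) fd g mod_hom_comp[OF p(1) h]]) (rule that)
  show "\<exists>h'\<in>mod_hom A M L. \<forall>x\<in>carrier M. g (h' x) = h x"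
    using mod_hom_comp[OF i h'(1)] h'(2) p(2) mod_homD(1)[OF i]
    by (intro bexI[of _ "\<lambda>x. h' (i x)"]) auto
qed (fact assms)

lemma projective_iso:
  assumes "projective A M" "right_module A N" "mod_iso A M N"
  shows "projective A N"
proof -
  obtain f g where fg: "f \<in> mod_hom A M N" "g \<in> mod_hom A N M"
    "\<And>x. x \<in> carrier M \<Longrightarrow> g (f x) = x" "\<And>y. y \<in> carrier N \<Longrightarrow> f (g y) = y"
    by (rule mod_isoE[OF assms(3) fd_right_module[OF projective_fd[OF assms(1)]]]) (rule that)
  show ?thesis
    by (rule projective_retract[OF assms(1) _ fg(2,1,4)])
      (rule fd_module_iso[OF projective_fd[OF assms(1)] assms(2,3)])
qed

text \<open>Lifts are chosen on each summand and added up.\<close>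

lemma projective_dsum:
  assumes "finite J" "\<And>j. j \<in> J \<Longrightarrow> projective A (P j)"
  shows "projective A (dsum J P)"
  unfolding projective_def
proof (intro conjI allI impI)
  have fd: "fd_module A (P j)" if "j \<in> J" for j using assms(2)[OF that] by (rule projective_fd)
  note rm = fd_right_module[OF fd]
  show "fd_module A (dsum J P)" using assms(1) fd by (rule fd_module_dsum)
  fix M :: "('e, 'k vec) module" and N :: "('e, 'k vec) module" and g h
  assume fdMN: "fd_module A M" "fd_module A N" and g: "g \<in> mod_hom A M N" "g ` carrier M = carrier N"
    and h: "h \<in> mod_hom A (dsum J P) N"
  note rmMN = fdMN[THEN fd_right_module]
  have "\<forall>j\<in>J. \<exists>h'. h' \<in> mod_hom A (P j) M \<and> (\<forall>x\<in>carrier (P j). g (h' x) = h (dinj J P j x))"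
  proof
    fix j assume j: "j \<in> J"
    show "\<exists>h'. h' \<in> mod_hom A (P j) M \<and> (\<forall>x\<in>carrier (P j). g (h' x) = h (dinj J P j x))"
      by (rule projective_lift[OF assms(2)[OF j] fdMN g mod_hom_comp[OF mod_hom_dinj[OF rm j] h]])
        blast+
  qed
  then obtain h' where h': "\<And>j. j \<in> J \<Longrightarrow> h' j \<in> mod_hom A (P j) M"
    "\<And>j x. \<lbrakk>j \<in> J; x \<in> carrier (P j)\<rbrakk> \<Longrightarrow> g (h' j x) = h (dinj J P j x)"
    by metis
  let ?H = "\<lambda>x. \<Oplus>\<^bsub>M\<^esub>j\<in>J. h' j (x j)"
  show "\<exists>h'\<in>mod_hom A (dsum J P) M. \<forall>x\<in>carrier (dsum J P). g (h' x) = h x"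
  proof (intro bexI ballI)
    show "?H \<in> mod_hom A (dsum J P) M"
      by (rule mod_hom_finsum_fun[OF rmMN(1) assms(1)]) (rule mod_hom_comp[OF mod_hom_proj], use h'(1) in auto)
    fix x assume x: "x \<in> carrier (dsum J P)"
    then have xj: "x j \<in> carrier (P j)" if "j \<in> J" for j using that by (auto simp: PiE_iff)
    interpret N: right_module A N by (rule rmMN(2))
    have rD: "right_module A (dsum J P)" by (rule right_module_dsum[OF ring_axioms rm])
    have inj: "dinj J P j (x j) \<in> carrier (dsum J P)" if "j \<in> J" for j
      by (rule mod_homD(1)[OF mod_hom_dinj[OF rm]]) (use that xj in auto)
    have "g (?H x) = (\<Oplus>\<^bsub>N\<^esub>j\<in>J. g (h' j (x j)))"
      by (rule mod_hom_finsum[OF rmMN g(1) assms(1)]) (use mod_homD(1)[OF h'(1)] xj in blast)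
    also have "\<dots> = (\<Oplus>\<^bsub>N\<^esub>j\<in>J. h (dinj J P j (x j)))"
      using h'(2) xj mod_homD(1)[OF h inj] by (intro N.finsum_cong') auto
    also have "\<dots> = h (\<Oplus>\<^bsub>dsum J P\<^esub>j\<in>J. dinj J P j (x j))"
      by (rule mod_hom_finsum[OF rD rmMN(2) h assms(1), symmetric])
        (use inj in auto)
    also have "\<dots> = h x"
      using dsum_decomp[OF ring_axioms rm assms(1) x] by simp
    finally show "g (?H x) = h x" .
  qed
qed

end

section \<open>Path algebras\<close>

lemma path_algebra_simps:
  "carrier (path_algebra Q) = {f. finite {x. f x \<noteq> 0} \<and> {x. f x \<noteq> 0} \<subseteq> qpaths Q}"
  "(f \<otimes>\<^bsub>path_algebra Q\<^esub> g) (u, p) =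
    (\<Sum>i\<le>length p. f (u, take i p) * g (pre_digraph.awlast Q u (take i p), drop i p))"
  "\<one>\<^bsub>path_algebra Q\<^esub> x = (if fst x \<in> verts Q \<and> snd x = [] then 1 else 0)"
  "\<zero>\<^bsub>path_algebra Q\<^esub> = (\<lambda>_. 0)"
  "(f \<oplus>\<^bsub>path_algebra Q\<^esub> g) = (\<lambda>x. f x + g x)"
  by (simp_all add: path_algebra_def case_prod_beta)

text \<open>Counts the cuts of a path of length n into three pieces in two ways: by the second cut k
  and then the first, or by the length i of the first piece and the length l of the second. This is
  associativity of the path algebra.\<close>

lemma sum_split_assoc:
  fixes g :: "nat \<Rightarrow> nat \<Rightarrow> 'b::comm_monoid_add"
  shows "(\<Sum>k\<le>n. \<Sum>i\<le>k. g i (k - i)) = (\<Sum>i\<le>n. \<Sum>l\<le>n - i. g i l)"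
proof -
  have "(\<Sum>k\<le>n. \<Sum>i\<le>k. g i (k - i)) = (\<Sum>(i, j)\<in>{(i, j). i + j \<le> n}. g i j)"
    by (rule sum.triangle_reindex_eq[symmetric])
  also have "{(i, j). i + j \<le> n} = Sigma {..n} (\<lambda>i. {..n - i})"
    by auto
  also have "(\<Sum>(i, j)\<in>Sigma {..n} (\<lambda>i. {..n - i}). g i j) = (\<Sum>i\<le>n. \<Sum>l\<le>n - i. g i l)"
    by (rule sum.Sigma[symmetric]) auto
  finally show ?thesis .
qed

context pre_digraph
begin

lemma awlast_simps [simp]: "awlast u [] = u" "awlast u [e] = head G e"
  by simp_all

end

context fin_digraph
begin

lemma qpaths_iff: "(u, p) \<in> qpaths G \<longleftrightarrow> awalk u p (awlast u p)"
proof -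
  have "(u, p) \<in> qpaths G \<longleftrightarrow> (\<exists>v. awalk u p v)" by (simp add: qpaths_def)
  then show ?thesis by (metis awalkE)
qed

lemma qpaths_append:
  "(u, p @ q) \<in> qpaths G \<longleftrightarrow> (u, p) \<in> qpaths G \<and> (awlast u p, q) \<in> qpaths G"
  unfolding qpaths_iff by (metis awalk_append_iff awlast_append awalkE)

lemma qpaths_Nil [simp]: "(u, []) \<in> qpaths G \<longleftrightarrow> u \<in> verts G"
  by (simp add: qpaths_iff awalk_Nil_iff)

lemma qpaths_Cons:
  "(u, e # p) \<in> qpaths G \<longleftrightarrow> e \<in> arcs G \<and> tail G e = u \<and> (head G e, p) \<in> qpaths G"
  using qpaths_append[of u "[e]" p]
  by (auto simp: qpaths_iff awalk_Cons_iff awalk_Nil_iff simp del: awalk_verts.simps)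

lemma qpaths_snoc:
  "(u, p @ [e]) \<in> qpaths G \<longleftrightarrow> (u, p) \<in> qpaths G \<and> e \<in> arcs G \<and> tail G e = awlast u p"
  by (auto simp: qpaths_append qpaths_Cons)

lemma path_algebra_mult_apply_cases:
  assumes "(f \<otimes>\<^bsub>path_algebra G\<^esub> g) (u, p) \<noteq> 0"
  obtains q r where "p = q @ r" "f (u, q) \<noteq> 0" "g (awlast u q, r) \<noteq> 0"
proof -
  have "\<exists>i\<le>length p. f (u, take i p) * g (awlast u (take i p), drop i p) \<noteq> 0"
    using assms unfolding path_algebra_simps by (meson atMost_iff sum.not_neutral_contains_not_neutral)
  then show ?thesis using that by (metis append_take_drop_id mult_eq_0_iff)
qed

lemma path_algebra_mult_closed:
  assumes f: "f \<in> carrier (path_algebra G)" and g: "g \<in> carrier (path_algebra G)"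
  shows "f \<otimes>\<^bsub>path_algebra G\<^esub> g \<in> carrier (path_algebra G :: (_ \<Rightarrow> 'k::field) ring)"
proof -
  let ?h = "f \<otimes>\<^bsub>path_algebra G\<^esub> g"
  let ?c = "\<lambda>((u, p), (v, q)). (u, p @ q)"
  \<comment> \<open>A path in the support of the product is a concatenation of paths from the two
    finite supports.\<close>
  have "{x. ?h x \<noteq> 0} \<subseteq> ?c ` ({x. f x \<noteq> 0} \<times> {x. g x \<noteq> 0})"
  proof
    fix x assume "x \<in> {x. ?h x \<noteq> 0}"
    then obtain u p where x: "x = (u, p)" "?h (u, p) \<noteq> 0" by (cases x) auto
    from x(2) obtain q r where "p = q @ r" "f (u, q) \<noteq> 0" "g (awlast u q, r) \<noteq> 0"
      by (rule path_algebra_mult_apply_cases)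
    then show "x \<in> ?c ` ({x. f x \<noteq> 0} \<times> {x. g x \<noteq> 0})"
      using x by (intro image_eqI[of _ _ "((u, q), (awlast u q, r))"]) auto
  qed
  then have "finite {x. ?h x \<noteq> 0}"
    using f g by (rule_tac finite_subset) (auto simp: path_algebra_simps)
  moreover have "{x. ?h x \<noteq> 0} \<subseteq> qpaths G"
  proof
    fix x assume "x \<in> {x. ?h x \<noteq> 0}"
    then obtain u p where x: "x = (u, p)" "?h (u, p) \<noteq> 0" by (cases x) auto
    from x(2) obtain q r where "p = q @ r" "f (u, q) \<noteq> 0" "g (awlast u q, r) \<noteq> 0"
      by (rule path_algebra_mult_apply_cases)
    then show "x \<in> qpaths G"
      using f g x(1) by (auto simp: path_algebra_simps qpaths_append)
  qed
  ultimately show ?thesis by (simp add: path_algebra_simps(1))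
qed

lemma path_algebra_assoc:
  "(f \<otimes>\<^bsub>path_algebra G\<^esub> g) \<otimes>\<^bsub>path_algebra G\<^esub> (h :: _ \<Rightarrow> 'k::field) =
    f \<otimes>\<^bsub>path_algebra G\<^esub> (g \<otimes>\<^bsub>path_algebra G\<^esub> h)"
proof (rule ext, clarify)
  fix u and p :: "'b list"
  let ?n = "length p"
  \<comment> \<open>The contribution of the cut whose first two pieces have lengths i and l.\<close>
  let ?G = "\<lambda>i l. f (u, take i p) * (g (awlast u (take i p), take l (drop i p)) *
      h (awlast u (take (i + l) p), drop (i + l) p))"
  have "((f \<otimes>\<^bsub>path_algebra G\<^esub> g) \<otimes>\<^bsub>path_algebra G\<^esub> h) (u, p) = (\<Sum>k\<le>?n. \<Sum>i\<le>k. ?G i (k - i))"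
    unfolding path_algebra_simps sum_distrib_right
    by (intro sum.cong) (auto simp: min_def take_drop mult.assoc)
  also have "\<dots> = (\<Sum>i\<le>?n. \<Sum>l\<le>?n - i. ?G i l)"
    by (rule sum_split_assoc)
  also have "\<dots> = (f \<otimes>\<^bsub>path_algebra G\<^esub> (g \<otimes>\<^bsub>path_algebra G\<^esub> h)) (u, p)"
    unfolding path_algebra_simps sum_distrib_left
    by (intro sum.cong) (auto simp: take_add awlast_append add.commute)
  finally show "((f \<otimes>\<^bsub>path_algebra G\<^esub> g) \<otimes>\<^bsub>path_algebra G\<^esub> h) (u, p) =
      (f \<otimes>\<^bsub>path_algebra G\<^esub> (g \<otimes>\<^bsub>path_algebra G\<^esub> h)) (u, p)" .
qed

lemma path_algebra_outside:
  "f \<in> carrier (path_algebra G) \<Longrightarrow> x \<notin> qpaths G \<Longrightarrow> f x = 0"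
  by (auto simp: path_algebra_simps)

text \<open>For c = 1 this is a unit law; for general c it shows that \<open>scal\<close> is
  multiplicative and, with the version on the right, central.\<close>

lemma path_algebra_scaled_one_left:
  assumes "f \<in> carrier (path_algebra G)"
  shows "(\<lambda>x. c * \<one>\<^bsub>path_algebra G\<^esub> x) \<otimes>\<^bsub>path_algebra G\<^esub> f = (\<lambda>x. c * f x :: 'k::field)"
proof (rule ext, clarify)
  fix u p
  have "((\<lambda>x. c * \<one>\<^bsub>path_algebra G\<^esub> x) \<otimes>\<^bsub>path_algebra G\<^esub> f) (u, p) =
      (\<Sum>i\<le>length p. if i = 0 then (if u \<in> verts G then c * f (u, p) else 0) else 0)"
    unfolding path_algebra_simps by (intro sum.cong) auto
  also have "\<dots> = (if u \<in> verts G then c * f (u, p) else 0)" by simp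
  also have "\<dots> = c * f (u, p)"
    using path_algebra_outside[OF assms, of "(u, p)"] by (auto simp: qpaths_iff awalk_def)
  finally show "((\<lambda>x. c * \<one>\<^bsub>path_algebra G\<^esub> x) \<otimes>\<^bsub>path_algebra G\<^esub> f) (u, p) = c * f (u, p)" .
qed

lemma path_algebra_scaled_one_right:
  assumes "f \<in> carrier (path_algebra G)"
  shows "f \<otimes>\<^bsub>path_algebra G\<^esub> (\<lambda>x. c * \<one>\<^bsub>path_algebra G\<^esub> x) = (\<lambda>x. c * f x :: 'k::field)"
proof (rule ext, clarify)
  fix u p
  have "(f \<otimes>\<^bsub>path_algebra G\<^esub> (\<lambda>x. c * \<one>\<^bsub>path_algebra G\<^esub> x)) (u, p) =
      (\<Sum>i\<le>length p. if i = length p then (if awlast u p \<in> verts G then c * f (u, p) else 0) else 0)"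
    unfolding path_algebra_simps by (intro sum.cong) auto
  also have "\<dots> = (if awlast u p \<in> verts G then c * f (u, p) else 0)" by simp
  also have "\<dots> = c * f (u, p)"
    using path_algebra_outside[OF assms, of "(u, p)"] by (auto simp: qpaths_iff awalk_last_in_verts)
  finally show "(f \<otimes>\<^bsub>path_algebra G\<^esub> (\<lambda>x. c * \<one>\<^bsub>path_algebra G\<^esub> x)) (u, p) = c * f (u, p)" .
qed

lemma path_algebra_plus_closed:
  assumes "f \<in> carrier (path_algebra G)" "g \<in> carrier (path_algebra G)"
  shows "f \<oplus>\<^bsub>path_algebra G\<^esub> g \<in> carrier (path_algebra G :: (_ \<Rightarrow> 'k::field) ring)"
proof -
  have "{x. f x + g x \<noteq> 0} \<subseteq> {x. f x \<noteq> 0} \<union> {x. g x \<noteq> 0}" by auto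
  then show ?thesis
    using assms unfolding path_algebra_simps
    by (auto intro: finite_subset[of _ "{x. f x \<noteq> 0} \<union> {x. g x \<noteq> 0}"])
qed

lemma path_algebra_scaled_closed:
  assumes "f \<in> carrier (path_algebra G)"
  shows "(\<lambda>x. c * f x) \<in> carrier (path_algebra G :: (_ \<Rightarrow> 'k::field) ring)"
proof -
  have "{x. c * f x \<noteq> 0} \<subseteq> {x. f x \<noteq> 0}" by auto
  then show ?thesis using assms unfolding path_algebra_simps by (auto intro: finite_subset)
qed

lemma path_algebra_one_closed: "\<one>\<^bsub>path_algebra G\<^esub> \<in> carrier (path_algebra G :: (_ \<Rightarrow> 'k::field) ring)"
proof -
  have "{x. \<one>\<^bsub>path_algebra G\<^esub> x \<noteq> (0::'k)} \<subseteq> (\<lambda>u. (u, [])) ` verts G"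
    by (auto simp: path_algebra_simps split: if_splits)
  moreover from this have "finite {x. \<one>\<^bsub>path_algebra G\<^esub> x \<noteq> (0::'k)}"
    by (rule finite_subset) simp
  ultimately show ?thesis
    unfolding path_algebra_simps(1) by auto
qed

lemma ring_path_algebra: "ring (path_algebra G :: (_ \<Rightarrow> 'k::field) ring)"
proof (rule ringI)
  show "abelian_group (path_algebra G :: (_ \<Rightarrow> 'k::field) ring)"
  proof (rule abelian_groupI)
    fix f assume f: "f \<in> carrier (path_algebra G :: (_ \<Rightarrow> 'k::field) ring)"
    show "\<exists>g\<in>carrier (path_algebra G). g \<oplus>\<^bsub>path_algebra G\<^esub> f = \<zero>\<^bsub>path_algebra G\<^esub>"
      by (rule bexI[OF _ path_algebra_scaled_closed[OF f, of "-1"]]) (simp add: path_algebra_simps)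
  qed (simp_all add: path_algebra_plus_closed, simp_all add: path_algebra_simps add_ac)
  show "Group.monoid (path_algebra G :: (_ \<Rightarrow> 'k::field) ring)"
    by (rule monoidI)
      (use path_algebra_scaled_one_left[where c = 1] path_algebra_scaled_one_right[where c = 1]
        in \<open>simp_all add: path_algebra_mult_closed path_algebra_one_closed path_algebra_assoc\<close>)
qed (auto simp: path_algebra_simps fun_eq_iff sum.distrib distrib_left distrib_right)

lemma path_elem_closed [simp]:
  "x \<in> qpaths G \<Longrightarrow> path_elem x \<in> carrier (path_algebra G :: (_ \<Rightarrow> 'k::field) ring)"
proof -
  assume "x \<in> qpaths G"
  moreover have "{y. path_elem x y \<noteq> (0::'k)} = {x}" by (auto simp: path_elem_def)
  ultimately show ?thesis by (simp add: path_algebra_simps(1))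
qed

text \<open>Only the cut after \<open>length p\<close> arrows can contribute. A shorter path q
  contributes nothing, since \<open>take (length p) q\<close> is then too short to be p.\<close>

lemma path_elem_mult_apply:
  "(path_elem (u, p) \<otimes>\<^bsub>path_algebra G\<^esub> f) (v, q) =
    (if v = u \<and> take (length p) q = p then f (awlast u p, drop (length p) q) else (0::'k::field))"
proof -
  have "(path_elem (u, p) \<otimes>\<^bsub>path_algebra G\<^esub> f) (v, q) =
      (\<Sum>i\<le>length q. if i = length p then
        (if v = u \<and> take (length p) q = p then f (awlast u p, drop (length p) q) else 0) else 0)"
    unfolding path_algebra_simps
    by (intro sum.cong) (auto simp: path_elem_def min.absorb2)
  also have "\<dots> = (if v = u \<and> take (length p) q = p then f (awlast u p, drop (length p) q) else 0)"
    by (auto simp: sum.delta)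
  finally show ?thesis .
qed

lemma mult_path_elem_apply:
  "(f \<otimes>\<^bsub>path_algebra G\<^esub> path_elem (u, p)) (v, q @ p) =
    (if awlast v q = u then f (v, q) else (0::'k::field))"
proof -
  have "(f \<otimes>\<^bsub>path_algebra G\<^esub> path_elem (u, p)) (v, q @ p) =
      (\<Sum>i\<le>length (q @ p). if i = length q then (if awlast v q = u then f (v, q) else 0) else 0)"
    unfolding path_algebra_simps
  proof (intro sum.cong refl)
    fix i assume i: "i \<in> {..length (q @ p)}"
    have "i = length q" if "drop i (q @ p) = p"
      using arg_cong[OF that, of length] i by auto
    then show "f (v, take i (q @ p)) * path_elem (u, p) (awlast v (take i (q @ p)), drop i (q @ p)) =
        (if i = length q then (if awlast v q = u then f (v, q) else 0) else 0)"
      by (cases "i = length q") (auto simp: path_elem_def)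
  qed
  also have "\<dots> = (if awlast v q = u then f (v, q) else 0)" by simp
  finally show ?thesis .
qed

lemma mult_path_elem_apply_other:
  assumes "\<nexists>r. q = r @ p"
  shows "(f \<otimes>\<^bsub>path_algebra G\<^esub> path_elem (u, p)) (v, q) = (0::'k::field)"
proof (rule ccontr)
  assume "(f \<otimes>\<^bsub>path_algebra G\<^esub> path_elem (u, p)) (v, q) \<noteq> 0"
  then obtain r s where "q = r @ s" "path_elem (u, p) (awlast v r, s) \<noteq> (0::'k)"
    by (rule path_algebra_mult_apply_cases)
  then show False using assms by (auto simp: path_elem_def split: if_splits)
qed

lemma path_elem_mult:
  "path_elem (u, p) \<otimes>\<^bsub>path_algebra G\<^esub> path_elem (v, q) =
    (if awlast u p = v then path_elem (u, p @ q) else \<zero>\<^bsub>path_algebra G\<^esub> :: _ \<Rightarrow> 'k::field)"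
proof (rule ext, clarify)
  fix w r
  show "(path_elem (u, p) \<otimes>\<^bsub>path_algebra G\<^esub> path_elem (v, q)) (w, r) =
    (if awlast u p = v then path_elem (u, p @ q) else \<zero>\<^bsub>path_algebra G\<^esub> :: _ \<Rightarrow> 'k::field) (w, r)"
    unfolding path_elem_mult_apply
    by (auto simp: path_elem_def path_algebra_simps) (metis append_take_drop_id)+
qed

lemma path_algebra_finsum_apply:
  assumes "finite S" "f \<in> S \<rightarrow> carrier (path_algebra G)"
  shows "(\<Oplus>\<^bsub>path_algebra G\<^esub>i\<in>S. f i) x = (\<Sum>i\<in>S. f i x :: 'k::field)"
proof -
  interpret ring "path_algebra G :: (_ \<Rightarrow> 'k::field) ring" by (rule ring_path_algebra)
  show ?thesis using assms
    by (induct set: finite) (simp_all add: Pi_def, simp_all add: path_algebra_simps)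
qed

end

section \<open>Bound quiver algebras\<close>

text \<open>The algebra extends the quotient ring by the field \<open>scal\<close>, which the ring
  axioms do not see.\<close>

lemma ring_same_operations:
  assumes "ring R" "carrier S = carrier R" "mult S = mult R" "one S = one R" "zero S = zero R"
    "add S = add R"
  shows "ring S"
proof -
  interpret R: ring R by fact
  show ?thesis
  proof (rule ringI)
    show "abelian_group S"
      by (rule abelian_groupI) (use R.l_neg in \<open>auto simp: assms(2-) R.a_ac\<close>)
    show "Group.monoid S"
      by (rule monoidI) (auto simp: assms(2-) R.m_assoc)
  qed (auto simp: assms(2-) R.l_distr R.r_distr)
qed

locale bound_quiver = fin_digraph Q
  for Q :: "('v, 'a) pre_digraph" +
  fixes I :: "(('v, 'a) qpath \<Rightarrow> 'k::field) set"
  assumes admissible: "admissible Q I"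
begin

abbreviation KQ :: "(('v, 'a) qpath \<Rightarrow> 'k) ring" where
  "KQ \<equiv> path_algebra Q"

abbreviation A :: "('k, (('v, 'a) qpath \<Rightarrow> 'k) set) kalg" where
  "A \<equiv> quiver_algebra Q I"

abbreviation cl :: "(('v, 'a) qpath \<Rightarrow> 'k) \<Rightarrow> (('v, 'a) qpath \<Rightarrow> 'k) set" where
  "cl f \<equiv> I +>\<^bsub>KQ\<^esub> f"

definition idem :: "'v \<Rightarrow> (('v, 'a) qpath \<Rightarrow> 'k) set" where
  "idem i = path_class Q I (i, [])"

definition arr :: "'a \<Rightarrow> (('v, 'a) qpath \<Rightarrow> 'k) set" where
  "arr \<alpha> = path_class Q I (tail Q \<alpha>, [\<alpha>])"

text \<open>The same description as in \<open>vertex_simple\<close>. It is meaningful on paths of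
  length at most one, where all representatives of a class agree by \<open>coef_cl\<close>.\<close>

definition coef :: "(('v, 'a) qpath \<Rightarrow> 'k) set \<Rightarrow> ('v, 'a) qpath \<Rightarrow> 'k" where
  "coef a x = (THE c. \<forall>p\<in>a. p x = c)"

sublocale KQ: ring KQ
  by (rule ring_path_algebra)

sublocale I: ideal I KQ
  using admissible by (simp add: admissible_def)

text \<open>The coefficient of a trivial path in a product is the product of the coefficients. This
  ideal contains all arrows and therefore bounds the arrow ideal from above.\<close>

lemma ideal_trivial_coeff_zero: "ideal {f \<in> carrier KQ. \<forall>u. f (u, []) = 0} KQ" (is "ideal ?V _")
proof (rule idealI[OF KQ.ring_axioms])
  show "subgroup ?V (add_monoid KQ)"
  proof (rule group.subgroupI)
    show "?V \<noteq> {}" by (auto intro!: exI[of _ "\<zero>\<^bsub>KQ\<^esub>"]) (simp add: path_algebra_simps)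
    fix f assume f: "f \<in> ?V"
    then have cl: "(\<lambda>x. - 1 * f x) \<in> carrier KQ" by (intro path_algebra_scaled_closed) simp
    have "\<ominus>\<^bsub>KQ\<^esub> f = (\<lambda>x. - 1 * f x)"
      by (rule KQ.minus_equality) (use f cl in \<open>auto simp: path_algebra_simps(4,5)\<close>)
    then have "inv\<^bsub>add_monoid KQ\<^esub> f = (\<lambda>x. - 1 * f x)" by (simp add: a_inv_def)
    then show "inv\<^bsub>add_monoid KQ\<^esub> f \<in> ?V" using f cl by simp
  qed (use KQ.a_group path_algebra_plus_closed in \<open>auto simp: path_algebra_simps(5)\<close>)
qed (auto simp: path_algebra_mult_closed, auto simp: path_algebra_simps(2))

text \<open>In a product of two elements without trivial paths, every path has length at least two,
  and I lies in the square of the arrow ideal.\<close>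

lemma I_short_coeff_zero:
  assumes "f \<in> I" "length p \<le> 1"
  shows "f (u, p) = 0"
proof -
  let ?V = "{f \<in> carrier KQ. \<forall>u. f (u, []) = 0}"
  have arr_path': "path_elem (tail Q \<alpha>, [\<alpha>]) \<in> carrier KQ" if "\<alpha> \<in> arcs Q" for \<alpha>
    using that by (simp add: qpaths_Cons)
  have J: "arrow_ideal Q \<subseteq> ?V"
    unfolding arrow_ideal_def
  proof (rule KQ.genideal_minimal[OF ideal_trivial_coeff_zero])
    show "{path_elem (tail Q \<alpha>, [\<alpha>]) |\<alpha>. \<alpha> \<in> arcs Q} \<subseteq> ?V"
      using arr_path' by (auto, auto simp: path_elem_def)
  qed
  have J1: "x \<in> ?V" if "x \<in> carrier KQ \<cdot>\<^bsub>KQ\<^esub> arrow_ideal Q" for x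
    using that
  proof induct
    case (prod i j)
    then show ?case using J ideal.I_l_closed[OF ideal_trivial_coeff_zero, of j i] by auto
  next
    case (sum s1 s2)
    then show ?case using path_algebra_plus_closed[of s1 s2] by (auto simp: path_algebra_simps(5))
  qed
  have "x (u, p) = 0" if "x \<in> (carrier KQ \<cdot>\<^bsub>KQ\<^esub> arrow_ideal Q) \<cdot>\<^bsub>KQ\<^esub> arrow_ideal Q" for x
    using that
  proof induct
    case (prod i j)
    have "i (w, []) = 0" "j (w, []) = 0" for w
      using prod J J1 by blast+
    then show ?case using assms(2)
      by (cases p) (auto simp: path_algebra_simps(2) le_Suc_eq)
  next
    case (sum s1 s2)
    then show ?case by (simp add: path_algebra_simps(5))
  qed
  \<comment> \<open>Powers start from the unit of \<open>ideals_set\<close>, the whole ring; hence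
    the extra factor \<open>carrier KQ\<close>.\<close>
  moreover have "arrow_ideal Q [^]\<^bsub>ideals_set KQ\<^esub> (2::nat) =
      (carrier KQ \<cdot>\<^bsub>KQ\<^esub> arrow_ideal Q) \<cdot>\<^bsub>KQ\<^esub> arrow_ideal Q"
    by (simp add: nat_pow_def numeral_2_eq_2 ideals_set_def)
  ultimately show ?thesis
    using admissible assms(1) by (auto simp: admissible_def)
qed

text \<open>A path of length n is a product of n arrows and lies in the n-th power of the arrow
  ideal; a longer path is cut after m arrows, where m is the exponent from admissibility.\<close>

lemma path_elem_in_I: "\<exists>m. \<forall>(u, p)\<in>qpaths Q. length p \<ge> m \<longrightarrow> path_elem (u, p) \<in> I"
proof -
  obtain m where m: "arrow_ideal Q [^]\<^bsub>ideals_set KQ\<^esub> (m::nat) \<subseteq> I"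
    using admissible by (auto simp: admissible_def)
  have gen: "path_elem (tail Q \<alpha>, [\<alpha>]) \<in> (arrow_ideal Q :: (_ \<Rightarrow> 'k) set)" if "\<alpha> \<in> arcs Q" for \<alpha>
    unfolding arrow_ideal_def by (rule subsetD[OF KQ.genideal_self]) (use that in \<open>auto simp: qpaths_Cons\<close>)
  have pow: "path_elem (u, p) \<in> (arrow_ideal Q [^]\<^bsub>ideals_set KQ\<^esub> length p :: (_ \<Rightarrow> 'k) set)"
    if "(u, p) \<in> qpaths Q" for u p
    using that
  proof (induct p rule: rev_induct)
    case Nil
    then show ?case by (simp add: nat_pow_def ideals_set_def)
  next
    case (snoc \<alpha> p)
    then have *: "(u, p) \<in> qpaths Q" "\<alpha> \<in> arcs Q" "tail Q \<alpha> = awlast u p"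
      by (auto simp: qpaths_snoc)
    have "path_elem (u, p) \<otimes>\<^bsub>KQ\<^esub> path_elem (tail Q \<alpha>, [\<alpha>]) \<in>
        (arrow_ideal Q [^]\<^bsub>ideals_set KQ\<^esub> length p) \<cdot>\<^bsub>KQ\<^esub> arrow_ideal Q"
      by (rule ideal_prod.prod[OF snoc(1)[OF *(1)] gen[OF *(2)]])
    then show ?case using * by (simp add: path_elem_mult nat_pow_def ideals_set_def)
  qed
  have "path_elem (u, p) \<in> I" if up: "(u, p) \<in> qpaths Q" "length p \<ge> m" for u p
  proof -
    have *: "(u, take m p) \<in> qpaths Q" "(awlast u (take m p), drop m p) \<in> qpaths Q"
      using up(1) qpaths_append[of u "take m p" "drop m p"] by auto
    have "path_elem (u, take m p) \<in> I" using pow[OF *(1)] m up(2) by (auto simp: min.absorb2)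
    then have "path_elem (u, take m p) \<otimes>\<^bsub>KQ\<^esub> path_elem (awlast u (take m p), drop m p) \<in> I"
      by (rule I.I_r_closed) (use * in auto)
    then show ?thesis by (simp add: path_elem_mult)
  qed
  then show ?thesis by blast
qed

lemma A_simps:
  "carrier A = a_rcosets\<^bsub>KQ\<^esub> I" "a \<otimes>\<^bsub>A\<^esub> b = rcoset_mult KQ I a b" "\<one>\<^bsub>A\<^esub> = cl \<one>\<^bsub>KQ\<^esub>"
  "\<zero>\<^bsub>A\<^esub> = I" "a \<oplus>\<^bsub>A\<^esub> b = set_add KQ a b" "scal A c = cl (\<lambda>x. c * \<one>\<^bsub>KQ\<^esub> x)"
  by (simp_all add: quiver_algebra_def FactRing_def ring.defs kalg.defs)

lemma A_carrier_iff: "a \<in> carrier A \<longleftrightarrow> (\<exists>f\<in>carrier KQ. a = cl f)"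
  by (auto simp: A_simps A_RCOSETS_def')

lemma cl_closed [simp, intro]: "f \<in> carrier KQ \<Longrightarrow> cl f \<in> carrier A"
  by (auto simp: A_carrier_iff)

lemma cl_mult: "\<lbrakk>f \<in> carrier KQ; g \<in> carrier KQ\<rbrakk> \<Longrightarrow> cl f \<otimes>\<^bsub>A\<^esub> cl g = cl (f \<otimes>\<^bsub>KQ\<^esub> g)"
  by (simp add: A_simps I.rcoset_mult_add)

lemma cl_add: "\<lbrakk>f \<in> carrier KQ; g \<in> carrier KQ\<rbrakk> \<Longrightarrow> cl f \<oplus>\<^bsub>A\<^esub> cl g = cl (f \<oplus>\<^bsub>KQ\<^esub> g)"
  by (simp add: A_simps I.a_rcos_sum)

lemma cl_eq_zero: "f \<in> I \<Longrightarrow> cl f = \<zero>\<^bsub>A\<^esub>"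
  by (simp add: A_simps KQ.a_coset_join2[OF _ I.a_subgroup] I.a_Hcarr)

lemma cl_zero: "cl \<zero>\<^bsub>KQ\<^esub> = \<zero>\<^bsub>A\<^esub>"
  by (rule cl_eq_zero) simp

sublocale A: kalgebra A
proof -
  have "ring (KQ Quot I)" by (rule I.quotient_is_ring)
  then have "ring A"
    by (rule ring_same_operations) (simp_all add: quiver_algebra_def ring.defs)
  moreover have sc: "(\<lambda>x. c * \<one>\<^bsub>KQ\<^esub> x) \<in> carrier KQ" for c
    by (rule path_algebra_scaled_closed) simp
  ultimately show "kalgebra A"
  proof (intro kalgebra.intro kalgebra_axioms.intro)
    fix c d
    show "scal A c \<in> carrier A" using sc by (simp add: A_simps(6) cl_closed)
    show "scal A (c + d) = scal A c \<oplus>\<^bsub>A\<^esub> scal A d"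
      using sc by (simp add: A_simps(6) cl_add) (simp add: path_algebra_simps(5) distrib_right)
    show "scal A (c * d) = scal A c \<otimes>\<^bsub>A\<^esub> scal A d"
      using sc by (simp add: A_simps(6) cl_mult path_algebra_scaled_one_left mult.assoc)
    show "scal A 1 = \<one>\<^bsub>A\<^esub>" by (simp add: A_simps)
    fix a assume "a \<in> carrier A"
    then obtain f where "f \<in> carrier KQ" "a = cl f" by (auto simp: A_carrier_iff)
    then show "scal A c \<otimes>\<^bsub>A\<^esub> a = a \<otimes>\<^bsub>A\<^esub> scal A c"
      using sc by (simp add: A_simps(6) cl_mult path_algebra_scaled_one_left path_algebra_scaled_one_right)
  qed
qed

lemma cl_finsum:
  assumes "finite S" "f \<in> S \<rightarrow> carrier KQ"
  shows "cl (\<Oplus>\<^bsub>KQ\<^esub>i\<in>S. f i) = (\<Oplus>\<^bsub>A\<^esub>i\<in>S. cl (f i))"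
  using assms
  by (induct set: finite) (simp_all add: Pi_def cl_add[symmetric] cl_zero)

lemma coef_cl:
  assumes "f \<in> carrier KQ" "length p \<le> 1"
  shows "coef (cl f) (u, p) = f (u, p)"
proof -
  have eq: "g (u, p) = f (u, p)" if "g \<in> cl f" for g
    using that I_short_coeff_zero[OF _ assms(2)]
    by (auto simp: a_r_coset_def' path_algebra_simps(5))
  have self: "f \<in> cl f" by (rule I.a_rcos_self[OF assms(1)])
  show ?thesis
    unfolding coef_def
  proof (rule the_equality)
    show "\<forall>g\<in>cl f. g (u, p) = f (u, p)" using eq by (rule ballI)
    fix c assume "\<forall>g\<in>cl f. g (u, p) = c"
    from bspec[OF this self] show "c = f (u, p)" by (rule sym)
  qed
qed

lemma coef_add:
  assumes "a \<in> carrier A" "b \<in> carrier A" "length p \<le> 1"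
  shows "coef (a \<oplus>\<^bsub>A\<^esub> b) (u, p) = coef a (u, p) + coef b (u, p)"
proof -
  obtain f g where "f \<in> carrier KQ" "a = cl f" "g \<in> carrier KQ" "b = cl g"
    using assms by (auto simp: A_carrier_iff)
  then show ?thesis
    using coef_cl[OF path_algebra_plus_closed assms(3), of f g u] coef_cl[OF _ assms(3)]
    by (simp add: cl_add) (simp add: path_algebra_simps(5))
qed

text \<open>The trivial path at u gives a character of the algebra. The coefficient of an arrow
  behaves like a derivation between the characters at its two ends, because a single arrow can be
  cut only before or after itself.\<close>

lemma coef_mult:
  assumes "a \<in> carrier A" "b \<in> carrier A"
  shows "coef (a \<otimes>\<^bsub>A\<^esub> b) (u, []) = coef a (u, []) * coef b (u, [])"
    "coef (a \<otimes>\<^bsub>A\<^esub> b) (u, [\<alpha>]) = coef a (u, []) * coef b (u, [\<alpha>]) + coef a (u, [\<alpha>]) * coef b (head Q \<alpha>, [])"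
proof -
  obtain f g where "f \<in> carrier KQ" "a = cl f" "g \<in> carrier KQ" "b = cl g"
    using assms by (auto simp: A_carrier_iff)
  then show "coef (a \<otimes>\<^bsub>A\<^esub> b) (u, []) = coef a (u, []) * coef b (u, [])"
    "coef (a \<otimes>\<^bsub>A\<^esub> b) (u, [\<alpha>]) = coef a (u, []) * coef b (u, [\<alpha>]) + coef a (u, [\<alpha>]) * coef b (head Q \<alpha>, [])"
    by (simp_all add: cl_mult coef_cl path_algebra_mult_closed) (simp_all add: path_algebra_simps(2))
qed

lemma coef_zero: "length p \<le> 1 \<Longrightarrow> coef \<zero>\<^bsub>A\<^esub> (u, p) = 0"
  using coef_cl[of "\<zero>\<^bsub>KQ\<^esub>" p u] by (simp add: cl_zero) (simp add: path_algebra_simps(4))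

section \<open>Idempotents, arrows and the radical\<close>

lemma idem_eq: "idem i = cl (path_elem (i, []))"
  and arr_eq: "arr \<alpha> = cl (path_elem (tail Q \<alpha>, [\<alpha>]))"
  by (simp_all add: idem_def arr_def path_class_def)

lemma idem_closed [simp]: "i \<in> verts Q \<Longrightarrow> idem i \<in> carrier A"
  by (simp add: idem_eq cl_closed)

lemma arr_path: "\<alpha> \<in> arcs Q \<Longrightarrow> (tail Q \<alpha>, [\<alpha>]) \<in> qpaths Q"
  by (simp add: qpaths_Cons)

lemma arr_closed [simp]: "\<alpha> \<in> arcs Q \<Longrightarrow> arr \<alpha> \<in> carrier A"
  by (simp add: arr_eq cl_closed arr_path)

lemma coef_idem: "i \<in> verts Q \<Longrightarrow> coef (idem i) (u, []) = (if u = i then 1 else 0)"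
  by (simp add: idem_eq coef_cl) (simp add: path_elem_def)

lemma coef_arr: "\<alpha> \<in> arcs Q \<Longrightarrow> coef (arr \<alpha>) (u, [\<beta>]) = (if u = tail Q \<alpha> \<and> \<beta> = \<alpha> then 1 else 0)"
  "\<alpha> \<in> arcs Q \<Longrightarrow> coef (arr \<alpha>) (u, []) = 0"
  by (simp_all add: arr_eq coef_cl arr_path) (simp_all add: path_elem_def)

lemma coef_scal: "u \<in> verts Q \<Longrightarrow> coef (scal A c) (u, []) = c"
  using coef_cl[OF path_algebra_scaled_closed[OF KQ.one_closed, of c], of "[]" u]
  by (simp add: A_simps(6)) (simp add: path_algebra_simps(3))

lemma idem_mult:
  assumes "i \<in> verts Q" "j \<in> verts Q"
  shows "idem i \<otimes>\<^bsub>A\<^esub> idem j = (if i = j then idem i else \<zero>\<^bsub>A\<^esub>)"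
  using assms by (simp add: idem_eq cl_mult path_elem_mult cl_zero)

lemma idem_arr: "\<alpha> \<in> arcs Q \<Longrightarrow> idem (tail Q \<alpha>) \<otimes>\<^bsub>A\<^esub> arr \<alpha> = arr \<alpha>"
  by (simp add: idem_eq arr_eq cl_mult arr_path path_elem_mult)

lemma arr_idem:
  "\<lbrakk>\<alpha> \<in> arcs Q; i \<in> verts Q\<rbrakk> \<Longrightarrow> arr \<alpha> \<otimes>\<^bsub>A\<^esub> idem i = (if i = head Q \<alpha> then arr \<alpha> else \<zero>\<^bsub>A\<^esub>)"
  by (simp add: idem_eq arr_eq cl_mult arr_path path_elem_mult cl_zero)

lemma one_eq_sum_idem: "\<one>\<^bsub>A\<^esub> = (\<Oplus>\<^bsub>A\<^esub>i\<in>verts Q. idem i)"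
proof -
  have "\<one>\<^bsub>KQ\<^esub> = (\<Oplus>\<^bsub>KQ\<^esub>i\<in>verts Q. path_elem (i, []))"
  proof (rule ext)
    fix x :: "('v, 'a) qpath"
    have "(\<Oplus>\<^bsub>KQ\<^esub>i\<in>verts Q. path_elem (i, [])) x = (\<Sum>i\<in>verts Q. path_elem (i, []) x :: 'k)"
      by (rule path_algebra_finsum_apply) auto
    also have "\<dots> = (\<Sum>i\<in>verts Q. if i = fst x then if snd x = [] then 1 else 0 else 0)"
      by (rule sum.cong) (auto simp: path_elem_def prod_eq_iff)
    also have "\<dots> = \<one>\<^bsub>KQ\<^esub> x"
      by (simp add: path_algebra_simps(3))
    finally show "\<one>\<^bsub>KQ\<^esub> x = (\<Oplus>\<^bsub>KQ\<^esub>i\<in>verts Q. path_elem (i, [])) x" by simp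
  qed
  then show ?thesis by (simp add: A_simps(3) cl_finsum idem_eq Pi_def)
qed

lemma path_class_closed: "x \<in> qpaths Q \<Longrightarrow> path_class Q I x \<in> carrier A"
  by (simp add: path_class_def cl_closed)

lemma path_class_mult_arr:
  "\<lbrakk>(u, p) \<in> qpaths Q; \<alpha> \<in> arcs Q\<rbrakk> \<Longrightarrow> path_class Q I (u, p) \<otimes>\<^bsub>A\<^esub> arr \<alpha> =
    (if awlast u p = tail Q \<alpha> then path_class Q I (u, p @ [\<alpha>]) else \<zero>\<^bsub>A\<^esub>)"
  by (simp add: path_class_def arr_eq cl_mult arr_path path_elem_mult cl_zero)

lemma path_class_nilpotent:
  "\<exists>m. \<forall>(u, p)\<in>qpaths Q. length p \<ge> m \<longrightarrow> path_class Q I (u, p) = \<zero>\<^bsub>A\<^esub>"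
proof -
  obtain m where m: "\<forall>(u, p)\<in>qpaths Q. length p \<ge> m \<longrightarrow> path_elem (u, p) \<in> I"
    using path_elem_in_I by blast
  have "path_class Q I (u, p) = \<zero>\<^bsub>A\<^esub>" if "(u, p) \<in> qpaths Q" "length p \<ge> m" for u p
    unfolding path_class_def by (rule cl_eq_zero) (use m that in blast)
  then show ?thesis by blast
qed

text \<open>Sort the non-trivial paths by their last arrow \<open>\<alpha>\<close> and strip it;
  \<open>x \<alpha>\<close> collects the remaining initial parts. They end at the start of
  \<open>\<alpha>\<close>, which places \<open>x \<alpha>\<close> in the left projective module at
  that vertex.\<close>

lemma radical_right_decomp:
  assumes "a \<in> carrier A" "\<And>i. i \<in> verts Q \<Longrightarrow> coef a (i, []) = 0"
  obtains x where "\<And>\<alpha>. \<alpha> \<in> arcs Q \<Longrightarrow> x \<alpha> \<in> carrier A"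
    "\<And>\<alpha>. \<alpha> \<in> arcs Q \<Longrightarrow> x \<alpha> \<otimes>\<^bsub>A\<^esub> idem (tail Q \<alpha>) = x \<alpha>"
    "a = (\<Oplus>\<^bsub>A\<^esub>\<alpha>\<in>arcs Q. x \<alpha> \<otimes>\<^bsub>A\<^esub> arr \<alpha>)"
proof -
  obtain f where f: "f \<in> carrier KQ" "a = cl f" using assms(1) by (auto simp: A_carrier_iff)
  have f0: "f (u, []) = 0" for u
    using assms(2)[of u] coef_cl[OF f(1), of "[]" u] f path_algebra_outside[OF f(1), of "(u, [])"]
    by (cases "u \<in> verts Q") auto
  define g where "g \<alpha> = (\<lambda>(u, p). f (u, p @ [\<alpha>]))" for \<alpha>
  have gQ: "(u, p) \<in> qpaths Q \<and> awlast u p = tail Q \<alpha>" if "g \<alpha> (u, p) \<noteq> 0" for \<alpha> u p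
  proof -
    have "(u, p @ [\<alpha>]) \<in> qpaths Q"
      using that path_algebra_outside[OF f(1), of "(u, p @ [\<alpha>])"] by (auto simp: g_def)
    then show ?thesis by (simp add: qpaths_snoc)
  qed
  have g: "g \<alpha> \<in> carrier KQ" for \<alpha>
  proof -
    have "{x. g \<alpha> x \<noteq> 0} \<subseteq> (\<lambda>(u, p). (u, butlast p)) ` {x. f x \<noteq> 0}"
      by (auto simp: g_def image_iff split: prod.splits) (metis butlast_snoc)
    then have "finite {x. g \<alpha> x \<noteq> 0}"
      using f(1) by (auto simp: path_algebra_simps(1) intro: finite_subset[OF _ finite_imageI])
    then show ?thesis using gQ by (auto simp: path_algebra_simps(1))
  qed
  have gi: "g \<alpha> \<otimes>\<^bsub>KQ\<^esub> path_elem (tail Q \<alpha>, []) = g \<alpha>" for \<alpha>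
  proof (rule ext, clarify)
    fix u p
    show "(g \<alpha> \<otimes>\<^bsub>KQ\<^esub> path_elem (tail Q \<alpha>, [])) (u, p) = g \<alpha> (u, p)"
      using mult_path_elem_apply[of "g \<alpha>" "tail Q \<alpha>" "[]" u p] gQ[of \<alpha> u p] by auto
  qed
  have fs: "f = (\<Oplus>\<^bsub>KQ\<^esub>\<alpha>\<in>arcs Q. g \<alpha> \<otimes>\<^bsub>KQ\<^esub> path_elem (tail Q \<alpha>, [\<alpha>]))"
  proof (rule ext, clarify)
    fix u p
    have "(\<Oplus>\<^bsub>KQ\<^esub>\<alpha>\<in>arcs Q. g \<alpha> \<otimes>\<^bsub>KQ\<^esub> path_elem (tail Q \<alpha>, [\<alpha>])) (u, p) =
        (\<Sum>\<alpha>\<in>arcs Q. (g \<alpha> \<otimes>\<^bsub>KQ\<^esub> path_elem (tail Q \<alpha>, [\<alpha>])) (u, p))"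
      by (rule path_algebra_finsum_apply) (auto simp: g arr_path path_algebra_mult_closed)
    also have "\<dots> = f (u, p)"
    proof (cases p rule: rev_cases)
      case Nil
      then show ?thesis by (simp add: f0 mult_path_elem_apply_other)
    next
      case (snoc q \<beta>)
      have "(g \<alpha> \<otimes>\<^bsub>KQ\<^esub> path_elem (tail Q \<alpha>, [\<alpha>])) (u, p) = (if \<alpha> = \<beta> then f (u, p) else 0)" for \<alpha>
      proof (cases "\<alpha> = \<beta>")
        case True
        then show ?thesis
          using snoc mult_path_elem_apply[of "g \<beta>" "tail Q \<beta>" "[\<beta>]" u q] gQ[of \<beta> u q]
          by (auto simp: g_def)
      next
        case False
        then show ?thesis using snoc by (simp add: mult_path_elem_apply_other)
      qed
      then have "(\<Sum>\<alpha>\<in>arcs Q. (g \<alpha> \<otimes>\<^bsub>KQ\<^esub> path_elem (tail Q \<alpha>, [\<alpha>])) (u, p)) =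
          (if \<beta> \<in> arcs Q then f (u, p) else 0)" by simp
      also have "\<dots> = f (u, p)"
        using path_algebra_outside[OF f(1), of "(u, p)"] snoc by (auto simp: qpaths_snoc)
      finally show ?thesis .
    qed
    finally show "f (u, p) = (\<Oplus>\<^bsub>KQ\<^esub>\<alpha>\<in>arcs Q. g \<alpha> \<otimes>\<^bsub>KQ\<^esub> path_elem (tail Q \<alpha>, [\<alpha>])) (u, p)"
      by simp
  qed
  show ?thesis
  proof (rule that[of "\<lambda>\<alpha>. cl (g \<alpha>)"])
    show "cl (g \<alpha>) \<otimes>\<^bsub>A\<^esub> idem (tail Q \<alpha>) = cl (g \<alpha>)" if "\<alpha> \<in> arcs Q" for \<alpha>
      using that g gi by (simp add: idem_eq cl_mult)
    have "a = (\<Oplus>\<^bsub>A\<^esub>\<alpha>\<in>arcs Q. cl (g \<alpha> \<otimes>\<^bsub>KQ\<^esub> path_elem (tail Q \<alpha>, [\<alpha>])))"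
      unfolding f(2)
      by (subst fs, rule cl_finsum) (auto simp: g arr_path path_algebra_mult_closed)
    also have "\<dots> = (\<Oplus>\<^bsub>A\<^esub>\<alpha>\<in>arcs Q. cl (g \<alpha>) \<otimes>\<^bsub>A\<^esub> arr \<alpha>)"
      by (rule A.finsum_cong') (auto simp: arr_eq cl_mult g arr_path path_algebra_mult_closed)
    finally show "a = (\<Oplus>\<^bsub>A\<^esub>\<alpha>\<in>arcs Q. cl (g \<alpha>) \<otimes>\<^bsub>A\<^esub> arr \<alpha>)" .
  qed (use g in auto)
qed

text \<open>The same with the paths sorted by their first arrow.\<close>

lemma radical_left_decomp:
  assumes "a \<in> carrier A" "\<And>i. i \<in> verts Q \<Longrightarrow> coef a (i, []) = 0"
  obtains x where "\<And>\<alpha>. \<alpha> \<in> arcs Q \<Longrightarrow> x \<alpha> \<in> carrier A"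
    "a = (\<Oplus>\<^bsub>A\<^esub>\<alpha>\<in>arcs Q. arr \<alpha> \<otimes>\<^bsub>A\<^esub> x \<alpha>)"
proof -
  obtain f where f: "f \<in> carrier KQ" "a = cl f" using assms(1) by (auto simp: A_carrier_iff)
  have f0: "f (u, []) = 0" for u
    using assms(2)[of u] coef_cl[OF f(1), of "[]" u] f path_algebra_outside[OF f(1), of "(u, [])"]
    by (cases "u \<in> verts Q") auto
  \<comment> \<open>A path carries its start vertex, so stripping the first arrow must reset it to
    \<open>head Q \<alpha>\<close>.\<close>
  define g where "g \<alpha> = (\<lambda>(u, p). if u = head Q \<alpha> then f (tail Q \<alpha>, \<alpha> # p) else 0)" for \<alpha>
  have g: "g \<alpha> \<in> carrier KQ" for \<alpha>
  proof -
    have "{x. g \<alpha> x \<noteq> 0} \<subseteq> (\<lambda>(u, p). (head Q \<alpha>, tl p)) ` {x. f x \<noteq> 0}"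
      by (auto simp: g_def image_iff split: prod.splits if_splits) (metis list.sel(3))
    then have "finite {x. g \<alpha> x \<noteq> 0}"
      using f(1) by (auto simp: path_algebra_simps(1) intro: finite_subset[OF _ finite_imageI])
    moreover have "(u, p) \<in> qpaths Q" if "g \<alpha> (u, p) \<noteq> 0" for u p
      using that path_algebra_outside[OF f(1), of "(tail Q \<alpha>, \<alpha> # p)"]
      by (auto simp: g_def qpaths_Cons split: if_splits)
    ultimately show ?thesis by (auto simp: path_algebra_simps(1))
  qed
  have fs: "f = (\<Oplus>\<^bsub>KQ\<^esub>\<alpha>\<in>arcs Q. path_elem (tail Q \<alpha>, [\<alpha>]) \<otimes>\<^bsub>KQ\<^esub> g \<alpha>)"
  proof (rule ext, clarify)
    fix u p
    have "(\<Oplus>\<^bsub>KQ\<^esub>\<alpha>\<in>arcs Q. path_elem (tail Q \<alpha>, [\<alpha>]) \<otimes>\<^bsub>KQ\<^esub> g \<alpha>) (u, p) =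
        (\<Sum>\<alpha>\<in>arcs Q. (path_elem (tail Q \<alpha>, [\<alpha>]) \<otimes>\<^bsub>KQ\<^esub> g \<alpha>) (u, p))"
      by (rule path_algebra_finsum_apply) (auto simp: g arr_path path_algebra_mult_closed)
    also have "\<dots> = f (u, p)"
    proof (cases p)
      case Nil
      then show ?thesis by (simp add: f0 path_elem_mult_apply)
    next
      case (Cons \<beta> q)
      have "(path_elem (tail Q \<alpha>, [\<alpha>]) \<otimes>\<^bsub>KQ\<^esub> g \<alpha>) (u, p) =
          (if \<alpha> = \<beta> then if u = tail Q \<beta> then f (u, p) else 0 else 0)" for \<alpha>
        using Cons by (auto simp: path_elem_mult_apply g_def)
      then have "(\<Sum>\<alpha>\<in>arcs Q. (path_elem (tail Q \<alpha>, [\<alpha>]) \<otimes>\<^bsub>KQ\<^esub> g \<alpha>) (u, p)) =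
          (if \<beta> \<in> arcs Q then if u = tail Q \<beta> then f (u, p) else 0 else 0)" by simp
      also have "\<dots> = f (u, p)"
        using path_algebra_outside[OF f(1), of "(u, p)"] Cons by (auto simp: qpaths_Cons)
      finally show ?thesis .
    qed
    finally show "f (u, p) = (\<Oplus>\<^bsub>KQ\<^esub>\<alpha>\<in>arcs Q. path_elem (tail Q \<alpha>, [\<alpha>]) \<otimes>\<^bsub>KQ\<^esub> g \<alpha>) (u, p)"
      by simp
  qed
  show ?thesis
  proof (rule that[of "\<lambda>\<alpha>. cl (g \<alpha>)"])
    have "a = (\<Oplus>\<^bsub>A\<^esub>\<alpha>\<in>arcs Q. cl (path_elem (tail Q \<alpha>, [\<alpha>]) \<otimes>\<^bsub>KQ\<^esub> g \<alpha>))"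
      unfolding f(2)
      by (subst fs, rule cl_finsum) (auto simp: g arr_path path_algebra_mult_closed)
    also have "\<dots> = (\<Oplus>\<^bsub>A\<^esub>\<alpha>\<in>arcs Q. arr \<alpha> \<otimes>\<^bsub>A\<^esub> cl (g \<alpha>))"
      by (rule A.finsum_cong') (auto simp: arr_eq cl_mult g arr_path path_algebra_mult_closed)
    finally show "a = (\<Oplus>\<^bsub>A\<^esub>\<alpha>\<in>arcs Q. arr \<alpha> \<otimes>\<^bsub>A\<^esub> cl (g \<alpha>))" .
  qed (use g in auto)
qed

text \<open>The only path starting at a sink k is the trivial one, so the projective at k is spanned
  by \<open>idem k\<close>.\<close>

lemma idem_mult_sink:
  assumes "k \<in> verts Q" "\<And>\<alpha>. \<alpha> \<in> arcs Q \<Longrightarrow> tail Q \<alpha> \<noteq> k" "a \<in> carrier A"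
  shows "idem k \<otimes>\<^bsub>A\<^esub> a = scal A (coef a (k, [])) \<otimes>\<^bsub>A\<^esub> idem k"
proof -
  obtain f where f: "f \<in> carrier KQ" "a = cl f" using assms(3) by (auto simp: A_carrier_iff)
  have "path_elem (k, []) \<otimes>\<^bsub>KQ\<^esub> f = (\<lambda>x. f (k, []) * path_elem (k, []) x)"
  proof (rule ext, clarify)
    fix u p
    have "f (k, p) = 0" if "p \<noteq> []"
      using path_algebra_outside[OF f(1), of "(k, p)"] that assms(2) by (cases p) (auto simp: qpaths_Cons)
    then show "(path_elem (k, []) \<otimes>\<^bsub>KQ\<^esub> f) (u, p) = f (k, []) * path_elem (k, []) (u, p)"
      by (simp add: path_elem_mult_apply) (auto simp: path_elem_def)
  qed
  then show ?thesis
    using f assms(1) path_algebra_scaled_closed[OF KQ.one_closed]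
    by (simp add: idem_eq A_simps(6) cl_mult coef_cl path_algebra_scaled_one_left)
qed

end

section \<open>Lifting and comparison of resolutions\<close>

context kalgebra
begin

text \<open>Onto its image f is surjective, and the image is finite-dimensional as a quotient of L.
  This is the form of lifting used to construct chain maps and homotopies.\<close>

lemma lift_into_image:
  assumes "projective A P" "fd_module A L" "right_module A N"
    and f: "f \<in> mod_hom A L N" and h: "h \<in> mod_hom A P N"
    and sub: "\<And>x. x \<in> carrier P \<Longrightarrow> h x \<in> f ` carrier L"
  obtains h' where "h' \<in> mod_hom A P L" "\<And>x. x \<in> carrier P \<Longrightarrow> f (h' x) = h x"
proof -
  let ?I = "submod N (f ` carrier L)"
  have "right_module A ?I"
    by (rule right_module_submod[OF assms(3) submodule_image[OF fd_right_module[OF assms(2)] assms(3) f]])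
  moreover have f': "f \<in> mod_hom A L ?I" using f by (rule mod_hom_submod_codomain) auto
  ultimately have "fd_module A ?I"
    by (rule fd_module_image[OF assms(2)]) simp
  moreover have "h \<in> mod_hom A P ?I" using h sub by (rule mod_hom_submod_codomain)
  ultimately show ?thesis
    using projective_lift[OF assms(1,2) _ f', of h] that by auto
qed

lemma projective_dprod:
  assumes "projective A P" "projective A P'"
  shows "projective A (dprod P P')"
  unfolding projective_def
proof (intro conjI allI impI)
  show "fd_module A (dprod P P')"
    using assms by (intro fd_module_dprod projective_fd)
  fix M :: "('e, 'k vec) module" and N :: "('e, 'k vec) module" and g h
  assume fd: "fd_module A M" "fd_module A N" and g: "g \<in> mod_hom A M N" "g ` carrier M = carrier N"
    and h: "h \<in> mod_hom A (dprod P P') N"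
  note rm = fd_right_module[OF projective_fd[OF assms(1)]] fd_right_module[OF projective_fd[OF assms(2)]]
  interpret P: right_module A P by (rule rm)
  interpret P': right_module A P' by (rule rm)
  obtain h1 where h1: "h1 \<in> mod_hom A P M" "\<And>x. x \<in> carrier P \<Longrightarrow> g (h1 x) = h (x, \<zero>\<^bsub>P'\<^esub>)"
    using projective_lift[OF assms(1) fd g mod_hom_comp[OF mod_hom_inl[OF rm(2)] h]] by blast
  obtain h2 where h2: "h2 \<in> mod_hom A P' M" "\<And>x. x \<in> carrier P' \<Longrightarrow> g (h2 x) = h (\<zero>\<^bsub>P\<^esub>, x)"
    using projective_lift[OF assms(2) fd g mod_hom_comp[OF mod_hom_inr[OF rm(1)] h]] by blast
  let ?h = "\<lambda>x. h1 (fst x) \<oplus>\<^bsub>M\<^esub> h2 (snd x)"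
  have hm: "?h \<in> mod_hom A (dprod P P') M"
    by (intro mod_hom_plus fd_right_module fd mod_hom_comp[OF mod_hom_fst h1(1)]
        mod_hom_comp[OF mod_hom_snd h2(1)])
  have hx: "g (?h x) = h x" if "x \<in> carrier (dprod P P')" for x
  proof -
    obtain y z where x: "x = (y, z)" "y \<in> carrier P" "z \<in> carrier P'" using \<open>x \<in> carrier (dprod P P')\<close> by auto
    have "g (?h x) = h (y, \<zero>\<^bsub>P'\<^esub>) \<oplus>\<^bsub>N\<^esub> h (\<zero>\<^bsub>P\<^esub>, z)"
      using x h1 h2 by (simp add: mod_homD(1)[OF h1(1)] mod_homD(1)[OF h2(1)] mod_homD(2)[OF g(1)])
    also have "\<dots> = h ((y, \<zero>\<^bsub>P'\<^esub>) \<oplus>\<^bsub>dprod P P'\<^esub> (\<zero>\<^bsub>P\<^esub>, z))"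
      using x by (intro mod_homD(2)[OF h, symmetric]) auto
    finally show ?thesis using x by simp
  qed
  show "\<exists>h'\<in>mod_hom A (dprod P P') M. \<forall>x\<in>carrier (dprod P P'). g (h' x) = h x"
    by (rule bexI[OF _ hm], rule ballI, rule hx)
qed

lemma projective_zero_mod:
  assumes "projective A P" shows "projective A (zero_mod P)"
proof (rule projective_retract[OF assms])
  have rm: "right_module A P" using assms by (intro fd_right_module projective_fd)
  show "fd_module A (zero_mod P)" using assms by (intro fd_module_zero_mod projective_fd)
  interpret P: right_module A P by (rule rm)
  show "(\<lambda>x. x) \<in> mod_hom A (zero_mod P) P" by (rule mod_homI) auto
  show "(\<lambda>x. \<zero>\<^bsub>P\<^esub>) \<in> mod_hom A P (zero_mod P)" by (rule mod_homI) auto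
qed simp

lemma projective_cover_unique:
  assumes 1: "projective_cover A P1 M p1" and 2: "projective_cover A P2 M p2" and rM: "right_module A M"
  obtains \<theta> \<eta> where "\<theta> \<in> mod_hom A P1 P2" "\<eta> \<in> mod_hom A P2 P1"
    "\<And>x. x \<in> carrier P1 \<Longrightarrow> \<eta> (\<theta> x) = x" "\<And>y. y \<in> carrier P2 \<Longrightarrow> \<theta> (\<eta> y) = y"
    "\<And>x. x \<in> carrier P1 \<Longrightarrow> p2 (\<theta> x) = p1 x"
proof -
  note c1 = 1[unfolded projective_cover_def] and c2 = 2[unfolded projective_cover_def]
  have fd: "fd_module A P1" "fd_module A P2" using c1 c2 by (auto intro: projective_fd)
  note rm = fd[THEN fd_right_module]
  interpret P1: right_module A P1 by (rule rm)
  interpret P2: right_module A P2 by (rule rm)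
  interpret M: right_module A M by (rule rM)
  have p1: "p1 \<in> mod_hom A P1 M" "p1 ` carrier P1 = carrier M"
    and p2: "p2 \<in> mod_hom A P2 M" "p2 ` carrier P2 = carrier M" using c1 c2 by auto
  have "fd_module A M" using fd_module_image[OF fd(1) rM p1] .
  then obtain h where h: "h \<in> mod_hom A P1 P2" "\<And>x. x \<in> carrier P1 \<Longrightarrow> p2 (h x) = p1 x"
    using projective_lift[OF _ fd(2) _ p2 p1(1)] c1 by blast
  \<comment> \<open>A submodule with the same image as P supplements the kernel of p, and so it is
    all of P.\<close>
  have surj: "H = carrier P"
    if P: "right_module A P" "superfluous A P (a_kernel P M p)" "p \<in> mod_hom A P M"
      and H: "submodule H A P" "p ` H = p ` carrier P" for P :: "('e, 'x) module" and p H
  proof -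
    interpret P: right_module A P by (rule P(1))
    note Hc = P.submodule_closed[OF H(1)]
    have "carrier P \<subseteq> a_kernel P M p <+>\<^bsub>P\<^esub> H"
    proof
      fix x assume x: "x \<in> carrier P"
      then obtain y where y: "y \<in> H" "p x = p y" using H(2) by (metis imageE imageI)
      then have yc: "y \<in> carrier P" using Hc(1) by auto
      have "p (x \<ominus>\<^bsub>P\<^esub> y) = \<zero>\<^bsub>M\<^esub>"
        using mod_hom_diff[OF P(1) rM P(3) x yc] y mod_homD(1)[OF P(3) yc]
        by (simp add: a_minus_def M.r_neg)
      moreover have "x = (x \<ominus>\<^bsub>P\<^esub> y) \<oplus>\<^bsub>P\<^esub> y"
        using x yc by (simp add: a_minus_def P.a_assoc P.l_neg)
      ultimately show "x \<in> a_kernel P M p <+>\<^bsub>P\<^esub> H"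
        unfolding set_add_def' using x yc y by fastforce
    qed
    moreover have "a_kernel P M p <+>\<^bsub>P\<^esub> H \<subseteq> carrier P"
      unfolding set_add_def' using Hc by auto
    ultimately show ?thesis using P(2) H(1) unfolding superfluous_def by blast
  qed
  have hs: "h ` carrier P1 = carrier P2"
  proof (rule surj[OF rm(2) _ p2(1) submodule_image[OF rm h(1)]])
    show "superfluous A P2 (a_kernel P2 M p2)" using c2 by blast
    have "p2 ` h ` carrier P1 = p1 ` carrier P1" using h(2) by (simp add: image_image)
    then show "p2 ` h ` carrier P1 = p2 ` carrier P2" using p1 p2 by simp
  qed
  obtain s where s: "s \<in> mod_hom A P2 P1" "\<And>y. y \<in> carrier P2 \<Longrightarrow> h (s y) = y"
    using projective_lift[OF _ fd h(1) hs mod_hom_id(2)] c2 by blast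
  have ss: "s ` carrier P2 = carrier P1"
  proof (rule surj[OF rm(1) _ p1(1) submodule_image[OF rm(2,1) s(1)]])
    show "superfluous A P1 (a_kernel P1 M p1)" using c1 by blast
    have "p1 (s y) = p2 y" if "y \<in> carrier P2" for y
      using h(2)[OF mod_homD(1)[OF s(1) that]] s(2)[OF that] by simp
    then have "p1 ` s ` carrier P2 = p2 ` carrier P2" by (simp add: image_image)
    then show "p1 ` s ` carrier P2 = p1 ` carrier P1" using p1 p2 by simp
  qed
  \<comment> \<open>Write x as \<open>s y\<close> and use that s is a section of h.\<close>
  have "s (h x) = x" if "x \<in> carrier P1" for x
    using that ss s(2) by (metis imageE)
  then show ?thesis using that[OF h(1) s(1) _ s(2) h(2)] by blast
qed

text \<open>
  The kernel is a second syzygy of \<open>X\<close>.  Comparing with a projective resolution of length 2 shows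
  that it is a direct summand of \<open>P\<^sub>2 \<oplus> P\<close>.
\<close>

lemma projective_second_syzygy:
  assumes pd: "pd_le A 2 X" and X: "right_module A X"
    and P: "projective A P" and R: "projective A R"
    and f: "f \<in> mod_hom A P R" and c: "c \<in> mod_hom A R X" "c ` carrier R = carrier X"
    and ex: "a_kernel R X c = f ` carrier P"
  shows "projective A (submod P (a_kernel P R f))"
proof -
  obtain Pr :: "nat \<Rightarrow> ('e, 'k vec) module" and d \<epsilon> where
    Pr: "\<And>i. projective A (Pr i)" and Pr0: "\<And>i. i > 2 \<Longrightarrow> carrier (Pr i) = {\<zero>\<^bsub>Pr i\<^esub>}"
    and d: "\<And>i. d i \<in> mod_hom A (Pr (Suc i)) (Pr i)"
    and \<epsilon>: "\<epsilon> \<in> mod_hom A (Pr 0) X" "\<epsilon> ` carrier (Pr 0) = carrier X"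
    and ex0: "exact_at (Pr 1) (Pr 0) X (d 0) \<epsilon>"
    and exi: "\<And>i. exact_at (Pr (Suc (Suc i))) (Pr (Suc i)) (Pr i) (d (Suc i)) (d i)"
    using pd unfolding pd_le_def by blast
  have fdPr: "fd_module A (Pr i)" for i using Pr by (rule projective_fd)
  note rmPr = fdPr[THEN fd_right_module]
  have fdP: "fd_module A P" "fd_module A R" using P R by (auto intro: projective_fd)
  note rmP = fdP[THEN fd_right_module]
  interpret P: right_module A P by (rule rmP)
  interpret R: right_module A R by (rule rmP)
  interpret X: right_module A X by (rule X)
  interpret P0: right_module A "Pr 0" by (rule rmPr)
  interpret P1: right_module A "Pr 1" by (rule rmPr)
  interpret P2: right_module A "Pr 2" by (rule rmPr)
  have fdX: "fd_module A X" by (rule fd_module_image[OF fdP(2) X c])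
  let ?N = "submod P (a_kernel P R f)"
  have subN: "submodule (a_kernel P R f) A P" by (rule submodule_a_kernel[OF rmP f])
  have fdN: "fd_module A ?N" by (rule fd_module_submod[OF fdP(1) subN])
  note rmN = fd_right_module[OF fdN]
  have d01: "d 0 \<in> mod_hom A (Pr 1) (Pr 0)" "d 1 \<in> mod_hom A (Pr 2) (Pr 1)"
    using d[of 0] d[of 1] by (simp_all add: numeral_2_eq_2)
  have k0: "\<And>x. x \<in> carrier (Pr 0) \<Longrightarrow> \<epsilon> x = \<zero>\<^bsub>X\<^esub> \<longleftrightarrow> x \<in> d 0 ` carrier (Pr 1)"
    using ex0 by (auto simp: exact_at_def)
  have k1: "\<And>x. x \<in> carrier (Pr 1) \<Longrightarrow> d 0 x = \<zero>\<^bsub>Pr 0\<^esub> \<longleftrightarrow> x \<in> d 1 ` carrier (Pr 2)"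
    using exi[of 0] by (auto simp: exact_at_def numeral_2_eq_2)
  have dd: "d 0 (d 1 x) = \<zero>\<^bsub>Pr 0\<^esub>" if "x \<in> carrier (Pr 2)" for x
    using k1[OF mod_homD(1)[OF d01(2) that]] that by blast
  have eps_d: "\<epsilon> (d 0 x) = \<zero>\<^bsub>X\<^esub>" if "x \<in> carrier (Pr 1)" for x
    using k0[OF mod_homD(1)[OF d01(1) that]] that by blast
  \<comment> \<open>The resolution stops after index 2, so exactness there is injectivity of
    \<open>d 1\<close>.\<close>
  have inj1: "inj_on (d 1) (carrier (Pr 2))"
  proof (rule mod_hom_inj_on[OF rmPr rmPr d01(2)])
    fix x assume x: "x \<in> carrier (Pr 2)" "d 1 x = \<zero>\<^bsub>Pr 1\<^esub>"
    then have "x \<in> d 2 ` carrier (Pr 3)"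
      using exi[of 1] by (auto simp: exact_at_def numeral_2_eq_2 numeral_3_eq_3)
    moreover have "d 2 \<zero>\<^bsub>Pr 3\<^esub> = \<zero>\<^bsub>Pr 2\<^esub>"
      using mod_hom_zero[OF rmPr rmPr d[of 2]] by (simp add: numeral_3_eq_3 numeral_2_eq_2)
    ultimately show "x = \<zero>\<^bsub>Pr 2\<^esub>" using Pr0[of 3] by auto
  qed
  have kc: "\<And>x. x \<in> carrier R \<Longrightarrow> c x = \<zero>\<^bsub>X\<^esub> \<longleftrightarrow> x \<in> f ` carrier P"
    using ex by (auto simp flip: ex)
  have cf: "c (f x) = \<zero>\<^bsub>X\<^esub>" if "x \<in> carrier P" for x
    using kc[OF mod_homD(1)[OF f that]] that by blast
  \<comment> \<open>Comparison map from the resolution \<open>Pr\<close> to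
    \<open>P \<rightarrow> R \<rightarrow> X\<close>; the maps \<open>\<psi>\<close> below go
    back.\<close>
  obtain \<phi>0 where \<phi>0: "\<phi>0 \<in> mod_hom A (Pr 0) R" "\<And>x. x \<in> carrier (Pr 0) \<Longrightarrow> c (\<phi>0 x) = \<epsilon> x"
    using projective_lift[OF Pr fdP(2) fdX c \<epsilon>(1)] by blast
  obtain \<phi>1 where \<phi>1: "\<phi>1 \<in> mod_hom A (Pr 1) P" "\<And>x. x \<in> carrier (Pr 1) \<Longrightarrow> f (\<phi>1 x) = \<phi>0 (d 0 x)"
  proof (rule lift_into_image[OF Pr fdP(1) rmP(2) f mod_hom_comp[OF d01(1) \<phi>0(1)]])
    fix x assume x: "x \<in> carrier (Pr 1)"
    note dx = mod_homD(1)[OF d01(1) x]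
    show "\<phi>0 (d 0 x) \<in> f ` carrier P"
      using kc[OF mod_homD(1)[OF \<phi>0(1) dx]] \<phi>0(2)[OF dx] eps_d[OF x] by simp
  qed (rule that)
  have "f (\<phi>1 (d 1 x)) = \<zero>\<^bsub>R\<^esub>" if "x \<in> carrier (Pr 2)" for x
    using \<phi>1(2)[OF mod_homD(1)[OF d01(2) that]] dd[OF that] mod_hom_zero[OF rmPr rmP(2) \<phi>0(1)] by simp
  then have \<phi>2: "(\<lambda>x. \<phi>1 (d 1 x)) \<in> mod_hom A (Pr 2) ?N"
    by (intro mod_hom_submod_codomain mod_hom_comp[OF d01(2) \<phi>1(1)])
      (use mod_homD(1)[OF \<phi>1(1) mod_homD(1)[OF d01(2)]] in simp)
  obtain \<psi>0 where \<psi>0: "\<psi>0 \<in> mod_hom A R (Pr 0)" "\<And>x. x \<in> carrier R \<Longrightarrow> \<epsilon> (\<psi>0 x) = c x"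
    using projective_lift[OF R fdPr fdX \<epsilon> c(1)] by blast
  obtain \<psi>1 where \<psi>1: "\<psi>1 \<in> mod_hom A P (Pr 1)" "\<And>x. x \<in> carrier P \<Longrightarrow> d 0 (\<psi>1 x) = \<psi>0 (f x)"
  proof (rule lift_into_image[OF P fdPr rmPr d01(1) mod_hom_comp[OF f \<psi>0(1)]])
    fix x assume x: "x \<in> carrier P"
    note fx = mod_homD(1)[OF f x]
    show "\<psi>0 (f x) \<in> d 0 ` carrier (Pr 1)"
      using k0[OF mod_homD(1)[OF \<psi>0(1) fx]] \<psi>0(2)[OF fx] cf[OF x] by simp
  qed (rule that)
  let ?D = "d 1 ` carrier (Pr 2)"
  have subD: "submodule ?D A (Pr 1)" by (rule submodule_image[OF rmPr rmPr d01(2)])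
  have d1D: "d 1 \<in> mod_hom A (Pr 2) (submod (Pr 1) ?D)"
    by (rule mod_hom_submod_codomain[OF d01(2)]) auto
  let ?inv = "inv_into (carrier (Pr 2)) (d 1)"
  have inv: "?inv \<in> mod_hom A (submod (Pr 1) ?D) (Pr 2)"
    by (rule mod_hom_inv_into[OF rmPr d1D]) (use inj1 in \<open>simp add: bij_betw_def\<close>)
  \<comment> \<open>On the kernel of f, \<open>\<psi>1\<close> takes values in the kernel of
    \<open>d 0\<close>, which is the image of \<open>d 1\<close>; there \<open>d 1\<close> can be
    inverted.\<close>
  have \<psi>1N: "\<psi>1 n \<in> ?D" if "n \<in> carrier ?N" for n
  proof -
    from that have n: "n \<in> carrier P" "f n = \<zero>\<^bsub>R\<^esub>" by auto
    show ?thesis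
      using k1[OF mod_homD(1)[OF \<psi>1(1) n(1)]] \<psi>1(2)[OF n(1)] n(2) mod_hom_zero[OF rmP(2) rmPr \<psi>0(1)] by simp
  qed
  have \<psi>2: "(\<lambda>n. ?inv (\<psi>1 n)) \<in> mod_hom A ?N (Pr 2)"
    by (rule mod_hom_comp[OF mod_hom_submod_codomain[OF mod_hom_submod_domain[OF \<psi>1(1)] \<psi>1N] inv]) auto
  have d\<psi>2: "d 1 (?inv (\<psi>1 n)) = \<psi>1 n" if "n \<in> carrier ?N" for n
    using \<psi>1N[OF that] by (rule f_inv_into_f)
  have \<phi>\<psi>0: "(\<lambda>x. \<phi>0 (\<psi>0 x)) \<in> mod_hom A R R" by (rule mod_hom_comp[OF \<psi>0(1) \<phi>0(1)])
  have h0: "(\<lambda>x. x \<ominus>\<^bsub>R\<^esub> \<phi>0 (\<psi>0 x)) \<in> mod_hom A R R"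
    by (rule mod_hom_minus_fun[OF rmP(2) mod_hom_id(2) \<phi>\<psi>0])
  \<comment> \<open>The degree-0 part of a homotopy between the identity and
    \<open>\<phi> \<psi>\<close>.\<close>
  obtain s0 where s0: "s0 \<in> mod_hom A R P" "\<And>x. x \<in> carrier R \<Longrightarrow> f (s0 x) = x \<ominus>\<^bsub>R\<^esub> \<phi>0 (\<psi>0 x)"
  proof (rule lift_into_image[OF R fdP(1) rmP(2) f h0])
    fix x assume x: "x \<in> carrier R"
    note px = mod_homD(1)[OF \<phi>\<psi>0 x]
    have "c (x \<ominus>\<^bsub>R\<^esub> \<phi>0 (\<psi>0 x)) = c x \<ominus>\<^bsub>X\<^esub> c x"
      using mod_hom_diff[OF rmP(2) X c(1) x px] \<phi>0(2)[OF mod_homD(1)[OF \<psi>0(1) x]] \<psi>0(2)[OF x] by simp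
    also have "\<dots> = \<zero>\<^bsub>X\<^esub>" using mod_homD(1)[OF c(1) x] by (simp add: a_minus_def X.r_neg)
    finally show "x \<ominus>\<^bsub>R\<^esub> \<phi>0 (\<psi>0 x) \<in> f ` carrier P"
      using kc[OF mod_homD(1)[OF h0 x]] by simp
  qed (rule that)
  \<comment> \<open>The defect of that homotopy one degree further left; f annihilates it, so it
    takes values in the kernel.\<close>
  let ?s1 = "\<lambda>x. (x \<ominus>\<^bsub>P\<^esub> \<phi>1 (\<psi>1 x)) \<ominus>\<^bsub>P\<^esub> s0 (f x)"
  have \<phi>\<psi>1: "(\<lambda>x. \<phi>1 (\<psi>1 x)) \<in> mod_hom A P P" by (rule mod_hom_comp[OF \<psi>1(1) \<phi>1(1)])
  have s1': "?s1 \<in> mod_hom A P P"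
    by (intro mod_hom_minus_fun rmP mod_hom_id(2) \<phi>\<psi>1 mod_hom_comp[OF f s0(1)])
  have s1: "?s1 \<in> mod_hom A P ?N"
  proof (rule mod_hom_submod_codomain[OF s1'])
    fix x assume x: "x \<in> carrier P"
    note fx = mod_homD(1)[OF f x]
    have cl: "\<phi>1 (\<psi>1 x) \<in> carrier P" "s0 (f x) \<in> carrier P" "\<phi>0 (\<psi>0 (f x)) \<in> carrier R"
      using mod_homD(1)[OF \<phi>\<psi>1 x] mod_homD(1)[OF s0(1) fx] mod_homD(1)[OF \<phi>\<psi>0 fx] by auto
    have "f (?s1 x) = (f x \<ominus>\<^bsub>R\<^esub> f (\<phi>1 (\<psi>1 x))) \<ominus>\<^bsub>R\<^esub> f (s0 (f x))"
      using x cl by (simp add: mod_hom_diff[OF rmP f])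
    also have "f (\<phi>1 (\<psi>1 x)) = \<phi>0 (\<psi>0 (f x))"
      using \<phi>1(2)[OF mod_homD(1)[OF \<psi>1(1) x]] \<psi>1(2)[OF x] by simp
    also have "f (s0 (f x)) = f x \<ominus>\<^bsub>R\<^esub> \<phi>0 (\<psi>0 (f x))" by (rule s0(2)[OF fx])
    also have "(f x \<ominus>\<^bsub>R\<^esub> \<phi>0 (\<psi>0 (f x))) \<ominus>\<^bsub>R\<^esub> (f x \<ominus>\<^bsub>R\<^esub> \<phi>0 (\<psi>0 (f x))) = \<zero>\<^bsub>R\<^esub>"
      using fx cl by (simp add: a_minus_def R.r_neg)
    finally show "?s1 x \<in> a_kernel P R f" using mod_homD(1)[OF s1' x] by simp
  qed
  let ?p = "\<lambda>z. \<phi>1 (d 1 (fst z)) \<oplus>\<^bsub>?N\<^esub> ?s1 (snd z)"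
  show ?thesis
  proof (rule projective_retract[OF projective_dprod[OF Pr[of 2] P] fdN])
    \<comment> \<open>On the kernel the term with \<open>s0 (f n)\<close> vanishes, so
      \<open>?p\<close> adds \<open>\<phi>1 (\<psi>1 n)\<close> and its difference from n.\<close>
    show "(\<lambda>n. (?inv (\<psi>1 n), n)) \<in> mod_hom A ?N (dprod (Pr 2) P)"
      by (rule mod_hom_Pair[OF \<psi>2 mod_hom_submod_domain[OF mod_hom_id(2)]]) auto
    show "?p \<in> mod_hom A (dprod (Pr 2) P) ?N"
      by (rule mod_hom_plus[OF rmN mod_hom_comp[OF mod_hom_fst \<phi>2] mod_hom_comp[OF mod_hom_snd s1]])
    fix n assume n: "n \<in> carrier ?N"
    then have nP: "n \<in> carrier P" "f n = \<zero>\<^bsub>R\<^esub>" by auto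
    have s00: "s0 \<zero>\<^bsub>R\<^esub> = \<zero>\<^bsub>P\<^esub>" by (rule mod_hom_zero[OF rmP(2,1) s0(1)])
    have "?p (?inv (\<psi>1 n), n) = \<phi>1 (\<psi>1 n) \<oplus>\<^bsub>P\<^esub> (n \<ominus>\<^bsub>P\<^esub> \<phi>1 (\<psi>1 n))"
      using nP mod_homD(1)[OF \<phi>\<psi>1 nP(1)] d\<psi>2[OF n] by (simp add: s00 a_minus_def right_module.minus_zero[OF rmP(1)])
    also have "\<dots> = n"
      using nP mod_homD(1)[OF \<phi>\<psi>1 nP(1)]
      by (simp add: a_minus_def P.a_lcomm[of _ n] P.r_neg)
    finally show "?p (?inv (\<psi>1 n), n) = n" .
  qed
qed

text \<open>The complement demanded by \<open>in_add\<close> is the kernel of p, copied to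
  \<open>'k vec\<close>; \<open>?e\<close>, the identity minus \<open>i p\<close>, is the projection
  onto it.\<close>

lemma in_add_retract:
  assumes "fd_module A T" "fd_module A M"
    and i: "i \<in> mod_hom A M (dsum {..<n::nat} (\<lambda>_. T))" and p: "p \<in> mod_hom A (dsum {..<n} (\<lambda>_. T)) M"
    and pi: "\<And>x. x \<in> carrier M \<Longrightarrow> p (i x) = x"
  shows "in_add A T M"
proof -
  let ?D = "dsum {..<n} (\<lambda>_. T)"
  have fdD: "fd_module A ?D" by (rule fd_module_dsum) (simp_all add: assms(1))
  note rm = fd_right_module[OF fdD] fd_right_module[OF assms(2)]
  interpret D: right_module A ?D by (rule rm)
  interpret M: right_module A M by (rule rm)
  let ?K = "submod ?D (a_kernel ?D M p)"
  have sub: "submodule (a_kernel ?D M p) A ?D" by (rule submodule_a_kernel[OF rm p])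
  have fdK: "fd_module A ?K" by (rule fd_module_submod[OF fdD sub])
  obtain N :: "('e, 'k vec) module" and f g where N: "fd_module A N" "f \<in> mod_hom A ?K N"
    "g \<in> mod_hom A N ?K" "\<And>x. x \<in> carrier ?K \<Longrightarrow> g (f x) = x" "\<And>y. y \<in> carrier N \<Longrightarrow> f (g y) = y"
    by (rule ex_vec_copy[OF fdK]) (rule that)
  have g': "g \<in> mod_hom A N ?D" using mod_hom_from_submod[OF N(3)] D.submodule_closed(1)[OF sub] by blast
  let ?e = "\<lambda>x. x \<ominus>\<^bsub>?D\<^esub> i (p x)"
  have e': "?e \<in> mod_hom A ?D ?D"
    by (rule mod_hom_minus_fun[OF rm(1) mod_hom_id(2) mod_hom_comp[OF p i]])
  have e: "?e \<in> mod_hom A ?D ?K"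
  proof (rule mod_hom_submod_codomain[OF e'])
    fix x assume x: "x \<in> carrier ?D"
    note px = mod_homD(1)[OF p x]
    have "p (?e x) = p x \<ominus>\<^bsub>M\<^esub> p x"
      using mod_hom_diff[OF rm p x mod_homD(1)[OF i px]] pi[OF px] by simp
    then show "?e x \<in> a_kernel ?D M p"
      using mod_homD(1)[OF e' x] px by (simp add: a_minus_def M.r_neg)
  qed
  have "mod_iso A (dprod M N) ?D"
  proof (rule mod_isoI)
    show "(\<lambda>z. i (fst z) \<oplus>\<^bsub>?D\<^esub> g (snd z)) \<in> mod_hom A (dprod M N) ?D"
      by (rule mod_hom_plus[OF rm(1) mod_hom_comp[OF mod_hom_fst i] mod_hom_comp[OF mod_hom_snd g']])
    show "(\<lambda>x. (p x, f (?e x))) \<in> mod_hom A ?D (dprod M N)"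
      by (rule mod_hom_Pair[OF p mod_hom_comp[OF e N(2)]])
    fix z assume "z \<in> carrier (dprod M N)"
    then obtain x y where z: "z = (x, y)" "x \<in> carrier M" "y \<in> carrier N" by auto
    have cl: "i x \<in> carrier ?D" "g y \<in> carrier ?D" "g y \<in> carrier ?K" "p (g y) = \<zero>\<^bsub>M\<^esub>"
      using mod_homD(1)[OF i z(2)] mod_homD(1)[OF g' z(3)] mod_homD(1)[OF N(3) z(3)] by auto
    have px: "p (i x \<oplus>\<^bsub>?D\<^esub> g y) = x"
      using mod_homD(2)[OF p cl(1,2)] cl(4) pi[OF z(2)] z(2) by simp
    have "(i x \<oplus>\<^bsub>?D\<^esub> g y) \<ominus>\<^bsub>?D\<^esub> i x = g y"
      using cl(1,2) by (metis D.a_comm D.add.inv_solve_right' D.minus_eq D.a_closed)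
    then show "(p (i (fst z) \<oplus>\<^bsub>?D\<^esub> g (snd z)),
        f ((i (fst z) \<oplus>\<^bsub>?D\<^esub> g (snd z)) \<ominus>\<^bsub>?D\<^esub> i (p (i (fst z) \<oplus>\<^bsub>?D\<^esub> g (snd z))))) = z"
      using z px N(5) by (simp del: dsum_simps)
  next
    fix x assume x: "x \<in> carrier ?D"
    note ex = mod_homD(1)[OF e x] and ix = mod_homD(1)[OF i mod_homD(1)[OF p x]]
    have "i (p x) \<oplus>\<^bsub>?D\<^esub> ?e x = x"
      unfolding a_minus_def using x ix
      by (metis D.a_inv_closed D.a_lcomm D.r_neg D.r_zero)
    then show "i (fst (p x, f (?e x))) \<oplus>\<^bsub>?D\<^esub> g (snd (p x, f (?e x))) = x"
      using N(4)[OF ex] by (simp del: dsum_simps)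
  qed
  then show ?thesis unfolding in_add_def using assms(2) N(1) by blast
qed

text \<open>The end terms of the coresolution in \<open>tilting_module_pd1\<close> live on
  \<open>'k vec\<close>, so membership in \<open>in_add\<close> has to pass to copies.\<close>

lemma in_add_iso:
  assumes "in_add A T M" and N: "fd_module A (N :: ('e, 'n) module)" "f \<in> mod_hom A M N" "g \<in> mod_hom A N M"
    "\<And>x. x \<in> carrier M \<Longrightarrow> g (f x) = x" "\<And>y. y \<in> carrier N \<Longrightarrow> f (g y) = y"
  shows "in_add A T N"
proof -
  obtain L :: "('e, 'k vec) module" and n where L: "fd_module A L"
    and iso: "mod_iso A (dprod M L) (dsum {..<n::nat} (\<lambda>_. T))" and M: "fd_module A M"
    using assms(1) unfolding in_add_def by blast
  have rm: "right_module A (dprod M L)" by (intro right_module_dprod fd_right_module M L)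
  obtain u v where u: "u \<in> mod_hom A (dprod M L) (dsum {..<n} (\<lambda>_. T))" and v: "v \<in> mod_hom A (dsum {..<n} (\<lambda>_. T)) (dprod M L)"
    and vu: "\<And>x. x \<in> carrier (dprod M L) \<Longrightarrow> v (u x) = x" and uv: "\<And>y. y \<in> carrier (dsum {..<n} (\<lambda>_. T)) \<Longrightarrow> u (v y) = y"
    by (rule mod_isoE[OF iso rm]) (rule that)
  have "mod_iso A (dprod N L) (dsum {..<n} (\<lambda>_. T))"
  proof (rule mod_isoI)
    show "(\<lambda>z. u (g (fst z), snd z)) \<in> mod_hom A (dprod N L) (dsum {..<n} (\<lambda>_. T))"
      by (rule mod_hom_comp[OF mod_hom_Pair[OF mod_hom_comp[OF mod_hom_fst N(3)] mod_hom_snd] u])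
    show "(\<lambda>y. (f (fst (v y)), snd (v y))) \<in> mod_hom A (dsum {..<n} (\<lambda>_. T)) (dprod N L)"
      by (rule mod_hom_Pair[OF mod_hom_comp[OF mod_hom_comp[OF v mod_hom_fst] N(2)] mod_hom_comp[OF v mod_hom_snd]])
    fix z assume "z \<in> carrier (dprod N L)"
    then show "(f (fst (v (u (g (fst z), snd z)))), snd (v (u (g (fst z), snd z)))) = z"
      using vu[of "(g (fst z), snd z)"] N(5) mod_homD(1)[OF N(3)] by (auto simp del: dsum_simps)
  next
    fix y assume y: "y \<in> carrier (dsum {..<n} (\<lambda>_. T))"
    have "fst (v y) \<in> carrier M" using mod_homD(1)[OF v y] by auto
    then show "u (g (fst (f (fst (v y)), snd (v y))), snd (f (fst (v y)), snd (v y))) = y"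
      using N(4) uv[OF y] by (simp del: dsum_simps)
  qed
  then show ?thesis unfolding in_add_def using N(1) L by blast
qed

end

section \<open>Complexes\<close>

lemma (in right_module) coset_eq_iff:
  assumes N: "submodule N A M" and x: "x \<in> carrier M" and y: "y \<in> carrier M"
  shows "N +>\<^bsub>M\<^esub> x = N +>\<^bsub>M\<^esub> y \<longleftrightarrow> (\<exists>n\<in>N. x = n \<oplus>\<^bsub>M\<^esub> y)"
proof -
  note Nc = submodule_closed[OF N]
  have cos: "N +>\<^bsub>M\<^esub> z = (\<lambda>n. n \<oplus>\<^bsub>M\<^esub> z) ` N" for z by (auto simp: a_r_coset_def')
  show ?thesis
  proof
    assume "N +>\<^bsub>M\<^esub> x = N +>\<^bsub>M\<^esub> y"
    moreover have "x \<in> N +>\<^bsub>M\<^esub> x" using Nc(2) x by (auto simp: cos image_iff intro!: bexI[of _ "\<zero>\<^bsub>M\<^esub>"])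
    ultimately show "\<exists>n\<in>N. x = n \<oplus>\<^bsub>M\<^esub> y" by (auto simp: cos)
  next
    assume "\<exists>n\<in>N. x = n \<oplus>\<^bsub>M\<^esub> y"
    then obtain n where n: "n \<in> N" "x = n \<oplus>\<^bsub>M\<^esub> y" by blast
    have nc: "m \<in> carrier M" if "m \<in> N" for m using Nc(1) that by auto
    have "m \<oplus>\<^bsub>M\<^esub> x \<in> N +>\<^bsub>M\<^esub> y" if "m \<in> N" for m
      unfolding cos n(2) using that n y Nc(3) nc
      by (intro image_eqI[of _ _ "m \<oplus>\<^bsub>M\<^esub> n"]) (auto simp: M.a_assoc)
    moreover have "m \<oplus>\<^bsub>M\<^esub> y \<in> N +>\<^bsub>M\<^esub> x" if "m \<in> N" for m
    proof -
      have "m \<oplus>\<^bsub>M\<^esub> y = (m \<oplus>\<^bsub>M\<^esub> \<ominus>\<^bsub>M\<^esub> n) \<oplus>\<^bsub>M\<^esub> x"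
        unfolding n(2) using that n y nc by (simp add: M.a_assoc M.r_neg1)
      then show ?thesis
        unfolding cos using that n Nc(3,4) by (intro image_eqI[of _ _ "m \<oplus>\<^bsub>M\<^esub> \<ominus>\<^bsub>M\<^esub> n"]) auto
    qed
    ultimately show "N +>\<^bsub>M\<^esub> x = N +>\<^bsub>M\<^esub> y" by (auto simp: cos)
  qed
qed

context kalgebra
begin

text \<open>Maps on classes are defined as unions over representatives. As f maps K into N, all
  members of such a union coincide.\<close>

lemma coset_Union:
  assumes M: "right_module A M" and N: "submodule N A M" and L: "right_module A L" "submodule K A L" and f: "f \<in> mod_hom A L M"
    and fK: "\<And>x. x \<in> K \<Longrightarrow> f x \<in> N" and x: "x \<in> carrier L"
  shows "(\<Union>y\<in>K +>\<^bsub>L\<^esub> x. N +>\<^bsub>M\<^esub> f y) = N +>\<^bsub>M\<^esub> f x"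
proof -
  interpret M: right_module A M by fact
  interpret L: right_module A L by fact
  note Kc = L.submodule_closed[OF L(2)]
  have "N +>\<^bsub>M\<^esub> f (n \<oplus>\<^bsub>L\<^esub> x) = N +>\<^bsub>M\<^esub> f x" if "n \<in> K" for n
    using that Kc(1) x fK[OF that] mod_homD(1,2)[OF f]
    by (subst M.coset_eq_iff[OF N]) (auto intro!: bexI[of _ "f n"])
  moreover have "K +>\<^bsub>L\<^esub> x = (\<lambda>n. n \<oplus>\<^bsub>L\<^esub> x) ` K" by (auto simp: a_r_coset_def')
  ultimately show ?thesis using Kc(2) by auto
qed

section \<open>Bounded complexes and quasi-isomorphisms\<close>

lemma bounded_cplxD:
  assumes "bounded_cplx A X"
  shows "fd_module A (cobj X n)" "right_module A (cobj X n)"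
    "cdiff X n \<in> mod_hom A (cobj X n) (cobj X (n + 1))"
    "x \<in> carrier (cobj X n) \<Longrightarrow> cdiff X (n + 1) (cdiff X n x) = \<zero>\<^bsub>cobj X (n + 2)\<^esub>"
  using assms by (auto simp: bounded_cplx_def fd_right_module)

lemma cdiff_pred:
  assumes "bounded_cplx A X"
  shows "cdiff X (n - 1) \<in> mod_hom A (cobj X (n - 1)) (cobj X n)"
  using bounded_cplxD(3)[OF assms, of "n - 1"] by simp

lemma submodule_cocycles: "bounded_cplx A X \<Longrightarrow> submodule (cocycles X n) A (cobj X n)"
  unfolding cocycles_def by (intro submodule_a_kernel bounded_cplxD)

lemma submodule_coboundaries: "bounded_cplx A X \<Longrightarrow> submodule (coboundaries X n) A (cobj X n)"
  unfolding coboundaries_def by (intro submodule_image cdiff_pred bounded_cplxD)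

lemma cocycles_iff: "x \<in> cocycles X n \<longleftrightarrow> x \<in> carrier (cobj X n) \<and> cdiff X n x = \<zero>\<^bsub>cobj X (n + 1)\<^esub>"
  by (simp add: cocycles_def)

lemma coboundaries_subset: "bounded_cplx A X \<Longrightarrow> coboundaries X n \<subseteq> cocycles X n"
  using bounded_cplxD(4)[of X _ "n - 1"] mod_homD(1)[OF cdiff_pred[of X n]]
  by (auto simp: coboundaries_def cocycles_iff add.commute)

lemma chain_mapD:
  assumes "chain_map A X Y f"
  shows "f n \<in> mod_hom A (cobj X n) (cobj Y n)"
    "x \<in> carrier (cobj X n) \<Longrightarrow> f (n + 1) (cdiff X n x) = cdiff Y n (f n x)"
  using assms by (auto simp: chain_map_def)

lemma chain_map_cocycles:
  assumes "bounded_cplx A X" "bounded_cplx A Y" "chain_map A X Y f" "x \<in> cocycles X n"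
  shows "f n x \<in> cocycles Y n"
proof -
  have x: "x \<in> carrier (cobj X n)" "cdiff X n x = \<zero>\<^bsub>cobj X (n + 1)\<^esub>" using assms(4) by (auto simp: cocycles_iff)
  show ?thesis
    using chain_mapD(2)[OF assms(3) x(1)] x(2) mod_homD(1)[OF chain_mapD(1)[OF assms(3)] x(1)]
      mod_hom_zero[OF bounded_cplxD(2)[OF assms(1)] bounded_cplxD(2)[OF assms(2)] chain_mapD(1)[OF assms(3)]]
    by (simp add: cocycles_iff)
qed

lemma chain_map_coboundaries:
  assumes "bounded_cplx A X" "chain_map A X Y f" "x \<in> coboundaries X n"
  shows "f n x \<in> coboundaries Y n"
proof -
  obtain w where w: "w \<in> carrier (cobj X (n - 1))" "x = cdiff X (n - 1) w"
    using assms(3) by (auto simp: coboundaries_def)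
  have "f n x = cdiff Y (n - 1) (f (n - 1) w)"
    using chain_mapD(2)[OF assms(2) w(1)] w(2) by simp
  then show ?thesis
    using mod_homD(1)[OF chain_mapD(1)[OF assms(2)] w(1)] by (auto simp: coboundaries_def)
qed

lemma chain_map_comp:
  assumes "chain_map A X Y f" "chain_map A Y Z g"
  shows "chain_map A X Z (ccomp g f)"
  unfolding chain_map_def ccomp_def comp_def
proof (intro conjI allI ballI)
  fix n
  note f = chain_mapD[OF assms(1), where n = n] and g = chain_mapD[OF assms(2), where n = n]
  show "(\<lambda>x. g n (f n x)) \<in> mod_hom A (cobj X n) (cobj Z n)" by (rule mod_hom_comp[OF f(1) g(1)])
  fix x assume x: "x \<in> carrier (cobj X n)"
  show "g (n + 1) (f (n + 1) (cdiff X n x)) = cdiff Z n (g n (f n x))"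
    using f(2)[OF x] g(2)[OF mod_homD(1)[OF f(1) x]] by simp
qed

lemma carrier_cohomology: "carrier (cohomology X n) = (\<lambda>x. coboundaries X n +>\<^bsub>cobj X n\<^esub> x) ` cocycles X n"
  by (auto simp: cohomology_def quot_mod_def A_RCOSETS_def' a_r_coset_def')

text \<open>Surjectivity and injectivity on cohomology in terms of elements. Cosets do not appear in
  later arguments about quasi-isomorphisms.\<close>

lemma quasi_iso_iff:
  assumes X: "bounded_cplx A X" and Y: "bounded_cplx A Y" and f: "chain_map A X Y f"
  shows "quasi_iso A X Y f \<longleftrightarrow> (\<forall>n.
    (\<forall>y\<in>cocycles Y n. \<exists>x\<in>cocycles X n. \<exists>b\<in>coboundaries Y n. y = b \<oplus>\<^bsub>cobj Y n\<^esub> f n x) \<and>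
    (\<forall>x\<in>cocycles X n. f n x \<in> coboundaries Y n \<longrightarrow> x \<in> coboundaries X n))"
proof -
  have "bij_betw (coh_map Y f n) (carrier (cohomology X n)) (carrier (cohomology Y n)) \<longleftrightarrow>
    (\<forall>y\<in>cocycles Y n. \<exists>x\<in>cocycles X n. \<exists>b\<in>coboundaries Y n. y = b \<oplus>\<^bsub>cobj Y n\<^esub> f n x) \<and>
    (\<forall>x\<in>cocycles X n. f n x \<in> coboundaries Y n \<longrightarrow> x \<in> coboundaries X n)" (is "?L \<longleftrightarrow> ?S \<and> ?I") for n
  proof -
    interpret Xn: right_module A "cobj X n" by (rule bounded_cplxD(2)[OF X])
    interpret Yn: right_module A "cobj Y n" by (rule bounded_cplxD(2)[OF Y])
    note sX = submodule_coboundaries[OF X, of n] and sY = submodule_coboundaries[OF Y, of n]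
    note fn = chain_mapD(1)[OF f, of n]
    let ?cX = "\<lambda>x. coboundaries X n +>\<^bsub>cobj X n\<^esub> x" and ?cY = "\<lambda>x. coboundaries Y n +>\<^bsub>cobj Y n\<^esub> x"
    have zX: "x \<in> carrier (cobj X n)" if "x \<in> cocycles X n" for x using that by (simp add: cocycles_iff)
    have zY: "x \<in> carrier (cobj Y n)" if "x \<in> cocycles Y n" for x using that by (simp add: cocycles_iff)
    note fz = chain_map_cocycles[OF X Y f]
    have F: "coh_map Y f n (?cX x) = ?cY (f n x)" if "x \<in> cocycles X n" for x
      unfolding coh_map_def
      by (rule coset_Union[OF Yn.right_module_axioms sY Xn.right_module_axioms sX fn chain_map_coboundaries[OF X f] zX[OF that]])
    have F': "coh_map Y f n ` carrier (cohomology X n) = (\<lambda>x. ?cY (f n x)) ` cocycles X n"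
      unfolding carrier_cohomology image_image by (rule image_cong) (simp_all add: F)
    have "coh_map Y f n ` carrier (cohomology X n) = carrier (cohomology Y n) \<longleftrightarrow> ?S"
    proof
      assume eq: "coh_map Y f n ` carrier (cohomology X n) = carrier (cohomology Y n)"
      show ?S
      proof
        fix y assume y: "y \<in> cocycles Y n"
        then have "?cY y \<in> ?cY ` cocycles Y n" by (rule imageI)
        then have "?cY y \<in> (\<lambda>x. ?cY (f n x)) ` cocycles X n"
          using eq unfolding F' unfolding carrier_cohomology by (simp only:)
        then obtain x where x: "?cY y = ?cY (f n x)" "x \<in> cocycles X n" by (rule imageE)
        show "\<exists>x\<in>cocycles X n. \<exists>b\<in>coboundaries Y n. y = b \<oplus>\<^bsub>cobj Y n\<^esub> f n x"
          using iffD1[OF Yn.coset_eq_iff[OF sY zY[OF y] zY[OF fz[OF x(2)]]] x(1)] x(2) by (rule bexI)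
      qed
    next
      assume S: ?S
      have "?cY y \<in> (\<lambda>x. ?cY (f n x)) ` cocycles X n" if y: "y \<in> cocycles Y n" for y
      proof -
        obtain x b where x: "x \<in> cocycles X n" "b \<in> coboundaries Y n" "y = b \<oplus>\<^bsub>cobj Y n\<^esub> f n x"
          using S y by blast
        have "?cY y = ?cY (f n x)"
          unfolding Yn.coset_eq_iff[OF sY zY[OF y] zY[OF fz[OF x(1)]]] using x(3,2) by (rule bexI)
        then show ?thesis using x(1) by (rule image_eqI)
      qed
      then show "coh_map Y f n ` carrier (cohomology X n) = carrier (cohomology Y n)"
        unfolding F' unfolding carrier_cohomology
        by (intro subset_antisym image_subsetI) (rule imageI, erule fz)
    qed
    moreover have "inj_on (coh_map Y f n) (carrier (cohomology X n)) \<longleftrightarrow> ?I"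
    proof
      assume inj: "inj_on (coh_map Y f n) (carrier (cohomology X n))"
      show ?I
      proof (intro ballI impI)
        fix x assume x: "x \<in> cocycles X n" "f n x \<in> coboundaries Y n"
        have z: "\<zero>\<^bsub>cobj X n\<^esub> \<in> cocycles X n" by (rule Xn.submodule_closed(2)[OF submodule_cocycles[OF X]])
        have fz0: "f n \<zero>\<^bsub>cobj X n\<^esub> = \<zero>\<^bsub>cobj Y n\<^esub>"
          by (rule mod_hom_zero[OF Xn.right_module_axioms Yn.right_module_axioms fn])
        have "?cY (f n x) = ?cY (f n \<zero>\<^bsub>cobj X n\<^esub>)"
          using x(2) zY[OF fz[OF x(1)]] unfolding fz0
          by (subst Yn.coset_eq_iff[OF sY]) (auto intro!: bexI[of _ "f n x"])
        then have "coh_map Y f n (?cX x) = coh_map Y f n (?cX \<zero>\<^bsub>cobj X n\<^esub>)"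
          using F[OF x(1)] F[OF z] by simp
        then have "?cX x = ?cX \<zero>\<^bsub>cobj X n\<^esub>"
          using inj_onD[OF inj] imageI[OF x(1), of ?cX] imageI[OF z, of ?cX] unfolding carrier_cohomology by metis
        then obtain b where "b \<in> coboundaries X n" "x = b \<oplus>\<^bsub>cobj X n\<^esub> \<zero>\<^bsub>cobj X n\<^esub>"
          unfolding Xn.coset_eq_iff[OF sX zX[OF x(1)] zX[OF z]] by (rule bexE)
        then show "x \<in> coboundaries X n" using Xn.submodule_closed(1)[OF sX] by auto
      qed
    next
      assume I: ?I
      \<comment> \<open>If x and y have the same image class, then \<open>?d\<close>, which is x
        minus y, is a cocycle whose image is a coboundary.\<close>
      have cos: "?cX x = ?cX y" if xy: "x \<in> cocycles X n" "y \<in> cocycles X n" "?cY (f n x) = ?cY (f n y)" for x y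
      proof -
        note xc = zX[OF xy(1)] zX[OF xy(2)]
        note fc = zY[OF fz[OF xy(1)]] zY[OF fz[OF xy(2)]]
        obtain b where b: "b \<in> coboundaries Y n" "f n x = b \<oplus>\<^bsub>cobj Y n\<^esub> f n y"
          using xy(3) unfolding Yn.coset_eq_iff[OF sY fc] by (rule bexE)
        have bc: "b \<in> carrier (cobj Y n)" using b Yn.submodule_closed(1)[OF sY] by auto
        let ?d = "x \<oplus>\<^bsub>cobj X n\<^esub> \<ominus>\<^bsub>cobj X n\<^esub> y"
        have "f n ?d = b"
          using mod_homD(2)[OF fn xc(1), of "\<ominus>\<^bsub>cobj X n\<^esub> y"] xc fc bc b(2)
            mod_hom_minus[OF Xn.right_module_axioms Yn.right_module_axioms fn xc(2)]
          by (simp add: Yn.M.a_assoc Yn.M.r_neg)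
        moreover have "?d \<in> cocycles X n"
          using Xn.submodule_closed(3,4)[OF submodule_cocycles[OF X]] xy by blast
        ultimately have "?d \<in> coboundaries X n" using I b(1) by auto
        moreover have "x = ?d \<oplus>\<^bsub>cobj X n\<^esub> y" using xc by (simp add: Xn.M.a_assoc Xn.M.l_neg)
        ultimately show ?thesis unfolding Xn.coset_eq_iff[OF sX xc] by (rule bexI[rotated])
      qed
      show "inj_on (coh_map Y f n) (carrier (cohomology X n))"
      proof (intro inj_onI)
        fix C D
        assume CD: "C \<in> carrier (cohomology X n)" "D \<in> carrier (cohomology X n)"
          "coh_map Y f n C = coh_map Y f n D"
        obtain x where x: "C = ?cX x" "x \<in> cocycles X n"
          using CD(1) unfolding carrier_cohomology by (rule imageE)
        obtain y where y: "D = ?cX y" "y \<in> cocycles X n"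
          using CD(2) unfolding carrier_cohomology by (rule imageE)
        show "C = D"
          unfolding x(1) y(1) using cos[OF x(2) y(2)]
            CD(3) unfolding x(1) y(1) F[OF x(2)] F[OF y(2)] by simp
      qed
    qed
    ultimately show ?thesis by (simp add: bij_betw_def conj_commute)
  qed
  then show ?thesis using f by (simp add: quasi_iso_def)
qed

lemma quasi_iso_chain_map: "quasi_iso A X Y f \<Longrightarrow> chain_map A X Y f"
  by (simp add: quasi_iso_def)

lemma quasi_isoD:
  assumes X: "bounded_cplx A X" and Y: "bounded_cplx A Y" and f: "quasi_iso A X Y f"
  shows "y \<in> cocycles Y n \<Longrightarrow> \<exists>x\<in>cocycles X n. \<exists>b\<in>coboundaries Y n. y = b \<oplus>\<^bsub>cobj Y n\<^esub> f n x"
    "\<lbrakk>x \<in> cocycles X n; f n x \<in> coboundaries Y n\<rbrakk> \<Longrightarrow> x \<in> coboundaries X n"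
  using quasi_iso_iff[OF X Y quasi_iso_chain_map[OF f]] f by auto

text \<open>Chain maps are total functions, of which only the values on the carriers matter.\<close>

lemma quasi_iso_cong:
  assumes X: "bounded_cplx A X" and Y: "bounded_cplx A Y" and f: "quasi_iso A X Y f"
    and g: "chain_map A X Y g" and eq: "\<And>n x. x \<in> carrier (cobj X n) \<Longrightarrow> g n x = f n x"
  shows "quasi_iso A X Y g"
proof -
  have "g n x = f n x" if "x \<in> cocycles X n" for n x using eq that by (simp add: cocycles_iff)
  then show ?thesis
    using quasi_iso_iff[OF X Y g] quasi_isoD[OF X Y f] by metis
qed

lemma quasi_iso_comp:
  assumes X: "bounded_cplx A X" and Y: "bounded_cplx A Y" and Z: "bounded_cplx A Z"
    and f: "quasi_iso A X Y f" and g: "quasi_iso A Y Z g"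
  shows "quasi_iso A X Z (ccomp g f)"
proof -
  show ?thesis
    unfolding quasi_iso_iff[OF X Z chain_map_comp[OF quasi_iso_chain_map[OF f] quasi_iso_chain_map[OF g]]]
  proof (intro allI conjI ballI impI)
    fix n z assume z: "z \<in> cocycles Z n"
    interpret Zn: right_module A "cobj Z n" by (rule bounded_cplxD(2)[OF Z])
    note sZ = submodule_coboundaries[OF Z, of n]
    note gn = chain_mapD(1)[OF quasi_iso_chain_map[OF g], of n] and fn = chain_mapD(1)[OF quasi_iso_chain_map[OF f], of n]
    obtain y b where y: "y \<in> cocycles Y n" "b \<in> coboundaries Z n" "z = b \<oplus>\<^bsub>cobj Z n\<^esub> g n y"
      using quasi_isoD(1)[OF Y Z g z] by blast
    obtain x b' where x: "x \<in> cocycles X n" "b' \<in> coboundaries Y n" "y = b' \<oplus>\<^bsub>cobj Y n\<^esub> f n x"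
      using quasi_isoD(1)[OF X Y f y(1)] by blast
    have gb: "g n b' \<in> coboundaries Z n"
      by (rule chain_map_coboundaries[OF Y quasi_iso_chain_map[OF g] x(2)])
    have xc: "x \<in> carrier (cobj X n)" "b' \<in> carrier (cobj Y n)"
      using x coboundaries_subset[OF Y, of n] by (auto simp: cocycles_iff)
    have "z = (b \<oplus>\<^bsub>cobj Z n\<^esub> g n b') \<oplus>\<^bsub>cobj Z n\<^esub> g n (f n x)"
      unfolding y(3) x(3) using mod_homD(1)[OF fn xc(1)] mod_homD(1,2)[OF gn] xc y(2)
        Zn.submodule_closed(1)[OF sZ] by (simp add: Zn.M.a_assoc subset_eq)
    then show "\<exists>x\<in>cocycles X n. \<exists>b\<in>coboundaries Z n. z = b \<oplus>\<^bsub>cobj Z n\<^esub> ccomp g f n x"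
      using x(1) Zn.submodule_closed(3)[OF sZ y(2) gb] by (auto simp: ccomp_def)
  next
    fix n x assume x: "x \<in> cocycles X n" "ccomp g f n x \<in> coboundaries Z n"
    have "f n x \<in> coboundaries Y n"
      using quasi_isoD(2)[OF Y Z g chain_map_cocycles[OF X Y quasi_iso_chain_map[OF f] x(1)]] x(2)
      by (simp add: ccomp_def)
    then show "x \<in> coboundaries X n" by (rule quasi_isoD(2)[OF X Y f x(1)])
  qed
qed

text \<open>A degreewise inverse g that is a chain map carries cocycles and coboundaries
  back.\<close>

lemma quasi_iso_iso:
  assumes X: "bounded_cplx A X" and Y: "bounded_cplx A Y" and f: "chain_map A X Y f" and g: "chain_map A Y X g"
    and gf: "\<And>n x. x \<in> carrier (cobj X n) \<Longrightarrow> g n (f n x) = x"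
    and fg: "\<And>n y. y \<in> carrier (cobj Y n) \<Longrightarrow> f n (g n y) = y"
  shows "quasi_iso A X Y f"
  unfolding quasi_iso_iff[OF X Y f]
proof (intro allI conjI ballI impI)
  fix n y assume y: "y \<in> cocycles Y n"
  interpret Yn: right_module A "cobj Y n" by (rule bounded_cplxD(2)[OF Y])
  have "y = \<zero>\<^bsub>cobj Y n\<^esub> \<oplus>\<^bsub>cobj Y n\<^esub> f n (g n y)" using y fg by (simp add: cocycles_iff)
  then show "\<exists>x\<in>cocycles X n. \<exists>b\<in>coboundaries Y n. y = b \<oplus>\<^bsub>cobj Y n\<^esub> f n x"
    using chain_map_cocycles[OF Y X g y] Yn.submodule_closed(2)[OF submodule_coboundaries[OF Y]] by blast
next
  fix n x assume x: "x \<in> cocycles X n" "f n x \<in> coboundaries Y n"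
  have "g n (f n x) \<in> coboundaries X n" by (rule chain_map_coboundaries[OF Y g x(2)])
  then show "x \<in> coboundaries X n" using gf x(1) by (simp add: cocycles_iff)
qed

text \<open>The middle complex of a roof must live on \<open>'k vec\<close>. Copying each term
  supplies one, together with a strict inverse t of the quasi-isomorphism s.\<close>

lemma ex_vec_cplx:
  assumes X: "bounded_cplx A (X :: ('e, 'm) cplx)"
  obtains Z :: "('e, 'k vec) cplx" and s t
  where "bounded_cplx A Z" "quasi_iso A Z X s" "chain_map A X Z t"
    "\<And>n z. z \<in> carrier (cobj Z n) \<Longrightarrow> t n (s n z) = z" "\<And>n x. x \<in> carrier (cobj X n) \<Longrightarrow> s n (t n x) = x"
proof -
  have "\<forall>n. \<exists>w. fd_module A (fst w :: ('e, 'k vec) module) \<and>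
      fst (snd w) \<in> mod_hom A (cobj X n) (fst w) \<and> snd (snd w) \<in> mod_hom A (fst w) (cobj X n) \<and>
      (\<forall>x\<in>carrier (cobj X n). snd (snd w) (fst (snd w) x) = x) \<and>
      (\<forall>y\<in>carrier (fst w). fst (snd w) (snd (snd w) y) = y)"
  proof
    fix n
    obtain M' :: "('e, 'k vec) module" and f g where "fd_module A M'" "f \<in> mod_hom A (cobj X n) M'"
      "g \<in> mod_hom A M' (cobj X n)" "\<And>x. x \<in> carrier (cobj X n) \<Longrightarrow> g (f x) = x"
      "\<And>y. y \<in> carrier M' \<Longrightarrow> f (g y) = y"
      by (rule ex_vec_copy[OF bounded_cplxD(1)[OF X]]) (rule that)
    then show "\<exists>w. fd_module A (fst w :: ('e, 'k vec) module) \<and>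
      fst (snd w) \<in> mod_hom A (cobj X n) (fst w) \<and> snd (snd w) \<in> mod_hom A (fst w) (cobj X n) \<and>
      (\<forall>x\<in>carrier (cobj X n). snd (snd w) (fst (snd w) x) = x) \<and>
      (\<forall>y\<in>carrier (fst w). fst (snd w) (snd (snd w) y) = y)"
      by (intro exI[of _ "(M', f, g)"]) simp
  qed
  from choice[OF this] obtain w where w: "\<And>n. fd_module A (fst (w n) :: ('e, 'k vec) module)"
      "\<And>n. fst (snd (w n)) \<in> mod_hom A (cobj X n) (fst (w n))"
      "\<And>n. snd (snd (w n)) \<in> mod_hom A (fst (w n)) (cobj X n)"
      "\<And>n x. x \<in> carrier (cobj X n) \<Longrightarrow> snd (snd (w n)) (fst (snd (w n)) x) = x"
      "\<And>n y. y \<in> carrier (fst (w n)) \<Longrightarrow> fst (snd (w n)) (snd (snd (w n)) y) = y"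
    by blast
  define t where "t n = fst (snd (w n))" for n
  define s where "s n = snd (snd (w n))" for n
  \<comment> \<open>The differential is conjugated with the chosen isomorphisms.\<close>
  define Z where "Z = \<lparr>cobj = (\<lambda>n. fst (w n)), cdiff = (\<lambda>n z. t (n + 1) (cdiff X n (s n z)))\<rparr>"
  have Zo: "cobj Z n = fst (w n)" and Zd: "cdiff Z n z = t (n + 1) (cdiff X n (s n z))" for n z
    by (simp_all add: Z_def)
  have t: "t n \<in> mod_hom A (cobj X n) (cobj Z n)" and s: "s n \<in> mod_hom A (cobj Z n) (cobj X n)"
    and st: "x \<in> carrier (cobj X n) \<Longrightarrow> s n (t n x) = x" and ts: "z \<in> carrier (cobj Z n) \<Longrightarrow> t n (s n z) = z" for n x z
    using w by (simp_all add: t_def s_def Zo)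
  have rmZ: "right_module A (cobj Z n)" for n using w(1) by (simp add: Zo fd_right_module)
  have tz: "t n \<zero>\<^bsub>cobj X n\<^esub> = \<zero>\<^bsub>cobj Z n\<^esub>" for n
    by (rule mod_hom_zero[OF bounded_cplxD(2)[OF X] rmZ t])
  have d: "cdiff Z n \<in> mod_hom A (cobj Z n) (cobj Z (n + 1))" for n
    unfolding Zd by (rule mod_hom_comp[OF mod_hom_comp[OF s bounded_cplxD(3)[OF X]] t])
  have bd: "bounded_cplx A Z"
    unfolding bounded_cplx_def
  proof (intro conjI allI ballI)
    show "fd_module A (cobj Z n)" for n using w(1) by (simp add: Zo)
    show "cdiff Z n \<in> mod_hom A (cobj Z n) (cobj Z (n + 1))" for n by (rule d)
    fix n z assume z: "z \<in> carrier (cobj Z n)"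
    note sz = mod_homD(1)[OF s z]
    note dsz = mod_homD(1)[OF bounded_cplxD(3)[OF X] sz]
    show "cdiff Z (n + 1) (cdiff Z n z) = \<zero>\<^bsub>cobj Z (n + 2)\<^esub>"
      unfolding Zd st[OF dsz] bounded_cplxD(4)[OF X sz] using tz[of "n + 2"] by (simp add: add.assoc)
  next
    obtain b where b: "\<forall>n. \<bar>n\<bar> > b \<longrightarrow> carrier (cobj X n) = {\<zero>\<^bsub>cobj X n\<^esub>}"
      using X by (auto simp: bounded_cplx_def)
    have "carrier (cobj Z n) = {\<zero>\<^bsub>cobj Z n\<^esub>}" if "\<bar>n\<bar> > b" for n
    proof -
      interpret Zn: right_module A "cobj Z n" by (rule rmZ)
      have "z = \<zero>\<^bsub>cobj Z n\<^esub>" if z: "z \<in> carrier (cobj Z n)" for z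
        using mod_homD(1)[OF s z] b \<open>\<bar>n\<bar> > b\<close> ts[OF z] tz[of n] by auto
      then show ?thesis by auto
    qed
    then show "\<exists>b. \<forall>n. \<bar>n\<bar> > b \<longrightarrow> carrier (cobj Z n) = {\<zero>\<^bsub>cobj Z n\<^esub>}" by blast
  qed
  have cs: "chain_map A Z X s"
    unfolding chain_map_def Zd using s st mod_homD(1)[OF bounded_cplxD(3)[OF X] mod_homD(1)[OF s]] by auto
  have ct: "chain_map A X Z t"
    unfolding chain_map_def Zd using t st by auto
  show ?thesis
  proof (rule that[of Z s t])
    show "quasi_iso A Z X s" by (rule quasi_iso_iso[OF bd X cs ct]) (simp_all add: st ts)
  qed (simp_all add: bd ct st ts)
qed

section \<open>Homotopies and isomorphisms in the derived category\<close>

lemma homotopic_refl: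
  assumes "bounded_cplx A X" "\<And>n. right_module A (cobj Y n)" "\<And>n. cdiff Y n \<zero>\<^bsub>cobj Y n\<^esub> = \<zero>\<^bsub>cobj Y (n + 1)\<^esub>"
    and "\<And>n x. x \<in> carrier (cobj X n) \<Longrightarrow> f n x = g n x \<and> g n x \<in> carrier (cobj Y n)"
  shows "homotopic A X Y f g"
  unfolding homotopic_def
proof (intro exI[of _ "\<lambda>n _. \<zero>\<^bsub>cobj Y (n - 1)\<^esub>"] conjI allI ballI)
  show "(\<lambda>_. \<zero>\<^bsub>cobj Y (n - 1)\<^esub>) \<in> mod_hom A (cobj X n) (cobj Y (n - 1))" for n
    by (rule mod_hom_const_zero[OF assms(2)])
  fix n x assume x: "x \<in> carrier (cobj X n)"
  interpret Yn: right_module A "cobj Y n" by (rule assms(2))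
  show "f n x = g n x \<oplus>\<^bsub>cobj Y n\<^esub>
      (cdiff Y (n - 1) \<zero>\<^bsub>cobj Y (n - 1)\<^esub> \<oplus>\<^bsub>cobj Y n\<^esub> \<zero>\<^bsub>cobj Y (n + 1 - 1)\<^esub>)"
    using assms(3)[of "n - 1"] assms(4)[OF x] by simp
qed

lemma homotopic_refl_bounded:
  assumes "bounded_cplx A X" "bounded_cplx A Y" "chain_map A X Y f"
  shows "homotopic A X Y f f"
  using assms
  by (intro homotopic_refl) (auto simp: bounded_cplxD(2) mod_homD(1)[OF chain_mapD(1)]
      intro: mod_hom_zero[OF bounded_cplxD(2) bounded_cplxD(2) bounded_cplxD(3)])

text \<open>Both legs of the roof \<open>(Z, s, q s)\<close> are quasi-isomorphisms, so it can be
  read backwards, which gives its inverse. Both composites are formed with the identity of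
  Z.\<close>

lemma D_iso_of_quasi_iso:
  assumes X: "bounded_cplx A X" and Y: "bounded_cplx A Y" and q: "quasi_iso A X Y q"
  shows "D_iso A X Y"
proof -
  obtain Z :: "('e, 'k vec) cplx" and s t where Z: "bounded_cplx A Z" "quasi_iso A Z X s"
    by (rule ex_vec_cplx[OF X])
  let ?p = "ccomp q s"
  have p: "quasi_iso A Z Y ?p" by (rule quasi_iso_comp[OF Z(1) X Y Z(2) q])
  note cs = quasi_iso_chain_map[OF Z(2)] and cp = quasi_iso_chain_map[OF p]
  let ?i = "\<lambda>(n::int) x. x :: 'k vec"
  have i: "quasi_iso A Z Z ?i"
    by (rule quasi_iso_iso[OF Z(1,1)]) (auto simp: chain_map_def)
  have 1: "(Z, ccomp s ?i, ccomp s ?i) \<in> roof_comps A Y (Z, s, ?p) (Z, ?p, s)"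
    unfolding roof_comps.simps
    using Z(1) i quasi_iso_chain_map[OF i] homotopic_refl_bounded[OF Z(1) Y chain_map_comp[OF quasi_iso_chain_map[OF i] cp]]
    by blast
  have 2: "(Z, ccomp ?p ?i, ccomp ?p ?i) \<in> roof_comps A X (Z, ?p, s) (Z, s, ?p)"
    unfolding roof_comps.simps
    using Z(1) i quasi_iso_chain_map[OF i] homotopic_refl_bounded[OF Z(1) X chain_map_comp[OF quasi_iso_chain_map[OF i] cs]]
    by blast
  \<comment> \<open>A roof with two equal legs represents the identity, again by way of Z
    itself.\<close>
  have 3: "represents_id A V (Z, ccomp v ?i, ccomp v ?i)" if V: "bounded_cplx A V" "quasi_iso A Z V v" for V v
  proof -
    have v: "ccomp v ?i = v" by (simp add: ccomp_def comp_def)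
    show ?thesis
      unfolding v represents_id.simps roof_equiv.simps
      by (rule exI[of _ Z], rule exI[of _ ?i], rule exI[of _ ?i])
        (use Z(1) quasi_iso_chain_map[OF i] V homotopic_refl_bounded[OF Z(1) V(1) quasi_iso_chain_map[OF V(2)]]
          in \<open>simp add: v\<close>)
  qed
  have "is_roof A X Y (Z, s, ?p)" "is_roof A Y X (Z, ?p, s)"
    using Z p cs cp by simp_all
  then show ?thesis
    unfolding D_iso_def using 1 2 3[OF X Z(2)] 3[OF Y p] by blast
qed

end

section \<open>Modules resolved by a two-term complex of projectives\<close>

lemma stalk_simps:
  "cobj (stalk M) n = (if n = 0 then M else zero_mod M)" "cdiff (stalk M) n = (\<lambda>x. \<zero>\<^bsub>M\<^esub>)"
  by (simp_all add: stalk_def)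

lemma (in kalgebra) bounded_cplx_stalk:
  assumes "fd_module A M" shows "bounded_cplx A (stalk M)"
proof -
  interpret M: right_module A M using assms by (rule fd_right_module)
  have "(\<lambda>x. \<zero>\<^bsub>M\<^esub>) \<in> mod_hom A N L" if "L = M \<or> L = zero_mod M" for N :: "('e, 'm) module" and L
    using that by (auto intro!: mod_homI)
  then show ?thesis
    unfolding bounded_cplx_def
    by (auto simp: stalk_simps assms fd_module_zero_mod intro!: exI[of _ 0])
qed

lemma shift_simps:
  "cobj (shift X r) n = cobj X (n + r)"
  "cdiff (shift X r) n x = (if even r then cdiff X (n + r) x
    else \<ominus>\<^bsub>cobj X (n + r + 1)\<^esub> cdiff X (n + r) x)"
  by (simp_all add: shift_def)

text \<open>The passage from the complex to the module that it resolves, kept free of quivers. It is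
  applied to \<open>T_minus\<close> and \<open>T_BB\<close>.\<close>

locale two_term_resolution = kalgebra A
  for A :: "('k::field, 'e) kalg" (structure) +
  fixes T :: "('e, 'm) cplx" and M :: "('e, 'n) module" and q :: "'m \<Rightarrow> 'n"
  assumes projective_T: "projective_cplx A T"
    and vanish: "\<lbrakk>n \<noteq> 0; n \<noteq> -1\<rbrakk> \<Longrightarrow> carrier (cobj T n) = {\<zero>\<^bsub>cobj T n\<^esub>}"
    and fd_M: "fd_module A M"
    and q_hom: "q \<in> mod_hom A (cobj T 0) M"
    and q_surj: "q ` carrier (cobj T 0) = carrier M"
    and q_kernel: "x \<in> carrier (cobj T 0) \<Longrightarrow>
      q x = \<zero>\<^bsub>M\<^esub> \<longleftrightarrow> x \<in> cdiff T (-1) ` carrier (cobj T (-1))"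
    and d_inj: "inj_on (cdiff T (-1)) (carrier (cobj T (-1)))"
begin

definition aug :: "int \<Rightarrow> 'm \<Rightarrow> 'n" where
  "aug n x = (if n = 0 then q x else \<zero>\<^bsub>M\<^esub>)"

lemma bounded_T: "bounded_cplx A T"
  using projective_T by (simp add: projective_cplx_def)

lemma proj_T: "projective A (cobj T n)"
  using projective_T by (simp add: projective_cplx_def)

lemmas fd_T = bounded_cplxD(1)[OF bounded_T] and rm_T = bounded_cplxD(2)[OF bounded_T]

lemmas bounded_stalk_M = bounded_cplx_stalk[OF fd_M]

lemma rm_M: "right_module A M"
  by (rule fd_right_module[OF fd_M])

sublocale M: right_module A M by (rule rm_M)

lemma d_hom: "cdiff T (-1) \<in> mod_hom A (cobj T (-1)) (cobj T 0)"
  using bounded_cplxD(3)[OF bounded_T, of "-1"] by simp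

lemma zero_T: "cdiff T n \<zero>\<^bsub>cobj T n\<^esub> = \<zero>\<^bsub>cobj T (n + 1)\<^esub>"
  by (rule mod_hom_zero[OF rm_T rm_T bounded_cplxD(3)[OF bounded_T]])

lemma q_d: "x \<in> carrier (cobj T (-1)) \<Longrightarrow> q (cdiff T (-1) x) = \<zero>\<^bsub>M\<^esub>"
  using q_kernel mod_homD(1)[OF d_hom] by blast

lemma chain_map_aug: "chain_map A T (stalk M) aug"
  unfolding chain_map_def
proof (intro conjI allI ballI)
  fix n
  show "aug n \<in> mod_hom A (cobj T n) (cobj (stalk M) n)"
    using q_hom mod_hom_const_zero[OF right_module_zero_mod[OF rm_M]]
    by (cases "n = 0") (simp_all add: aug_def[abs_def] stalk_simps)
  fix x assume "x \<in> carrier (cobj T n)"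
  then show "aug (n + 1) (cdiff T n x) = cdiff (stalk M) n (aug n x)"
    using q_d by (cases "n = -1") (auto simp: aug_def stalk_simps)
qed

text \<open>In degree 0 this is exactness at the augmentation, in degree -1 injectivity of the
  differential; elsewhere both complexes are zero.\<close>

lemma quasi_iso_aug: "quasi_iso A T (stalk M) aug"
  unfolding quasi_iso_iff[OF bounded_T bounded_stalk_M chain_map_aug]
proof (intro allI conjI ballI impI)
  fix n y assume y: "y \<in> cocycles (stalk M) n"
  have z: "\<zero>\<^bsub>M\<^esub> \<in> coboundaries (stalk M) n"
    unfolding coboundaries_def by (rule image_eqI[of _ _ "\<zero>\<^bsub>M\<^esub>"]) (simp_all add: stalk_simps)
  show "\<exists>x\<in>cocycles T n. \<exists>b\<in>coboundaries (stalk M) n. y = b \<oplus>\<^bsub>cobj (stalk M) n\<^esub> aug n x"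
  proof (cases "n = 0")
    case True
    then have "y \<in> carrier M" using y by (simp add: cocycles_iff stalk_simps)
    then obtain x where x: "x \<in> carrier (cobj T 0)" "y = q x" using q_surj by blast
    have "cdiff T 0 x \<in> carrier (cobj T 1)"
      using mod_homD(1)[OF bounded_cplxD(3)[OF bounded_T] x(1)] by simp
    then have "x \<in> cocycles T 0" using x vanish[of 1] by (simp add: cocycles_iff)
    then show ?thesis
      using True x z \<open>y \<in> carrier M\<close> by (intro bexI[of _ x] bexI[of _ "\<zero>\<^bsub>M\<^esub>"]) (auto simp: stalk_simps aug_def)
  next
    case False
    then have "y = \<zero>\<^bsub>M\<^esub>" using y by (simp add: cocycles_iff stalk_simps)
    moreover have "\<zero>\<^bsub>cobj T n\<^esub> \<in> cocycles T n"
      by (rule right_module.submodule_closed(2)[OF rm_T submodule_cocycles[OF bounded_T]])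
    ultimately show ?thesis
      using False z by (intro bexI[of _ "\<zero>\<^bsub>cobj T n\<^esub>"] bexI[of _ "\<zero>\<^bsub>M\<^esub>"]) (auto simp: stalk_simps aug_def)
  qed
next
  fix n x assume x: "x \<in> cocycles T n" "aug n x \<in> coboundaries (stalk M) n"
  have zb: "\<zero>\<^bsub>cobj T n\<^esub> \<in> coboundaries T n"
    by (rule right_module.submodule_closed(2)[OF rm_T submodule_coboundaries[OF bounded_T]])
  have xc: "x \<in> carrier (cobj T n)" "cdiff T n x = \<zero>\<^bsub>cobj T (n + 1)\<^esub>" using x(1) by (auto simp: cocycles_iff)
  consider "n = 0" | "n = -1" | "n \<noteq> 0" "n \<noteq> -1" by blast
  then show "x \<in> coboundaries T n"
  proof cases
    case 1
    then have "q x = \<zero>\<^bsub>M\<^esub>" using x(2) by (auto simp: coboundaries_def stalk_simps aug_def)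
    then show ?thesis using q_kernel xc 1 by (auto simp: coboundaries_def)
  next
    case 2
    have z: "\<zero>\<^bsub>cobj T (-1)\<^esub> \<in> carrier (cobj T (-1))"
      using right_module.submodule_closed(2)[OF rm_T submodule_cocycles[OF bounded_T]] by (auto simp: cocycles_iff)
    have "x = \<zero>\<^bsub>cobj T (-1)\<^esub>"
      using inj_onD[OF d_inj _ _ z] xc zero_T[of "-1"] 2 by simp
    then show ?thesis using zb 2 by simp
  next
    case 3
    then show ?thesis using vanish[OF 3] xc zb by auto
  qed
qed

lemma D_iso_stalk: "D_iso A T (stalk M)"
  by (rule D_iso_of_quasi_iso[OF bounded_T bounded_stalk_M quasi_iso_aug])

lemma pd_le_one: "pd_le A 1 M"
proof -
  obtain P0 :: "('e, 'k vec) module" and f0 g0 where 0: "fd_module A P0" "f0 \<in> mod_hom A (cobj T 0) P0"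
    "g0 \<in> mod_hom A P0 (cobj T 0)" "\<And>x. x \<in> carrier (cobj T 0) \<Longrightarrow> g0 (f0 x) = x" "\<And>y. y \<in> carrier P0 \<Longrightarrow> f0 (g0 y) = y"
    by (rule ex_vec_copy[OF fd_T]) (rule that)
  obtain P1 :: "('e, 'k vec) module" and f1 g1 where 1: "fd_module A P1" "f1 \<in> mod_hom A (cobj T (-1)) P1"
    "g1 \<in> mod_hom A P1 (cobj T (-1))" "\<And>x. x \<in> carrier (cobj T (-1)) \<Longrightarrow> g1 (f1 x) = x" "\<And>y. y \<in> carrier P1 \<Longrightarrow> f1 (g1 y) = y"
    by (rule ex_vec_copy[OF fd_T]) (rule that)
  note rm0 = fd_right_module[OF 0(1)] and rm1 = fd_right_module[OF 1(1)]
  interpret P0: right_module A P0 by (rule rm0)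
  interpret P1: right_module A P1 by (rule rm1)
  \<comment> \<open>The two terms are numbered 0 and 1 and padded with zero modules. The value of
    \<open>?d 1\<close> is the zero of \<open>P1\<close>, that of all later maps the zero of
    \<open>P0\<close>.\<close>
  let ?P = "\<lambda>i::nat. if i = 0 then P0 else if i = 1 then P1 else zero_mod P0"
  let ?d = "\<lambda>(i::nat) x. if i = 0 then f0 (cdiff T (-1) (g1 x)) else if i = 1 then \<zero>\<^bsub>P1\<^esub> else \<zero>\<^bsub>P0\<^esub>"
  let ?e = "\<lambda>x. q (g0 x)"
  have p0: "projective A P0"
    by (rule projective_iso[OF proj_T rm0 mod_isoI[OF 0(2-5)]])
  have p1: "projective A P1"
    by (rule projective_iso[OF proj_T rm1 mod_isoI[OF 1(2-5)]])
  have d0: "(\<lambda>x. f0 (cdiff T (-1) (g1 x))) \<in> mod_hom A P1 P0"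
    by (rule mod_hom_comp[OF mod_hom_comp[OF 1(3) d_hom] 0(2)])
  have z0: "g0 \<zero>\<^bsub>P0\<^esub> = \<zero>\<^bsub>cobj T 0\<^esub>" by (rule mod_hom_zero[OF rm0 rm_T 0(3)])
  have z0': "f0 \<zero>\<^bsub>cobj T 0\<^esub> = \<zero>\<^bsub>P0\<^esub>" by (rule mod_hom_zero[OF rm_T rm0 0(2)])
  have z1: "f1 \<zero>\<^bsub>cobj T (-1)\<^esub> = \<zero>\<^bsub>P1\<^esub>" by (rule mod_hom_zero[OF rm_T rm1 1(2)])
  have inj: "x = \<zero>\<^bsub>P1\<^esub>" if x: "x \<in> carrier P1" "f0 (cdiff T (-1) (g1 x)) = \<zero>\<^bsub>P0\<^esub>" for x
  proof -
    note gx = mod_homD(1)[OF 1(3) x(1)]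
    have z: "\<zero>\<^bsub>cobj T (-1)\<^esub> \<in> carrier (cobj T (-1))"
      using right_module.submodule_closed(2)[OF rm_T submodule_cocycles[OF bounded_T]] by (auto simp: cocycles_iff)
    have "cdiff T (-1) (g1 x) = \<zero>\<^bsub>cobj T 0\<^esub>"
      using 0(4)[OF mod_homD(1)[OF d_hom gx]] x(2) z0 by simp
    then have "g1 x = \<zero>\<^bsub>cobj T (-1)\<^esub>"
      using inj_onD[OF d_inj _ gx z] zero_T[of "-1"] by simp
    then show ?thesis using 1(5)[OF x(1)] z1 by simp
  qed
  have e: "?e \<in> mod_hom A P0 M" by (rule mod_hom_comp[OF 0(3) q_hom])
  have es: "?e ` carrier P0 = carrier M"
  proof (intro subset_antisym subsetI)
    fix y assume "y \<in> carrier M"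
    then obtain x where x: "x \<in> carrier (cobj T 0)" "y = q x" using q_surj by blast
    then show "y \<in> ?e ` carrier P0"
      using 0(4) mod_homD(1)[OF 0(2) x(1)] by (intro image_eqI[of _ _ "f0 x"]) auto
  qed (use mod_homD(1)[OF e] in blast)
  have ex0: "(\<lambda>x. f0 (cdiff T (-1) (g1 x))) ` carrier P1 = a_kernel P0 M ?e"
  proof (intro subset_antisym subsetI)
    fix y assume "y \<in> (\<lambda>x. f0 (cdiff T (-1) (g1 x))) ` carrier P1"
    then obtain x where x: "x \<in> carrier P1" "y = f0 (cdiff T (-1) (g1 x))" by blast
    then show "y \<in> a_kernel P0 M ?e"
      using mod_homD(1)[OF d0 x(1)] 0(4)[OF mod_homD(1)[OF d_hom mod_homD(1)[OF 1(3) x(1)]]]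
        q_d[OF mod_homD(1)[OF 1(3) x(1)]] by simp
  next
    fix y assume "y \<in> a_kernel P0 M ?e"
    then have y: "y \<in> carrier P0" "q (g0 y) = \<zero>\<^bsub>M\<^esub>" by auto
    then obtain w where w: "w \<in> carrier (cobj T (-1))" "g0 y = cdiff T (-1) w"
      using q_kernel[OF mod_homD(1)[OF 0(3) y(1)]] by blast
    then have "y = f0 (cdiff T (-1) (g1 (f1 w)))" using 0(5)[OF y(1)] 1(4) by simp
    then show "y \<in> (\<lambda>x. f0 (cdiff T (-1) (g1 x))) ` carrier P1"
      using mod_homD(1)[OF 1(2) w(1)] by blast
  qed
  have zd: "f0 (cdiff T (-1) (g1 \<zero>\<^bsub>P1\<^esub>)) = \<zero>\<^bsub>P0\<^esub>" by (rule mod_hom_zero[OF rm1 rm0 d0])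
  show ?thesis
    unfolding pd_le_def
  proof (rule exI[of _ ?P], rule exI[of _ ?d], rule exI[of _ ?e], intro conjI allI impI)
    show "projective A (?P i)" for i using p0 p1 projective_zero_mod[OF p0] by simp
    show "carrier (?P i) = {\<zero>\<^bsub>?P i\<^esub>}" if "1 < i" for i using that by auto
    show "?d i \<in> mod_hom A (?P (Suc i)) (?P i)" for i
      using d0 by (cases "i = 0") (auto intro!: mod_homI)
    show "?e \<in> mod_hom A (?P 0) M" using e by simp
    show "?e ` carrier (?P 0) = carrier M" using es by simp
    show "exact_at (?P 1) (?P 0) M (?d 0) ?e" using ex0 by (simp add: exact_at_def)
    show "exact_at (?P (Suc (Suc i))) (?P (Suc i)) (?P i) (?d (Suc i)) (?d i)" for i
      using inj zd by (cases "i = 0") (auto simp: exact_at_def)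
  qed
qed

text \<open>Complexes of projectives lift along quasi-isomorphisms. The map q lifts to the cocycles
  of Z in degree 0; coboundaries of T are then sent to cocycles that are trivial in cohomology, and
  this gives the component in degree -1.\<close>

lemma lift_along_quasi_iso:
  assumes Z: "bounded_cplx A Z" and s: "quasi_iso A Z (stalk M) s"
  obtains u where "chain_map A T Z u" "\<And>x. x \<in> carrier (cobj T 0) \<Longrightarrow> s 0 (u 0 x) = q x"
proof -
  note cs = quasi_iso_chain_map[OF s]
  have s0: "s 0 \<in> mod_hom A (cobj Z 0) M" using chain_mapD(1)[OF cs, of 0] by (simp add: stalk_simps)
  \<comment> \<open>Lifting into the cocycles makes u compatible with the differential in degree 0.
    Already on them \<open>s 0\<close> is onto M, since the only coboundary of the stalk complex is
    zero.\<close>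
  let ?C = "submod (cobj Z 0) (cocycles Z 0)"
  have subC: "submodule (cocycles Z 0) A (cobj Z 0)" by (rule submodule_cocycles[OF Z])
  have fdC: "fd_module A ?C" by (rule fd_module_submod[OF bounded_cplxD(1)[OF Z] subC])
  have sC: "s 0 \<in> mod_hom A ?C M"
    by (rule mod_hom_submod_domain[OF s0]) (auto simp: cocycles_iff)
  have sur: "s 0 ` carrier ?C = carrier M"
  proof (intro subset_antisym subsetI)
    fix y assume y: "y \<in> carrier M"
    then have "y \<in> cocycles (stalk M) 0" by (simp add: cocycles_iff stalk_simps)
    then obtain x b where xb: "x \<in> cocycles Z 0" "b \<in> coboundaries (stalk M) 0" "y = b \<oplus>\<^bsub>cobj (stalk M) 0\<^esub> s 0 x"
      using quasi_isoD(1)[OF Z bounded_stalk_M s] by blast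
    have "b = \<zero>\<^bsub>M\<^esub>" using xb(2) by (auto simp: coboundaries_def stalk_simps)
    then have "y = s 0 x" using xb mod_homD(1)[OF s0] by (simp add: stalk_simps cocycles_iff)
    then show "y \<in> s 0 ` carrier ?C" using xb(1) by simp
  qed (use mod_homD(1)[OF sC] in blast)
  obtain u0 where u0: "u0 \<in> mod_hom A (cobj T 0) ?C" "\<And>x. x \<in> carrier (cobj T 0) \<Longrightarrow> s 0 (u0 x) = q x"
    using projective_lift[OF proj_T fdC fd_M sC sur q_hom] by blast
  have u0c: "u0 x \<in> cocycles Z 0" if "x \<in> carrier (cobj T 0)" for x using mod_homD(1)[OF u0(1) that] by simp
  have u0Z: "u0 \<in> mod_hom A (cobj T 0) (cobj Z 0)"
    by (rule mod_hom_from_submod[OF u0(1)]) (auto simp: cocycles_iff)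
  have dZ: "cdiff Z (-1) \<in> mod_hom A (cobj Z (-1)) (cobj Z 0)"
    using bounded_cplxD(3)[OF Z, of "-1"] by simp
  obtain u1 where u1: "u1 \<in> mod_hom A (cobj T (-1)) (cobj Z (-1))"
    "\<And>x. x \<in> carrier (cobj T (-1)) \<Longrightarrow> cdiff Z (-1) (u1 x) = u0 (cdiff T (-1) x)"
  proof (rule lift_into_image[OF proj_T bounded_cplxD(1,2)[OF Z] dZ mod_hom_comp[OF d_hom u0Z]])
    fix x assume x: "x \<in> carrier (cobj T (-1))"
    note dx = mod_homD(1)[OF d_hom x]
    have "s 0 (u0 (cdiff T (-1) x)) \<in> coboundaries (stalk M) 0"
      unfolding u0(2)[OF dx] q_d[OF x] coboundaries_def
      by (rule image_eqI[of _ _ "\<zero>\<^bsub>M\<^esub>"]) (simp_all add: stalk_simps)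
    then have "u0 (cdiff T (-1) x) \<in> coboundaries Z 0"
      by (rule quasi_isoD(2)[OF Z bounded_stalk_M s u0c[OF dx]])
    then show "u0 (cdiff T (-1) x) \<in> cdiff Z (-1) ` carrier (cobj Z (-1))"
      by (simp add: coboundaries_def)
  qed (rule that)
  define u where "u n x = (if n = 0 then u0 x else if n = -1 then u1 x else \<zero>\<^bsub>cobj Z n\<^esub>)" for n x
  have "chain_map A T Z u"
    unfolding chain_map_def
  proof (intro conjI allI ballI)
    fix n
    show "u n \<in> mod_hom A (cobj T n) (cobj Z n)"
      using u0Z u1(1) mod_hom_const_zero[OF bounded_cplxD(2)[OF Z]]
      by (cases "n = 0"; cases "n = -1") (simp_all add: u_def[abs_def])
    fix x assume x: "x \<in> carrier (cobj T n)"
    consider "n = 0" | "n = -1" | "n \<noteq> 0" "n \<noteq> -1" by blast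
    then show "u (n + 1) (cdiff T n x) = cdiff Z n (u n x)"
    proof cases
      case 1
      then show ?thesis using u0c[of x] x by (simp add: u_def cocycles_iff)
    next
      case 2
      then show ?thesis using u1(2)[of x] x by (simp add: u_def)
    next
      case 3
      have "cdiff Z n \<zero>\<^bsub>cobj Z n\<^esub> = \<zero>\<^bsub>cobj Z (n + 1)\<^esub>"
        by (rule mod_hom_zero[OF bounded_cplxD(2,2)[OF Z] bounded_cplxD(3)[OF Z]])
      moreover have "x = \<zero>\<^bsub>cobj T n\<^esub>" using vanish[OF 3] x by simp
      moreover have "u1 \<zero>\<^bsub>cobj T (-1)\<^esub> = \<zero>\<^bsub>cobj Z (-1)\<^esub>"
        by (rule mod_hom_zero[OF rm_T bounded_cplxD(2)[OF Z] u1(1)])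
      ultimately show ?thesis using 3 zero_T[of n] by (cases "n = -2") (auto simp: u_def)
    qed
  qed
  then show ?thesis by (rule that) (simp add: u_def u0(2))
qed

text \<open>The composite agrees with \<open>aug\<close>: in degree 0 by the assumption on u,
  elsewhere because the stalk complex is zero.\<close>

lemma quasi_iso_lift:
  assumes Z: "bounded_cplx A Z" and s: "quasi_iso A Z (stalk M) s" and u: "chain_map A T Z u"
    and su: "\<And>x. x \<in> carrier (cobj T 0) \<Longrightarrow> s 0 (u 0 x) = q x"
  shows "quasi_iso A T (stalk M) (ccomp s u)"
proof (rule quasi_iso_cong[OF bounded_T bounded_stalk_M quasi_iso_aug])
  note cs = quasi_iso_chain_map[OF s]
  show "chain_map A T (stalk M) (ccomp s u)" by (rule chain_map_comp[OF u cs])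
  fix n x assume x: "x \<in> carrier (cobj T n)"
  show "ccomp s u n x = aug n x"
    using mod_homD(1)[OF chain_mapD(1)[OF cs] mod_homD(1)[OF chain_mapD(1)[OF u] x]] su[of x] x
    by (cases "n = 0") (auto simp: ccomp_def aug_def stalk_simps)
qed

text \<open>
  A morphism \<open>M \<rightarrow> M[1]\<close> is given, after lifting \<open>T\<close> to the roof, by a map \<open>\<gamma>: T\<^sup>-\<^sup>1 \<rightarrow> M\<close>.  It
  factors through \<open>q\<close> and thereby defines a morphism \<open>T \<rightarrow> T[1]\<close>.  A homotopy killing the latter
  exists only on some \<open>W\<close> quasi-isomorphic to \<open>T\<close>; pulling it back to \<open>T\<close> changes the identity of
  \<open>T\<close> by a homotopy \<open>\<sigma>\<close>, and the result extends \<open>\<gamma>\<close> to \<open>T\<^sup>0\<close>.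
\<close>

lemma D_Hom_zero_stalk:
  assumes rigid: "D_Hom_zero A T (shift T 1)"
  shows "D_Hom_zero A (stalk M) (shift (stalk M) 1)"
proof -
  obtain Z' :: "('e, 'k vec) cplx" and s' t' where Z': "bounded_cplx A Z'" "quasi_iso A Z' T s'" "chain_map A T Z' t'"
    "\<And>n z. z \<in> carrier (cobj Z' n) \<Longrightarrow> t' n (s' n z) = z" "\<And>n x. x \<in> carrier (cobj T n) \<Longrightarrow> s' n (t' n x) = x"
    by (rule ex_vec_cplx[OF bounded_T]) (rule that)
  note cs' = quasi_iso_chain_map[OF Z'(2)]
  interpret T0: right_module A "cobj T 0" by (rule rm_T)
  interpret T1: right_module A "cobj T (-1)" by (rule rm_T)
  \<comment> \<open>In terms of the resolution, this is the vanishing of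
    \<open>Ext^1(M, M)\<close>.\<close>
  have extend: "\<exists>H\<in>mod_hom A (cobj T 0) M. \<forall>x\<in>carrier (cobj T (-1)). \<gamma> x = H (cdiff T (-1) x)"
    if \<gamma>: "\<gamma> \<in> mod_hom A (cobj T (-1)) M" for \<gamma>
  proof -
    obtain \<gamma>' where \<gamma>': "\<gamma>' \<in> mod_hom A (cobj T (-1)) (cobj T 0)" "\<And>x. x \<in> carrier (cobj T (-1)) \<Longrightarrow> q (\<gamma>' x) = \<gamma> x"
      using projective_lift[OF proj_T fd_T fd_M q_hom q_surj \<gamma>] by blast
    \<comment> \<open>Only for n = -1 can both \<open>T^n\<close> and \<open>T^(n+1)\<close> be
      non-zero.\<close>
    define G where "G n x = (if n = -1 then \<gamma>' x else \<zero>\<^bsub>cobj T (n + 1)\<^esub>)" for n :: int and x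
    have G: "chain_map A T (shift T 1) G"
      unfolding chain_map_def
    proof (intro conjI allI ballI)
      fix n
      show "G n \<in> mod_hom A (cobj T n) (cobj (shift T 1) n)"
        using \<gamma>'(1) mod_hom_const_zero[OF rm_T] by (cases "n = -1") (simp_all add: G_def[abs_def] shift_simps)
      fix x assume x: "x \<in> carrier (cobj T n)"
      interpret Tn: right_module A "cobj T (n + 2)" by (rule rm_T)
      have m0: "\<ominus>\<^bsub>cobj T (n + 2)\<^esub> \<zero>\<^bsub>cobj T (n + 2)\<^esub> = \<zero>\<^bsub>cobj T (n + 2)\<^esub>" by simp
      consider "n = -1" | "n = -2" | "n \<noteq> -1" "n \<noteq> -2" by blast
      then show "G (n + 1) (cdiff T n x) = cdiff (shift T 1) n (G n x)"
      proof cases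
        case 1
        have "cdiff T 0 (\<gamma>' x) \<in> carrier (cobj T 1)"
          using mod_homD(1)[OF bounded_cplxD(3)[OF bounded_T] mod_homD(1)[OF \<gamma>'(1)]] x 1 by fastforce
        then have "cdiff T 0 (\<gamma>' x) = \<zero>\<^bsub>cobj T 1\<^esub>" using vanish[of 1] by simp
        then show ?thesis using 1 m0 by (simp add: G_def shift_simps)
      next
        case 2
        have "x = \<zero>\<^bsub>cobj T n\<^esub>" using x vanish[of n] 2 by simp
        then have "cdiff T n x = \<zero>\<^bsub>cobj T (-1)\<^esub>" using zero_T[of n] 2 by simp
        then show ?thesis
          using 2 m0 zero_T[of "-1"] mod_hom_zero[OF rm_T rm_T \<gamma>'(1)] by (simp add: G_def shift_simps)
      next
        case 3
        then show ?thesis using m0 zero_T[of "n + 1"] by (simp add: G_def shift_simps add.assoc)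
      qed
    qed
    have "is_roof A T (shift T 1) (Z', s', ccomp G s')"
      using Z'(1,2) chain_map_comp[OF cs' G] by simp
    then have "represents_zero A T (shift T 1) (Z', s', ccomp G s')"
      using rigid unfolding D_Hom_zero_def by blast
    then obtain W :: "('e, 'k vec) cplx" and u' and v' :: "int \<Rightarrow> 'k vec \<Rightarrow> 'k vec" where W: "bounded_cplx A W" "chain_map A W Z' u'"
      "quasi_iso A W T (ccomp s' u')"
      "homotopic A W (shift T 1) (ccomp (ccomp G s') u') (ccomp (\<lambda>n _. \<zero>\<^bsub>cobj (shift T 1) n\<^esub>) v')"
      unfolding represents_zero.simps roof_equiv.simps by (elim exE conjE) (rule that)
    define v where "v = ccomp s' u'"
    have v: "quasi_iso A W T v" using W(3) by (simp add: v_def)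
    note cv = quasi_iso_chain_map[OF v]
    obtain k where k: "\<And>n. k n \<in> mod_hom A (cobj W n) (cobj (shift T 1) (n - 1))"
      "\<And>n w. w \<in> carrier (cobj W n) \<Longrightarrow> G n (v n w) = \<zero>\<^bsub>cobj (shift T 1) n\<^esub> \<oplus>\<^bsub>cobj (shift T 1) n\<^esub>
        (cdiff (shift T 1) (n - 1) (k n w) \<oplus>\<^bsub>cobj (shift T 1) n\<^esub> k (n + 1) (cdiff W n w))"
      using W(4) unfolding homotopic_def by (auto simp: ccomp_def v_def)
    have k0: "k 0 \<in> mod_hom A (cobj W 0) (cobj T 0)" and k1: "k (-1) \<in> mod_hom A (cobj W (-1)) (cobj T (-1))"
      using k(1)[of 0] k(1)[of "-1"] by (simp_all add: shift_simps)
    have dW: "cdiff W (-1) \<in> mod_hom A (cobj W (-1)) (cobj W 0)"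
      using bounded_cplxD(3)[OF W(1), of "-1"] by simp
    \<comment> \<open>In degree -1 the homotopy contributes a term with the differential of T,
      negated by the shift; q annihilates it.\<close>
    have star: "\<gamma> (v (-1) w) = q (k 0 (cdiff W (-1) w))" if w: "w \<in> carrier (cobj W (-1))" for w
    proof -
      note kw = mod_homD(1)[OF k1 w] and dw = mod_homD(1)[OF dW w]
      note dkw = mod_homD(1)[OF d_hom kw] and kdw = mod_homD(1)[OF k0 dw]
      have "\<gamma>' (v (-1) w) = \<zero>\<^bsub>cobj T 0\<^esub> \<oplus>\<^bsub>cobj T 0\<^esub> (\<ominus>\<^bsub>cobj T 0\<^esub> cdiff T (-1) (k (-1) w) \<oplus>\<^bsub>cobj T 0\<^esub> k 0 (cdiff W (-1) w))"
        using k(2)[OF w] by (simp add: G_def shift_simps)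
      then have eq: "\<gamma>' (v (-1) w) = \<ominus>\<^bsub>cobj T 0\<^esub> cdiff T (-1) (k (-1) w) \<oplus>\<^bsub>cobj T 0\<^esub> k 0 (cdiff W (-1) w)"
        using dkw kdw by simp
      have "\<gamma> (v (-1) w) = q (\<gamma>' (v (-1) w))"
        using \<gamma>'(2)[OF mod_homD(1)[OF chain_mapD(1)[OF cv] w]] by simp
      also have "\<dots> = \<ominus>\<^bsub>M\<^esub> q (cdiff T (-1) (k (-1) w)) \<oplus>\<^bsub>M\<^esub> q (k 0 (cdiff W (-1) w))"
        unfolding eq using mod_homD(2)[OF q_hom _ kdw] dkw mod_hom_minus[OF rm_T rm_M q_hom dkw] by simp
      also have "\<dots> = q (k 0 (cdiff W (-1) w))"
        using q_d[OF kw] mod_homD(1)[OF q_hom kdw] by simp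
      finally show ?thesis .
    qed
    have av: "quasi_iso A W (stalk M) (ccomp aug v)"
      by (rule quasi_iso_comp[OF W(1) bounded_T bounded_stalk_M v quasi_iso_aug])
    obtain u where u: "chain_map A T W u" "\<And>x. x \<in> carrier (cobj T 0) \<Longrightarrow> ccomp aug v 0 (u 0 x) = q x"
      by (rule lift_along_quasi_iso[OF W(1) av]) (rule that)
    \<comment> \<open>Up to W and back: a chain endomorphism of T compatible with q.\<close>
    define e where "e = ccomp v u"
    have e: "chain_map A T T e" unfolding e_def by (rule chain_map_comp[OF u(1) cv])
    have e0: "e 0 \<in> mod_hom A (cobj T 0) (cobj T 0)" by (rule chain_mapD(1)[OF e])
    have qe: "q (e 0 x) = q x" if "x \<in> carrier (cobj T 0)" for x
      using u(2)[OF that] by (simp add: e_def ccomp_def aug_def)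
    have e0': "(\<lambda>x. e 0 x \<ominus>\<^bsub>cobj T 0\<^esub> x) \<in> mod_hom A (cobj T 0) (cobj T 0)"
      by (rule mod_hom_minus_fun[OF rm_T e0 mod_hom_id(2)])
    \<comment> \<open>The map \<open>e 0\<close> differs from the identity by values in the kernel
      of q, hence in the image of the differential.\<close>
    obtain \<sigma> where \<sigma>: "\<sigma> \<in> mod_hom A (cobj T 0) (cobj T (-1))"
      "\<And>x. x \<in> carrier (cobj T 0) \<Longrightarrow> cdiff T (-1) (\<sigma> x) = e 0 x \<ominus>\<^bsub>cobj T 0\<^esub> x"
    proof (rule lift_into_image[OF proj_T fd_T rm_T d_hom e0'])
      fix x assume x: "x \<in> carrier (cobj T 0)"
      have "q (e 0 x \<ominus>\<^bsub>cobj T 0\<^esub> x) = \<zero>\<^bsub>M\<^esub>"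
        using mod_hom_diff[OF rm_T rm_M q_hom mod_homD(1)[OF e0 x] x] qe[OF x] mod_homD(1)[OF q_hom x]
        by (simp add: a_minus_def M.M.r_neg)
      then show "e 0 x \<ominus>\<^bsub>cobj T 0\<^esub> x \<in> cdiff T (-1) ` carrier (cobj T (-1))"
        using q_kernel[OF mod_homD(1)[OF e0' x]] by simp
    qed (rule that)
    have u0: "u 0 \<in> mod_hom A (cobj T 0) (cobj W 0)" by (rule chain_mapD(1)[OF u(1)])
    let ?H1 = "\<lambda>x. q (k 0 (u 0 x))" and ?H2 = "\<lambda>x. \<gamma> (\<sigma> x)"
    have H1: "?H1 \<in> mod_hom A (cobj T 0) M" by (rule mod_hom_comp[OF mod_hom_comp[OF u0 k0] q_hom])
    have H2: "?H2 \<in> mod_hom A (cobj T 0) M" by (rule mod_hom_comp[OF \<sigma>(1) \<gamma>])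
    \<comment> \<open>Since the differential d is injective, \<open>e (-1)\<close> is the identity
      plus \<open>\<sigma> d\<close>. By \<open>star\<close>, \<open>\<gamma> (e (-1) x)\<close>
      equals \<open>?H1\<close> applied to \<open>d x\<close>, and \<open>?H2\<close> accounts for
      the correction term.\<close>
    have "\<gamma> x = ?H1 (cdiff T (-1) x) \<ominus>\<^bsub>M\<^esub> ?H2 (cdiff T (-1) x)" if x: "x \<in> carrier (cobj T (-1))" for x
    proof -
      note dx = mod_homD(1)[OF d_hom x]
      note sdx = mod_homD(1)[OF \<sigma>(1) dx]
      have ex: "e (-1) x \<in> carrier (cobj T (-1))" by (rule mod_homD(1)[OF chain_mapD(1)[OF e] x])
      have "cdiff T (-1) (e (-1) x) = e 0 (cdiff T (-1) x)"
        using chain_mapD(2)[OF e x] by simp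
      also have "\<dots> = cdiff T (-1) x \<oplus>\<^bsub>cobj T 0\<^esub> cdiff T (-1) (\<sigma> (cdiff T (-1) x))"
        unfolding \<sigma>(2)[OF dx] a_minus_def using dx mod_homD(1)[OF e0 dx]
        by (simp add: T0.M.a_lcomm[of "cdiff T (-1) x"] T0.M.r_neg)
      also have "\<dots> = cdiff T (-1) (x \<oplus>\<^bsub>cobj T (-1)\<^esub> \<sigma> (cdiff T (-1) x))"
        by (rule mod_homD(2)[OF d_hom x sdx, symmetric])
      finally have "e (-1) x = x \<oplus>\<^bsub>cobj T (-1)\<^esub> \<sigma> (cdiff T (-1) x)"
        using inj_onD[OF d_inj _ ex] x sdx by simp
      then have "\<gamma> (e (-1) x) = \<gamma> x \<oplus>\<^bsub>M\<^esub> ?H2 (cdiff T (-1) x)"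
        using mod_homD(2)[OF \<gamma> x sdx] by simp
      moreover have "\<gamma> (e (-1) x) = ?H1 (cdiff T (-1) x)"
        using star[OF mod_homD(1)[OF chain_mapD(1)[OF u(1)] x]] chain_mapD(2)[OF u(1) x]
        by (simp add: e_def ccomp_def)
      ultimately have "?H1 (cdiff T (-1) x) = \<gamma> x \<oplus>\<^bsub>M\<^esub> ?H2 (cdiff T (-1) x)" by simp
      then show ?thesis
        using mod_homD(1)[OF \<gamma> x] mod_homD(1)[OF \<gamma> sdx]
        by (simp add: a_minus_def M.M.a_assoc M.M.r_neg)
    qed
    then show ?thesis
      by (intro bexI[OF _ mod_hom_minus_fun[OF rm_M H1 H2]]) simp
  qed
  have "represents_zero A (stalk M) (shift (stalk M) 1) (Z, s, g)"
    if roof: "is_roof A (stalk M) (shift (stalk M) 1) (Z, s, g)" for Z :: "('e, 'k vec) cplx" and s g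
  proof -
    have Z: "bounded_cplx A Z" and s: "quasi_iso A Z (stalk M) s" and g: "chain_map A Z (shift (stalk M) 1) g"
      using roof by auto
    obtain u where u: "chain_map A T Z u" "\<And>x. x \<in> carrier (cobj T 0) \<Longrightarrow> s 0 (u 0 x) = q x"
      by (rule lift_along_quasi_iso[OF Z s]) (rule that)
    have su: "quasi_iso A T (stalk M) (ccomp s u)" by (rule quasi_iso_lift[OF Z s u(1)]) (rule u(2))
    have g1: "g (-1) \<in> mod_hom A (cobj Z (-1)) M"
      using chain_mapD(1)[OF g, of "-1"] by (simp add: shift_simps stalk_simps)
    obtain H where H: "H \<in> mod_hom A (cobj T 0) M"
      "\<And>x. x \<in> carrier (cobj T (-1)) \<Longrightarrow> g (-1) (u (-1) x) = H (cdiff T (-1) x)"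
      using extend[OF mod_hom_comp[OF chain_mapD(1)[OF u(1)] g1]] by blast
    \<comment> \<open>The complex above the given roof is \<open>Z'\<close>, the copy of T on
      \<open>'k vec\<close>, mapped to Z through the lift u.\<close>
    let ?w = "ccomp u s'"
    have w: "chain_map A Z' Z ?w" by (rule chain_map_comp[OF cs' u(1)])
    have sw: "quasi_iso A Z' (stalk M) (ccomp s ?w)"
      using quasi_iso_comp[OF Z'(1) bounded_T bounded_stalk_M Z'(2) su] by (simp add: ccomp_def comp_assoc)
    have h1: "homotopic A Z' (stalk M) (ccomp s ?w) (ccomp s ?w)"
      by (rule homotopic_refl_bounded[OF Z'(1) bounded_stalk_M quasi_iso_chain_map[OF sw]])
    have h2: "homotopic A Z' (shift (stalk M) 1) (ccomp g ?w) (ccomp (\<lambda>n _. \<zero>\<^bsub>cobj (shift (stalk M) 1) n\<^esub>) ?w)"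
      unfolding homotopic_def
    \<comment> \<open>The shifted stalk lives in degree -1, so the homotopy has one non-zero
      component, from degree 0; it is the extension H.\<close>
    proof (intro exI[of _ "\<lambda>n z. if n = 0 then H (s' 0 z) else \<zero>\<^bsub>M\<^esub>"] conjI allI ballI)
      fix n
      show "(\<lambda>z. if n = 0 then H (s' 0 z) else \<zero>\<^bsub>M\<^esub>) \<in> mod_hom A (cobj Z' n) (cobj (shift (stalk M) 1) (n - 1))"
        using mod_hom_comp[OF chain_mapD(1)[OF cs'] H(1)] mod_hom_const_zero[OF right_module_zero_mod[OF rm_M]]
        by (auto simp: shift_simps stalk_simps)
      fix z assume z: "z \<in> carrier (cobj Z' n)"
      have m0: "\<ominus>\<^bsub>zero_mod M\<^esub> \<zero>\<^bsub>M\<^esub> = \<zero>\<^bsub>M\<^esub>"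
        using right_module.minus_zero[OF right_module_zero_mod[OF rm_M]] by simp
      note sz = mod_homD(1)[OF chain_mapD(1)[OF cs'] z]
      note gw = mod_homD(1)[OF chain_mapD(1)[OF chain_map_comp[OF w g]] z]
      show "ccomp g ?w n z = ccomp (\<lambda>n _. \<zero>\<^bsub>cobj (shift (stalk M) 1) n\<^esub>) ?w n z \<oplus>\<^bsub>cobj (shift (stalk M) 1) n\<^esub>
          (cdiff (shift (stalk M) 1) (n - 1) (if n = 0 then H (s' 0 z) else \<zero>\<^bsub>M\<^esub>) \<oplus>\<^bsub>cobj (shift (stalk M) 1) n\<^esub>
           (if n + 1 = 0 then H (s' 0 (cdiff Z' n z)) else \<zero>\<^bsub>M\<^esub>))"
      proof (cases "n = -1")
        case True
        have "H (s' 0 (cdiff Z' (-1) z)) = g (-1) (u (-1) (s' (-1) z))"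
          using H(2)[of "s' (-1) z"] sz True chain_mapD(2)[OF cs' z] by simp
        then show ?thesis
          using True m0 gw by (simp add: shift_simps stalk_simps ccomp_def)
      next
        case False
        then have "n + 1 \<noteq> 0" by simp
        then show ?thesis
          using False m0 gw by (simp add: shift_simps stalk_simps ccomp_def)
      qed
    qed
    show ?thesis
      unfolding represents_zero.simps roof_equiv.simps
      using Z'(1) w sw h1 h2 by blast
  qed
  then show ?thesis unfolding D_Hom_zero_def by (metis prod_cases3)
qed

end

section \<open>The inverse translate of a simple module\<close>

text \<open>Scalars are central, so the same finite set spans from either side.\<close>

lemma (in kalgebra) fd_module_regular_opp:
  assumes "fd_module A (regular_mod A)"
  shows "fd_module (opp A) (regular_mod (opp A))"
proof -
  interpret op: kalgebra "opp A" by (rule kalgebra_opp)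
  obtain B where B: "finite B" "B \<subseteq> carrier (regular_mod A)" "carrier (regular_mod A) \<subseteq> kspan A (regular_mod A) B"
    using assms by (rule fd_moduleE)
  have "x \<in> kspan (opp A) (regular_mod (opp A)) B" if "x \<in> kspan A (regular_mod A) B" for x
    using that
  proof induct
    case zero
    then show ?case using kspan.zero[where A = "opp A" and M = "regular_mod (opp A)" and B = B] by simp
  next
    case (step b x c)
    then show ?case
      using kspan.step[where A = "opp A" and M = "regular_mod (opp A)" and B = B and c = c, OF step(1,3)] B(2)
        scal_commute[of b c] by auto
  qed
  then show ?thesis
    using B by (intro op.fd_moduleI[OF right_module_regular[OF op.ring_axioms], of B]) auto
qed

lemma hom_regular_simps:
  "carrier (hom_regular A P) = mod_hom A P (regular_mod A) \<inter> extensional (carrier P)"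
  "\<zero>\<^bsub>hom_regular A P\<^esub> = (\<lambda>x\<in>carrier P. \<zero>\<^bsub>A\<^esub>)"
  "\<phi> \<oplus>\<^bsub>hom_regular A P\<^esub> \<psi> = (\<lambda>x\<in>carrier P. \<phi> x \<oplus>\<^bsub>A\<^esub> \<psi> x)"
  "a \<odot>\<^bsub>hom_regular A P\<^esub> \<phi> = (\<lambda>x\<in>carrier P. a \<otimes>\<^bsub>A\<^esub> \<phi> x)"
  by (simp_all add: hom_regular_def)

lemma restrict_mod_hom:
  assumes "right_module A P" "\<phi> \<in> mod_hom A P N"
  shows "(\<lambda>x\<in>carrier P. \<phi> x) \<in> mod_hom A P N"
proof -
  interpret P: right_module A P by (rule assms(1))
  show ?thesis using assms(2) by (auto simp: mod_hom_def Pi_iff P.act_closed)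
qed

text \<open>Homomorphisms into the regular module exchange the two sides. Over \<open>opp A\<close>
  the result is a right A-module, which is where the inverse translate lives.\<close>

lemma (in kalgebra) right_module_hom_regular:
  assumes P: "right_module A P"
  shows "right_module (opp A) (hom_regular A P)"
proof -
  interpret P: right_module A P by (rule P)
  interpret op: kalgebra "opp A" by (rule kalgebra_opp)
  have rm: "right_module A (regular_mod A)" by (rule right_module_regular[OF ring_axioms])
  note restr = restrict_mod_hom[OF P]
  note H = hom_regular_simps[where A = A and P = P]
  have v: "\<phi> x \<in> carrier A" if "\<phi> \<in> mod_hom A P (regular_mod A)" "x \<in> carrier P" for \<phi> x
    using mod_homD(1)[OF that] by simp
  have e: "(\<lambda>x\<in>carrier P. \<phi> x) = \<phi>" if "\<phi> \<in> extensional (carrier P)" for \<phi> :: "'a \<Rightarrow> 'e"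
    using that by (simp add: extensional_restrict)
  show ?thesis
  proof (rule right_moduleI)
    show "ring (opp A)" by (rule op.ring_axioms)
    fix \<phi> \<psi> assume "\<phi> \<in> carrier (hom_regular A P)" "\<psi> \<in> carrier (hom_regular A P)"
    then show "\<phi> \<oplus>\<^bsub>hom_regular A P\<^esub> \<psi> \<in> carrier (hom_regular A P)"
      using restr[OF mod_hom_plus[OF rm, of \<phi> P \<psi>]] by (simp add: H)
  next
    show "\<zero>\<^bsub>hom_regular A P\<^esub> \<in> carrier (hom_regular A P)"
      using restr[OF mod_hom_const_zero[OF rm]] by (simp add: H)
  next
    fix \<phi> assume \<phi>: "\<phi> \<in> carrier (hom_regular A P)"
    have "(\<lambda>x\<in>carrier P. \<ominus>\<^bsub>regular_mod A\<^esub> \<phi> x) \<in> carrier (hom_regular A P)"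
      using restr[OF mod_hom_neg[OF rm, of \<phi> P]] \<phi> by (simp add: H)
    moreover have "(\<ominus>\<^bsub>regular_mod A\<^esub> \<phi> x) \<oplus> \<phi> x = \<zero>" if "x \<in> carrier P" for x
    proof -
      interpret r: right_module A "regular_mod A" by (rule rm)
      show ?thesis using r.M.l_neg[of "\<phi> x"] v[of \<phi> x] \<phi> that by (simp add: H)
    qed
    ultimately show "\<exists>\<psi>\<in>carrier (hom_regular A P). \<psi> \<oplus>\<^bsub>hom_regular A P\<^esub> \<phi> = \<zero>\<^bsub>hom_regular A P\<^esub>"
      by (intro bexI[of _ "\<lambda>x\<in>carrier P. \<ominus>\<^bsub>regular_mod A\<^esub> \<phi> x"]) (auto simp: H intro!: restrict_ext)
  next
    fix a \<phi> assume a: "a \<in> carrier (opp A)" and \<phi>: "\<phi> \<in> carrier (hom_regular A P)"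
    have "(\<lambda>x. a \<otimes> \<phi> x) \<in> mod_hom A P (regular_mod A)"
      using a \<phi> mod_homD[of \<phi> A P "regular_mod A"] by (intro mod_homI) (auto simp: H r_distr m_assoc)
    then show "a \<odot>\<^bsub>hom_regular A P\<^esub> \<phi> \<in> carrier (hom_regular A P)"
      using restr by (simp add: H)
  next
    fix \<phi> assume \<phi>: "\<phi> \<in> carrier (hom_regular A P)"
    have "(\<lambda>x\<in>carrier P. \<zero> \<oplus> \<phi> x) = (\<lambda>x\<in>carrier P. \<phi> x)" "(\<lambda>x\<in>carrier P. \<one> \<otimes> \<phi> x) = (\<lambda>x\<in>carrier P. \<phi> x)"
      using \<phi> by (auto simp: H v intro!: restrict_ext)
    then show "\<zero>\<^bsub>hom_regular A P\<^esub> \<oplus>\<^bsub>hom_regular A P\<^esub> \<phi> = \<phi>" "\<one>\<^bsub>opp A\<^esub> \<odot>\<^bsub>hom_regular A P\<^esub> \<phi> = \<phi>"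
      using \<phi> e by (simp_all add: H cong: restrict_cong)
  qed (auto simp: H v l_distr r_distr m_assoc a_ac intro!: restrict_ext)
qed

lemma mod_hom_quot:
  assumes M: "right_module A M" and N: "submodule N A M"
  shows "(\<lambda>x. N +>\<^bsub>M\<^esub> x) \<in> mod_hom A M (quot_mod M N)"
    "carrier (quot_mod M N) = (\<lambda>x. N +>\<^bsub>M\<^esub> x) ` carrier M"
proof -
  interpret M: right_module A M by (rule M)
  note Nc = M.submodule_closed[OF N]
  interpret N: abelian_subgroup N M
    by (rule abelian_subgroupI3)
      (use N in \<open>auto intro: additive_subgroup.intro simp: submodule_def M.abelian_group_axioms\<close>)
  show c: "carrier (quot_mod M N) = (\<lambda>x. N +>\<^bsub>M\<^esub> x) ` carrier M"
    by (auto simp: quot_mod_def A_RCOSETS_def')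
  show "(\<lambda>x. N +>\<^bsub>M\<^esub> x) \<in> mod_hom A M (quot_mod M N)"
  proof (rule mod_homI)
    fix x assume x: "x \<in> carrier M"
    show "N +>\<^bsub>M\<^esub> x \<in> carrier (quot_mod M N)" unfolding c using x by (rule imageI)
    fix y assume y: "y \<in> carrier M"
    show "N +>\<^bsub>M\<^esub> (x \<oplus>\<^bsub>M\<^esub> y) = (N +>\<^bsub>M\<^esub> x) \<oplus>\<^bsub>quot_mod M N\<^esub> (N +>\<^bsub>M\<^esub> y)"
      using N.a_rcos_sum[OF x y] by (simp add: quot_mod_def)
  next
    fix a x assume a: "a \<in> carrier A" and x: "x \<in> carrier M"
    have hom: "a \<odot>\<^bsub>M\<^esub> (n \<oplus>\<^bsub>M\<^esub> x) = a \<odot>\<^bsub>M\<^esub> n \<oplus>\<^bsub>M\<^esub> a \<odot>\<^bsub>M\<^esub> x" if "n \<in> N" for n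
      using that Nc(1) a x by (intro M.act_add_right) auto
    have "N +>\<^bsub>M\<^esub> (a \<odot>\<^bsub>M\<^esub> (n \<oplus>\<^bsub>M\<^esub> x)) = N +>\<^bsub>M\<^esub> (a \<odot>\<^bsub>M\<^esub> x)" if "n \<in> N" for n
      unfolding hom[OF that]
      by (subst M.coset_eq_iff[OF N])
        (use that Nc a x in \<open>auto intro!: bexI[of _ "a \<odot>\<^bsub>M\<^esub> n"] M.act_closed\<close>)
    moreover have "N +>\<^bsub>M\<^esub> x = (\<lambda>n. n \<oplus>\<^bsub>M\<^esub> x) ` N" by (auto simp: a_r_coset_def')
    moreover have "N \<noteq> {}" using Nc(2) by blast
    ultimately have "(\<Union>y\<in>N +>\<^bsub>M\<^esub> x. N +>\<^bsub>M\<^esub> (a \<odot>\<^bsub>M\<^esub> y)) = N +>\<^bsub>M\<^esub> (a \<odot>\<^bsub>M\<^esub> x)"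
      by simp
    then show "N +>\<^bsub>M\<^esub> (a \<odot>\<^bsub>M\<^esub> x) = a \<odot>\<^bsub>quot_mod M N\<^esub> (N +>\<^bsub>M\<^esub> x)"
      by (simp add: quot_mod_def)
  qed
qed

section \<open>Left projective modules, Nakayama's lemma and the dual of the simple module\<close>

context bound_quiver
begin

sublocale op: kalgebra "opp A"
  by (rule A.kalgebra_opp)

lemma coef_finsum:
  assumes "finite S" "f \<in> S \<rightarrow> carrier A" "length p \<le> 1"
  shows "coef (\<Oplus>\<^bsub>A\<^esub>i\<in>S. f i) (u, p) = (\<Sum>i\<in>S. coef (f i) (u, p))"
  using assms(1,2)
proof (induct set: finite)
  case empty
  then show ?case using coef_zero[OF assms(3)] by simp
next
  case (insert i S)
  then have "f i \<in> carrier A" "f \<in> S \<rightarrow> carrier A" by auto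
  then show ?case using insert coef_add[OF _ _ assms(3), of "f i" "\<Oplus>\<^bsub>A\<^esub>i\<in>S. f i" u] by simp
qed

text \<open>Left multiplication by an idempotent is a projection, so its image is the set of its
  fixed points.\<close>

lemma vertex_proj_simps:
  assumes "i \<in> verts Q"
  shows "carrier (vertex_proj Q I i) = {a \<in> carrier A. idem i \<otimes>\<^bsub>A\<^esub> a = a}"
    "zero (vertex_proj Q I i) = \<zero>\<^bsub>A\<^esub>" "add (vertex_proj Q I i) = add A"
    "a \<odot>\<^bsub>vertex_proj Q I i\<^esub> x = x \<otimes>\<^bsub>A\<^esub> a"
proof -
  have "idem i \<otimes>\<^bsub>A\<^esub> (idem i \<otimes>\<^bsub>A\<^esub> a) = idem i \<otimes>\<^bsub>A\<^esub> a" if "a \<in> carrier A" for a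
    using A.m_assoc[of "idem i" "idem i" a] that assms idem_mult[OF assms assms] by simp
  then show "carrier (vertex_proj Q I i) = {a \<in> carrier A. idem i \<otimes>\<^bsub>A\<^esub> a = a}"
    using assms by (auto simp: vertex_proj_def idem_def[symmetric])
qed (simp_all add: vertex_proj_def)

lemma right_module_vertex_proj:
  assumes "i \<in> verts Q" shows "right_module A (vertex_proj Q I i)"
proof -
  interpret r: right_module A "regular_mod A" by (rule right_module_regular[OF A.ring_axioms])
  have "submodule (carrier (vertex_proj Q I i)) A (regular_mod A)"
    by (rule r.submoduleI') (use assms in \<open>auto simp: vertex_proj_simps A.r_distr A.m_assoc[symmetric]\<close>)
  then have "right_module A (submod (regular_mod A) (carrier (vertex_proj Q I i)))"
    by (rule right_module_submod[OF r.right_module_axioms])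
  then show ?thesis by (simp add: vertex_proj_def)
qed

text \<open>The left module \<open>A e_i\<close>, read as a right module over \<open>opp A\<close>;
  it is spanned by the paths ending at i.\<close>

definition left_proj where
  "left_proj i = submod (regular_mod (opp A)) {a \<in> carrier A. a \<otimes>\<^bsub>A\<^esub> idem i = a}"

lemma left_proj_simps [simp]:
  "carrier (left_proj i) = {a \<in> carrier A. a \<otimes>\<^bsub>A\<^esub> idem i = a}"
  "zero (left_proj i) = \<zero>\<^bsub>A\<^esub>" "add (left_proj i) = add A" "a \<odot>\<^bsub>left_proj i\<^esub> x = a \<otimes>\<^bsub>A\<^esub> x"
  by (simp_all add: left_proj_def)

lemma submodule_left_proj:
  assumes "i \<in> verts Q"
  shows "submodule {a \<in> carrier A. a \<otimes>\<^bsub>A\<^esub> idem i = a} (opp A) (regular_mod (opp A))"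
proof -
  interpret r: right_module "opp A" "regular_mod (opp A)" by (rule right_module_regular[OF op.ring_axioms])
  show ?thesis
    by (rule r.submoduleI') (use assms in \<open>auto simp: A.l_distr A.m_assoc\<close>)
qed

lemma right_module_left_proj: "i \<in> verts Q \<Longrightarrow> right_module (opp A) (left_proj i)"
  unfolding left_proj_def
  by (intro right_module_submod[OF right_module_regular[OF op.ring_axioms]] submodule_left_proj)

lemma idem_left_proj: "i \<in> verts Q \<Longrightarrow> idem i \<in> carrier (left_proj i)"
  by (simp add: idem_mult)

text \<open>A homomorphism h from \<open>A e_i\<close> is determined by its value at the idempotent.
  For a preimage m of that value, \<open>a \<mapsto> a m\<close> is a lift of h.\<close>

lemma projective_left_proj:
  assumes "fd_module A (regular_mod A)" "i \<in> verts Q"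
  shows "projective (opp A) (left_proj i)"
  unfolding projective_def
proof (intro conjI allI impI)
  show "fd_module (opp A) (left_proj i)"
    unfolding left_proj_def
    by (rule op.fd_module_submod[OF A.fd_module_regular_opp[OF assms(1)] submodule_left_proj[OF assms(2)]])
  fix M :: "((('v, 'a) qpath \<Rightarrow> 'k) set, 'k vec) module" and N :: "((('v, 'a) qpath \<Rightarrow> 'k) set, 'k vec) module" and g h
  assume fd: "fd_module (opp A) M" "fd_module (opp A) N" and g: "g \<in> mod_hom (opp A) M N" "g ` carrier M = carrier N"
    and h: "h \<in> mod_hom (opp A) (left_proj i) N"
  interpret M: right_module "opp A" M by (rule op.fd_right_module[OF fd(1)])
  have "h (idem i) \<in> g ` carrier M" using mod_homD(1)[OF h idem_left_proj[OF assms(2)]] g(2) by simp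
  then obtain m where m: "m \<in> carrier M" "g m = h (idem i)" by auto
  have hm: "(\<lambda>a. a \<odot>\<^bsub>M\<^esub> m) \<in> mod_hom (opp A) (left_proj i) M"
    by (rule mod_homI)
      (use m(1) M.act_closed M.act_add_left M.act_mult[of _ _ m] in \<open>auto\<close>)
  have "g (a \<odot>\<^bsub>M\<^esub> m) = h a" if a: "a \<in> carrier (left_proj i)" for a
  proof -
    have "g (a \<odot>\<^bsub>M\<^esub> m) = a \<odot>\<^bsub>N\<^esub> h (idem i)" using mod_homD(3)[OF g(1), of a m] a m by simp
    also have "\<dots> = h (a \<odot>\<^bsub>left_proj i\<^esub> idem i)"
      using mod_homD(3)[OF h, of a "idem i"] a idem_left_proj[OF assms(2)] by simp
    finally show ?thesis using a by simp
  qed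
  then show "\<exists>h'\<in>mod_hom (opp A) (left_proj i) M. \<forall>x\<in>carrier (left_proj i). g (h' x) = h x"
    using hm by (rule_tac x = "\<lambda>a. a \<odot>\<^bsub>M\<^esub> m" in bexI) auto
qed

text \<open>
  Nakayama's lemma: by descending induction on \<open>\<ell>\<close>, paths of length at least \<open>\<ell>\<close> map \<open>M\<close>
  into a submodule that generates \<open>M\<close> together with \<open>rad M\<close>.
\<close>

lemma superfluous_radical:
  assumes M: "right_module (opp A) M" and N: "N \<subseteq> carrier M"
    and rad: "\<And>n. n \<in> N \<Longrightarrow> \<exists>m. (\<forall>\<alpha>\<in>arcs Q. m \<alpha> \<in> carrier M) \<and> n = (\<Oplus>\<^bsub>M\<^esub>\<alpha>\<in>arcs Q. arr \<alpha> \<odot>\<^bsub>M\<^esub> m \<alpha>)"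
  shows "superfluous (opp A) M N"
  unfolding superfluous_def
proof (intro allI impI)
  fix H assume H: "submodule H (opp A) M" and sum: "N <+>\<^bsub>M\<^esub> H = carrier M"
  interpret M: right_module "opp A" M by (rule M)
  note Hc = M.submodule_closed[OF H]
  obtain l where l: "\<forall>(u, p)\<in>qpaths Q. length p \<ge> l \<longrightarrow> path_class Q I (u, p) = \<zero>\<^bsub>A\<^esub>"
    using path_class_nilpotent by blast
  have finH: "(\<Oplus>\<^bsub>M\<^esub>i\<in>S. x i) \<in> H" if "finite S" "\<And>i. i \<in> S \<Longrightarrow> x i \<in> H" for S :: "'s set" and x
    using that
  proof (induct set: finite)
    case empty
    then show ?case using Hc(2) by simp
  next
    case (insert i S)
    then have "x \<in> S \<rightarrow> carrier M" "x i \<in> carrier M" using Hc(1) by auto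
    then show ?case using insert Hc(3) by simp
  qed
  have step: "path_class Q I (u, p) \<odot>\<^bsub>M\<^esub> m \<in> H"
    if "l \<le> length p + d" "(u, p) \<in> qpaths Q" "m \<in> carrier M" for d u p m
    using that
  proof (induct d arbitrary: p m)
    case 0
    then have "path_class Q I (u, p) = \<zero>\<^bsub>A\<^esub>" using l by auto
    then show ?case using M.act_zero_left[of m] 0 Hc(2) by simp
  next
    case (Suc d)
    have "m \<in> N <+>\<^bsub>M\<^esub> H" using sum Suc(4) by simp
    then obtain n h where nh: "n \<in> N" "h \<in> H" "m = n \<oplus>\<^bsub>M\<^esub> h" by (auto simp: set_add_def')
    obtain m' where m': "\<And>\<alpha>. \<alpha> \<in> arcs Q \<Longrightarrow> m' \<alpha> \<in> carrier M" "n = (\<Oplus>\<^bsub>M\<^esub>\<alpha>\<in>arcs Q. arr \<alpha> \<odot>\<^bsub>M\<^esub> m' \<alpha>)"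
      using rad[OF nh(1)] by blast
    note pc = path_class_closed[OF Suc(3)]
    have am: "(\<lambda>\<alpha>. arr \<alpha> \<odot>\<^bsub>M\<^esub> m' \<alpha>) \<in> arcs Q \<rightarrow> carrier M" using m'(1) by (auto intro!: M.act_closed)
    have "path_class Q I (u, p) \<odot>\<^bsub>M\<^esub> (arr \<alpha> \<odot>\<^bsub>M\<^esub> m' \<alpha>) \<in> H" if \<alpha>: "\<alpha> \<in> arcs Q" for \<alpha>
    proof -
      have "path_class Q I (u, p) \<odot>\<^bsub>M\<^esub> (arr \<alpha> \<odot>\<^bsub>M\<^esub> m' \<alpha>) = (path_class Q I (u, p) \<otimes>\<^bsub>A\<^esub> arr \<alpha>) \<odot>\<^bsub>M\<^esub> m' \<alpha>"
        using M.act_mult[of "arr \<alpha>" "path_class Q I (u, p)" "m' \<alpha>"] pc \<alpha> m'(1) by simp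
      also have "\<dots> \<in> H"
      proof (cases "awlast u p = tail Q \<alpha>")
        case True
        then have "(u, p @ [\<alpha>]) \<in> qpaths Q" using Suc(3) \<alpha> by (simp add: qpaths_snoc)
        then have "path_class Q I (u, p @ [\<alpha>]) \<odot>\<^bsub>M\<^esub> m' \<alpha> \<in> H"
          using Suc(2) m'(1)[OF \<alpha>] by (intro Suc(1)) auto
        then show ?thesis using True Suc(3) \<alpha> by (simp add: path_class_mult_arr)
      next
        case False
        then show ?thesis
          using M.act_zero_left[OF m'(1)[OF \<alpha>]] Suc(3) \<alpha> Hc(2) by (simp add: path_class_mult_arr)
      qed
      finally show ?thesis .
    qed
    then have "(\<Oplus>\<^bsub>M\<^esub>\<alpha>\<in>arcs Q. path_class Q I (u, p) \<odot>\<^bsub>M\<^esub> (arr \<alpha> \<odot>\<^bsub>M\<^esub> m' \<alpha>)) \<in> H"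
      by (intro finH) auto
    then have "path_class Q I (u, p) \<odot>\<^bsub>M\<^esub> n \<in> H"
      unfolding m'(2) using M.act_finsum_right[OF finite_arcs _ am, of "path_class Q I (u, p)"] pc by simp
    then show ?case
      unfolding nh(3) using M.act_add_right[of "path_class Q I (u, p)" n h] pc
        Hc(3)[OF _ Hc(5)[OF _ nh(2)]] subsetD[OF N nh(1)] subsetD[OF Hc(1) nh(2)] by simp
  qed
  \<comment> \<open>Trivial paths are covered by \<open>step\<close> as well, and together they act
    as the identity.\<close>
  have "m \<in> H" if m: "m \<in> carrier M" for m
  proof -
    have "idem i \<odot>\<^bsub>M\<^esub> m \<in> H" if "i \<in> verts Q" for i
      unfolding idem_def by (rule step[of "[]" l]) (use that m in auto)
    then have "(\<Oplus>\<^bsub>M\<^esub>i\<in>verts Q. idem i \<odot>\<^bsub>M\<^esub> m) \<in> H" by (intro finH) auto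
    moreover have "(\<Oplus>\<^bsub>opp A\<^esub>i\<in>verts Q. idem i) = (\<Oplus>\<^bsub>A\<^esub>i\<in>verts Q. idem i)"
      by (simp add: finsum_def finprod_def)
    ultimately show ?thesis
      using M.act_finsum_left[OF finite_verts m, of idem] M.act_one[OF m] one_eq_sum_idem by (simp add: Pi_def)
  qed
  then show "H = carrier M" using Hc(1) by auto
qed

text \<open>Since n is fixed by \<open>idem i\<close> on the right, its coefficients at the other
  trivial paths vanish by themselves. Multiplying the components by \<open>idem i\<close> keeps them
  inside \<open>A e_i\<close>.\<close>

lemma left_proj_radical:
  assumes i: "i \<in> verts Q" and n: "n \<in> carrier (left_proj i)" "coef n (i, []) = 0"
  shows "\<exists>m. (\<forall>\<alpha>\<in>arcs Q. m \<alpha> \<in> carrier (left_proj i)) \<and> n = (\<Oplus>\<^bsub>A\<^esub>\<alpha>\<in>arcs Q. arr \<alpha> \<otimes>\<^bsub>A\<^esub> m \<alpha>)"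
proof -
  have nA: "n \<in> carrier A" "n \<otimes>\<^bsub>A\<^esub> idem i = n" using n(1) by auto
  have "coef n (j, []) = 0" if "j \<in> verts Q" for j
    using coef_mult(1)[OF nA(1) idem_closed[OF i], of j] nA(2) n(2) coef_idem[OF i, of j] by (cases "j = i") auto
  then obtain x where x: "\<And>\<alpha>. \<alpha> \<in> arcs Q \<Longrightarrow> x \<alpha> \<in> carrier A" "n = (\<Oplus>\<^bsub>A\<^esub>\<alpha>\<in>arcs Q. arr \<alpha> \<otimes>\<^bsub>A\<^esub> x \<alpha>)"
    using radical_left_decomp[OF nA(1)] by blast
  have "(\<Oplus>\<^bsub>A\<^esub>\<alpha>\<in>arcs Q. arr \<alpha> \<otimes>\<^bsub>A\<^esub> (x \<alpha> \<otimes>\<^bsub>A\<^esub> idem i)) = (\<Oplus>\<^bsub>A\<^esub>\<alpha>\<in>arcs Q. (arr \<alpha> \<otimes>\<^bsub>A\<^esub> x \<alpha>) \<otimes>\<^bsub>A\<^esub> idem i)"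
    using x(1) i by (intro A.finsum_cong') (auto simp: A.m_assoc)
  also have "\<dots> = n \<otimes>\<^bsub>A\<^esub> idem i"
    unfolding x(2) using x(1) i by (intro A.finsum_ldistr[symmetric]) auto
  finally have "n = (\<Oplus>\<^bsub>A\<^esub>\<alpha>\<in>arcs Q. arr \<alpha> \<otimes>\<^bsub>A\<^esub> (x \<alpha> \<otimes>\<^bsub>A\<^esub> idem i))" using nA(2) by simp
  then show ?thesis
    using x(1) i by (intro exI[of _ "\<lambda>\<alpha>. x \<alpha> \<otimes>\<^bsub>A\<^esub> idem i"]) (auto simp: A.m_assoc idem_mult)
qed

lemma finsum_left_proj:
  assumes "i \<in> verts Q" "finite S" "f \<in> S \<rightarrow> carrier (left_proj i)"
  shows "(\<Oplus>\<^bsub>left_proj i\<^esub>j\<in>S. f j) = (\<Oplus>\<^bsub>A\<^esub>j\<in>S. f j)"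
proof -
  have "(\<lambda>x. x) \<in> mod_hom (opp A) (left_proj i) (regular_mod (opp A))" by (rule mod_homI) auto
  from mod_hom_finsum[OF right_module_left_proj[OF assms(1)] right_module_regular[OF op.ring_axioms] this assms(2,3)]
  show ?thesis by (simp add: finsum_def finprod_def)
qed

abbreviation simple_dual where
  "simple_dual i \<equiv> dual A (vertex_simple i :: (_, 'k) module)"

text \<open>A linear form on the ground field is multiplication by a scalar, so the dual is again
  one-dimensional, with the same action.\<close>

lemma simple_dual_simps:
  assumes "i \<in> verts Q"
  shows "carrier (simple_dual i) = range (*)" "zero (simple_dual i) = (*) 0"
    "(*) c \<oplus>\<^bsub>simple_dual i\<^esub> (*) d = (*) (c + d)"
    "a \<odot>\<^bsub>simple_dual i\<^esub> (*) c = (*) (coef a (i, []) * c)"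
proof -
  have sm: "a \<odot>\<^bsub>vertex_simple i\<^esub> x = x * coef a (i, [])" for a and x :: 'k
    by (simp add: vertex_simple_def coef_def)
  have cV: "carrier (vertex_simple i) = (UNIV :: 'k set)" "x \<oplus>\<^bsub>vertex_simple i\<^esub> y = x + (y :: 'k)" for x y
    by (simp_all add: vertex_simple_def)
  have lin: "\<phi> \<in> range (*)" if "\<And>c x. \<phi> (x * c) = c * \<phi> x" for \<phi> :: "'k \<Rightarrow> 'k"
  proof -
    have "\<phi> x = \<phi> 1 * x" for x using that[of 1 x] by (simp add: mult.commute)
    then have "\<phi> = (*) (\<phi> 1)" by (rule ext)
    then show ?thesis by blast
  qed
  have car: "\<phi> \<in> carrier (simple_dual i) \<longleftrightarrow>
      (\<forall>x y. \<phi> (x + y) = \<phi> x + \<phi> y) \<and> (\<forall>c x. \<phi> (x * c) = c * \<phi> x)" for \<phi>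
    using assms by (simp add: dual_def sm cV coef_scal)
  show "carrier (simple_dual i) = range (*)"
  proof (intro subset_antisym subsetI)
    fix \<phi> assume "\<phi> \<in> carrier (simple_dual i)"
    then show "\<phi> \<in> range (*)" using lin[of \<phi>] car[of \<phi>] by blast
  next
    fix \<phi> :: "'k \<Rightarrow> 'k" assume "\<phi> \<in> range (*)"
    then obtain c where "\<phi> = (*) c" by blast
    then show "\<phi> \<in> carrier (simple_dual i)" unfolding car by (simp add: algebra_simps)
  qed
  show "zero (simple_dual i) = (*) 0" "(*) c \<oplus>\<^bsub>simple_dual i\<^esub> (*) d = (*) (c + d)"
    "a \<odot>\<^bsub>simple_dual i\<^esub> (*) c = (*) (coef a (i, []) * c)"
    by (auto simp: dual_def sm cV fun_eq_iff algebra_simps)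
qed

lemma right_module_simple_dual:
  assumes "i \<in> verts Q" shows "right_module (opp A) (simple_dual i)"
proof -
  note s = simple_dual_simps[OF assms]
  have "coef \<one>\<^bsub>A\<^esub> (i, []) = 1" using coef_scal[OF assms, of 1] by (simp add: A.scal_one)
  then show ?thesis
  proof (intro right_moduleI)
    fix \<phi> assume "\<phi> \<in> carrier (simple_dual i)"
    then obtain c where "\<phi> = (*) c" by (auto simp: s)
    then show "\<exists>\<psi>\<in>carrier (simple_dual i). \<psi> \<oplus>\<^bsub>simple_dual i\<^esub> \<phi> = \<zero>\<^bsub>simple_dual i\<^esub>"
      by (intro bexI[of _ "(*) (- c)"]) (simp_all add: s)
  qed (auto simp: s op.ring_axioms add_ac coef_add coef_mult algebra_simps)
qed

lemma projective_cover_simple_dual: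
  assumes fd: "fd_module A (regular_mod A)" and i: "i \<in> verts Q"
  shows "projective_cover (opp A) (left_proj i) (simple_dual i) (\<lambda>a. (*) (coef a (i, [])))"
  unfolding projective_cover_def
proof (intro conjI)
  note s = simple_dual_simps[OF i]
  show "projective (opp A) (left_proj i)" by (rule projective_left_proj[OF fd i])
  show "(\<lambda>a. (*) (coef a (i, []))) \<in> mod_hom (opp A) (left_proj i) (simple_dual i)"
    by (rule mod_homI) (auto simp: s coef_add coef_mult)
  have "(*) c \<in> (\<lambda>a. (*) (coef a (i, []))) ` carrier (left_proj i)" for c
    using i coef_mult(1)[of "scal A c" "idem i" i]
    by (intro image_eqI[of _ _ "scal A c \<otimes>\<^bsub>A\<^esub> idem i"])
      (auto simp: A.m_assoc idem_mult coef_scal coef_idem)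
  then show "(\<lambda>a. (*) (coef a (i, []))) ` carrier (left_proj i) = carrier (simple_dual i)"
    unfolding s by auto
  show "superfluous (opp A) (left_proj i)
      (a_kernel (left_proj i) (simple_dual i) (\<lambda>a. (*) (coef a (i, []))))"
  proof (rule superfluous_radical[OF right_module_left_proj[OF i]])
    fix n assume "n \<in> a_kernel (left_proj i) (simple_dual i) (\<lambda>a. (*) (coef a (i, [])))"
    then have n: "n \<in> carrier (left_proj i)" "(*) (coef n (i, [])) = (*) 0" by (auto simp: s)
    from fun_cong[OF n(2), of 1] have "coef n (i, []) = 0" by simp
    then obtain m where m: "\<forall>\<alpha>\<in>arcs Q. m \<alpha> \<in> carrier (left_proj i)" "n = (\<Oplus>\<^bsub>A\<^esub>\<alpha>\<in>arcs Q. arr \<alpha> \<otimes>\<^bsub>A\<^esub> m \<alpha>)"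
      using left_proj_radical[OF i n(1)] by blast
    have "n = (\<Oplus>\<^bsub>left_proj i\<^esub>\<alpha>\<in>arcs Q. arr \<alpha> \<odot>\<^bsub>left_proj i\<^esub> m \<alpha>)"
      using m i by (subst finsum_left_proj) (auto simp: A.m_assoc)
    then show "\<exists>m. (\<forall>\<alpha>\<in>arcs Q. m \<alpha> \<in> carrier (left_proj i)) \<and>
        n = (\<Oplus>\<^bsub>left_proj i\<^esub>\<alpha>\<in>arcs Q. arr \<alpha> \<odot>\<^bsub>left_proj i\<^esub> m \<alpha>)" using m(1) by blast
  qed auto
qed

end

section \<open>The minimal presentation of the dual simple module\<close>

context bound_quiver
begin

lemma arrows_intoD:
  assumes "\<alpha> \<in> arrows_into Q k"
  shows "\<alpha> \<in> arcs Q" "head Q \<alpha> = k" "tail Q \<alpha> \<in> verts Q" "head Q \<alpha> \<in> verts Q"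
  using assms by (auto simp: arrows_into_def)

lemma finite_arrows_into: "finite (arrows_into Q k)"
  by (simp add: arrows_into_def)

abbreviation left_arrow_sum where
  "left_arrow_sum k \<equiv> dsum (arrows_into Q k) (\<lambda>\<alpha>. left_proj (tail Q \<alpha>))"

text \<open>Together with its domain, the left term of the minimal presentation: up to isomorphism,
  the projective cover of the radical of \<open>A e_k\<close>.\<close>

definition left_arrow_map where
  "left_arrow_map k x = (\<Oplus>\<^bsub>A\<^esub>\<alpha>\<in>arrows_into Q k. x \<alpha> \<otimes>\<^bsub>A\<^esub> arr \<alpha>)"

lemma right_module_left_arrow_sum: "right_module (opp A) (left_arrow_sum k)"
  by (rule right_module_dsum[OF op.ring_axioms right_module_left_proj]) (rule arrows_intoD)

lemma left_arrow_sumD: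
  assumes "x \<in> carrier (left_arrow_sum k)" "\<alpha> \<in> arrows_into Q k"
  shows "x \<alpha> \<in> carrier A" "x \<alpha> \<otimes>\<^bsub>A\<^esub> idem (tail Q \<alpha>) = x \<alpha>"
  using assms by (auto simp: PiE_iff)

lemma mod_hom_left_arrow_map:
  assumes k: "k \<in> verts Q"
  shows "left_arrow_map k \<in> mod_hom (opp A) (left_arrow_sum k) (left_proj k)"
proof -
  have hom: "(\<lambda>x. x \<alpha> \<otimes>\<^bsub>A\<^esub> arr \<alpha>) \<in> mod_hom (opp A) (left_arrow_sum k) (left_proj k)"
    if \<alpha>: "\<alpha> \<in> arrows_into Q k" for \<alpha>
  proof (rule mod_homI)
    note D = arrows_intoD[OF \<alpha>]
    show "x \<alpha> \<otimes>\<^bsub>A\<^esub> arr \<alpha> \<in> carrier (left_proj k)" if x: "x \<in> carrier (left_arrow_sum k)" for x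
      using left_arrow_sumD(1)[OF x \<alpha>] D k by (simp add: A.m_assoc arr_idem)
  next
    note D = arrows_intoD[OF \<alpha>]
    fix x y assume xy: "x \<in> carrier (left_arrow_sum k)" "y \<in> carrier (left_arrow_sum k)"
    show "(x \<oplus>\<^bsub>left_arrow_sum k\<^esub> y) \<alpha> \<otimes>\<^bsub>A\<^esub> arr \<alpha> = (x \<alpha> \<otimes>\<^bsub>A\<^esub> arr \<alpha>) \<oplus>\<^bsub>left_proj k\<^esub> (y \<alpha> \<otimes>\<^bsub>A\<^esub> arr \<alpha>)"
      using left_arrow_sumD(1)[OF xy(1) \<alpha>] left_arrow_sumD(1)[OF xy(2) \<alpha>] D \<alpha> by (simp add: A.l_distr)
  next
    note D = arrows_intoD[OF \<alpha>]
    fix a x assume a: "a \<in> carrier (opp A)" and x: "x \<in> carrier (left_arrow_sum k)"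
    show "(a \<odot>\<^bsub>left_arrow_sum k\<^esub> x) \<alpha> \<otimes>\<^bsub>A\<^esub> arr \<alpha> = a \<odot>\<^bsub>left_proj k\<^esub> (x \<alpha> \<otimes>\<^bsub>A\<^esub> arr \<alpha>)"
      using left_arrow_sumD(1)[OF x \<alpha>] D \<alpha> a by (simp add: A.m_assoc)
  qed
  have sum: "(\<lambda>x. \<Oplus>\<^bsub>left_proj k\<^esub>\<alpha>\<in>arrows_into Q k. x \<alpha> \<otimes>\<^bsub>A\<^esub> arr \<alpha>) \<in> mod_hom (opp A) (left_arrow_sum k) (left_proj k)"
    by (rule mod_hom_finsum_fun[OF right_module_left_proj[OF k] finite_arrows_into hom])
  have eq: "(\<Oplus>\<^bsub>left_proj k\<^esub>\<alpha>\<in>arrows_into Q k. x \<alpha> \<otimes>\<^bsub>A\<^esub> arr \<alpha>) = left_arrow_map k x"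
    if x: "x \<in> carrier (left_arrow_sum k)" for x
    unfolding left_arrow_map_def
    by (rule finsum_left_proj[OF k finite_arrows_into]) (use mod_homD(1)[OF hom] x in blast)
  interpret S: right_module "opp A" "left_arrow_sum k" by (rule right_module_left_arrow_sum)
  show ?thesis
  proof (rule mod_homI)
    show "left_arrow_map k x \<in> carrier (left_proj k)" if "x \<in> carrier (left_arrow_sum k)" for x
      using mod_homD(1)[OF sum that] eq[OF that] by (simp only:)
  next
    fix x y assume xy: "x \<in> carrier (left_arrow_sum k)" "y \<in> carrier (left_arrow_sum k)"
    show "left_arrow_map k (x \<oplus>\<^bsub>left_arrow_sum k\<^esub> y) = left_arrow_map k x \<oplus>\<^bsub>left_proj k\<^esub> left_arrow_map k y"
      using mod_homD(2)[OF sum xy] unfolding eq[OF xy(1)] eq[OF xy(2)] eq[OF S.M.a_closed[OF xy]] .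
  next
    fix a x assume ax: "a \<in> carrier (opp A)" "x \<in> carrier (left_arrow_sum k)"
    show "left_arrow_map k (a \<odot>\<^bsub>left_arrow_sum k\<^esub> x) = a \<odot>\<^bsub>left_proj k\<^esub> left_arrow_map k x"
      using mod_homD(3)[OF sum ax] unfolding eq[OF ax(2)] eq[OF S.act_closed[OF ax]] .
  qed
qed

text \<open>In \<open>x \<alpha> \<otimes> arr \<alpha>\<close> the coefficient of a single arrow
  comes from the trivial path in \<open>x \<alpha>\<close>. The second part therefore puts all
  components of a kernel element into the radical.\<close>

lemma coef_left_arrow_map:
  assumes x: "x \<in> carrier (left_arrow_sum k)"
  shows "coef (left_arrow_map k x) (u, []) = 0"
    "\<beta> \<in> arrows_into Q k \<Longrightarrow> coef (left_arrow_map k x) (tail Q \<beta>, [\<beta>]) = coef (x \<beta>) (tail Q \<beta>, [])"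
proof -
  have cl: "(\<lambda>\<alpha>. x \<alpha> \<otimes>\<^bsub>A\<^esub> arr \<alpha>) \<in> arrows_into Q k \<rightarrow> carrier A"
    using left_arrow_sumD(1)[OF x] arrows_intoD(1) by auto
  show "coef (left_arrow_map k x) (u, []) = 0"
    unfolding left_arrow_map_def
    using left_arrow_sumD(1)[OF x] arrows_intoD(1)
    by (subst coef_finsum[OF finite_arrows_into cl]) (auto simp: coef_mult coef_arr intro!: sum.neutral)
  assume \<beta>: "\<beta> \<in> arrows_into Q k"
  have "coef (left_arrow_map k x) (tail Q \<beta>, [\<beta>]) = (\<Sum>\<alpha>\<in>arrows_into Q k. coef (x \<alpha> \<otimes>\<^bsub>A\<^esub> arr \<alpha>) (tail Q \<beta>, [\<beta>]))"
    unfolding left_arrow_map_def by (rule coef_finsum[OF finite_arrows_into cl]) simp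
  also have "\<dots> = (\<Sum>\<alpha>\<in>arrows_into Q k. if \<alpha> = \<beta> then coef (x \<beta>) (tail Q \<beta>, []) else 0)"
    using left_arrow_sumD(1)[OF x] arrows_intoD(1) by (intro sum.cong) (auto simp: coef_mult coef_arr)
  also have "\<dots> = coef (x \<beta>) (tail Q \<beta>, [])"
    using \<beta> finite_arrows_into by simp
  finally show "coef (left_arrow_map k x) (tail Q \<beta>, [\<beta>]) = coef (x \<beta>) (tail Q \<beta>, [])" .
qed

text \<open>Sort the paths in a by their last arrow; multiplying by \<open>idem k\<close> removes
  the arrows that do not end at k.\<close>

lemma left_arrow_map_surj:
  assumes k: "k \<in> verts Q" and a: "a \<in> carrier (left_proj k)" "coef a (k, []) = 0"
  shows "a \<in> left_arrow_map k ` carrier (left_arrow_sum k)"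
proof -
  have aA: "a \<in> carrier A" "a \<otimes>\<^bsub>A\<^esub> idem k = a" using a(1) by auto
  have "coef a (j, []) = 0" if "j \<in> verts Q" for j
    using coef_mult(1)[OF aA(1) idem_closed[OF k], of j] aA(2) a(2) coef_idem[OF k, of j] by (cases "j = k") auto
  then obtain x where x: "\<And>\<alpha>. \<alpha> \<in> arcs Q \<Longrightarrow> x \<alpha> \<in> carrier A"
    "\<And>\<alpha>. \<alpha> \<in> arcs Q \<Longrightarrow> x \<alpha> \<otimes>\<^bsub>A\<^esub> idem (tail Q \<alpha>) = x \<alpha>" "a = (\<Oplus>\<^bsub>A\<^esub>\<alpha>\<in>arcs Q. x \<alpha> \<otimes>\<^bsub>A\<^esub> arr \<alpha>)"
    using radical_right_decomp[OF aA(1)] by blast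
  have "a = (\<Oplus>\<^bsub>A\<^esub>\<alpha>\<in>arcs Q. x \<alpha> \<otimes>\<^bsub>A\<^esub> arr \<alpha>) \<otimes>\<^bsub>A\<^esub> idem k" using aA(2) x(3) by simp
  also have "\<dots> = (\<Oplus>\<^bsub>A\<^esub>\<alpha>\<in>arcs Q. (x \<alpha> \<otimes>\<^bsub>A\<^esub> arr \<alpha>) \<otimes>\<^bsub>A\<^esub> idem k)"
    using x(1) k by (intro A.finsum_ldistr) auto
  also have "\<dots> = (\<Oplus>\<^bsub>A\<^esub>\<alpha>\<in>arrows_into Q k. x \<alpha> \<otimes>\<^bsub>A\<^esub> arr \<alpha>)"
    using x(1) k
    by (intro A.add.finprod_mono_neutral_cong_right)
      (auto simp: arrows_into_def A.m_assoc arr_idem)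
  also have "\<dots> = left_arrow_map k (\<lambda>\<alpha>\<in>arrows_into Q k. x \<alpha>)"
    unfolding left_arrow_map_def using x(1) by (intro A.finsum_cong') (auto simp: arrows_into_def)
  finally show ?thesis
    using x by (intro image_eqI[of _ _ "\<lambda>\<alpha>\<in>arrows_into Q k. x \<alpha>"]) (auto simp: arrows_into_def)
qed

text \<open>Kernel elements have all their components in the radical, so Nakayama's lemma applies.
  This is the minimality of the presentation.\<close>

lemma superfluous_left_arrow_kernel:
  assumes N: "N \<subseteq> carrier (left_arrow_sum k)" "\<And>n. n \<in> N \<Longrightarrow> left_arrow_map k n = \<zero>\<^bsub>A\<^esub>"
  shows "superfluous (opp A) (left_arrow_sum k) N"
proof (rule superfluous_radical[OF right_module_left_arrow_sum N(1)])
  fix n assume n: "n \<in> N"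
  then have nS: "n \<in> carrier (left_arrow_sum k)" using N(1) by blast
  have "\<exists>m. (\<forall>\<alpha>\<in>arcs Q. m \<alpha> \<in> carrier (left_proj (tail Q \<beta>))) \<and> n \<beta> = (\<Oplus>\<^bsub>A\<^esub>\<alpha>\<in>arcs Q. arr \<alpha> \<otimes>\<^bsub>A\<^esub> m \<alpha>)"
    if \<beta>: "\<beta> \<in> arrows_into Q k" for \<beta>
  proof (rule left_proj_radical)
    show "tail Q \<beta> \<in> verts Q" by (rule arrows_intoD[OF \<beta>])
    show "n \<beta> \<in> carrier (left_proj (tail Q \<beta>))" using left_arrow_sumD[OF nS \<beta>] by simp
    show "coef (n \<beta>) (tail Q \<beta>, []) = 0"
      using coef_left_arrow_map(2)[OF nS \<beta>] N(2)[OF n] coef_zero[of "[\<beta>]"] by simp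
  qed
  then have "\<forall>\<beta>\<in>arrows_into Q k. \<exists>m. (\<forall>\<alpha>\<in>arcs Q. m \<alpha> \<in> carrier (left_proj (tail Q \<beta>))) \<and>
      n \<beta> = (\<Oplus>\<^bsub>A\<^esub>\<alpha>\<in>arcs Q. arr \<alpha> \<otimes>\<^bsub>A\<^esub> m \<alpha>)"
    by (rule ballI)
  then obtain m where m': "\<forall>\<beta>\<in>arrows_into Q k. (\<forall>\<alpha>\<in>arcs Q. m \<beta> \<alpha> \<in> carrier (left_proj (tail Q \<beta>))) \<and>
      n \<beta> = (\<Oplus>\<^bsub>A\<^esub>\<alpha>\<in>arcs Q. arr \<alpha> \<otimes>\<^bsub>A\<^esub> m \<beta> \<alpha>)"
    unfolding bchoice_iff by (rule exE)
  have m1: "m \<beta> \<alpha> \<in> carrier (left_proj (tail Q \<beta>))" if "\<beta> \<in> arrows_into Q k" "\<alpha> \<in> arcs Q" for \<beta> \<alpha>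
    using bspec[OF m' that(1)] that(2) by blast
  have m2: "n \<beta> = (\<Oplus>\<^bsub>A\<^esub>\<alpha>\<in>arcs Q. arr \<alpha> \<otimes>\<^bsub>A\<^esub> m \<beta> \<alpha>)" if "\<beta> \<in> arrows_into Q k" for \<beta>
    using bspec[OF m' that] by blast
  let ?S = "left_arrow_sum k"
  interpret S: right_module "opp A" ?S by (rule right_module_left_arrow_sum)
  \<comment> \<open>The decompositions of the components are regrouped: for each arrow
    \<open>\<alpha>\<close>, one tuple indexed by the arrows \<open>\<beta>\<close> into k.\<close>
  let ?m = "\<lambda>\<alpha>. \<lambda>\<beta>\<in>arrows_into Q k. m \<beta> \<alpha>"
  have mS: "?m \<alpha> \<in> carrier ?S" if "\<alpha> \<in> arcs Q" for \<alpha>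
    using m1[OF _ that] by (simp add: PiE_iff)
  have amS: "(\<lambda>\<alpha>. arr \<alpha> \<odot>\<^bsub>?S\<^esub> ?m \<alpha>) \<in> arcs Q \<rightarrow> carrier ?S"
    using S.act_closed[OF _ mS] by auto
  have "n = (\<Oplus>\<^bsub>?S\<^esub>\<alpha>\<in>arcs Q. arr \<alpha> \<odot>\<^bsub>?S\<^esub> ?m \<alpha>)"
  proof (rule PiE_ext)
    show "n \<in> (\<Pi>\<^sub>E \<alpha>\<in>arrows_into Q k. carrier (left_proj (tail Q \<alpha>)))" using nS by (simp only: dsum_simps)
    show "(\<Oplus>\<^bsub>?S\<^esub>\<alpha>\<in>arcs Q. arr \<alpha> \<odot>\<^bsub>?S\<^esub> ?m \<alpha>) \<in> (\<Pi>\<^sub>E \<alpha>\<in>arrows_into Q k. carrier (left_proj (tail Q \<alpha>)))"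
      using S.M.finsum_closed[OF amS] by (simp only: dsum_simps)
    fix \<beta> assume \<beta>: "\<beta> \<in> arrows_into Q k"
    note tb = arrows_intoD(3)[OF \<beta>]
    have "(\<Oplus>\<^bsub>?S\<^esub>\<alpha>\<in>arcs Q. arr \<alpha> \<odot>\<^bsub>?S\<^esub> ?m \<alpha>) \<beta> = (\<Oplus>\<^bsub>left_proj (tail Q \<beta>)\<^esub>\<alpha>\<in>arcs Q. (arr \<alpha> \<odot>\<^bsub>?S\<^esub> ?m \<alpha>) \<beta>)"
      by (rule mod_hom_finsum[OF S.right_module_axioms right_module_left_proj[OF tb] mod_hom_proj[OF \<beta>] finite_arcs amS])
    also have "\<dots> = (\<Oplus>\<^bsub>A\<^esub>\<alpha>\<in>arcs Q. (arr \<alpha> \<odot>\<^bsub>?S\<^esub> ?m \<alpha>) \<beta>)"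
      using \<beta> tb m1[OF \<beta>] by (intro finsum_left_proj) (auto simp: A.m_assoc)
    also have "\<dots> = n \<beta>"
      unfolding m2[OF \<beta>] using \<beta> m1[OF \<beta>] by (intro A.finsum_cong') auto
    finally show "n \<beta> = (\<Oplus>\<^bsub>?S\<^esub>\<alpha>\<in>arcs Q. arr \<alpha> \<odot>\<^bsub>?S\<^esub> ?m \<alpha>) \<beta>" by simp
  qed
  then show "\<exists>m. (\<forall>\<alpha>\<in>arcs Q. m \<alpha> \<in> carrier ?S) \<and> n = (\<Oplus>\<^bsub>?S\<^esub>\<alpha>\<in>arcs Q. arr \<alpha> \<odot>\<^bsub>?S\<^esub> m \<alpha>)"
    using mS by (intro exI[of _ ?m]) blast
qed

section \<open>The differential of \<open>L_k\<close> and the cokernel description of the inverse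
  translate\<close>

abbreviation arrow_sum where
  "arrow_sum k \<equiv> dsum (arrows_into Q k) (\<lambda>\<alpha>. vertex_proj Q I (tail Q \<alpha>))"

definition arrow_map where
  "arrow_map k x = (\<lambda>\<alpha>\<in>arrows_into Q k. arr \<alpha> \<otimes>\<^bsub>A\<^esub> x)"

lemma right_module_arrow_sum: "right_module A (arrow_sum k)"
  by (rule right_module_dsum[OF A.ring_axioms right_module_vertex_proj]) (rule arrows_intoD)

lemma arrow_sumD:
  assumes "r \<in> carrier (arrow_sum k)" "\<alpha> \<in> arrows_into Q k"
  shows "r \<alpha> \<in> carrier A" "idem (tail Q \<alpha>) \<otimes>\<^bsub>A\<^esub> r \<alpha> = r \<alpha>"
  using assms arrows_intoD(3)[OF assms(2)] by (auto simp: PiE_iff vertex_proj_simps)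

lemma arrow_sum_add:
  "\<alpha> \<in> arrows_into Q k \<Longrightarrow> (r \<oplus>\<^bsub>arrow_sum k\<^esub> r') \<alpha> = r \<alpha> \<oplus>\<^bsub>A\<^esub> r' \<alpha>"
  "\<alpha> \<in> arrows_into Q k \<Longrightarrow> (a \<odot>\<^bsub>arrow_sum k\<^esub> r) \<alpha> = r \<alpha> \<otimes>\<^bsub>A\<^esub> a"
  using arrows_intoD(3)[of \<alpha> k] by (simp_all add: vertex_proj_simps)

lemma mod_hom_arrow_map:
  assumes k: "k \<in> verts Q"
  shows "arrow_map k \<in> mod_hom A (vertex_proj Q I k) (arrow_sum k)"
  unfolding arrow_map_def[abs_def]
proof (rule mod_hom_tuple)
  fix \<alpha> assume "\<alpha> \<in> arrows_into Q k"
  note D = arrows_intoD[OF this]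
  show "(\<lambda>x. arr \<alpha> \<otimes>\<^bsub>A\<^esub> x) \<in> mod_hom A (vertex_proj Q I k) (vertex_proj Q I (tail Q \<alpha>))"
    by (rule mod_homI)
      (use D k in \<open>auto simp: vertex_proj_simps A.m_assoc[symmetric] idem_arr A.r_distr\<close>)
qed

text \<open>
  Applying \<open>Hom(-, A)\<close> to the canonical minimal presentation of the dual simple module turns left
  multiplication by arrows on the direct sum of left projectives into the map \<open>arrow_map\<close>.
\<close>

lemma tau_inv_presentation:
  assumes fd: "fd_module A (regular_mod A)" and k: "k \<in> verts Q"
    and X: "is_tau_inv A (vertex_simple k :: (_, 'k) module) X"
  obtains c where "c \<in> mod_hom A (arrow_sum k) X" "c ` carrier (arrow_sum k) = carrier X"
    "a_kernel (arrow_sum k) X c = arrow_map k ` carrier (vertex_proj Q I k)"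
proof -
  let ?B = "opp A" and ?S = "left_arrow_sum k" and ?C = "simple_dual k" and ?R = "arrow_sum k"
  let ?\<rho> = "left_arrow_map k" and ?\<pi> = "\<lambda>a. (*) (coef a (k, []))"
  from X obtain P1 :: "((('v, 'a) qpath \<Rightarrow> 'k) set, 'k vec) module"
    and P0 :: "((('v, 'a) qpath \<Rightarrow> 'k) set, 'k vec) module" and p1 p0 where
    fdX: "fd_module A X" and mp: "minimal_presentation ?B P1 P0 ?C p1 p0" and
    iso: "mod_iso A X (quot_mod (hom_regular ?B P1)
      ((\<lambda>\<phi>. \<lambda>x\<in>carrier P1. \<phi> (p1 x)) ` carrier (hom_regular ?B P0)))"
    unfolding is_tau_inv_def is_transpose_def opp_opp by blast
  let ?K = "a_kernel P0 ?C p0"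
  have c0: "projective_cover ?B P0 ?C p0" and c1: "projective_cover ?B P1 (submod P0 ?K) p1"
    using mp by (auto simp: minimal_presentation_def)
  have rmX: "right_module A X" using fdX by (rule A.fd_right_module)
  have p0: "p0 \<in> mod_hom ?B P0 ?C" and fd0: "fd_module ?B P0" and fd1: "fd_module ?B P1"
    and p1: "p1 \<in> mod_hom ?B P1 (submod P0 ?K)"
    using c0 c1 by (auto simp: projective_cover_def intro: op.projective_fd)
  note rm0 = op.fd_right_module[OF fd0] and rm1 = op.fd_right_module[OF fd1]
  note rmC = right_module_simple_dual[OF k]
  note rmL = right_module_left_proj[OF k] and rmS = right_module_left_arrow_sum[of k]
  note \<rho> = mod_hom_left_arrow_map[OF k]
  interpret L: right_module ?B "left_proj k" by (rule rmL)
  interpret S: right_module ?B ?S by (rule rmS)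
  interpret P0: right_module ?B P0 by (rule rm0)
  interpret P1: right_module ?B P1 by (rule rm1)
  interpret R: right_module A ?R by (rule right_module_arrow_sum)
  \<comment> \<open>The given \<open>P0\<close> is just some projective cover; it is compared with
    the explicit one.\<close>
  obtain \<theta>0 \<eta>0 where \<theta>0: "\<theta>0 \<in> mod_hom ?B (left_proj k) P0" and \<eta>0: "\<eta>0 \<in> mod_hom ?B P0 (left_proj k)"
    and \<eta>\<theta>0: "\<And>x. x \<in> carrier (left_proj k) \<Longrightarrow> \<eta>0 (\<theta>0 x) = x" and \<theta>\<eta>0: "\<And>y. y \<in> carrier P0 \<Longrightarrow> \<theta>0 (\<eta>0 y) = y"
    and p0\<theta>: "\<And>x. x \<in> carrier (left_proj k) \<Longrightarrow> p0 (\<theta>0 x) = ?\<pi> x"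
    by (rule op.projective_cover_unique[OF projective_cover_simple_dual[OF fd k] c0 rmC]) (rule that)
  have subK: "submodule ?K ?B P0" by (rule submodule_a_kernel[OF rm0 rmC p0])
  have \<theta>\<rho>: "(\<lambda>x. \<theta>0 (?\<rho> x)) \<in> mod_hom ?B ?S (submod P0 ?K)"
  proof (rule mod_hom_submod_codomain[OF mod_hom_comp[OF \<rho> \<theta>0]])
    fix x assume x: "x \<in> carrier ?S"
    note rx = mod_homD(1)[OF \<rho> x]
    show "\<theta>0 (?\<rho> x) \<in> ?K"
      using mod_homD(1)[OF \<theta>0 rx] p0\<theta>[OF rx] coef_left_arrow_map(1)[OF x] by (simp add: simple_dual_simps[OF k])
  qed
  \<comment> \<open>Under the comparison the kernel of \<open>p0\<close> corresponds to the radical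
    of \<open>A e_k\<close>, so the left projectives at the arrows into k cover it and can be
    compared with \<open>P1\<close>.\<close>
  have cover: "projective_cover ?B ?S (submod P0 ?K) (\<lambda>x. \<theta>0 (?\<rho> x))"
    unfolding projective_cover_def
  proof (intro conjI)
    show "projective ?B ?S"
      by (rule op.projective_dsum[OF finite_arrows_into projective_left_proj[OF fd]]) (rule arrows_intoD)
    show "(\<lambda>x. \<theta>0 (?\<rho> x)) \<in> mod_hom ?B ?S (submod P0 ?K)" by (rule \<theta>\<rho>)
    show "(\<lambda>x. \<theta>0 (?\<rho> x)) ` carrier ?S = carrier (submod P0 ?K)"
    proof (intro subset_antisym subsetI)
      fix y assume "y \<in> carrier (submod P0 ?K)"
      then have y: "y \<in> carrier P0" "p0 y = (*) 0" by (auto simp: simple_dual_simps[OF k])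
      note ey = mod_homD(1)[OF \<eta>0 y(1)]
      have "?\<pi> (\<eta>0 y) = (*) 0" using p0\<theta>[OF ey] \<theta>\<eta>0[OF y(1)] y(2) by simp
      from fun_cong[OF this, of 1] have "coef (\<eta>0 y) (k, []) = 0" by simp
      from left_arrow_map_surj[OF k ey this] obtain x where "\<eta>0 y = ?\<rho> x" "x \<in> carrier ?S" by (rule imageE)
      then show "y \<in> (\<lambda>x. \<theta>0 (?\<rho> x)) ` carrier ?S"
        using \<theta>\<eta>0[OF y(1)] by (intro image_eqI[of _ _ x]) simp_all
    next
      fix y assume "y \<in> (\<lambda>x. \<theta>0 (?\<rho> x)) ` carrier ?S"
      then obtain x where "y = \<theta>0 (?\<rho> x)" "x \<in> carrier ?S" by (rule imageE)
      then show "y \<in> carrier (submod P0 ?K)" using mod_homD(1)[OF \<theta>\<rho>] by simp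
    qed
    show "superfluous ?B ?S (a_kernel ?S (submod P0 ?K) (\<lambda>x. \<theta>0 (?\<rho> x)))"
    proof (rule superfluous_left_arrow_kernel)
      show "a_kernel ?S (submod P0 ?K) (\<lambda>x. \<theta>0 (?\<rho> x)) \<subseteq> carrier ?S" by (rule subsetI) (simp only: a_kernel_iff)
      fix n assume "n \<in> a_kernel ?S (submod P0 ?K) (\<lambda>x. \<theta>0 (?\<rho> x))"
      then have n: "n \<in> carrier ?S" "\<theta>0 (?\<rho> n) = \<zero>\<^bsub>P0\<^esub>" by (simp_all only: a_kernel_iff submod_simps)
      have "?\<rho> n = \<eta>0 \<zero>\<^bsub>P0\<^esub>" using \<eta>\<theta>0[OF mod_homD(1)[OF \<rho> n(1)]] n(2) by simp
      then show "?\<rho> n = \<zero>\<^bsub>A\<^esub>" using mod_hom_zero[OF rm0 rmL \<eta>0] by simp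
    qed
  qed
  obtain \<theta>1 \<eta>1 where \<theta>1: "\<theta>1 \<in> mod_hom ?B ?S P1" and \<eta>1: "\<eta>1 \<in> mod_hom ?B P1 ?S"
    and \<eta>\<theta>1: "\<And>x. x \<in> carrier ?S \<Longrightarrow> \<eta>1 (\<theta>1 x) = x" and \<theta>\<eta>1: "\<And>y. y \<in> carrier P1 \<Longrightarrow> \<theta>1 (\<eta>1 y) = y"
    and p1\<theta>: "\<And>x. x \<in> carrier ?S \<Longrightarrow> p1 (\<theta>1 x) = \<theta>0 (?\<rho> x)"
    by (rule op.projective_cover_unique[OF cover c1 right_module_submod[OF rm0 subK]]) (rule that)
  have p1': "p1 \<in> mod_hom ?B P1 P0" by (rule mod_hom_from_submod[OF p1]) auto
  have p1\<eta>: "\<eta>0 (p1 y) = ?\<rho> (\<eta>1 y)" if y: "y \<in> carrier P1" for y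
    using p1\<theta>[OF mod_homD(1)[OF \<eta>1 y]] \<theta>\<eta>1[OF y] \<eta>\<theta>0[OF mod_homD(1)[OF \<rho> mod_homD(1)[OF \<eta>1 y]]] by simp
  let ?H1 = "hom_regular ?B P1" and ?H0 = "hom_regular ?B P0"
  have rmH1: "right_module A ?H1" using op.right_module_hom_regular[OF rm1] by simp
  have rmH0: "right_module A ?H0" using op.right_module_hom_regular[OF rm0] by simp
  let ?pre = "\<lambda>\<phi>. \<lambda>x\<in>carrier P1. \<phi> (p1 x)"
  have pre: "?pre \<in> mod_hom A ?H0 ?H1"
  proof (rule mod_homI)
    fix \<phi> assume "\<phi> \<in> carrier ?H0"
    then show "?pre \<phi> \<in> carrier ?H1"
      using restrict_mod_hom[OF rm1 mod_hom_comp[OF p1', of \<phi>]] by (simp add: hom_regular_simps)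
  qed (auto simp: hom_regular_simps mod_homD(1)[OF p1'] intro!: restrict_ext)
  let ?Im = "?pre ` carrier ?H0"
  have subIm: "submodule ?Im A ?H1" by (rule submodule_image[OF rmH0 rmH1 pre])
  \<comment> \<open>The identification of \<open>Hom(A e_i, A)\<close> with \<open>e_i A\<close>,
    summand by summand: the component of y at \<open>\<alpha>\<close> is multiplied on the right by
    \<open>r \<alpha>\<close>.\<close>
  let ?\<Phi> = "\<lambda>r. \<lambda>y\<in>carrier P1. \<Oplus>\<^bsub>A\<^esub>\<alpha>\<in>arrows_into Q k. \<eta>1 y \<alpha> \<otimes>\<^bsub>A\<^esub> r \<alpha>"
  have \<eta>1A: "\<eta>1 y \<alpha> \<in> carrier A" if "y \<in> carrier P1" "\<alpha> \<in> arrows_into Q k" for y \<alpha>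
    by (rule left_arrow_sumD(1)[OF mod_homD(1)[OF \<eta>1 that(1)] that(2)])
  have fin: "(\<lambda>\<alpha>. \<eta>1 y \<alpha> \<otimes>\<^bsub>A\<^esub> r \<alpha>) \<in> arrows_into Q k \<rightarrow> carrier A"
    if "y \<in> carrier P1" "r \<in> carrier ?R" for y r
    using \<eta>1A[OF that(1)] arrow_sumD(1)[OF that(2)] by auto
  have \<Phi>: "?\<Phi> \<in> mod_hom A ?R ?H1"
  proof (rule mod_homI)
    fix r assume r: "r \<in> carrier ?R"
    have "(\<lambda>y. \<Oplus>\<^bsub>A\<^esub>\<alpha>\<in>arrows_into Q k. \<eta>1 y \<alpha> \<otimes>\<^bsub>A\<^esub> r \<alpha>) \<in> mod_hom ?B P1 (regular_mod ?B)"
    proof (rule mod_homI)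
      fix y assume y: "y \<in> carrier P1"
      show "(\<Oplus>\<^bsub>A\<^esub>\<alpha>\<in>arrows_into Q k. \<eta>1 y \<alpha> \<otimes>\<^bsub>A\<^esub> r \<alpha>) \<in> carrier (regular_mod ?B)"
        using A.finsum_closed[OF fin[OF y r]] by simp
      fix z assume z: "z \<in> carrier P1"
      have "\<eta>1 (y \<oplus>\<^bsub>P1\<^esub> z) \<alpha> = \<eta>1 y \<alpha> \<oplus>\<^bsub>A\<^esub> \<eta>1 z \<alpha>" if "\<alpha> \<in> arrows_into Q k" for \<alpha>
        using mod_homD(2)[OF \<eta>1 y z] that by simp
      then have "(\<Oplus>\<^bsub>A\<^esub>\<alpha>\<in>arrows_into Q k. \<eta>1 (y \<oplus>\<^bsub>P1\<^esub> z) \<alpha> \<otimes>\<^bsub>A\<^esub> r \<alpha>) =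
          (\<Oplus>\<^bsub>A\<^esub>\<alpha>\<in>arrows_into Q k. \<eta>1 y \<alpha> \<otimes>\<^bsub>A\<^esub> r \<alpha> \<oplus>\<^bsub>A\<^esub> \<eta>1 z \<alpha> \<otimes>\<^bsub>A\<^esub> r \<alpha>)"
        using \<eta>1A[OF y] \<eta>1A[OF z] arrow_sumD(1)[OF r] by (intro A.finsum_cong') (auto simp: A.l_distr)
      then show "(\<Oplus>\<^bsub>A\<^esub>\<alpha>\<in>arrows_into Q k. \<eta>1 (y \<oplus>\<^bsub>P1\<^esub> z) \<alpha> \<otimes>\<^bsub>A\<^esub> r \<alpha>) =
          (\<Oplus>\<^bsub>A\<^esub>\<alpha>\<in>arrows_into Q k. \<eta>1 y \<alpha> \<otimes>\<^bsub>A\<^esub> r \<alpha>) \<oplus>\<^bsub>regular_mod ?B\<^esub> (\<Oplus>\<^bsub>A\<^esub>\<alpha>\<in>arrows_into Q k. \<eta>1 z \<alpha> \<otimes>\<^bsub>A\<^esub> r \<alpha>)"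
        using A.finsum_addf[OF fin[OF y r] fin[OF z r]] by simp
    next
      fix a y assume a: "a \<in> carrier ?B" and y: "y \<in> carrier P1"
      have "\<eta>1 (a \<odot>\<^bsub>P1\<^esub> y) \<alpha> = a \<otimes>\<^bsub>A\<^esub> \<eta>1 y \<alpha>" if "\<alpha> \<in> arrows_into Q k" for \<alpha>
        using mod_homD(3)[OF \<eta>1 a y] that by simp
      then have "(\<Oplus>\<^bsub>A\<^esub>\<alpha>\<in>arrows_into Q k. \<eta>1 (a \<odot>\<^bsub>P1\<^esub> y) \<alpha> \<otimes>\<^bsub>A\<^esub> r \<alpha>) =
          (\<Oplus>\<^bsub>A\<^esub>\<alpha>\<in>arrows_into Q k. a \<otimes>\<^bsub>A\<^esub> (\<eta>1 y \<alpha> \<otimes>\<^bsub>A\<^esub> r \<alpha>))"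
        using \<eta>1A[OF y] arrow_sumD(1)[OF r] a by (intro A.finsum_cong') (auto simp: A.m_assoc)
      also have "\<dots> = a \<otimes>\<^bsub>A\<^esub> (\<Oplus>\<^bsub>A\<^esub>\<alpha>\<in>arrows_into Q k. \<eta>1 y \<alpha> \<otimes>\<^bsub>A\<^esub> r \<alpha>)"
        using A.finsum_rdistr[OF finite_arrows_into _ fin[OF y r], of a] a by simp
      finally show "(\<Oplus>\<^bsub>A\<^esub>\<alpha>\<in>arrows_into Q k. \<eta>1 (a \<odot>\<^bsub>P1\<^esub> y) \<alpha> \<otimes>\<^bsub>A\<^esub> r \<alpha>) =
          a \<odot>\<^bsub>regular_mod ?B\<^esub> (\<Oplus>\<^bsub>A\<^esub>\<alpha>\<in>arrows_into Q k. \<eta>1 y \<alpha> \<otimes>\<^bsub>A\<^esub> r \<alpha>)" by simp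
    qed
    then show "?\<Phi> r \<in> carrier ?H1" using restrict_mod_hom[OF rm1] by (simp add: hom_regular_simps)
  next
    fix r r' assume r: "r \<in> carrier ?R" "r' \<in> carrier ?R"
    have "(\<Oplus>\<^bsub>A\<^esub>\<alpha>\<in>arrows_into Q k. \<eta>1 y \<alpha> \<otimes>\<^bsub>A\<^esub> (r \<oplus>\<^bsub>?R\<^esub> r') \<alpha>) =
        (\<Oplus>\<^bsub>A\<^esub>\<alpha>\<in>arrows_into Q k. \<eta>1 y \<alpha> \<otimes>\<^bsub>A\<^esub> r \<alpha>) \<oplus>\<^bsub>A\<^esub> (\<Oplus>\<^bsub>A\<^esub>\<alpha>\<in>arrows_into Q k. \<eta>1 y \<alpha> \<otimes>\<^bsub>A\<^esub> r' \<alpha>)"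
      if y: "y \<in> carrier P1" for y
      unfolding A.finsum_addf[OF fin[OF y r(1)] fin[OF y r(2)], symmetric]
      using \<eta>1A[OF y] arrow_sumD(1)[OF r(1)] arrow_sumD(1)[OF r(2)]
      by (intro A.finsum_cong') (auto simp: arrow_sum_add A.r_distr simp del: dsum_simps)
    then show "?\<Phi> (r \<oplus>\<^bsub>?R\<^esub> r') = ?\<Phi> r \<oplus>\<^bsub>?H1\<^esub> ?\<Phi> r'"
      by (auto simp: hom_regular_simps simp del: dsum_simps intro!: restrict_ext)
  next
    fix a r assume a: "a \<in> carrier A" and r: "r \<in> carrier ?R"
    have "(\<Oplus>\<^bsub>A\<^esub>\<alpha>\<in>arrows_into Q k. \<eta>1 y \<alpha> \<otimes>\<^bsub>A\<^esub> (a \<odot>\<^bsub>?R\<^esub> r) \<alpha>) =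
        (\<Oplus>\<^bsub>A\<^esub>\<alpha>\<in>arrows_into Q k. \<eta>1 y \<alpha> \<otimes>\<^bsub>A\<^esub> r \<alpha>) \<otimes>\<^bsub>A\<^esub> a" if y: "y \<in> carrier P1" for y
      unfolding A.finsum_ldistr[OF finite_arrows_into a fin[OF y r]]
      using \<eta>1A[OF y] arrow_sumD(1)[OF r] a
      by (intro A.finsum_cong') (auto simp: arrow_sum_add A.m_assoc simp del: dsum_simps)
    then show "?\<Phi> (a \<odot>\<^bsub>?R\<^esub> r) = a \<odot>\<^bsub>?H1\<^esub> ?\<Phi> r"
      by (auto simp: hom_regular_simps simp del: dsum_simps intro!: restrict_ext)
  qed
  define \<iota> where "\<iota> \<alpha> = dinj (arrows_into Q k) (\<lambda>\<alpha>. left_proj (tail Q \<alpha>)) \<alpha>" for \<alpha>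
  have \<iota>: "\<iota> \<alpha> \<in> mod_hom ?B (left_proj (tail Q \<alpha>)) ?S" if "\<alpha> \<in> arrows_into Q k" for \<alpha>
    unfolding \<iota>_def by (rule mod_hom_dinj[OF right_module_left_proj that]) (rule arrows_intoD)
  have \<iota>e: "\<iota> \<alpha> (idem (tail Q \<alpha>)) \<in> carrier ?S" if "\<alpha> \<in> arrows_into Q k" for \<alpha>
    by (rule mod_homD(1)[OF \<iota>[OF that] idem_left_proj]) (rule arrows_intoD[OF that])
  \<comment> \<open>Evaluating at the generator of the summand at \<open>\<alpha>\<close> recovers
    \<open>r \<alpha>\<close>; injectivity follows.\<close>
  have \<Phi>\<iota>: "?\<Phi> r (\<theta>1 (\<iota> \<alpha> (idem (tail Q \<alpha>)))) = r \<alpha>" if r: "r \<in> carrier ?R" and \<alpha>: "\<alpha> \<in> arrows_into Q k" for r \<alpha>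
  proof -
    let ?y = "\<theta>1 (\<iota> \<alpha> (idem (tail Q \<alpha>)))"
    have y: "?y \<in> carrier P1" by (rule mod_homD(1)[OF \<theta>1 \<iota>e[OF \<alpha>]])
    have "(\<Oplus>\<^bsub>A\<^esub>\<beta>\<in>arrows_into Q k. \<eta>1 ?y \<beta> \<otimes>\<^bsub>A\<^esub> r \<beta>) = (\<Oplus>\<^bsub>A\<^esub>\<beta>\<in>arrows_into Q k. if \<alpha> = \<beta> then r \<alpha> else \<zero>\<^bsub>A\<^esub>)"
      unfolding \<eta>\<theta>1[OF \<iota>e[OF \<alpha>]]
      using arrow_sumD[OF r] by (intro A.finsum_cong') (auto simp: \<iota>_def dinj_def)
    also have "\<dots> = r \<alpha>"
      by (rule A.finsum_singleton[where f = "\<lambda>_. r \<alpha>"]) (use \<alpha> finite_arrows_into arrow_sumD(1)[OF r] in auto)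
    finally show ?thesis using y by simp
  qed
  have \<Phi>_inj: "r = r'" if "r \<in> carrier ?R" "r' \<in> carrier ?R" "?\<Phi> r = ?\<Phi> r'" for r r'
  proof (rule PiE_ext)
    show "r \<in> (\<Pi>\<^sub>E \<alpha>\<in>arrows_into Q k. carrier (vertex_proj Q I (tail Q \<alpha>)))"
      "r' \<in> (\<Pi>\<^sub>E \<alpha>\<in>arrows_into Q k. carrier (vertex_proj Q I (tail Q \<alpha>)))"
      using that by (simp_all only: dsum_simps)
    show "r \<alpha> = r' \<alpha>" if "\<alpha> \<in> arrows_into Q k" for \<alpha>
      using \<Phi>\<iota>[OF \<open>r \<in> carrier ?R\<close> that] \<Phi>\<iota>[OF \<open>r' \<in> carrier ?R\<close> that] \<open>?\<Phi> r = ?\<Phi> r'\<close> by (simp only:)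
  qed
  \<comment> \<open>Conversely, the values of a homomorphism at these generators serve as the
    components of r.\<close>
  have \<Phi>_surj: "\<exists>r\<in>carrier ?R. \<phi> = ?\<Phi> r" if \<phi>: "\<phi> \<in> carrier ?H1" for \<phi>
  proof -
    have \<phi>h: "\<phi> \<in> mod_hom ?B P1 (regular_mod ?B)" "\<phi> \<in> extensional (carrier P1)"
      using \<phi> by (auto simp: hom_regular_simps)
    let ?y = "\<lambda>\<alpha>. \<theta>1 (\<iota> \<alpha> (idem (tail Q \<alpha>)))"
    let ?r = "\<lambda>\<alpha>\<in>arrows_into Q k. \<phi> (?y \<alpha>)"
    have y: "?y \<alpha> \<in> carrier P1" if "\<alpha> \<in> arrows_into Q k" for \<alpha> by (rule mod_homD(1)[OF \<theta>1 \<iota>e[OF that]])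
    have act: "\<phi> (\<theta>1 (\<iota> \<alpha> a)) = a \<otimes>\<^bsub>A\<^esub> \<phi> (?y \<alpha>)"
      if \<alpha>: "\<alpha> \<in> arrows_into Q k" and a: "a \<in> carrier (left_proj (tail Q \<alpha>))" for \<alpha> a
    proof -
      note e = idem_left_proj[OF arrows_intoD(3)[OF \<alpha>]]
      have aA: "a \<in> carrier ?B" using a by simp
      have "\<iota> \<alpha> a = a \<odot>\<^bsub>?S\<^esub> \<iota> \<alpha> (idem (tail Q \<alpha>))"
        using mod_homD(3)[OF \<iota>[OF \<alpha>] aA e] a by simp
      then have "\<theta>1 (\<iota> \<alpha> a) = a \<odot>\<^bsub>P1\<^esub> ?y \<alpha>" using mod_homD(3)[OF \<theta>1 aA \<iota>e[OF \<alpha>]] by simp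
      then show ?thesis using mod_homD(3)[OF \<phi>h(1) aA y[OF \<alpha>]] by simp
    qed
    have r: "?r \<in> carrier ?R"
    proof -
      have "\<phi> (?y \<alpha>) \<in> carrier (vertex_proj Q I (tail Q \<alpha>))" if \<alpha>: "\<alpha> \<in> arrows_into Q k" for \<alpha>
        using act[OF \<alpha> idem_left_proj] mod_homD(1)[OF \<phi>h(1) y[OF \<alpha>]] arrows_intoD(3)[OF \<alpha>]
        by (simp add: vertex_proj_simps)
      then show ?thesis by simp
    qed
    have "\<phi> z = ?\<Phi> ?r z" if z: "z \<in> carrier P1" for z
    proof -
      note ez = mod_homD(1)[OF \<eta>1 z]
      have comp: "\<eta>1 z \<alpha> \<in> carrier (left_proj (tail Q \<alpha>))" if "\<alpha> \<in> arrows_into Q k" for \<alpha>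
        using left_arrow_sumD[OF ez that] by simp
      have cl: "(\<lambda>\<alpha>. \<iota> \<alpha> (\<eta>1 z \<alpha>)) \<in> arrows_into Q k \<rightarrow> carrier ?S"
        using mod_homD(1)[OF \<iota> comp] by (intro Pi_I)
      have \<phi>\<theta>: "(\<lambda>x. \<phi> (\<theta>1 x)) \<in> mod_hom ?B ?S (regular_mod ?B)" by (rule mod_hom_comp[OF \<theta>1 \<phi>h(1)])
      have "\<eta>1 z = (\<Oplus>\<^bsub>?S\<^esub>\<alpha>\<in>arrows_into Q k. \<iota> \<alpha> (\<eta>1 z \<alpha>))"
        unfolding \<iota>_def
        by (rule dsum_decomp[OF op.ring_axioms right_module_left_proj finite_arrows_into ez]) (rule arrows_intoD)
      then have "\<phi> z = \<phi> (\<theta>1 (\<Oplus>\<^bsub>?S\<^esub>\<alpha>\<in>arrows_into Q k. \<iota> \<alpha> (\<eta>1 z \<alpha>)))" using \<theta>\<eta>1[OF z] by simp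
      also have "\<dots> = (\<Oplus>\<^bsub>regular_mod ?B\<^esub>\<alpha>\<in>arrows_into Q k. \<phi> (\<theta>1 (\<iota> \<alpha> (\<eta>1 z \<alpha>))))"
        by (rule mod_hom_finsum[OF rmS right_module_regular[OF op.ring_axioms] \<phi>\<theta> finite_arrows_into cl])
      also have "\<dots> = (\<Oplus>\<^bsub>A\<^esub>\<alpha>\<in>arrows_into Q k. \<phi> (\<theta>1 (\<iota> \<alpha> (\<eta>1 z \<alpha>))))"
        by (simp add: finsum_def finprod_def)
      also have "\<dots> = (\<Oplus>\<^bsub>A\<^esub>\<alpha>\<in>arrows_into Q k. \<eta>1 z \<alpha> \<otimes>\<^bsub>A\<^esub> ?r \<alpha>)"
        by (rule A.finsum_cong'[OF refl fin[OF z r]]) (simp add: act comp del: left_proj_simps)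
      finally show ?thesis using z by simp
    qed
    then have "\<phi> = ?\<Phi> ?r" using \<phi>h(2) by (intro extensionalityI[of _ "carrier P1"]) auto
    then show ?thesis using r by blast
  qed
  \<comment> \<open>The element \<open>arrow_map k x\<close> corresponds to
    \<open>left_arrow_map\<close> followed by right multiplication by x.\<close>
  have \<Phi>_arrow: "?\<Phi> (arrow_map k x) y = ?\<rho> (\<eta>1 y) \<otimes>\<^bsub>A\<^esub> x"
    if x: "x \<in> carrier (vertex_proj Q I k)" and y: "y \<in> carrier P1" for x y
  proof -
    have xA: "x \<in> carrier A" using x k by (simp add: vertex_proj_simps)
    have cl: "(\<lambda>\<alpha>. \<eta>1 y \<alpha> \<otimes>\<^bsub>A\<^esub> arr \<alpha>) \<in> arrows_into Q k \<rightarrow> carrier A"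
      using \<eta>1A[OF y] arrows_intoD(1) by auto
    have "(\<Oplus>\<^bsub>A\<^esub>\<alpha>\<in>arrows_into Q k. \<eta>1 y \<alpha> \<otimes>\<^bsub>A\<^esub> arrow_map k x \<alpha>) = (\<Oplus>\<^bsub>A\<^esub>\<alpha>\<in>arrows_into Q k. (\<eta>1 y \<alpha> \<otimes>\<^bsub>A\<^esub> arr \<alpha>) \<otimes>\<^bsub>A\<^esub> x)"
      using \<eta>1A[OF y] xA arrows_intoD(1) by (intro A.finsum_cong') (auto simp: arrow_map_def A.m_assoc)
    also have "\<dots> = ?\<rho> (\<eta>1 y) \<otimes>\<^bsub>A\<^esub> x"
      unfolding left_arrow_map_def by (rule A.finsum_ldistr[OF finite_arrows_into xA cl, symmetric])
    finally show ?thesis using y by simp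
  qed
  have Im: "?\<Phi> r \<in> ?Im \<longleftrightarrow> r \<in> arrow_map k ` carrier (vertex_proj Q I k)" if r: "r \<in> carrier ?R" for r
  proof
    assume "?\<Phi> r \<in> ?Im"
    then obtain \<phi> where \<phi>: "?\<Phi> r = ?pre \<phi>" "\<phi> \<in> carrier ?H0" by (rule imageE)
    have \<phi>h: "\<phi> \<in> mod_hom ?B P0 (regular_mod ?B)" using \<phi>(2) by (simp add: hom_regular_simps)
    note e = idem_left_proj[OF k]
    \<comment> \<open>A homomorphism from \<open>A e_k\<close> to A is right multiplication by its
      value at the idempotent, an element of the vertex projective at k.\<close>
    let ?x = "\<phi> (\<theta>0 (idem k))"
    have act: "\<phi> (\<theta>0 a) = a \<otimes>\<^bsub>A\<^esub> ?x" if a: "a \<in> carrier (left_proj k)" for a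
    proof -
      have aA: "a \<in> carrier ?B" using a by simp
      have "\<theta>0 a = a \<odot>\<^bsub>P0\<^esub> \<theta>0 (idem k)" using mod_homD(3)[OF \<theta>0 aA e] a by simp
      then show ?thesis using mod_homD(3)[OF \<phi>h aA mod_homD(1)[OF \<theta>0 e]] by simp
    qed
    have x: "?x \<in> carrier (vertex_proj Q I k)"
      using act[OF e] mod_homD(1)[OF \<phi>h mod_homD(1)[OF \<theta>0 e]] k by (simp add: vertex_proj_simps)
    have "?\<Phi> r = ?\<Phi> (arrow_map k ?x)"
    proof (rule extensionalityI[of _ "carrier P1"])
      fix y assume y: "y \<in> carrier P1"
      have py: "p1 y \<in> carrier P0" by (rule mod_homD(1)[OF p1' y])
      have "?\<Phi> r y = \<phi> (p1 y)" unfolding \<phi>(1) using y by simp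
      also have "\<dots> = \<phi> (\<theta>0 (\<eta>0 (p1 y)))" using \<theta>\<eta>0[OF py] by simp
      also have "\<dots> = ?\<rho> (\<eta>1 y) \<otimes>\<^bsub>A\<^esub> ?x" using act[OF mod_homD(1)[OF \<eta>0 py]] unfolding p1\<eta>[OF y] .
      finally show "?\<Phi> r y = ?\<Phi> (arrow_map k ?x) y" using \<Phi>_arrow[OF x y] by (simp only:)
    qed simp_all
    then have "r = arrow_map k ?x" by (rule \<Phi>_inj[OF r mod_homD(1)[OF mod_hom_arrow_map[OF k] x]])
    then show "r \<in> arrow_map k ` carrier (vertex_proj Q I k)" using x by (rule image_eqI)
  next
    assume "r \<in> arrow_map k ` carrier (vertex_proj Q I k)"
    then obtain x where x: "r = arrow_map k x" "x \<in> carrier (vertex_proj Q I k)" by (rule imageE)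
    have xA: "x \<in> carrier A" using x(2) k by (simp add: vertex_proj_simps)
    let ?\<phi> = "\<lambda>z\<in>carrier P0. \<eta>0 z \<otimes>\<^bsub>A\<^esub> x"
    have "(\<lambda>z. z \<otimes>\<^bsub>A\<^esub> x) \<in> mod_hom ?B (left_proj k) (regular_mod ?B)"
      by (rule mod_homI) (use xA in \<open>auto simp: A.l_distr A.m_assoc\<close>)
    from restrict_mod_hom[OF rm0 mod_hom_comp[OF \<eta>0 this]]
    have \<phi>: "?\<phi> \<in> carrier ?H0" by (simp add: hom_regular_simps)
    have "?\<Phi> r = ?pre ?\<phi>"
    proof (rule extensionalityI[of _ "carrier P1"])
      fix y assume y: "y \<in> carrier P1"
      show "?\<Phi> r y = ?pre ?\<phi> y"
        unfolding x(1) \<Phi>_arrow[OF x(2) y] using y mod_homD(1)[OF p1' y] p1\<eta>[OF y] by simp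
    qed simp_all
    then show "?\<Phi> r \<in> ?Im" using \<phi> by (rule image_eqI)
  qed
  note quot = mod_hom_quot[OF rmH1 subIm]
  obtain g j where g: "g \<in> mod_hom A X (quot_mod ?H1 ?Im)" and j: "j \<in> mod_hom A (quot_mod ?H1 ?Im) X"
    and jg: "\<And>x. x \<in> carrier X \<Longrightarrow> j (g x) = x" and gj: "\<And>y. y \<in> carrier (quot_mod ?H1 ?Im) \<Longrightarrow> g (j y) = y"
    by (rule mod_isoE[OF iso rmX]) (rule that)
  \<comment> \<open>Identify r with a homomorphism on \<open>P1\<close>, pass to the class in the
    transpose, and return to X.\<close>
  let ?c = "\<lambda>r. j (?Im +>\<^bsub>?H1\<^esub> ?\<Phi> r)"
  have c: "?c \<in> mod_hom A ?R X" by (rule mod_hom_comp[OF mod_hom_comp[OF \<Phi> quot(1)] j])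
  interpret H1: right_module A ?H1 by (rule rmH1)
  show ?thesis
  proof (rule that[OF c])
    show "?c ` carrier ?R = carrier X"
    proof (intro subset_antisym subsetI)
      fix x assume x: "x \<in> carrier X"
      from mod_homD(1)[OF g x] obtain \<phi> where \<phi>: "g x = ?Im +>\<^bsub>?H1\<^esub> \<phi>" "\<phi> \<in> carrier ?H1"
        unfolding quot(2) by (rule imageE)
      obtain r where r: "r \<in> carrier ?R" "\<phi> = ?\<Phi> r" using \<Phi>_surj[OF \<phi>(2)] by (rule bexE)
      have "x = ?c r" using jg[OF x] unfolding \<phi>(1) r(2) by (rule sym)
      then show "x \<in> ?c ` carrier ?R" using r(1) by (rule image_eqI)
    next
      fix x assume "x \<in> ?c ` carrier ?R"
      then obtain r where "x = ?c r" "r \<in> carrier ?R" by (rule imageE)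
      then show "x \<in> carrier X" using mod_homD(1)[OF c] by simp
    qed
    show "a_kernel ?R X ?c = arrow_map k ` carrier (vertex_proj Q I k)"
    proof (rule Set.set_eqI)
      fix r
      have z: "?\<Phi> \<zero>\<^bsub>?R\<^esub> = \<zero>\<^bsub>?H1\<^esub>" by (rule mod_hom_zero[OF right_module_arrow_sum rmH1 \<Phi>])
      have "?c r = \<zero>\<^bsub>X\<^esub> \<longleftrightarrow> ?\<Phi> r \<in> ?Im" if r: "r \<in> carrier ?R"
      proof -
        note fr = mod_homD(1)[OF \<Phi> r] and f0 = mod_homD(1)[OF \<Phi> R.M.zero_closed]
        have "?c r = \<zero>\<^bsub>X\<^esub> \<longleftrightarrow> ?c r = ?c \<zero>\<^bsub>?R\<^esub>"
          using mod_hom_zero[OF right_module_arrow_sum rmX c] by (simp only:)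
        also have "\<dots> \<longleftrightarrow> ?Im +>\<^bsub>?H1\<^esub> ?\<Phi> r = ?Im +>\<^bsub>?H1\<^esub> ?\<Phi> \<zero>\<^bsub>?R\<^esub>"
        proof
          assume "?c r = ?c \<zero>\<^bsub>?R\<^esub>"
          then have "g (?c r) = g (?c \<zero>\<^bsub>?R\<^esub>)" by (rule arg_cong)
          then show "?Im +>\<^bsub>?H1\<^esub> ?\<Phi> r = ?Im +>\<^bsub>?H1\<^esub> ?\<Phi> \<zero>\<^bsub>?R\<^esub>"
            unfolding gj[OF mod_homD(1)[OF quot(1) fr]] gj[OF mod_homD(1)[OF quot(1) f0]] .
        qed (rule arg_cong)
        also have "\<dots> \<longleftrightarrow> (\<exists>n\<in>?Im. ?\<Phi> r = n \<oplus>\<^bsub>?H1\<^esub> ?\<Phi> \<zero>\<^bsub>?R\<^esub>)"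
          by (rule H1.coset_eq_iff[OF subIm fr f0])
        also have "\<dots> \<longleftrightarrow> ?\<Phi> r \<in> ?Im"
        proof
          assume "\<exists>n\<in>?Im. ?\<Phi> r = n \<oplus>\<^bsub>?H1\<^esub> ?\<Phi> \<zero>\<^bsub>?R\<^esub>"
          then obtain n where n: "n \<in> ?Im" "?\<Phi> r = n \<oplus>\<^bsub>?H1\<^esub> \<zero>\<^bsub>?H1\<^esub>" unfolding z by (rule bexE)
          show "?\<Phi> r \<in> ?Im"
            using n(1) unfolding n(2) H1.M.r_zero[OF subsetD[OF H1.submodule_closed(1)[OF subIm] n(1)]] .
        next
          assume im: "?\<Phi> r \<in> ?Im"
          have "?\<Phi> r = ?\<Phi> r \<oplus>\<^bsub>?H1\<^esub> ?\<Phi> \<zero>\<^bsub>?R\<^esub>"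
            unfolding z by (rule H1.M.r_zero[OF fr, symmetric])
          then show "\<exists>n\<in>?Im. ?\<Phi> r = n \<oplus>\<^bsub>?H1\<^esub> ?\<Phi> \<zero>\<^bsub>?R\<^esub>"
            using im by (rule bexI)
        qed
        finally show ?thesis .
      qed
      then have a: "r \<in> carrier ?R \<Longrightarrow> ?c r = \<zero>\<^bsub>X\<^esub> \<longleftrightarrow> r \<in> arrow_map k ` carrier (vertex_proj Q I k)"
        using Im by (simp only:)
      have b: "r \<in> carrier ?R" if rx: "r \<in> arrow_map k ` carrier (vertex_proj Q I k)"
      proof -
        obtain x where x: "r = arrow_map k x" "x \<in> carrier (vertex_proj Q I k)" using rx by (rule imageE)
        show ?thesis unfolding x(1) by (rule mod_homD(1)[OF mod_hom_arrow_map[OF k] x(2)])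
      qed
      show "r \<in> a_kernel ?R X ?c \<longleftrightarrow> r \<in> arrow_map k ` carrier (vertex_proj Q I k)"
        unfolding a_kernel_iff
      proof (cases "r \<in> carrier ?R")
        case True
        from a[OF this] show "r \<in> carrier ?R \<and> ?c r = \<zero>\<^bsub>X\<^esub> \<longleftrightarrow> r \<in> arrow_map k ` carrier (vertex_proj Q I k)"
          using True by (simp only: simp_thms)
      next
        case False
        then have "r \<notin> arrow_map k ` carrier (vertex_proj Q I k)" by (rule contrapos_nn) (rule b)
        then show "r \<in> carrier ?R \<and> ?c r = \<zero>\<^bsub>X\<^esub> \<longleftrightarrow> r \<in> arrow_map k ` carrier (vertex_proj Q I k)"
          using False by (simp only: simp_thms)
      qed
    qed
  qed
qed

end

section \<open>The silting mutation at a vertex\<close>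

text \<open>A zero morphism acts as zero on cohomology: up to a coboundary, the cocycle t comes from
  a cocycle of W, and there the homotopy formula reduces to a coboundary. Y is described only by
  modules and homomorphisms, which is what \<open>cdiff_shift\<close> provides for shifted
  complexes.\<close>

lemma (in kalgebra) D_Hom_zero_cohomology:
  assumes X: "bounded_cplx A X" and rmY: "\<And>n. right_module A (cobj Y n)"
    and dY: "\<And>n. cdiff Y n \<in> mod_hom A (cobj Y n) (cobj Y (n + 1))"
    and G: "chain_map A X Y G" and zero: "D_Hom_zero A X Y" and t: "t \<in> cocycles X n"
  shows "G n t \<in> coboundaries Y n"
proof -
  obtain Z :: "('e, 'k vec) cplx" and s where Z: "bounded_cplx A Z" "quasi_iso A Z X s"
    by (rule ex_vec_cplx[OF X])
  have "is_roof A X Y (Z, s, ccomp G s)"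
    using Z chain_map_comp[OF quasi_iso_chain_map[OF Z(2)] G] by simp
  then have "represents_zero A X Y (Z, s, ccomp G s)"
    using zero unfolding D_Hom_zero_def by blast
  then obtain W :: "('e, 'k vec) cplx" and u and v :: "int \<Rightarrow> 'k vec \<Rightarrow> 'k vec" where W: "bounded_cplx A W" "chain_map A W Z u"
    "quasi_iso A W X (ccomp s u)" "homotopic A W Y (ccomp (ccomp G s) u) (ccomp (\<lambda>n _. \<zero>\<^bsub>cobj Y n\<^esub>) v)"
    unfolding represents_zero.simps roof_equiv.simps by (elim exE conjE) (rule that)
  obtain h where h: "\<And>n. h n \<in> mod_hom A (cobj W n) (cobj Y (n - 1))"
    "\<And>n w. w \<in> carrier (cobj W n) \<Longrightarrow> G n (ccomp s u n w) = \<zero>\<^bsub>cobj Y n\<^esub> \<oplus>\<^bsub>cobj Y n\<^esub>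
      (cdiff Y (n - 1) (h n w) \<oplus>\<^bsub>cobj Y n\<^esub> h (n + 1) (cdiff W n w))"
    using W(4) unfolding homotopic_def by (auto simp: ccomp_def)
  obtain w b where wb: "w \<in> cocycles W n" "b \<in> coboundaries X n" "t = b \<oplus>\<^bsub>cobj X n\<^esub> ccomp s u n w"
    using quasi_isoD(1)[OF W(1) X W(3) t] by blast
  interpret Yn: right_module A "cobj Y n" by (rule rmY)
  interpret Xn: right_module A "cobj X n" by (rule bounded_cplxD(2)[OF X])
  have w: "w \<in> carrier (cobj W n)" "cdiff W n w = \<zero>\<^bsub>cobj W (n + 1)\<^esub>" using wb(1) by (auto simp: cocycles_iff)
  have dY': "cdiff Y (n - 1) \<in> mod_hom A (cobj Y (n - 1)) (cobj Y n)" using dY[of "n - 1"] by simp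
  have sub: "submodule (coboundaries Y n) A (cobj Y n)"
    unfolding coboundaries_def by (rule submodule_image[OF rmY rmY dY'])
  have "h (n + 1) \<zero>\<^bsub>cobj W (n + 1)\<^esub> = \<zero>\<^bsub>cobj Y n\<^esub>"
    using mod_hom_zero[OF bounded_cplxD(2)[OF W(1)] rmY h(1), of "n + 1"] by simp
  then have "G n (ccomp s u n w) = cdiff Y (n - 1) (h n w)"
    using h(2)[OF w(1)] w(2) mod_homD(1)[OF dY' mod_homD(1)[OF h(1) w(1)]] by simp
  then have "G n (ccomp s u n w) \<in> coboundaries Y n"
    using mod_homD(1)[OF h(1) w(1)] by (auto simp: coboundaries_def)
  moreover have "G n b \<in> coboundaries Y n" by (rule chain_map_coboundaries[OF X G wb(2)])
  moreover have "G n t = G n b \<oplus>\<^bsub>cobj Y n\<^esub> G n (ccomp s u n w)"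
    unfolding wb(3) using wb(2) Xn.submodule_closed(1)[OF submodule_coboundaries[OF X]]
      mod_homD(1)[OF chain_mapD(1)[OF quasi_iso_chain_map[OF W(3)]] w(1)]
    by (intro mod_homD(2)[OF chain_mapD(1)[OF G]]) auto
  ultimately show ?thesis using Yn.submodule_closed(3)[OF sub] by simp
qed

lemma (in kalgebra) cdiff_shift:
  assumes "bounded_cplx A X"
  shows "right_module A (cobj (shift X r) n)"
    "cdiff (shift X r) n \<in> mod_hom A (cobj (shift X r) n) (cobj (shift X r) (n + 1))"
proof -
  show "right_module A (cobj (shift X r) n)" by (simp add: shift_simps bounded_cplxD(2)[OF assms])
  have eq: "n + r + 1 = n + 1 + r" by simp
  note d = bounded_cplxD(3)[OF assms, of "n + r", unfolded eq]
  show "cdiff (shift X r) n \<in> mod_hom A (cobj (shift X r) n) (cobj (shift X r) (n + 1))"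
    using d mod_hom_neg[OF bounded_cplxD(2)[OF assms] d]
    by (cases "even r") (simp_all add: shift_def add.commute add.left_commute)
qed

section \<open>The complex \<open>T_minus\<close> and the kernel of its differential\<close>

context bound_quiver
begin

lemma right_module_other_projs: "right_module A (other_projs Q I k)"
  unfolding other_projs_def
  by (rule right_module_dsum[OF A.ring_axioms right_module_vertex_proj]) simp

lemma other_projsD:
  assumes "x \<in> carrier (other_projs Q I k)" "i \<in> verts Q - {k}"
  shows "x i \<in> carrier A" "idem i \<otimes>\<^bsub>A\<^esub> x i = x i"
  using assms by (auto simp: other_projs_def PiE_iff vertex_proj_simps)

lemma T_minus_simps:
  "cobj (T_minus Q I k) n =
    dprod (dprod (if n = -1 then vertex_proj Q I k else zero_mod (vertex_proj Q I k))
        (if n = 0 then arrow_sum k else zero_mod (arrow_sum k)))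
      (if n = 0 then other_projs Q I k else zero_mod (other_projs Q I k))"
  "cdiff (T_minus Q I k) n z = ((\<zero>\<^bsub>vertex_proj Q I k\<^esub>,
      if n = -1 then arrow_map k (fst (fst z)) else \<zero>\<^bsub>arrow_sum k\<^esub>), \<zero>\<^bsub>other_projs Q I k\<^esub>)"
  by (simp_all add: T_minus_def cplx_dsum_def L_cplx_def two_term_def stalk_simps arrow_map_def arr_def
      case_prod_beta del: dsum_simps)

lemma zero_T_minus:
  "\<zero>\<^bsub>cobj (T_minus Q I k) n\<^esub> = ((\<zero>\<^bsub>vertex_proj Q I k\<^esub>, \<zero>\<^bsub>arrow_sum k\<^esub>), \<zero>\<^bsub>other_projs Q I k\<^esub>)"
  by (simp add: T_minus_simps del: dsum_simps)

lemma idem_decomp: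
  assumes "k \<in> verts Q" "a \<in> carrier A"
  shows "a = idem k \<otimes>\<^bsub>A\<^esub> a \<oplus>\<^bsub>A\<^esub> (\<Oplus>\<^bsub>A\<^esub>i\<in>verts Q - {k}. idem i \<otimes>\<^bsub>A\<^esub> a)"
    "a = a \<otimes>\<^bsub>A\<^esub> idem k \<oplus>\<^bsub>A\<^esub> (\<Oplus>\<^bsub>A\<^esub>i\<in>verts Q - {k}. a \<otimes>\<^bsub>A\<^esub> idem i)"
proof -
  have "(\<Oplus>\<^bsub>A\<^esub>i\<in>insert k (verts Q - {k}). idem i) = idem k \<oplus>\<^bsub>A\<^esub> (\<Oplus>\<^bsub>A\<^esub>i\<in>verts Q - {k}. idem i)"
    by (rule A.finsum_insert) (use assms(1) in auto)
  then have one: "\<one>\<^bsub>A\<^esub> = idem k \<oplus>\<^bsub>A\<^esub> (\<Oplus>\<^bsub>A\<^esub>i\<in>verts Q - {k}. idem i)"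
    using one_eq_sum_idem insert_Diff[OF assms(1)] by simp
  have cl: "(\<Oplus>\<^bsub>A\<^esub>i\<in>verts Q - {k}. idem i) \<in> carrier A" by (rule A.finsum_closed) auto
  have "a = \<one>\<^bsub>A\<^esub> \<otimes>\<^bsub>A\<^esub> a" using assms(2) by simp
  also have "\<dots> = idem k \<otimes>\<^bsub>A\<^esub> a \<oplus>\<^bsub>A\<^esub> (\<Oplus>\<^bsub>A\<^esub>i\<in>verts Q - {k}. idem i) \<otimes>\<^bsub>A\<^esub> a"
    unfolding one using assms cl by (intro A.l_distr) auto
  also have "(\<Oplus>\<^bsub>A\<^esub>i\<in>verts Q - {k}. idem i) \<otimes>\<^bsub>A\<^esub> a = (\<Oplus>\<^bsub>A\<^esub>i\<in>verts Q - {k}. idem i \<otimes>\<^bsub>A\<^esub> a)"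
    by (rule A.finsum_ldistr) (use assms in auto)
  finally show "a = idem k \<otimes>\<^bsub>A\<^esub> a \<oplus>\<^bsub>A\<^esub> (\<Oplus>\<^bsub>A\<^esub>i\<in>verts Q - {k}. idem i \<otimes>\<^bsub>A\<^esub> a)" .
  have "a = a \<otimes>\<^bsub>A\<^esub> \<one>\<^bsub>A\<^esub>" using assms(2) by simp
  also have "\<dots> = a \<otimes>\<^bsub>A\<^esub> idem k \<oplus>\<^bsub>A\<^esub> a \<otimes>\<^bsub>A\<^esub> (\<Oplus>\<^bsub>A\<^esub>i\<in>verts Q - {k}. idem i)"
    unfolding one using assms cl by (intro A.r_distr) auto
  also have "a \<otimes>\<^bsub>A\<^esub> (\<Oplus>\<^bsub>A\<^esub>i\<in>verts Q - {k}. idem i) = (\<Oplus>\<^bsub>A\<^esub>i\<in>verts Q - {k}. a \<otimes>\<^bsub>A\<^esub> idem i)"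
    by (rule A.finsum_rdistr) (use assms in auto)
  finally show "a = a \<otimes>\<^bsub>A\<^esub> idem k \<oplus>\<^bsub>A\<^esub> (\<Oplus>\<^bsub>A\<^esub>i\<in>verts Q - {k}. a \<otimes>\<^bsub>A\<^esub> idem i)" .
qed

text \<open>The modules in question are direct summands of terms of the complex, and those are
  projective and finite-dimensional. The regular module is an image of the projective at k times the
  others, whence its finite dimension.\<close>

lemma projective_T_minusD:
  assumes k: "k \<in> verts Q" and T: "projective_cplx A (T_minus Q I k)"
  shows "projective A (vertex_proj Q I k)" "projective A (arrow_sum k)"
    "fd_module A (other_projs Q I k)" "fd_module A (regular_mod A)"
proof -
  let ?P = "vertex_proj Q I k" and ?R = "arrow_sum k" and ?O = "other_projs Q I k" and ?T = "T_minus Q I k"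
  have bd: "bounded_cplx A ?T" and pr: "projective A (cobj ?T n)" for n
    using T by (auto simp: projective_cplx_def)
  note rmP = right_module_vertex_proj[OF k] and rmR = right_module_arrow_sum[of k] and rmO = right_module_other_projs[of k]
  interpret P: right_module A ?P by (rule rmP)
  interpret R: right_module A ?R by (rule rmR)
  interpret O: right_module A ?O by (rule rmO)
  have T1: "cobj ?T (-1) = dprod (dprod ?P (zero_mod ?R)) (zero_mod ?O)"
    and T0: "cobj ?T 0 = dprod (dprod (zero_mod ?P) ?R) ?O"
    by (simp_all add: T_minus_simps del: dsum_simps)
  have p1: "(\<lambda>z. fst (fst z)) \<in> mod_hom A (cobj ?T (-1)) ?P"
    and p0: "(\<lambda>z. snd (fst z)) \<in> mod_hom A (cobj ?T 0) ?R" and s0: "snd \<in> mod_hom A (cobj ?T 0) ?O"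
    unfolding T1 T0 by (rule mod_hom_comp[OF A.mod_hom_fst A.mod_hom_fst] mod_hom_comp[OF A.mod_hom_fst A.mod_hom_snd] A.mod_hom_snd)+
  have i1: "(\<lambda>x. ((x, \<zero>\<^bsub>?R\<^esub>), \<zero>\<^bsub>?O\<^esub>)) \<in> mod_hom A ?P (cobj ?T (-1))"
    unfolding T1 using mod_hom_const_zero[OF right_module_zero_mod[OF rmR]] mod_hom_const_zero[OF right_module_zero_mod[OF rmO]]
    by (intro A.mod_hom_Pair) (simp_all del: dsum_simps)
  have i0: "(\<lambda>x. ((\<zero>\<^bsub>?P\<^esub>, x), \<zero>\<^bsub>?O\<^esub>)) \<in> mod_hom A ?R (cobj ?T 0)"
    unfolding T0 using mod_hom_const_zero[OF right_module_zero_mod[OF rmP]] mod_hom_const_zero[OF rmO]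
    by (intro A.mod_hom_Pair) (simp_all del: dsum_simps)
  have j0: "(\<lambda>x. ((\<zero>\<^bsub>?P\<^esub>, \<zero>\<^bsub>?R\<^esub>), x)) \<in> mod_hom A ?O (cobj ?T 0)"
    unfolding T0 using mod_hom_const_zero[OF right_module_zero_mod[OF rmP]] mod_hom_const_zero[OF rmR]
    by (intro A.mod_hom_Pair) (simp_all del: dsum_simps)
  have surj: "p ` carrier L = carrier M" if "p \<in> mod_hom A L M" "i \<in> mod_hom A M L" "\<And>x. p (i x) = x"
    for L :: "('x, 'y) module" and M :: "('x, 'z) module" and p i and A :: "('w, 'x) kalg"
  proof (intro subset_antisym subsetI)
    fix x assume "x \<in> carrier M"
    then show "x \<in> p ` carrier L" using mod_homD(1)[OF that(2)] that(3) by (intro image_eqI[of _ _ "i x"]) auto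
  qed (use mod_homD(1)[OF that(1)] in auto)
  have fdP: "fd_module A ?P" by (rule A.fd_module_image[OF A.bounded_cplxD(1)[OF bd] rmP p1 surj[OF p1 i1]]) simp
  have fdR: "fd_module A ?R" by (rule A.fd_module_image[OF A.bounded_cplxD(1)[OF bd] rmR p0 surj[OF p0 i0]]) simp
  show fdO: "fd_module A ?O" by (rule A.fd_module_image[OF A.bounded_cplxD(1)[OF bd] rmO s0 surj[OF s0 j0]]) simp
  show "projective A ?P" by (rule A.projective_retract[OF pr fdP i1 p1]) simp
  show "projective A ?R" by (rule A.projective_retract[OF pr fdR i0 p0]) simp
  have rmA: "right_module A (regular_mod A)" by (rule right_module_regular[OF A.ring_axioms])
  have hP: "(\<lambda>x. x) \<in> mod_hom A ?P (regular_mod A)"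
    by (rule mod_homI) (use k in \<open>auto simp: vertex_proj_simps\<close>)
  have hO: "(\<lambda>x. x i) \<in> mod_hom A ?O (regular_mod A)" if "i \<in> verts Q - {k}" for i
    by (rule mod_homI) (use that in \<open>auto simp: other_projs_def PiE_iff vertex_proj_simps\<close>)
  \<comment> \<open>Summing the components; onto, because every a is the sum of its parts
    \<open>idem i \<otimes> a\<close>.\<close>
  let ?g = "\<lambda>z. fst z \<oplus>\<^bsub>regular_mod A\<^esub> (\<Oplus>\<^bsub>regular_mod A\<^esub>i\<in>verts Q - {k}. snd z i)"
  have g: "?g \<in> mod_hom A (dprod ?P ?O) (regular_mod A)"
    by (rule mod_hom_plus[OF rmA mod_hom_comp[OF A.mod_hom_fst hP]
        mod_hom_finsum_fun[OF rmA _ mod_hom_comp[OF A.mod_hom_snd hO]]]) simp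
  have "a \<in> ?g ` carrier (dprod ?P ?O)" if a: "a \<in> carrier A" for a
  proof (rule image_eqI)
    let ?z = "(idem k \<otimes>\<^bsub>A\<^esub> a, \<lambda>i\<in>verts Q - {k}. idem i \<otimes>\<^bsub>A\<^esub> a)"
    have "(\<Oplus>\<^bsub>regular_mod A\<^esub>i\<in>verts Q - {k}. snd ?z i) = (\<Oplus>\<^bsub>A\<^esub>i\<in>verts Q - {k}. snd ?z i)"
      by (simp add: finsum_def finprod_def)
    also have "\<dots> = (\<Oplus>\<^bsub>A\<^esub>i\<in>verts Q - {k}. idem i \<otimes>\<^bsub>A\<^esub> a)"
      using a by (intro A.finsum_cong') auto
    finally show "a = ?g ?z" using idem_decomp(1)[OF k a] by simp
    show "?z \<in> carrier (dprod ?P ?O)"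
      using a k by (auto simp: other_projs_def vertex_proj_simps A.m_assoc[symmetric] idem_mult)
  qed
  then have "?g ` carrier (dprod ?P ?O) = carrier (regular_mod A)"
    using mod_homD(1)[OF g] by (intro subset_antisym subsetI) auto
  then show "fd_module A (regular_mod A)"
    by (rule A.fd_module_image[OF A.fd_module_dprod[OF fdP fdO] rmA g])
qed

text \<open>Left multiplication by y maps the projective at i into the kernel of the differential,
  and so defines a chain map G from the complex to its shift by -1. As this morphism is zero in the
  derived category, its effect on the class of \<open>idem i\<close> gives the claim.\<close>

lemma arrow_kernel_idem_other:
  assumes k: "k \<in> verts Q" and T: "bounded_cplx A (T_minus Q I k)"
    and rigid: "D_Hom_zero A (T_minus Q I k) (shift (T_minus Q I k) (-1))"
    and y: "y \<in> carrier (vertex_proj Q I k)" "arrow_map k y = \<zero>\<^bsub>arrow_sum k\<^esub>" and i: "i \<in> verts Q - {k}"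
  shows "y \<otimes>\<^bsub>A\<^esub> idem i = \<zero>\<^bsub>A\<^esub>"
proof -
  let ?P = "vertex_proj Q I k" and ?R = "arrow_sum k" and ?O = "other_projs Q I k" and ?T = "T_minus Q I k"
  let ?z = "((\<zero>\<^bsub>?P\<^esub>, \<zero>\<^bsub>?R\<^esub>), \<zero>\<^bsub>?O\<^esub>)"
  note rmP = right_module_vertex_proj[OF k] and rmR = right_module_arrow_sum[of k] and rmO = right_module_other_projs[of k]
  interpret P: right_module A ?P by (rule rmP)
  interpret R: right_module A ?R by (rule rmR)
  interpret O: right_module A ?O by (rule rmO)
  have yA: "y \<in> carrier A" "idem k \<otimes>\<^bsub>A\<^esub> y = y" using y(1) k by (auto simp: vertex_proj_simps)
  have zO: "\<zero>\<^bsub>?O\<^esub> i = \<zero>\<^bsub>A\<^esub>" using i by (simp add: other_projs_def vertex_proj_simps)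
  have zP: "\<zero>\<^bsub>?P\<^esub> = \<zero>\<^bsub>A\<^esub>" using k by (simp add: vertex_proj_simps)
  define G where "G n z = (if n = 0 then ((y \<otimes>\<^bsub>A\<^esub> snd z i, \<zero>\<^bsub>?R\<^esub>), \<zero>\<^bsub>?O\<^esub>) else ?z)" for n :: int
    and z :: "((('v, 'a) qpath \<Rightarrow> 'k) set \<times> ('a \<Rightarrow> (('v, 'a) qpath \<Rightarrow> 'k) set)) \<times> ('v \<Rightarrow> (('v, 'a) qpath \<Rightarrow> 'k) set)"
  have T0: "cobj ?T 0 = dprod (dprod (zero_mod ?P) ?R) ?O"
    and T1: "cobj ?T (-1) = dprod (dprod ?P (zero_mod ?R)) (zero_mod ?O)"
    by (simp_all add: T_minus_simps del: dsum_simps)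
  have mult: "(\<lambda>x. y \<otimes>\<^bsub>A\<^esub> x i) \<in> mod_hom A ?O ?P"
    by (rule mod_homI)
      (use i k yA in \<open>auto simp: other_projs_def PiE_iff vertex_proj_simps A.r_distr A.m_assoc[symmetric]\<close>)
  have G0: "G 0 \<in> mod_hom A (cobj ?T 0) (cobj ?T (-1))"
  proof -
    have eq: "G 0 = (\<lambda>z. ((y \<otimes>\<^bsub>A\<^esub> snd z i, \<zero>\<^bsub>?R\<^esub>), \<zero>\<^bsub>?O\<^esub>))" by (rule ext) (simp only: G_def simp_thms if_True)
    have zR: "(\<lambda>z. \<zero>\<^bsub>?R\<^esub>) \<in> mod_hom A L (zero_mod ?R)" and zO: "(\<lambda>z. \<zero>\<^bsub>?O\<^esub>) \<in> mod_hom A L (zero_mod ?O)"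
      for L :: "(_, (((('v, 'a) qpath \<Rightarrow> 'k) set \<times> ('a \<Rightarrow> (('v, 'a) qpath \<Rightarrow> 'k) set)) \<times> ('v \<Rightarrow> (('v, 'a) qpath \<Rightarrow> 'k) set))) module"
      using mod_hom_const_zero[OF right_module_zero_mod[OF rmR]] mod_hom_const_zero[OF right_module_zero_mod[OF rmO]]
      by (simp_all only: zero_mod_simps)
    show ?thesis
      unfolding eq T0 T1
      by (rule A.mod_hom_Pair[OF A.mod_hom_Pair[OF mod_hom_comp[OF A.mod_hom_snd mult] zR] zO])
  qed
  have rmT: "right_module A (cobj ?T n)" for n by (rule A.bounded_cplxD(2)[OF T])
  have neg: "\<ominus>\<^bsub>cobj ?T n\<^esub> ?z = ?z" for n
    using right_module.minus_zero[OF rmT, of n] unfolding zero_T_minus .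
  have ch: "chain_map A ?T (shift ?T (-1)) G"
    unfolding chain_map_def
  proof (intro conjI allI ballI)
    fix n
    show "G n \<in> mod_hom A (cobj ?T n) (cobj (shift ?T (-1)) n)"
      using G0 mod_hom_const_zero[OF rmT, of "n + -1" "cobj ?T n"]
      by (cases "n = 0") (simp_all add: shift_simps zero_T_minus G_def[abs_def] del: dsum_simps)
    fix z assume z: "z \<in> carrier (cobj ?T n)"
    have f0: "arrow_map k \<zero>\<^bsub>?P\<^esub> = \<zero>\<^bsub>?R\<^esub>" by (rule mod_hom_zero[OF rmP rmR mod_hom_arrow_map[OF k]])
    have L: "G (n + 1) (cdiff ?T n z) = ?z"
      using yA zO zP by (simp add: G_def T_minus_simps del: dsum_simps)
    have "cdiff ?T (n - 1) (G n z) = ?z"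
    proof (cases "n = 0")
      case True
      obtain p r x where z': "z = ((p, r), x)" by (metis surj_pair)
      have x: "x \<in> carrier ?O" using z True z' by (simp add: T0 del: dsum_simps)
      have "arrow_map k (y \<otimes>\<^bsub>A\<^esub> x i) = \<zero>\<^bsub>?R\<^esub>"
        using mod_homD(3)[OF mod_hom_arrow_map[OF k] other_projsD(1)[OF x i] y(1)] y(2) k other_projsD(1)[OF x i]
          R.act_zero_right by (simp add: vertex_proj_simps del: dsum_simps)
      then show ?thesis using True z' by (simp add: G_def T_minus_simps del: dsum_simps)
    next
      case False
      then show ?thesis using f0 by (simp add: G_def T_minus_simps del: dsum_simps)
    qed
    then show "G (n + 1) (cdiff ?T n z) = cdiff (shift ?T (-1)) n (G n z)"
      using L neg by (simp add: shift_simps del: dsum_simps)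
  qed
  \<comment> \<open>The generator of the summand at i.\<close>
  let ?e = "dinj (verts Q - {k}) (vertex_proj Q I) i (idem i)"
  have e: "?e \<in> carrier ?O"
    unfolding other_projs_def
    by (rule mod_homD(1)[OF mod_hom_dinj[OF right_module_vertex_proj]]) (use i in \<open>auto simp: vertex_proj_simps idem_mult\<close>)
  let ?t = "((\<zero>\<^bsub>?P\<^esub>, \<zero>\<^bsub>?R\<^esub>), ?e)"
  have "?t \<in> cocycles ?T 0"
    unfolding A.cocycles_iff zero_T_minus using e by (simp add: T0 T_minus_simps(2) del: dsum_simps)
  from A.D_Hom_zero_cohomology[OF T A.cdiff_shift[OF T] ch rigid this]
  have "G 0 ?t \<in> coboundaries (shift ?T (-1)) 0" .
  \<comment> \<open>Coboundaries here come from degree -2 of the complex, which is zero; so the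
    class in question vanishes only if the element does.\<close>
  moreover have "coboundaries (shift ?T (-1)) 0 \<subseteq> {?z}"
    unfolding coboundaries_def using neg
    by (auto simp: shift_simps T_minus_simps(2) simp del: dsum_simps)
  ultimately have "G 0 ?t = ?z" by blast
  then have "y \<otimes>\<^bsub>A\<^esub> ?e i = \<zero>\<^bsub>?P\<^esub>" by (simp add: G_def)
  then show ?thesis using i zP by (simp add: dinj_def)
qed

lemma vertex_proj_radical:
  assumes i: "i \<in> verts Q" and n: "n \<in> carrier (vertex_proj Q I i)" "coef n (i, []) = 0"
  obtains x where "\<And>\<alpha>. \<alpha> \<in> arcs Q \<Longrightarrow> x \<alpha> \<in> carrier A" "n = (\<Oplus>\<^bsub>A\<^esub>\<alpha>\<in>arcs Q. arr \<alpha> \<otimes>\<^bsub>A\<^esub> x \<alpha>)"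
proof -
  have nA: "n \<in> carrier A" "idem i \<otimes>\<^bsub>A\<^esub> n = n" using n(1) i by (auto simp: vertex_proj_simps)
  have "coef n (j, []) = 0" if "j \<in> verts Q" for j
    using coef_mult(1)[OF idem_closed[OF i] nA(1), of j] nA(2) n(2) coef_idem[OF i, of j] by (cases "j = i") auto
  then show ?thesis using radical_left_decomp[OF nA(1)] that by blast
qed

text \<open>
  The kernel \<open>N\<close> is a sum of copies of the simple module at \<open>k\<close>.  If it is projective and there is
  an arrow \<open>\<alpha>\<close> starting at \<open>k\<close>, then \<open>N\<close> vanishes: a section of a surjection
  \<open>P\<^sub>k\<^sup>m \<rightarrow> N\<close> has components annihilated by \<open>\<alpha>\<close>, hence in the radical.
\<close>

lemma arrow_kernel_zero:
  assumes k: "k \<in> verts Q" and no_loops: "\<And>\<alpha>. \<alpha> \<in> arcs Q \<Longrightarrow> \<not> (tail Q \<alpha> = k \<and> head Q \<alpha> = k)"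
    and not_isolated: "\<exists>\<alpha>\<in>arcs Q. tail Q \<alpha> = k \<or> head Q \<alpha> = k"
    and fdP: "fd_module A (vertex_proj Q I k)"
    and proj: "projective A (submod (vertex_proj Q I k) (a_kernel (vertex_proj Q I k) (arrow_sum k) (arrow_map k)))"
    and other: "\<And>y i. \<lbrakk>y \<in> a_kernel (vertex_proj Q I k) (arrow_sum k) (arrow_map k); i \<in> verts Q - {k}\<rbrakk> \<Longrightarrow>
      y \<otimes>\<^bsub>A\<^esub> idem i = \<zero>\<^bsub>A\<^esub>"
    and n: "n \<in> a_kernel (vertex_proj Q I k) (arrow_sum k) (arrow_map k)"
  shows "n = \<zero>\<^bsub>A\<^esub>"
proof -
  let ?P = "vertex_proj Q I k" and ?R = "arrow_sum k"
  let ?K = "a_kernel ?P ?R (arrow_map k)"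
  let ?N = "submod ?P ?K"
  note rmP = right_module_vertex_proj[OF k] and rmR = right_module_arrow_sum[of k]
  interpret P: right_module A ?P by (rule rmP)
  interpret R: right_module A ?R by (rule rmR)
  have sub: "submodule ?K A ?P" by (rule submodule_a_kernel[OF rmP rmR mod_hom_arrow_map[OF k]])
  note Kc = P.submodule_closed[OF sub]
  have fdN: "fd_module A ?N" by (rule A.fd_module_submod[OF fdP sub])
  have rmN: "right_module A ?N" by (rule A.fd_right_module[OF fdN])
  have KA: "y \<in> carrier A" "idem k \<otimes>\<^bsub>A\<^esub> y = y" if "y \<in> ?K" for y
    using subsetD[OF Kc(1) that] k by (auto simp: vertex_proj_simps)
  have Kk: "y \<otimes>\<^bsub>A\<^esub> idem k = y" if y: "y \<in> ?K" for y
  proof -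
    have "(\<Oplus>\<^bsub>A\<^esub>i\<in>verts Q - {k}. y \<otimes>\<^bsub>A\<^esub> idem i) = (\<Oplus>\<^bsub>A\<^esub>i\<in>verts Q - {k}. \<zero>\<^bsub>A\<^esub>)"
      using other[OF y] by (intro A.finsum_cong') auto
    then show ?thesis using idem_decomp(2)[OF k KA(1)[OF y]] KA(1)[OF y] k by simp
  qed
  \<comment> \<open>An arrow starting at k ends elsewhere, as there are no loops, and
    \<open>y \<otimes> arr \<alpha>\<close> is again in the kernel; an arrow starting elsewhere is
    annihilated because y is concentrated at k.\<close>
  have Karr: "y \<otimes>\<^bsub>A\<^esub> arr \<alpha> = \<zero>\<^bsub>A\<^esub>" if y: "y \<in> ?K" and \<alpha>: "\<alpha> \<in> arcs Q" for y \<alpha>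
  proof (cases "tail Q \<alpha> = k")
    case True
    then have h: "head Q \<alpha> \<in> verts Q - {k}" using no_loops[OF \<alpha>] \<alpha> by auto
    have "y \<otimes>\<^bsub>A\<^esub> arr \<alpha> \<in> ?K" using Kc(5)[of "arr \<alpha>" y] y \<alpha> k by (simp only: vertex_proj_simps arr_closed)
    from other[OF this h] show ?thesis
      using KA(1)[OF y] \<alpha> h by (simp add: A.m_assoc arr_idem)
  next
    case False
    then have t: "tail Q \<alpha> \<in> verts Q - {k}" using \<alpha> by auto
    have "y \<otimes>\<^bsub>A\<^esub> arr \<alpha> = (y \<otimes>\<^bsub>A\<^esub> idem (tail Q \<alpha>)) \<otimes>\<^bsub>A\<^esub> arr \<alpha>"
      using KA(1)[OF y] \<alpha> t idem_arr[OF \<alpha>] by (simp add: A.m_assoc)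
    then show ?thesis using other[OF y t] \<alpha> by simp
  qed
  show ?thesis
  proof (cases "\<exists>\<alpha>\<in>arcs Q. tail Q \<alpha> = k")
    case True
    then obtain \<alpha> where \<alpha>: "\<alpha> \<in> arcs Q" "tail Q \<alpha> = k" by blast
    obtain B where B: "finite B" "B \<subseteq> carrier ?N" "carrier ?N \<subseteq> kspan A ?N B" using fdN by (rule A.fd_moduleE)
    have BK: "b \<in> ?K" if "b \<in> B" for b using subsetD[OF B(2) that] by simp
    let ?G = "dsum B (\<lambda>_. ?P)"
    have fdG: "fd_module A ?G" by (rule A.fd_module_dsum[OF B(1) fdP])
    have rmG: "right_module A ?G" by (rule A.fd_right_module[OF fdG])
    have hom: "(\<lambda>x. b \<otimes>\<^bsub>A\<^esub> x) \<in> mod_hom A ?P ?N" if "b \<in> B" for b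
    proof (rule mod_homI)
      have b: "b \<in> carrier A" by (rule KA(1)[OF BK[OF that]])
      fix x assume x: "x \<in> carrier ?P"
      then have xA: "x \<in> carrier A" using k by (simp add: vertex_proj_simps)
      show "b \<otimes>\<^bsub>A\<^esub> x \<in> carrier ?N"
        using Kc(5)[OF xA BK[OF that]] k by (simp only: vertex_proj_simps submod_simps)
      show "b \<otimes>\<^bsub>A\<^esub> (x \<oplus>\<^bsub>?P\<^esub> x') = b \<otimes>\<^bsub>A\<^esub> x \<oplus>\<^bsub>?N\<^esub> b \<otimes>\<^bsub>A\<^esub> x'" if "x' \<in> carrier ?P" for x'
        using that xA b k by (simp add: vertex_proj_simps A.r_distr)
      show "b \<otimes>\<^bsub>A\<^esub> (a \<odot>\<^bsub>?P\<^esub> x) = a \<odot>\<^bsub>?N\<^esub> (b \<otimes>\<^bsub>A\<^esub> x)" if "a \<in> carrier A" for a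
        using that xA b k by (simp add: vertex_proj_simps A.m_assoc)
    qed
    have comp: "(\<lambda>x. b \<otimes>\<^bsub>A\<^esub> x b) \<in> mod_hom A ?G ?N" if "b \<in> B" for b
      by (rule mod_hom_comp[OF mod_hom_proj[OF that, where M = "\<lambda>_. ?P"] hom[OF that]])
    \<comment> \<open>Sends the generator \<open>idem k\<close> in position b to b itself, since
      elements of the kernel are fixed by \<open>idem k\<close> on the right.\<close>
    let ?g = "\<lambda>x. \<Oplus>\<^bsub>?N\<^esub>b\<in>B. b \<otimes>\<^bsub>A\<^esub> x b"
    have g: "?g \<in> mod_hom A ?G ?N"
      by (rule mod_hom_finsum_fun[OF rmN B(1) comp])
    have subg: "submodule (?g ` carrier ?G) A ?N" by (rule submodule_image[OF rmG rmN g])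
    interpret N: right_module A ?N by (rule rmN)
    note gc = N.submodule_closed[OF subg]
    have gB: "b \<in> ?g ` carrier ?G" if b: "b \<in> B" for b
    proof (rule image_eqI)
      let ?x = "dinj B (\<lambda>_. ?P) b (idem k)"
      have ek: "idem k \<in> carrier ?P" using k by (simp add: vertex_proj_simps idem_mult)
      show "?x \<in> carrier ?G" by (rule mod_homD(1)[OF mod_hom_dinj[OF rmP b] ek])
      have val: "c \<otimes>\<^bsub>A\<^esub> ?x c = (if b = c then b else \<zero>\<^bsub>?N\<^esub>)" if "c \<in> B" for c
        using KA(1)[OF BK[OF that]] Kk[OF BK[OF that]] that k by (simp add: dinj_def vertex_proj_simps)
      have "?g ?x = (\<Oplus>\<^bsub>?N\<^esub>c\<in>B. if b = c then b else \<zero>\<^bsub>?N\<^esub>)"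
      proof (rule N.M.finsum_cong'[OF refl])
        show "(\<lambda>c. if b = c then b else \<zero>\<^bsub>?N\<^esub>) \<in> B \<rightarrow> carrier ?N"
          using subsetD[OF B(2) b] N.M.zero_closed by (intro Pi_I) (simp only: simp_thms split: if_split)
      qed (rule val)
      also have "\<dots> = b" by (rule N.M.finsum_singleton[where f = "\<lambda>_. b"]) (use b B in auto)
      finally show "b = ?g ?x" by (rule sym)
    qed
    have "x \<in> ?g ` carrier ?G" if "x \<in> kspan A ?N B" for x
      using that
    proof induct
      case zero
      show ?case by (rule gc(2))
    next
      case (step b x c)
      show ?case by (rule gc(3)[OF gc(5)[OF A.scal_closed gB[OF step(1)]] step(3)])
    qed
    then have sur: "?g ` carrier ?G = carrier ?N"
      using B(3) gc(1) by (intro subset_antisym subsetI) (simp_all only: subset_eq)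
    obtain h where h: "h \<in> mod_hom A ?N ?G" "\<And>x. x \<in> carrier ?N \<Longrightarrow> ?g (h x) = x"
      by (rule A.projective_lift[OF proj fdG fdN g sur mod_hom_id(2)]) (rule that)
    have nN: "n \<in> carrier ?N" using n by simp
    have hb: "b \<otimes>\<^bsub>A\<^esub> h n b = \<zero>\<^bsub>A\<^esub>" if b: "b \<in> B" for b
    proof -
      have hP: "h n b \<in> carrier ?P" by (rule mod_homD(1)[OF mod_hom_proj[OF b] mod_homD(1)[OF h(1) nN]])
      then have hA: "h n b \<in> carrier A" using k by (simp add: vertex_proj_simps)
      have "h n b \<otimes>\<^bsub>A\<^esub> arr \<alpha> = (arr \<alpha> \<odot>\<^bsub>?G\<^esub> h n) b" using b k by (simp add: vertex_proj_simps)
      also have "\<dots> = h (arr \<alpha> \<odot>\<^bsub>?N\<^esub> n) b" using mod_homD(3)[OF h(1) arr_closed[OF \<alpha>(1)] nN] by simp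
      also have "arr \<alpha> \<odot>\<^bsub>?N\<^esub> n = \<zero>\<^bsub>?N\<^esub>" using Karr[OF n \<alpha>(1)] k by (simp add: vertex_proj_simps)
      also have "h \<zero>\<^bsub>?N\<^esub> b = \<zero>\<^bsub>A\<^esub>" using mod_hom_zero[OF rmN rmG h(1)] b k by (simp add: vertex_proj_simps)
      finally have "h n b \<otimes>\<^bsub>A\<^esub> arr \<alpha> = \<zero>\<^bsub>A\<^esub>" .
      \<comment> \<open>In the product with \<open>arr \<alpha>\<close>, the coefficient of
        \<open>\<alpha>\<close> is exactly that of the trivial path in \<open>h n b\<close>.\<close>
      then have "coef (h n b) (k, []) = 0"
        using coef_mult(2)[OF hA arr_closed[OF \<alpha>(1)], of k \<alpha>] coef_zero[of "[\<alpha>]" k] \<alpha> by (simp add: coef_arr)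
      then obtain x where x: "\<And>\<beta>. \<beta> \<in> arcs Q \<Longrightarrow> x \<beta> \<in> carrier A" "h n b = (\<Oplus>\<^bsub>A\<^esub>\<beta>\<in>arcs Q. arr \<beta> \<otimes>\<^bsub>A\<^esub> x \<beta>)"
        using vertex_proj_radical[OF k hP] by blast
      have bA: "b \<in> carrier A" by (rule KA(1)[OF BK[OF b]])
      \<comment> \<open>By \<open>Karr\<close>, b annihilates everything that begins with an arrow,
        so no component of \<open>h n\<close> survives under \<open>?g\<close>.\<close>
      have "b \<otimes>\<^bsub>A\<^esub> h n b = (\<Oplus>\<^bsub>A\<^esub>\<beta>\<in>arcs Q. b \<otimes>\<^bsub>A\<^esub> (arr \<beta> \<otimes>\<^bsub>A\<^esub> x \<beta>))"
        unfolding x(2) by (rule A.finsum_rdistr) (use bA x(1) in auto)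
      also have "\<dots> = (\<Oplus>\<^bsub>A\<^esub>\<beta>\<in>arcs Q. \<zero>\<^bsub>A\<^esub>)"
        using bA x(1) Karr[OF BK[OF b]] by (intro A.finsum_cong') (auto simp: A.m_assoc[symmetric])
      finally show ?thesis by simp
    qed
    have zN: "\<zero>\<^bsub>?N\<^esub> = \<zero>\<^bsub>A\<^esub>" using k by (simp add: vertex_proj_simps)
    have "n = ?g (h n)" using h(2)[OF nN] by (rule sym)
    also have "\<dots> = (\<Oplus>\<^bsub>?N\<^esub>b\<in>B. \<zero>\<^bsub>?N\<^esub>)"
      by (rule N.M.finsum_cong'[OF refl]) (simp_all only: hb zN N.M.zero_closed[unfolded zN] Pi_I)
    also have "\<dots> = \<zero>\<^bsub>A\<^esub>" unfolding zN[symmetric] by (rule N.M.finsum_zero)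
    finally show ?thesis .
  next
    case False
    then obtain \<alpha> where \<alpha>: "\<alpha> \<in> arcs Q" "head Q \<alpha> = k" using not_isolated by blast
    \<comment> \<open>At a sink n is a multiple of \<open>idem k\<close>; the arrow ending at k
      detects the factor, because \<open>arr \<alpha> \<otimes> n\<close> is zero.\<close>
    let ?c = "coef n (k, [])"
    have nn: "n = scal A ?c \<otimes>\<^bsub>A\<^esub> idem k"
      using idem_mult_sink[OF k _ KA(1)[OF n]] False KA(2)[OF n] by auto
    have an: "arr \<alpha> \<otimes>\<^bsub>A\<^esub> n = \<zero>\<^bsub>A\<^esub>"
    proof -
      have into: "\<alpha> \<in> arrows_into Q k" using \<alpha> by (simp add: arrows_into_def)
      have "arrow_map k n = \<zero>\<^bsub>?R\<^esub>" using n by (simp only: a_kernel_iff)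
      then have "arrow_map k n \<alpha> = \<zero>\<^bsub>?R\<^esub> \<alpha>" by (rule fun_cong)
      then have "arr \<alpha> \<otimes>\<^bsub>A\<^esub> n = \<zero>\<^bsub>vertex_proj Q I (tail Q \<alpha>)\<^esub>"
        using into by (simp add: arrow_map_def)
      then show ?thesis using \<alpha>(1) by (simp add: vertex_proj_simps)
    qed
    have "?c = 0"
      using coef_mult(2)[OF arr_closed[OF \<alpha>(1)] KA(1)[OF n], of "tail Q \<alpha>" \<alpha>] coef_zero[of "[\<alpha>]" "tail Q \<alpha>"] \<alpha>
      by (simp add: an coef_arr)
    then show ?thesis using nn k by simp
  qed
qed

end

section \<open>The complex \<open>T_minus\<close> as a resolution, and the tilting
  coresolution\<close>

context bound_quiver
begin

lemma mod_hom_BB_map: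
  assumes "c \<in> mod_hom A (arrow_sum k) X"
  shows "(\<lambda>z. (c (snd (fst z)), snd z)) \<in> mod_hom A (cobj (T_minus Q I k) 0) (T_BB Q I k X)"
proof -
  have T0: "cobj (T_minus Q I k) 0 = dprod (dprod (zero_mod (vertex_proj Q I k)) (arrow_sum k)) (other_projs Q I k)"
    by (simp add: T_minus_simps del: dsum_simps)
  show ?thesis
    unfolding T0 T_BB_def
    by (intro A.mod_hom_Pair mod_hom_comp[OF mod_hom_comp[OF A.mod_hom_fst A.mod_hom_snd] assms] A.mod_hom_snd)
qed

text \<open>Exactness is that of the presentation of X through c, and injectivity of the
  differential is the vanishing of the kernel; the other projectives only occur in degree 0 and are
  mapped identically.\<close>

lemma two_term_resolution_T_minus:
  assumes k: "k \<in> verts Q" and T: "projective_cplx A (T_minus Q I k)" and X: "fd_module A X"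
    and c: "c \<in> mod_hom A (arrow_sum k) X" "c ` carrier (arrow_sum k) = carrier X"
      "a_kernel (arrow_sum k) X c = arrow_map k ` carrier (vertex_proj Q I k)"
    and inj: "\<And>n. n \<in> a_kernel (vertex_proj Q I k) (arrow_sum k) (arrow_map k) \<Longrightarrow> n = \<zero>\<^bsub>A\<^esub>"
  shows "two_term_resolution A (T_minus Q I k) (T_BB Q I k X) (\<lambda>z. (c (snd (fst z)), snd z))"
proof -
  let ?P = "vertex_proj Q I k" and ?R = "arrow_sum k" and ?O = "other_projs Q I k" and ?T = "T_minus Q I k"
  let ?q = "\<lambda>z. (c (snd (fst z)), snd z)"
  note rmP = right_module_vertex_proj[OF k] and rmR = right_module_arrow_sum[of k] and rmO = right_module_other_projs[of k]
  interpret P: right_module A ?P by (rule rmP)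
  interpret R: right_module A ?R by (rule rmR)
  interpret O: right_module A ?O by (rule rmO)
  have T0: "cobj ?T 0 = dprod (dprod (zero_mod ?P) ?R) ?O"
    and T1: "cobj ?T (-1) = dprod (dprod ?P (zero_mod ?R)) (zero_mod ?O)"
    by (simp_all add: T_minus_simps del: dsum_simps)
  have d: "cdiff ?T (-1) z = ((\<zero>\<^bsub>?P\<^esub>, arrow_map k (fst (fst z))), \<zero>\<^bsub>?O\<^esub>)" for z
    by (simp add: T_minus_simps del: dsum_simps)
  have kc: "c r = \<zero>\<^bsub>X\<^esub> \<longleftrightarrow> r \<in> arrow_map k ` carrier ?P" if "r \<in> carrier ?R" for r
    using c(3) that unfolding set_eq_iff a_kernel_iff by blast
  show ?thesis
  proof (intro two_term_resolution.intro two_term_resolution_axioms.intro)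
    show "kalgebra A" by (rule A.kalgebra_axioms)
    show "projective_cplx A ?T" by (rule T)
    show "carrier (cobj ?T n) = {\<zero>\<^bsub>cobj ?T n\<^esub>}" if "n \<noteq> 0" "n \<noteq> -1" for n
      using that by (simp add: T_minus_simps del: dsum_simps)
    show "fd_module A (T_BB Q I k X)"
      unfolding T_BB_def by (rule A.fd_module_dprod[OF X projective_T_minusD(3)[OF k T]])
    show "?q \<in> mod_hom A (cobj ?T 0) (T_BB Q I k X)" by (rule mod_hom_BB_map[OF c(1)])
    show "?q ` carrier (cobj ?T 0) = carrier (T_BB Q I k X)"
    proof (intro subset_antisym subsetI)
      fix y assume "y \<in> carrier (T_BB Q I k X)"
      then obtain x w where y: "y = (x, w)" "x \<in> carrier X" "w \<in> carrier ?O" by (auto simp: T_BB_def)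
      obtain r where r: "x = c r" "r \<in> carrier ?R" using y(2) unfolding c(2)[symmetric] by (rule imageE)
      show "y \<in> ?q ` carrier (cobj ?T 0)"
        unfolding T0 by (rule image_eqI[of _ _ "((\<zero>\<^bsub>?P\<^esub>, r), w)"]) (use y r in \<open>simp_all del: dsum_simps\<close>)
    qed (use mod_homD(1)[OF mod_hom_BB_map[OF c(1)]] in blast)
    show "?q x = \<zero>\<^bsub>T_BB Q I k X\<^esub> \<longleftrightarrow> x \<in> cdiff ?T (-1) ` carrier (cobj ?T (-1))"
      if x: "x \<in> carrier (cobj ?T 0)" for x
    proof -
      obtain r w where x': "x = ((\<zero>\<^bsub>?P\<^esub>, r), w)" "r \<in> carrier ?R" "w \<in> carrier ?O"
        using x unfolding T0 by (auto simp del: dsum_simps)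
      show ?thesis
      proof
        assume "?q x = \<zero>\<^bsub>T_BB Q I k X\<^esub>"
        then have "c r = \<zero>\<^bsub>X\<^esub>" "w = \<zero>\<^bsub>?O\<^esub>" by (simp_all add: x' T_BB_def)
        then obtain p where p: "r = arrow_map k p" "p \<in> carrier ?P" using kc[OF x'(2)] by blast
        show "x \<in> cdiff ?T (-1) ` carrier (cobj ?T (-1))"
          unfolding T1
          by (rule image_eqI[of _ _ "((p, \<zero>\<^bsub>?R\<^esub>), \<zero>\<^bsub>?O\<^esub>)"])
            (use p x' \<open>w = \<zero>\<^bsub>?O\<^esub>\<close> in \<open>simp_all add: d del: dsum_simps\<close>)
      next
        assume "x \<in> cdiff ?T (-1) ` carrier (cobj ?T (-1))"
        then obtain z where z: "x = cdiff ?T (-1) z" "z \<in> carrier (cobj ?T (-1))" by (rule imageE)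
        then have "r = arrow_map k (fst (fst z))" "w = \<zero>\<^bsub>?O\<^esub>" "fst (fst z) \<in> carrier ?P"
          using x'(1) unfolding d T1 by (auto simp del: dsum_simps)
        then show "?q x = \<zero>\<^bsub>T_BB Q I k X\<^esub>" using kc[OF x'(2)] x' by (simp add: T_BB_def del: dsum_simps)
      qed
    qed
    show "inj_on (cdiff ?T (-1)) (carrier (cobj ?T (-1)))"
    proof (rule inj_onI)
      have inj': "inj_on (arrow_map k) (carrier ?P)"
        by (rule mod_hom_inj_on[OF rmP rmR mod_hom_arrow_map[OF k]])
          (use inj k in \<open>simp add: vertex_proj_simps del: dsum_simps\<close>)
      fix x y assume xy: "x \<in> carrier (cobj ?T (-1))" "y \<in> carrier (cobj ?T (-1))" "cdiff ?T (-1) x = cdiff ?T (-1) y"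
      obtain p p' where "x = ((p, \<zero>\<^bsub>?R\<^esub>), \<zero>\<^bsub>?O\<^esub>)" "p \<in> carrier ?P" "y = ((p', \<zero>\<^bsub>?R\<^esub>), \<zero>\<^bsub>?O\<^esub>)" "p' \<in> carrier ?P"
        using xy(1,2) unfolding T1 by (auto simp del: dsum_simps)
      then show "x = y" using xy(3) inj_onD[OF inj', of p p'] unfolding d by (simp del: dsum_simps)
    qed
  qed
qed

text \<open>Without loops, every arrow into k starts at another vertex, so each summand of
  \<open>arrow_sum k\<close> is already a summand of \<open>other_projs\<close>.\<close>

lemma in_add_BB:
  assumes k: "k \<in> verts Q" and no_loops: "\<And>\<alpha>. \<alpha> \<in> arcs Q \<Longrightarrow> \<not> (tail Q \<alpha> = k \<and> head Q \<alpha> = k)"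
    and X: "fd_module A X" and fdR: "fd_module A (arrow_sum k)" and fdO: "fd_module A (other_projs Q I k)"
  shows "in_add A (T_BB Q I k X) X" "in_add A (T_BB Q I k X) (dprod (arrow_sum k) (other_projs Q I k))"
proof -
  let ?R = "arrow_sum k" and ?O = "other_projs Q I k" and ?T = "T_BB Q I k X"
  have fdT: "fd_module A ?T" unfolding T_BB_def by (rule A.fd_module_dprod[OF X fdO])
  note rmT = A.fd_right_module[OF fdT] and rmX = A.fd_right_module[OF X] and rmO = right_module_other_projs[of k]
  let ?D = "\<lambda>n. dsum {..<n::nat} (\<lambda>_. ?T)"
  have inl: "(\<lambda>x. (x, \<zero>\<^bsub>?O\<^esub>)) \<in> mod_hom A X ?T" and inr: "(\<lambda>x. (\<zero>\<^bsub>X\<^esub>, x)) \<in> mod_hom A ?O ?T"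
    unfolding T_BB_def by (rule A.mod_hom_inl[OF rmO], rule A.mod_hom_inr[OF rmX])
  have fst: "fst \<in> mod_hom A ?T X" and snd: "snd \<in> mod_hom A ?T ?O"
    unfolding T_BB_def by (rule A.mod_hom_fst, rule A.mod_hom_snd)
  have proj: "(\<lambda>t. t j) \<in> mod_hom A (?D n) ?T" if "j < n" for j n
    by (rule mod_hom_proj) (simp add: that)
  show "in_add A ?T X"
  proof (rule A.in_add_retract[OF fdT X])
    show "(\<lambda>x. \<lambda>j\<in>{..<1::nat}. (x, \<zero>\<^bsub>?O\<^esub>)) \<in> mod_hom A X (?D 1)"
      by (rule mod_hom_tuple) (rule inl)
    show "(\<lambda>t. fst (t 0)) \<in> mod_hom A (?D 1) X"
      by (rule mod_hom_comp[OF proj fst]) simp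
  qed simp
  \<comment> \<open>One copy of \<open>T_BB\<close> per arrow into k, and a last copy, number m, for
    the other projectives.\<close>
  define m where "m = card (arrows_into Q k)"
  obtain e where e: "bij_betw e {0..<m} (arrows_into Q k)"
    using ex_bij_betw_nat_finite[OF finite_arrows_into] m_def by blast
  let ?idx = "inv_into {0..<m} e"
  have idx: "?idx \<alpha> < m" "e (?idx \<alpha>) = \<alpha>" if "\<alpha> \<in> arrows_into Q k" for \<alpha>
    using inv_into_into[of \<alpha> e "{0..<m}"] f_inv_into_f[of \<alpha> e "{0..<m}"] that e
    by (auto simp: bij_betw_def)
  have em: "e j \<in> arrows_into Q k" if "j < m" for j using e that by (auto simp: bij_betw_def)
  have tail: "tail Q \<alpha> \<in> verts Q - {k}" if "\<alpha> \<in> arrows_into Q k" for \<alpha>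
    using arrows_intoD[OF that] no_loops by auto
  let ?ins = "\<lambda>\<alpha>. dinj (verts Q - {k}) (vertex_proj Q I) (tail Q \<alpha>)"
  have ins: "?ins \<alpha> \<in> mod_hom A (vertex_proj Q I (tail Q \<alpha>)) ?O" if "\<alpha> \<in> arrows_into Q k" for \<alpha>
    unfolding other_projs_def by (rule mod_hom_dinj[OF right_module_vertex_proj tail[OF that]]) simp
  have prO: "(\<lambda>x. x (tail Q \<alpha>)) \<in> mod_hom A ?O (vertex_proj Q I (tail Q \<alpha>))" if "\<alpha> \<in> arrows_into Q k" for \<alpha>
    unfolding other_projs_def by (rule mod_hom_proj[OF tail[OF that]])
  have prR: "(\<lambda>r. r \<alpha>) \<in> mod_hom A ?R (vertex_proj Q I (tail Q \<alpha>))" if "\<alpha> \<in> arrows_into Q k" for \<alpha>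
    by (rule mod_hom_proj[OF that])
  let ?RO = "dprod ?R ?O"
  let ?comp = "\<lambda>j z. if j < m then ?ins (e j) (fst z (e j)) else snd z"
  show "in_add A ?T ?RO"
  proof (rule A.in_add_retract[OF fdT A.fd_module_dprod[OF fdR fdO]])
    have "?comp j \<in> mod_hom A ?RO ?O" for j
    proof (cases "j < m")
      case True
      have "(\<lambda>z. ?ins (e j) (fst z (e j))) \<in> mod_hom A ?RO ?O"
        by (rule mod_hom_comp[OF mod_hom_comp[OF A.mod_hom_fst prR[OF em[OF True]]] ins[OF em[OF True]]])
      then show ?thesis by (simp only: True if_True)
    next
      case False
      show ?thesis using False A.mod_hom_snd[of ?R ?O] by (simp only: if_False)
    qed
    then show "(\<lambda>z. \<lambda>j\<in>{..<Suc m}. (\<zero>\<^bsub>X\<^esub>, ?comp j z)) \<in> mod_hom A ?RO (?D (Suc m))"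
      by (intro mod_hom_tuple mod_hom_comp[OF _ inr])
    show "(\<lambda>t. (\<lambda>\<alpha>\<in>arrows_into Q k. snd (t (?idx \<alpha>)) (tail Q \<alpha>), snd (t m))) \<in> mod_hom A (?D (Suc m)) ?RO"
    proof (rule A.mod_hom_Pair)
      show "(\<lambda>t. \<lambda>\<alpha>\<in>arrows_into Q k. snd (t (?idx \<alpha>)) (tail Q \<alpha>)) \<in> mod_hom A (?D (Suc m)) ?R"
      proof (rule mod_hom_tuple)
        fix \<alpha> assume \<alpha>: "\<alpha> \<in> arrows_into Q k"
        show "(\<lambda>t. snd (t (?idx \<alpha>)) (tail Q \<alpha>)) \<in> mod_hom A (?D (Suc m)) (vertex_proj Q I (tail Q \<alpha>))"
          by (rule mod_hom_comp[OF mod_hom_comp[OF proj snd] prO[OF \<alpha>]]) (use idx(1)[OF \<alpha>] in simp)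
      qed
      show "(\<lambda>t. snd (t m)) \<in> mod_hom A (?D (Suc m)) ?O"
        by (rule mod_hom_comp[OF proj snd]) simp
    qed
    fix z assume z: "z \<in> carrier ?RO"
    have ext: "fst z \<in> extensional (arrows_into Q k)" using z by (auto simp: PiE_iff)
    have "(\<lambda>\<alpha>\<in>arrows_into Q k. ?comp (?idx \<alpha>) z (tail Q \<alpha>)) = fst z"
      by (rule extensionalityI[OF _ ext]) (use idx tail in \<open>auto simp: dinj_def\<close>)
    moreover have "(\<lambda>\<alpha>\<in>arrows_into Q k. snd ((\<lambda>j\<in>{..<Suc m}. (\<zero>\<^bsub>X\<^esub>, ?comp j z)) (?idx \<alpha>)) (tail Q \<alpha>)) =
        (\<lambda>\<alpha>\<in>arrows_into Q k. ?comp (?idx \<alpha>) z (tail Q \<alpha>))"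
      by (rule restrict_ext) (use idx(1) in \<open>simp add: less_Suc_eq\<close>)
    ultimately show "(\<lambda>\<alpha>\<in>arrows_into Q k. snd ((\<lambda>j\<in>{..<Suc m}. (\<zero>\<^bsub>X\<^esub>, ?comp j z)) (?idx \<alpha>)) (tail Q \<alpha>),
        snd ((\<lambda>j\<in>{..<Suc m}. (\<zero>\<^bsub>X\<^esub>, ?comp j z)) m)) = z"
      by simp
  qed
qed

text \<open>Split the regular module into the projective at k and the others. On the former the
  embedding is \<open>arrow_map\<close>, on the others the identity, so its cokernel is that of
  \<open>arrow_map\<close>, namely X.\<close>

lemma regular_coresolution:
  assumes k: "k \<in> verts Q"
    and c: "c \<in> mod_hom A (arrow_sum k) X" "c ` carrier (arrow_sum k) = carrier X"
      "a_kernel (arrow_sum k) X c = arrow_map k ` carrier (vertex_proj Q I k)"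
    and inj: "\<And>n. n \<in> a_kernel (vertex_proj Q I k) (arrow_sum k) (arrow_map k) \<Longrightarrow> n = \<zero>\<^bsub>A\<^esub>"
  obtains f where "f \<in> mod_hom A (regular_mod A) (dprod (arrow_sum k) (other_projs Q I k))"
    "inj_on f (carrier A)"
    "f ` carrier A = a_kernel (dprod (arrow_sum k) (other_projs Q I k)) X (\<lambda>z. c (fst z))"
proof -
  let ?P = "vertex_proj Q I k" and ?R = "arrow_sum k" and ?O = "other_projs Q I k"
  note rmP = right_module_vertex_proj[OF k] and rmR = right_module_arrow_sum[of k] and rmO = right_module_other_projs[of k]
  interpret R: right_module A ?R by (rule rmR)
  interpret O: right_module A ?O by (rule rmO)
  have rmA: "right_module A (regular_mod A)" by (rule right_module_regular[OF A.ring_axioms])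
  have kc: "c r = \<zero>\<^bsub>X\<^esub> \<longleftrightarrow> r \<in> arrow_map k ` carrier ?P" if "r \<in> carrier ?R" for r
    using c(3) that unfolding set_eq_iff a_kernel_iff by blast
  have pr: "(\<lambda>a. idem i \<otimes>\<^bsub>A\<^esub> a) \<in> mod_hom A (regular_mod A) (vertex_proj Q I i)" if "i \<in> verts Q" for i
    by (rule mod_homI) (use that in \<open>auto simp: vertex_proj_simps A.m_assoc[symmetric] idem_mult A.r_distr\<close>)
  let ?o = "\<lambda>a. \<lambda>i\<in>verts Q - {k}. idem i \<otimes>\<^bsub>A\<^esub> a"
  let ?f = "\<lambda>a. (arrow_map k (idem k \<otimes>\<^bsub>A\<^esub> a), ?o a)"
  have o: "?o \<in> mod_hom A (regular_mod A) ?O"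
    unfolding other_projs_def by (rule mod_hom_tuple) (simp add: pr)
  have f: "?f \<in> mod_hom A (regular_mod A) (dprod ?R ?O)"
    by (rule A.mod_hom_Pair[OF mod_hom_comp[OF pr[OF k] mod_hom_arrow_map[OF k]] o])
  have rmRO: "right_module A (dprod ?R ?O)" by (rule right_module_dprod[OF rmR rmO])
  show ?thesis
  proof (rule that[OF f])
    have "inj_on ?f (carrier (regular_mod A))"
    proof (rule mod_hom_inj_on[OF rmA rmRO f])
      fix a assume a: "a \<in> carrier (regular_mod A)" "?f a = \<zero>\<^bsub>dprod ?R ?O\<^esub>"
      then have aA: "a \<in> carrier A" by simp
      have f1: "arrow_map k (idem k \<otimes>\<^bsub>A\<^esub> a) = \<zero>\<^bsub>?R\<^esub>" and f2: "?o a = \<zero>\<^bsub>?O\<^esub>"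
        using a(2) by (simp_all del: dsum_simps)
      have "idem k \<otimes>\<^bsub>A\<^esub> a \<in> a_kernel ?P ?R (arrow_map k)"
        using f1 mod_homD(1)[OF pr[OF k], of a] aA by (simp del: dsum_simps)
      then have ka: "idem k \<otimes>\<^bsub>A\<^esub> a = \<zero>\<^bsub>A\<^esub>" by (rule inj)
      have "idem i \<otimes>\<^bsub>A\<^esub> a = \<zero>\<^bsub>A\<^esub>" if "i \<in> verts Q - {k}" for i
        using fun_cong[OF f2, of i] that by (simp add: other_projs_def vertex_proj_simps)
      then have "(\<Oplus>\<^bsub>A\<^esub>i\<in>verts Q - {k}. idem i \<otimes>\<^bsub>A\<^esub> a) = (\<Oplus>\<^bsub>A\<^esub>i\<in>verts Q - {k}. \<zero>\<^bsub>A\<^esub>)"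
        by (intro A.finsum_cong') auto
      then show "a = \<zero>\<^bsub>regular_mod A\<^esub>" using idem_decomp(1)[OF k aA] ka by simp
    qed
    then show "inj_on ?f (carrier A)" by simp
    show "?f ` carrier A = a_kernel (dprod ?R ?O) X (\<lambda>z. c (fst z))"
    proof (intro subset_antisym subsetI)
      fix z assume "z \<in> ?f ` carrier A"
      then obtain a where a: "z = ?f a" "a \<in> carrier A" by (rule imageE)
      have aR: "a \<in> carrier (regular_mod A)" using a(2) by simp
      note ka = mod_homD(1)[OF pr[OF k] aR]
      have "c (arrow_map k (idem k \<otimes>\<^bsub>A\<^esub> a)) = \<zero>\<^bsub>X\<^esub>"
        using kc[OF mod_homD(1)[OF mod_hom_arrow_map[OF k] ka]] ka by blast
      then show "z \<in> a_kernel (dprod ?R ?O) X (\<lambda>z. c (fst z))"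
        using mod_homD(1)[OF f aR] unfolding a(1) a_kernel_iff by (simp only: fst_conv simp_thms)
    next
      fix z assume "z \<in> a_kernel (dprod ?R ?O) X (\<lambda>z. c (fst z))"
      then obtain r w where z: "z = (r, w)" "r \<in> carrier ?R" "w \<in> carrier ?O" "c r = \<zero>\<^bsub>X\<^esub>"
        by (auto simp del: dsum_simps)
      obtain p where p: "r = arrow_map k p" "p \<in> carrier ?P" using kc[OF z(2)] z(4) by blast
      have pA: "p \<in> carrier A" "idem k \<otimes>\<^bsub>A\<^esub> p = p" using p(2) k by (auto simp: vertex_proj_simps)
      have wA: "w i \<in> carrier A" "idem i \<otimes>\<^bsub>A\<^esub> w i = w i" if "i \<in> verts Q - {k}" for i
        using other_projsD[OF z(3) that] by auto
      have orth: "idem j \<otimes>\<^bsub>A\<^esub> x = \<zero>\<^bsub>A\<^esub>" if "x \<in> carrier A" "idem i \<otimes>\<^bsub>A\<^esub> x = x" "i \<in> verts Q" "j \<in> verts Q" "j \<noteq> i" for i j x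
      proof -
        have "idem j \<otimes>\<^bsub>A\<^esub> x = (idem j \<otimes>\<^bsub>A\<^esub> idem i) \<otimes>\<^bsub>A\<^esub> x" using that by (simp add: A.m_assoc)
        then show ?thesis using that by (simp add: idem_mult)
      qed
      let ?S = "\<Oplus>\<^bsub>A\<^esub>i\<in>verts Q - {k}. w i"
      have wcl: "w \<in> verts Q - {k} \<rightarrow> carrier A" using wA(1) by auto
      have Scl: "?S \<in> carrier A" by (rule A.finsum_closed[OF wcl])
      \<comment> \<open>Multiplication by \<open>idem j\<close> picks out the component at j, so p
        plus this sum is the required preimage.\<close>
      have idS: "idem j \<otimes>\<^bsub>A\<^esub> ?S = (if j = k then \<zero>\<^bsub>A\<^esub> else w j)" if j: "j \<in> verts Q" for j
      proof -
        have "idem j \<otimes>\<^bsub>A\<^esub> ?S = (\<Oplus>\<^bsub>A\<^esub>i\<in>verts Q - {k}. idem j \<otimes>\<^bsub>A\<^esub> w i)"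
          by (rule A.finsum_rdistr[OF _ _ wcl]) (use j in auto)
        also have "\<dots> = (\<Oplus>\<^bsub>A\<^esub>i\<in>verts Q - {k}. if j = i then w i else \<zero>\<^bsub>A\<^esub>)"
          using wA orth[OF wA] j by (intro A.finsum_cong') auto
        also have "\<dots> = (if j = k then \<zero>\<^bsub>A\<^esub> else w j)"
        proof (cases "j = k")
          case True
          then have "(\<Oplus>\<^bsub>A\<^esub>i\<in>verts Q - {k}. if j = i then w i else \<zero>\<^bsub>A\<^esub>) = (\<Oplus>\<^bsub>A\<^esub>i\<in>verts Q - {k}. \<zero>\<^bsub>A\<^esub>)"
            by (intro A.finsum_cong') auto
          then show ?thesis using True by simp
        next
          case False
          then show ?thesis using j wcl A.finsum_singleton[of j "verts Q - {k}" w] by simp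
        qed
        finally show ?thesis .
      qed
      let ?a = "p \<oplus>\<^bsub>A\<^esub> ?S"
      have a: "?a \<in> carrier A" using pA Scl by simp
      have ia: "idem j \<otimes>\<^bsub>A\<^esub> ?a = idem j \<otimes>\<^bsub>A\<^esub> p \<oplus>\<^bsub>A\<^esub> idem j \<otimes>\<^bsub>A\<^esub> ?S" if "j \<in> verts Q" for j
        using that pA Scl by (simp add: A.r_distr)
      have "idem k \<otimes>\<^bsub>A\<^esub> ?a = p" using ia[OF k] idS[OF k] pA by simp
      moreover have "?o ?a = w"
      proof (rule extensionalityI[of _ "verts Q - {k}"])
        show "w \<in> extensional (verts Q - {k})" using z(3) by (auto simp: other_projs_def PiE_iff)
        fix j assume j: "j \<in> verts Q - {k}"
        show "?o ?a j = w j" using j ia[of j] idS[of j] orth[OF pA k, of j] wA(1)[OF j] by simp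
      qed simp
      ultimately have "z = ?f ?a" unfolding z(1) p(1) by (simp only:)
      then show "z \<in> ?f ` carrier A" using a by (rule image_eqI)
    qed
  qed
qed

end

theorem lemma2p12:
  fixes Q :: "('v, 'a) pre_digraph"
    and I :: "(('v, 'a) qpath \<Rightarrow> 'k::field) set"
    and k :: 'v
    and X :: "((('v, 'a) qpath \<Rightarrow> 'k) set, 'x) module"
  defines "A \<equiv> quiver_algebra Q I"
  assumes "fin_digraph Q"
    and "admissible Q I"
    and "k \<in> verts Q"
    and no_loops: "\<forall>\<alpha>\<in>arcs Q. \<not> (tail Q \<alpha> = k \<and> head Q \<alpha> = k)"
    and not_isolated: "\<exists>\<alpha>\<in>arcs Q. tail Q \<alpha> = k \<or> head Q \<alpha> = k"
    and X: "is_tau_inv A (vertex_simple k) X"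
    and "pd_le A 2 X"
    and "tilting_complex A (T_minus Q I k)"
  shows "tilting_module_pd1 A (T_BB Q I k X)
    \<and> D_iso A (T_minus Q I k) (stalk (T_BB Q I k X))"
proof -
  interpret bound_quiver Q I
    using assms(2,3) by (intro bound_quiver.intro bound_quiver_axioms.intro)
  note k = assms(4)
  have tilt: "tilting_complex (quiver_algebra Q I) (T_minus Q I k)" using assms(9) by (simp add: A_def)
  have T: "projective_cplx (quiver_algebra Q I) (T_minus Q I k)"
    and rigid: "\<And>r. r \<noteq> 0 \<Longrightarrow> D_Hom_zero (quiver_algebra Q I) (T_minus Q I k) (shift (T_minus Q I k) r)"
    using tilt by (auto simp: tilting_complex_def)
  note pT = projective_T_minusD[OF k T]
  note rmP = right_module_vertex_proj[OF k] and rmR = right_module_arrow_sum[of k]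
  have X': "is_tau_inv (quiver_algebra Q I) (vertex_simple k) X" and pd: "pd_le (quiver_algebra Q I) 2 X"
    using X assms(8) by (simp_all add: A_def)
  have fdX: "fd_module (quiver_algebra Q I) X"
    using X' by (simp add: is_tau_inv_def is_transpose_def)
  obtain c where c: "c \<in> mod_hom (quiver_algebra Q I) (arrow_sum k) X" "c ` carrier (arrow_sum k) = carrier X"
    "a_kernel (arrow_sum k) X c = arrow_map k ` carrier (vertex_proj Q I k)"
    by (rule tau_inv_presentation[OF pT(4) k X']) (rule that)
  have bd: "bounded_cplx (quiver_algebra Q I) (T_minus Q I k)" using T by (simp add: projective_cplx_def)
  have projN: "projective (quiver_algebra Q I)
      (submod (vertex_proj Q I k) (a_kernel (vertex_proj Q I k) (arrow_sum k) (arrow_map k)))"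
    \<comment> \<open>The presentation through c makes this kernel a second syzygy of X.\<close>
    by (rule A.projective_second_syzygy[OF pd A.fd_right_module[OF fdX] pT(1,2) mod_hom_arrow_map[OF k] c])
  have ker: "n = \<zero>\<^bsub>quiver_algebra Q I\<^esub>"
    if "n \<in> a_kernel (vertex_proj Q I k) (arrow_sum k) (arrow_map k)" for n
  proof (rule arrow_kernel_zero[OF k _ not_isolated A.projective_fd[OF pT(1)] projN _ that])
    show "\<not> (tail Q \<alpha> = k \<and> head Q \<alpha> = k)" if "\<alpha> \<in> arcs Q" for \<alpha> using no_loops that by blast
    fix y i assume "y \<in> a_kernel (vertex_proj Q I k) (arrow_sum k) (arrow_map k)" and i: "i \<in> verts Q - {k}"
    then have y: "y \<in> carrier (vertex_proj Q I k)" "arrow_map k y = \<zero>\<^bsub>arrow_sum k\<^esub>" by (simp_all only: a_kernel_iff)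
    show "y \<otimes>\<^bsub>quiver_algebra Q I\<^esub> idem i = \<zero>\<^bsub>quiver_algebra Q I\<^esub>"
      by (rule arrow_kernel_idem_other[OF k bd rigid y i]) simp
  qed
  interpret res: two_term_resolution "quiver_algebra Q I" "T_minus Q I k" "T_BB Q I k X" "\<lambda>z. (c (snd (fst z)), snd z)"
    by (rule two_term_resolution_T_minus[OF k T fdX c ker])
  let ?RO = "dprod (arrow_sum k) (other_projs Q I k)"
  have fdR: "fd_module (quiver_algebra Q I) (arrow_sum k)" by (rule A.projective_fd[OF pT(2)])
  have fdRO: "fd_module (quiver_algebra Q I) ?RO" by (rule A.fd_module_dprod[OF fdR pT(3)])
  have add: "in_add (quiver_algebra Q I) (T_BB Q I k X) X" "in_add (quiver_algebra Q I) (T_BB Q I k X) ?RO"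
    by (rule in_add_BB[OF k _ fdX fdR pT(3)], use no_loops in blast)+
  obtain f where f: "f \<in> mod_hom (quiver_algebra Q I) (regular_mod (quiver_algebra Q I)) ?RO"
    "inj_on f (carrier (quiver_algebra Q I))"
    "f ` carrier (quiver_algebra Q I) = a_kernel ?RO X (\<lambda>z. c (fst z))"
    by (rule regular_coresolution[OF k c]) (erule ker, rule that)
  \<comment> \<open>The definition of a tilting module wants the end terms of the coresolution on
    \<open>'k vec\<close>; both are replaced by copies and the maps conjugated.\<close>
  obtain T0 :: "((('v, 'a) qpath \<Rightarrow> 'k) set, 'k vec) module" and f0 g0 where T0: "fd_module (quiver_algebra Q I) T0"
    "f0 \<in> mod_hom (quiver_algebra Q I) ?RO T0" "g0 \<in> mod_hom (quiver_algebra Q I) T0 ?RO"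
    "\<And>x. x \<in> carrier ?RO \<Longrightarrow> g0 (f0 x) = x" "\<And>y. y \<in> carrier T0 \<Longrightarrow> f0 (g0 y) = y"
    by (rule A.ex_vec_copy[OF fdRO]) (rule that)
  obtain T1 :: "((('v, 'a) qpath \<Rightarrow> 'k) set, 'k vec) module" and f1 g1 where T1: "fd_module (quiver_algebra Q I) T1"
    "f1 \<in> mod_hom (quiver_algebra Q I) X T1" "g1 \<in> mod_hom (quiver_algebra Q I) T1 X"
    "\<And>x. x \<in> carrier X \<Longrightarrow> g1 (f1 x) = x" "\<And>y. y \<in> carrier T1 \<Longrightarrow> f1 (g1 y) = y"
    by (rule A.ex_vec_copy[OF fdX]) (rule that)
  have add0: "in_add (quiver_algebra Q I) (T_BB Q I k X) T0"
    by (rule A.in_add_iso[OF add(2) T0])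
  have add1: "in_add (quiver_algebra Q I) (T_BB Q I k X) T1"
    by (rule A.in_add_iso[OF add(1) T1])
  let ?f = "\<lambda>a. f0 (f a)" and ?g = "\<lambda>t. f1 (c (fst (g0 t)))"
  have fm: "?f \<in> mod_hom (quiver_algebra Q I) (regular_mod (quiver_algebra Q I)) T0"
    by (rule mod_hom_comp[OF f(1) T0(2)])
  have cf: "(\<lambda>t. c (fst (g0 t))) \<in> mod_hom (quiver_algebra Q I) T0 X"
    by (rule mod_hom_comp[OF mod_hom_comp[OF T0(3) A.mod_hom_fst] c(1)])
  have gm: "?g \<in> mod_hom (quiver_algebra Q I) T0 T1" by (rule mod_hom_comp[OF cf T1(2)])
  have fa: "f a \<in> carrier ?RO" if "a \<in> carrier (quiver_algebra Q I)" for a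
    using mod_homD(1)[OF f(1), of a] that by simp
  have inj: "inj_on ?f (carrier (quiver_algebra Q I))"
  proof (rule inj_onI)
    fix a b assume ab: "a \<in> carrier (quiver_algebra Q I)" "b \<in> carrier (quiver_algebra Q I)" "?f a = ?f b"
    have "f a = f b" using arg_cong[OF ab(3), of g0] unfolding T0(4)[OF fa[OF ab(1)]] T0(4)[OF fa[OF ab(2)]] .
    then show "a = b" using inj_onD[OF f(2) _ ab(1,2)] by blast
  qed
  have z1: "f1 \<zero>\<^bsub>X\<^esub> = \<zero>\<^bsub>T1\<^esub>"
    by (rule mod_hom_zero[OF A.fd_right_module[OF fdX] A.fd_right_module[OF T1(1)] T1(2)])
  have z1': "g1 \<zero>\<^bsub>T1\<^esub> = \<zero>\<^bsub>X\<^esub>"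
    by (rule mod_hom_zero[OF A.fd_right_module[OF T1(1)] A.fd_right_module[OF fdX] T1(3)])
  have ex: "exact_at (regular_mod (quiver_algebra Q I)) T0 T1 ?f ?g"
    unfolding exact_at_def
  proof (intro subset_antisym subsetI)
    fix t assume "t \<in> ?f ` carrier (regular_mod (quiver_algebra Q I))"
    then obtain a where a: "t = ?f a" "a \<in> carrier (regular_mod (quiver_algebra Q I))" by (rule imageE)
    have aA: "a \<in> carrier (quiver_algebra Q I)" using a(2) by simp
    have "f a \<in> a_kernel ?RO X (\<lambda>z. c (fst z))" unfolding f(3)[symmetric] using aA by (rule imageI)
    then have "c (fst (f a)) = \<zero>\<^bsub>X\<^esub>" by (simp only: a_kernel_iff)
    then show "t \<in> a_kernel T0 T1 ?g"
      unfolding a_kernel_iff a(1) T0(4)[OF fa[OF aA]] using mod_homD(1)[OF fm a(2)] z1 by (simp only: simp_thms)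
  next
    fix t assume "t \<in> a_kernel T0 T1 ?g"
    then have t: "t \<in> carrier T0" "?g t = \<zero>\<^bsub>T1\<^esub>" by (simp_all only: a_kernel_iff)
    have "c (fst (g0 t)) = \<zero>\<^bsub>X\<^esub>"
      using arg_cong[OF t(2), of g1] unfolding T1(4)[OF mod_homD(1)[OF cf t(1)]] z1' .
    then have "g0 t \<in> f ` carrier (quiver_algebra Q I)"
      unfolding f(3) a_kernel_iff using mod_homD(1)[OF T0(3) t(1)] by (simp only: simp_thms)
    then obtain a where a: "g0 t = f a" "a \<in> carrier (quiver_algebra Q I)" by (rule imageE)
    show "t \<in> ?f ` carrier (regular_mod (quiver_algebra Q I))"
    proof (rule image_eqI)
      show "t = ?f a" using T0(5)[OF t(1)] unfolding a(1) by (rule sym)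
      show "a \<in> carrier (regular_mod (quiver_algebra Q I))" using a(2) by simp
    qed
  qed
  have sur: "?g ` carrier T0 = carrier T1"
  proof (intro subset_antisym subsetI)
    fix y assume y: "y \<in> carrier T1"
    have "g1 y \<in> c ` carrier (arrow_sum k)" unfolding c(2) by (rule mod_homD(1)[OF T1(3) y])
    then obtain r where r: "g1 y = c r" "r \<in> carrier (arrow_sum k)" by (rule imageE)
    interpret O: right_module "quiver_algebra Q I" "other_projs Q I k" by (rule right_module_other_projs)
    have z: "(r, \<zero>\<^bsub>other_projs Q I k\<^esub>) \<in> carrier ?RO" using r(2) by (simp del: dsum_simps)
    show "y \<in> ?g ` carrier T0"
    proof (rule image_eqI)
      show "y = ?g (f0 (r, \<zero>\<^bsub>other_projs Q I k\<^esub>))"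
        unfolding T0(4)[OF z] fst_conv r(1)[symmetric] by (rule T1(5)[OF y, symmetric])
      show "f0 (r, \<zero>\<^bsub>other_projs Q I k\<^esub>) \<in> carrier T0" by (rule mod_homD(1)[OF T0(2) z])
    qed
  next
    fix y assume "y \<in> ?g ` carrier T0"
    then obtain t where "y = ?g t" "t \<in> carrier T0" by (rule imageE)
    then show "y \<in> carrier T1" using mod_homD(1)[OF gm] by simp
  qed
  \<comment> \<open>The Hom-vanishing of the complex is used here for the shift by 1; the shift by
    -1 served for the kernel.\<close>
  have D1: "D_Hom_zero (quiver_algebra Q I) (stalk (T_BB Q I k X)) (shift (stalk (T_BB Q I k X)) 1)"
    by (rule res.D_Hom_zero_stalk[OF rigid]) simp
  have "tilting_module_pd1 (quiver_algebra Q I) (T_BB Q I k X)"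
    unfolding tilting_module_pd1_def using res.fd_M res.pd_le_one D1 add0 add1 fm gm inj ex sur by blast
  then show ?thesis using res.D_iso_stalk by (simp add: A_def)
qed

end
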